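(* Let $N\ge3$ and $V(x)=\sum_{i=1}^k\lambda_i|x-a_i|^{-2}\chi_{B(a_i,r_i)}(x)+\lambda_\infty|x|^{-2}\chi_{\mathbb{R}^N\setminus B(0,R)}(x)+W(x)\in\mathcal{V}$. Then the operator $-\Delta-V$, acting in $L^2(\mathbb{R}^N)$ with domain $C_c^\infty(\mathbb{R}^N\setminus\{a_1,\dots,a_k\})$, is essentially self-adjoint if and only if $\lambda_i\le\frac{(N-2)^2}{4}-1$ for all $i=1,\dots,k$.
   Context: The class $\mathcal{V}$ consists of all functions $V(x)=\sum_{i=1}^k\frac{\lambda_i\chi_{B(a_i,r_i)}(x)}{|x-a_i|^2}+\frac{\lambda_\infty\chi_{\mathbb{R}^N\setminus B(0,R)}(x)}{|x|^2}+W(x)$ with $k\in\mathbb{N}$, $r_i,R>0$, $a_i\in\mathbb{R}^N$ pairwise distinct, $\lambda_i,\lambda_\infty\in(-\infty,\frac{(N-2)^2}{4})$, and $W\in L^{N/2}(\mathbb{R}^N)\cap L^\infty(\mathbb{R}^N)$; $\chi_A$ is the characteristic function of $A$. *)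

theory Defs
  imports "HOL-Analysis.Analysis"
begin

definition partial_deriv :: "'n::finite \<Rightarrow> (real^'n \<Rightarrow> complex) \<Rightarrow> real^'n \<Rightarrow> complex" where
  "partial_deriv j u x = frechet_derivative u (at x) (axis j 1)"

fun Ck_fun :: "nat \<Rightarrow> (real^'n::finite \<Rightarrow> complex) \<Rightarrow> bool" where
  "Ck_fun 0 u = continuous_on UNIV u"
| "Ck_fun (Suc m) u = (u differentiable_on UNIV \<and> (\<forall>j. Ck_fun m (partial_deriv j u)))"

definition smooth_fun :: "(real^'n::finite \<Rightarrow> complex) \<Rightarrow> bool" where
  "smooth_fun u = (\<forall>m. Ck_fun m u)"

definition tsupport :: "(real^'n::finite \<Rightarrow> complex) \<Rightarrow> (real^'n) set" where
  "tsupport u = closure {x. u x \<noteq> 0}"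

definition Cc_infty :: "(real^'n::finite) set \<Rightarrow> (real^'n \<Rightarrow> complex) set" where
  "Cc_infty \<Omega> = {u. smooth_fun u \<and> compact (tsupport u) \<and> tsupport u \<subseteq> \<Omega>}"

definition laplacian :: "(real^'n::finite \<Rightarrow> complex) \<Rightarrow> real^'n \<Rightarrow> complex" where
  "laplacian u x = (\<Sum>j\<in>UNIV. partial_deriv j (partial_deriv j u) x)"

text \<open>L^2(R^N) (representatives; everything below is invariant under a.e. equality)\<close>
definition L2 :: "(real^'n::finite \<Rightarrow> complex) set" where
  "L2 = {f. f \<in> borel_measurable lebesgue \<and> integrable lebesgue (\<lambda>x. (norm (f x))\<^sup>2)}"

definition L2_norm :: "(real^'n::finite \<Rightarrow> complex) \<Rightarrow> real" where
  "L2_norm f = sqrt (LINT x|lebesgue. (norm (f x))\<^sup>2)"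

definition L2_inner :: "(real^'n::finite \<Rightarrow> complex) \<Rightarrow> (real^'n \<Rightarrow> complex) \<Rightarrow> complex" where
  "L2_inner f g = (LINT x|lebesgue. cnj (f x) * g x)"

text \<open>(Possibly multivalued) operators in L^2 represented by their graphs.\<close>
definition graph_closure :: "((real^'n::finite \<Rightarrow> complex) \<times> (real^'n \<Rightarrow> complex)) set
    \<Rightarrow> ((real^'n \<Rightarrow> complex) \<times> (real^'n \<Rightarrow> complex)) set" where
  "graph_closure G = {(v, w). v \<in> L2 \<and> w \<in> L2 \<and>
     (\<exists>s. (\<forall>n. s n \<in> G) \<and> (\<lambda>n. L2_norm (fst (s n) - v)) \<longlonglongrightarrow> 0
                         \<and> (\<lambda>n. L2_norm (snd (s n) - w)) \<longlonglongrightarrow> 0)}"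

definition graph_adjoint :: "((real^'n::finite \<Rightarrow> complex) \<times> (real^'n \<Rightarrow> complex)) set
    \<Rightarrow> ((real^'n \<Rightarrow> complex) \<times> (real^'n \<Rightarrow> complex)) set" where
  "graph_adjoint G = {(v, w). v \<in> L2 \<and> w \<in> L2 \<and>
     (\<forall>(u, f)\<in>G. L2_inner f v = L2_inner u w)}"

definition self_adjoint_graph :: "((real^'n::finite \<Rightarrow> complex) \<times> (real^'n \<Rightarrow> complex)) set \<Rightarrow> bool" where
  "self_adjoint_graph A = (graph_adjoint A = A)"

definition essentially_self_adjoint :: "((real^'n::finite \<Rightarrow> complex) \<times> (real^'n \<Rightarrow> complex)) set \<Rightarrow> bool" where
  "essentially_self_adjoint G = self_adjoint_graph (graph_closure G)"

definition schroedinger_graph :: "(real^'n::finite \<Rightarrow> real) \<Rightarrow> (real^'n \<Rightarrow> complex) set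
    \<Rightarrow> ((real^'n \<Rightarrow> complex) \<times> (real^'n \<Rightarrow> complex)) set" where
  "schroedinger_graph V D = {(u, \<lambda>x. - laplacian u x - complex_of_real (V x) * u x) | u. u \<in> D}"

text \<open>The potential V (indices i = 0..k-1 instead of 1..k).\<close>
definition potential :: "nat \<Rightarrow> (nat \<Rightarrow> real^'n::finite) \<Rightarrow> (nat \<Rightarrow> real) \<Rightarrow> (nat \<Rightarrow> real)
    \<Rightarrow> real \<Rightarrow> real \<Rightarrow> (real^'n \<Rightarrow> real) \<Rightarrow> real^'n \<Rightarrow> real" where
  "potential k a r lam lam_inf R W x =
     (\<Sum>i<k. lam i * indicator (ball (a i) (r i)) x / (norm (x - a i))\<^sup>2)
     + lam_inf * indicator (UNIV - ball 0 R) x / (norm x)\<^sup>2 + W x"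

end

theory Submission
  imports Defs
begin

text \<open>Write $\theta = (N-2)^2/4 - 1$ and $\alpha = N/2 - 2$, so that $\alpha(N-2-\alpha) = \theta$. The potential
  differs from $\sum_i \lambda_i |x-a_i|^{-2}$ by a bounded function.

  If all $\lambda_i \le \theta$, there is a weight $\Phi = e^L > 0$ that equals $|x-a_i|^{-\alpha}$
  near $a_i$, decays at infinity and satisfies $(\Delta + V)\Phi \le (M-1)\Phi$. Substituting $u = \Phi f$ shows that
  $H + M \ge 1$ on the test functions. If $v \in L^2$ is orthogonal to the range of $H + M$, Kato's inequality gives
  $(\Delta + V - M)|v| \ge 0$ off the poles. Testing this with $\Phi$ times a cutoff leaves an error of
  order $\epsilon^{-\alpha-2} \int |v|$ over the shell $|x-a_i| \sim \epsilon$; by Cauchy-Schwarz it is at most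
  $\epsilon^{-\alpha-2+N/2}$ times the $L^2$ norm of $v$ on the shell, and the power is $0$ for this $\alpha$. Hence
  $v = 0$, the range is dense, and the closure is self-adjoint.

  If $\theta < \lambda_i$, both solutions $|x-a_i|^{-\gamma_\pm}$ with $\gamma_\pm = (N-2)/2 \pm \mu$,
  $\mu^2 = (N-2)^2/4 - \lambda_i \in (0,1)$, are square-integrable near $a_i$. Cut off, they lie in the domain of the
  adjoint, and their non-zero Wronskian flux through small spheres shows that the adjoint is not symmetric.\<close>

subsection \<open>The space of square-integrable functions\<close>

text \<open>The 1 in the threshold is a matter of square integrability. Near a pole with coupling
  \<lambda> the two solutions are |x|^(-\<gamma>) with \<gamma> = (N-2)/2 \<plusminus> \<mu>, and
  |x|^(-\<gamma>) lies in L^2 near 0 exactly when 2\<gamma> < N; the larger exponent passes this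
  test iff \<mu> < 1. At \<lambda> = \<theta> one has \<mu> = 1, and \<alpha> = (N-2)/2 - 1 is the
  smaller exponent there: the weight is the tame solution of the extremal equation and serves all
  \<lambda>_i \<le> \<theta> at once. For N = 3 it even vanishes at the poles, since \<alpha> =
  -1/2. At the borderline the cutoff error has no power of \<epsilon> to spare. It tends to zero
  only because the L^2 mass of v on shrinking balls does, so that local mass has to be kept in every
  estimate. The shift M is arbitrary, so the interaction of the poles costs no more than a constant,
  and the weight can be glued from one-pole profiles whose transition zones are disjoint. An element
  orthogonal to the range is merely an L^2 function that solves the equation against test functions;
  it is mollified, and every integration by parts is carried out on compactly supported C^2
  data.\<close>

lemma square_integrable_mult:
  fixes f g :: "'a \<Rightarrow> real"
  assumes [measurable]: "f \<in> borel_measurable M" "g \<in> borel_measurable M"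
    and f: "integrable M (\<lambda>x. (f x)\<^sup>2)" and g: "integrable M (\<lambda>x. (g x)\<^sup>2)"
  shows "integrable M (\<lambda>x. f x * g x)"
proof (rule Bochner_Integration.integrable_bound)
  show "integrable M (\<lambda>x. (f x)\<^sup>2 + (g x)\<^sup>2)" using f g by simp
  have "\<bar>a * b\<bar> \<le> a\<^sup>2 + b\<^sup>2" for a b :: real
  proof -
    have "2 * (\<bar>a\<bar> * \<bar>b\<bar>) \<le> a\<^sup>2 + b\<^sup>2"
      using sum_squares_bound[of "\<bar>a\<bar>" "\<bar>b\<bar>"] by (simp add: mult.assoc)
    moreover have "0 \<le> \<bar>a\<bar> * \<bar>b\<bar>" by simp
    ultimately show ?thesis unfolding abs_mult by linarith
  qed
  then show "AE x in M. norm (f x * g x) \<le> norm ((f x)\<^sup>2 + (g x)\<^sup>2)" by simp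
qed simp

lemma Cauchy_Schwarz_integral:
  fixes f g :: "'a \<Rightarrow> real"
  assumes [measurable]: "f \<in> borel_measurable M" "g \<in> borel_measurable M"
    and f: "integrable M (\<lambda>x. (f x)\<^sup>2)" and g: "integrable M (\<lambda>x. (g x)\<^sup>2)"
  shows "(LINT x|M. \<bar>f x * g x\<bar>)\<^sup>2 \<le> (LINT x|M. (f x)\<^sup>2) * (LINT x|M. (g x)\<^sup>2)"
proof -
  have 1: "(\<integral>\<^sup>+x. ennreal \<bar>f x\<bar> * ennreal \<bar>g x\<bar> \<partial>M)\<^sup>2 \<le>
      (\<integral>\<^sup>+x. (ennreal \<bar>f x\<bar>)\<^sup>2 \<partial>M) * (\<integral>\<^sup>+x. (ennreal \<bar>g x\<bar>)\<^sup>2 \<partial>M)"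
    by (rule Cauchy_Schwarz_nn_integral) auto
  have 2: "(\<integral>\<^sup>+x. (ennreal \<bar>h x\<bar>)\<^sup>2 \<partial>M) = ennreal (LINT x|M. (h x)\<^sup>2)"
    if "integrable M (\<lambda>x. (h x)\<^sup>2)" for h :: "'a \<Rightarrow> real"
  proof -
    have "(\<integral>\<^sup>+x. (ennreal \<bar>h x\<bar>)\<^sup>2 \<partial>M) = (\<integral>\<^sup>+x. ennreal ((h x)\<^sup>2) \<partial>M)"
      by (intro nn_integral_cong) (simp add: ennreal_power)
    also have "\<dots> = ennreal (LINT x|M. (h x)\<^sup>2)" using that by (intro nn_integral_eq_integral) auto
    finally show ?thesis .
  qed
  have "integrable M (\<lambda>x. \<bar>f x * g x\<bar>)" using square_integrable_mult[OF assms] by simp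
  then have 3: "(\<integral>\<^sup>+x. ennreal \<bar>f x\<bar> * ennreal \<bar>g x\<bar> \<partial>M) = ennreal (LINT x|M. \<bar>f x * g x\<bar>)"
    by (subst nn_integral_eq_integral[symmetric]) (auto simp: ennreal_mult abs_mult)
  show ?thesis using 1 unfolding 2[OF f] 2[OF g] 3
    by (simp add: ennreal_power ennreal_mult[symmetric] ennreal_le_iff)
qed

lemma borel_measurable_cnj [measurable (raw)]:
  "f \<in> borel_measurable M \<Longrightarrow> (\<lambda>x. cnj (f x)) \<in> borel_measurable M"
  by (rule borel_measurable_continuous_on[OF _, of cnj]) (auto intro: continuous_intros)

section \<open>Inner product and norm on representatives\<close>

lemma L2_borel: "f \<in> L2 \<Longrightarrow> f \<in> borel_measurable lebesgue"
  by (simp add: L2_def)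

lemma L2_integrable: "f \<in> L2 \<Longrightarrow> integrable lebesgue (\<lambda>x. (norm (f x))\<^sup>2)"
  by (simp add: L2_def)

lemma L2_mult_integrable:
  assumes "f \<in> L2" "g \<in> L2"
  shows "integrable lebesgue (\<lambda>x. cnj (f x) * g x)"
proof -
  note [measurable] = assms[THEN L2_borel]
  have "integrable lebesgue (\<lambda>x. norm (f x) * norm (g x))"
    using assms by (intro square_integrable_mult) (auto simp: L2_def)
  then show ?thesis
    by (rule Bochner_Integration.integrable_bound) (auto simp: norm_mult)
qed

lemma L2_diff: assumes "f \<in> L2" "g \<in> L2" shows "f - g \<in> L2"
proof -
  note [measurable] = assms[THEN L2_borel]
  have "integrable lebesgue (\<lambda>x. 2 * (norm (f x))\<^sup>2 + 2 * (norm (g x))\<^sup>2)"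
    using assms by (simp add: L2_def)
  moreover have "(norm (a - b))\<^sup>2 \<le> 2 * (norm a)\<^sup>2 + 2 * (norm b)\<^sup>2" for a b :: complex
  proof -
    have "(norm (a - b))\<^sup>2 \<le> (norm a + norm b)\<^sup>2" by (intro power_mono norm_triangle_ineq4) simp
    also have "\<dots> \<le> 2 * (norm a)\<^sup>2 + 2 * (norm b)\<^sup>2"
      using sum_squares_bound[of "norm a" "norm b"] by (simp add: power2_sum)
    finally show ?thesis .
  qed
  ultimately have "integrable lebesgue (\<lambda>x. (norm (f x - g x))\<^sup>2)"
    by (elim Bochner_Integration.integrable_bound) auto
  then show ?thesis by (simp add: L2_def fun_diff_def)
qed

lemma L2_scale: assumes "f \<in> L2" shows "(\<lambda>x. c * f x) \<in> L2"
  using assms by (auto simp: L2_def norm_mult power_mult_distrib)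

lemma L2_add: assumes "f \<in> L2" "g \<in> L2" shows "(\<lambda>x. f x + g x) \<in> L2"
proof -
  have "f - (\<lambda>x. (-1) * g x) \<in> L2" by (intro L2_diff L2_scale assms)
  also have "f - (\<lambda>x. (-1) * g x) = (\<lambda>x. f x + g x)" by auto
  finally show ?thesis .
qed

text \<open>Lebesgue measure is complete, so preimages that agree almost everywhere are measurable
  together. This permits exchanging representatives, since the graphs consist of functions and not
  of classes.\<close>

lemma L2_AE_cong:
  assumes "f \<in> L2" "AE x in lebesgue. f x = g x"
  shows "g \<in> L2"
proof -
  have g [measurable]: "g \<in> borel_measurable lebesgue"
  proof (rule borel_measurableI)
    fix S :: "complex set" assume "open S"
    have eq: "AE x in lebesgue. x \<in> f -` S \<longleftrightarrow> x \<in> g -` S"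
      using assms(2) by eventually_elim simp
    have "f -` S \<in> sets lebesgue"
      using measurable_sets[OF L2_borel[OF assms(1)], of S] \<open>open S\<close> by simp
    then show "g -` S \<inter> space lebesgue \<in> sets lebesgue"
      using completion.in_sets_AE[OF eq] by simp
  qed
  have "integrable lebesgue (\<lambda>x. (norm (g x))\<^sup>2)"
    by (rule integrable_cong_AE_imp[OF L2_integrable[OF assms(1)]])
      (use assms(2) in auto)
  then show ?thesis using g by (simp add: L2_def)
qed

lemma L2_dominated:
  assumes "f \<in> L2" "g \<in> borel_measurable lebesgue" "AE x in lebesgue. norm (g x) \<le> c * norm (f x)"
  shows "g \<in> L2"
proof -
  note [measurable] = L2_borel[OF assms(1)] assms(2)
  have "integrable lebesgue (\<lambda>x. (c * norm (f x))\<^sup>2)"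
    using assms(1) by (simp add: L2_def power_mult_distrib)
  moreover have "AE x in lebesgue. norm ((norm (g x))\<^sup>2) \<le> norm ((c * norm (f x))\<^sup>2)"
    using assms(3) by eventually_elim (simp add: power_mono)
  ultimately have "integrable lebesgue (\<lambda>x. (norm (g x))\<^sup>2)"
    by (intro Bochner_Integration.integrable_bound[OF _ _ \<open>AE x in lebesgue. norm ((norm (g x))\<^sup>2) \<le> _\<close>]) auto
  then show ?thesis using assms(2) by (simp add: L2_def)
qed

lemma L2_norm_nonneg [simp]: "0 \<le> L2_norm f"
  by (simp add: L2_norm_def)

lemma L2_norm_sq: "(L2_norm f)\<^sup>2 = (LINT x|lebesgue. (norm (f x))\<^sup>2)"
  by (simp add: L2_norm_def)

lemma L2_inner_self: "f \<in> L2 \<Longrightarrow> L2_inner f f = of_real ((L2_norm f)\<^sup>2)"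
  unfolding L2_norm_sq L2_inner_def integral_complex_of_real[symmetric]
  by (intro Bochner_Integration.integral_cong) (auto simp: complex_norm_square mult.commute simp del: of_real_power)

lemma L2_inner_commute: "L2_inner g f = cnj (L2_inner f g)"
  unfolding L2_inner_def 
  by (rule trans[OF _ Bochner_Integration.integral_cnj]) (simp add: mult.commute)

lemma L2_inner_diff_right: "\<lbrakk>f \<in> L2; g \<in> L2; h \<in> L2\<rbrakk> \<Longrightarrow> L2_inner f (g - h) = L2_inner f g - L2_inner f h"
  unfolding L2_inner_def
  by (subst Bochner_Integration.integral_diff[symmetric]) (auto simp: ring_distribs intro: L2_mult_integrable)

lemma L2_inner_diff_left: "\<lbrakk>f \<in> L2; g \<in> L2; h \<in> L2\<rbrakk> \<Longrightarrow> L2_inner (g - h) f = L2_inner g f - L2_inner h f"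
  using L2_inner_diff_right[of f g h] by (subst (1 2 3) L2_inner_commute) simp

lemma L2_inner_add_right: "\<lbrakk>f \<in> L2; g \<in> L2; h \<in> L2\<rbrakk> \<Longrightarrow> L2_inner f (\<lambda>x. g x + h x) = L2_inner f g + L2_inner f h"
  unfolding L2_inner_def
  by (subst Bochner_Integration.integral_add[symmetric]) (auto simp: ring_distribs intro: L2_mult_integrable)

lemma L2_inner_add_left: "\<lbrakk>f \<in> L2; g \<in> L2; h \<in> L2\<rbrakk> \<Longrightarrow> L2_inner (\<lambda>x. g x + h x) f = L2_inner g f + L2_inner h f"
  using L2_inner_add_right[of f g h] by (subst (1 2 3) L2_inner_commute) simp

lemma L2_inner_scale_right: "L2_inner f (\<lambda>x. c * g x) = c * L2_inner f g"
  unfolding L2_inner_def by (subst integral_mult_right_zero[symmetric]) (simp add: mult_ac)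

lemma L2_inner_scale_left: "L2_inner (\<lambda>x. c * g x) f = cnj c * L2_inner g f"
  using L2_inner_scale_right[of f c g] by (subst (1 2) L2_inner_commute) simp

lemma L2_inner_bound:
  assumes "f \<in> L2" "g \<in> L2" shows "norm (L2_inner f g) \<le> L2_norm f * L2_norm g"
proof -
  note [measurable] = assms[THEN L2_borel]
  have "norm (L2_inner f g) \<le> (LINT x|lebesgue. \<bar>norm (f x) * norm (g x)\<bar>)"
    unfolding L2_inner_def by (rule order_trans[OF integral_norm_bound]) (simp add: norm_mult)
  also have "\<dots> \<le> sqrt ((LINT x|lebesgue. (norm (f x))\<^sup>2) * (LINT x|lebesgue. (norm (g x))\<^sup>2))"
    using assms by (intro real_le_rsqrt Cauchy_Schwarz_integral) (auto simp: L2_def)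
  finally show ?thesis by (simp add: L2_norm_def real_sqrt_mult)
qed

lemma L2_norm_triangle:
  assumes "f \<in> L2" "g \<in> L2" shows "L2_norm (\<lambda>x. f x + g x) \<le> L2_norm f + L2_norm g"
proof (rule power2_le_imp_le)
  have "complex_of_real ((L2_norm (\<lambda>x. f x + g x))\<^sup>2) = L2_inner f f + L2_inner f g + (L2_inner g f + L2_inner g g)"
    using assms L2_inner_self[OF L2_add[OF assms]]
    by (simp add: L2_inner_add_left L2_inner_add_right L2_add)
  then have "(L2_norm (\<lambda>x. f x + g x))\<^sup>2 = Re (L2_inner f f + L2_inner f g + (L2_inner g f + L2_inner g g))"
    by (metis Re_complex_of_real)
  also have "\<dots> = (L2_norm f)\<^sup>2 + 2 * Re (L2_inner f g) + (L2_norm g)\<^sup>2"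
    using assms by (subst (3) L2_inner_commute) (simp add: L2_inner_self)
  also have "\<dots> \<le> (L2_norm f)\<^sup>2 + 2 * (L2_norm f * L2_norm g) + (L2_norm g)\<^sup>2"
    using L2_inner_bound[OF assms] complex_Re_le_cmod[of "L2_inner f g"] by linarith
  finally show "(L2_norm (\<lambda>x. f x + g x))\<^sup>2 \<le> (L2_norm f + L2_norm g)\<^sup>2" by (simp add: power2_sum)
qed simp

lemma L2_norm_minus_commute: "L2_norm (f - g) = L2_norm (g - f)"
  by (simp add: L2_norm_def norm_minus_commute)

lemma L2_norm_scale: "L2_norm (\<lambda>x. c * f x) = norm c * L2_norm f"
  by (simp add: L2_norm_def norm_mult power_mult_distrib real_sqrt_mult)

lemma L2_norm_triangle_diff:
  assumes "f \<in> L2" "g \<in> L2" "h \<in> L2" shows "L2_norm (f - h) \<le> L2_norm (f - g) + L2_norm (g - h)"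
  using L2_norm_triangle[OF L2_diff[OF assms(1,2)] L2_diff[OF assms(2,3)]] by (simp add: fun_diff_def)

lemma L2_norm_AE_cong:
  assumes "f \<in> L2" "AE x in lebesgue. f x = g x" shows "L2_norm f = L2_norm g"
proof -
  note [measurable] = L2_borel[OF assms(1)] L2_borel[OF L2_AE_cong[OF assms]]
  show ?thesis unfolding L2_norm_def
    by (rule arg_cong[where f=sqrt], rule integral_cong_AE) (use assms(2) in auto)
qed

lemma L2_norm_eq_0: assumes "f \<in> L2" "L2_norm f = 0" shows "AE x in lebesgue. f x = 0"
proof -
  have "(LINT x|lebesgue. (norm (f x))\<^sup>2) = 0" using assms(2) L2_norm_sq[of f] by simp
  then have "AE x in lebesgue. (norm (f x))\<^sup>2 = 0"
    using integral_nonneg_eq_0_iff_AE[OF L2_integrable[OF assms(1)]] by simp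
  then show ?thesis by eventually_elim simp
qed

lemma L2_inner_tendsto:
  assumes "\<And>n. f n \<in> L2" "f' \<in> L2" "g \<in> L2" "(\<lambda>n. L2_norm (f n - f')) \<longlonglongrightarrow> 0"
  shows "(\<lambda>n. L2_inner (f n) g) \<longlonglongrightarrow> L2_inner f' g"
proof (rule LIM_zero_cancel, rule Lim_null_comparison)
  show "\<forall>\<^sub>F n in sequentially. norm (L2_inner (f n) g - L2_inner f' g) \<le> L2_norm (f n - f') * L2_norm g"
    using assms by (intro always_eventually allI)
      (metis L2_diff L2_inner_bound L2_inner_diff_left)
  show "(\<lambda>n. L2_norm (f n - f') * L2_norm g) \<longlonglongrightarrow> 0"
    using tendsto_mult_left_zero[OF assms(4)] by simp
qed

text \<open>If consecutive distances decay like $2^{-k}$, then $\sum_k 2^k |f_{k+1}-f_k|^2$ is integrable,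
  hence finite almost everywhere, which already forces pointwise convergence.\<close>

lemma L2_fast_Cauchy_AE:
  fixes f :: "nat \<Rightarrow> real^'n \<Rightarrow> complex"
  assumes f: "\<And>k. f k \<in> L2" and fast: "\<And>k. L2_norm (f (Suc k) - f k) \<le> (1/2) ^ k"
  shows "AE x in lebesgue. convergent (\<lambda>k. f k x)"
proof -
  note [measurable] = L2_borel[OF f]
  define h where "h k x = ennreal (2 ^ k * (norm (f (Suc k) x - f k x))\<^sup>2)" for k x
  have hm [measurable]: "h k \<in> borel_measurable lebesgue" for k unfolding h_def by measurable
  have hk: "(\<integral>\<^sup>+x. h k x \<partial>lebesgue) \<le> ennreal ((1/2) ^ k)" for k
  proof -
    have "(\<integral>\<^sup>+x. h k x \<partial>lebesgue) = ennreal (LINT x|lebesgue. 2 ^ k * (norm (f (Suc k) x - f k x))\<^sup>2)"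
      unfolding h_def using L2_integrable[OF L2_diff[OF f[of "Suc k"] f[of k]]]
      by (intro nn_integral_eq_integral) auto
    also have "(LINT x|lebesgue. 2 ^ k * (norm (f (Suc k) x - f k x))\<^sup>2) = 2 ^ k * (L2_norm (f (Suc k) - f k))\<^sup>2"
      by (simp add: L2_norm_sq)
    also have "\<dots> \<le> 2 ^ k * ((1/2) ^ k)\<^sup>2"
      using fast by (intro mult_left_mono power_mono) auto
    also have "\<dots> = (1/2) ^ k" by (simp add: power2_eq_square power_one_over)
    finally show ?thesis by (simp add: ennreal_leI)
  qed
  have "(\<integral>\<^sup>+x. (\<Sum>k. h k x) \<partial>lebesgue) = (\<Sum>k. \<integral>\<^sup>+x. h k x \<partial>lebesgue)"
    by (rule nn_integral_suminf) measurable
  also have "\<dots> \<le> (\<Sum>k. ennreal ((1/2) ^ k))" by (intro suminf_le hk) auto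
  also have "\<dots> = ennreal (\<Sum>k. (1/2) ^ k)" by (intro suminf_ennreal2) (auto intro: summable_geometric)
  also have "\<dots> < \<infinity>" by simp
  finally have "AE x in lebesgue. (\<Sum>k. h k x) \<noteq> \<infinity>" by (intro nn_integral_PInf_AE) auto
  then show ?thesis
  proof eventually_elim
    case (elim x)
    obtain S where S: "(\<Sum>k. h k x) = ennreal S" "S \<ge> 0" using elim by (cases "\<Sum>k. h k x") auto
    \<comment> \<open>One term of the nonnegative series is at most its sum \<open>S\<close>, which
      bounds the increments by a geometric sequence with ratio \<open>sqrt (1/2)\<close>.\<close>
    have b: "norm (f (Suc k) x - f k x) \<le> sqrt S * (sqrt (1/2)) ^ k" for k
    proof -
      have "h k x \<le> ennreal S" unfolding S(1)[symmetric] using sum_le_suminf[of "\<lambda>k. h k x" "{k}"] by simp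
      then have "2 ^ k * (norm (f (Suc k) x - f k x))\<^sup>2 \<le> S" using S(2) by (simp add: h_def)
      then have "(norm (f (Suc k) x - f k x))\<^sup>2 \<le> S * (1/2) ^ k"
        by (simp add: field_simps)
      then have "norm (f (Suc k) x - f k x) \<le> sqrt (S * (1/2) ^ k)" by (rule real_le_rsqrt)
      then show ?thesis by (simp add: real_sqrt_mult real_sqrt_power)
    qed
    have "summable (\<lambda>k. sqrt S * (sqrt (1/2)) ^ k)"
      by (intro summable_mult summable_geometric) (simp add: real_sqrt_divide)
    then have "summable (\<lambda>k. f (Suc k) x - f k x)"
      by (rule summable_comparison_test') (use b in auto)
    then have "convergent (\<lambda>n. \<Sum>k<n. f (Suc k) x - f k x)" by (simp add: summable_iff_convergent)
    then have "convergent (\<lambda>n. f n x - f 0 x)" using sum_lessThan_telescope[of "\<lambda>k. f k x"] by simp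
    then have "convergent (\<lambda>n. (f n x - f 0 x) + f 0 x)" by (intro convergent_add convergent_const)
    then show "convergent (\<lambda>k. f k x)" by simp
  qed
qed

text \<open>A subsequence with consecutive distances below 2^(-k) converges almost everywhere, and
  Fatou's lemma makes its pointwise limit a limit in norm. On the null set of divergence
  \<open>lim\<close> has an arbitrary value, which does no harm.\<close>

lemma L2_complete:
  fixes f :: "nat \<Rightarrow> real^'n \<Rightarrow> complex"
  assumes f: "\<And>k. f k \<in> L2"
    and Cauchy: "\<And>e. e > 0 \<Longrightarrow> \<exists>K. \<forall>m\<ge>K. \<forall>n\<ge>K. L2_norm (f m - f n) < e"
  shows "\<exists>g\<in>L2. (\<lambda>n. L2_norm (f n - g)) \<longlonglongrightarrow> 0"
proof -
  have "\<forall>k. \<exists>K. \<forall>m\<ge>K. \<forall>n\<ge>K. L2_norm (f m - f n) < (1/2) ^ k" using Cauchy by simp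
  then obtain K where K: "\<And>k m n. m \<ge> K k \<Longrightarrow> n \<ge> K k \<Longrightarrow> L2_norm (f m - f n) < (1/2) ^ k" by metis
  \<comment> \<open>Summing the thresholds gives indices that are monotone and still at least
    \<open>K k\<close>.\<close>
  define r where "r k = (\<Sum>i\<le>k. K i)" for k
  have rK: "K k \<le> r k" for k unfolding r_def by (rule member_le_sum) auto
  have rm: "mono r" unfolding r_def by (intro monoI sum_mono2) auto
  have "AE x in lebesgue. convergent (\<lambda>k. f (r k) x)"
  proof (rule L2_fast_Cauchy_AE)
    show "L2_norm (f (r (Suc k)) - f (r k)) \<le> (1/2) ^ k" for k
      using K[of k "r (Suc k)" "r k"] rK[of k] monoD[OF rm, of k "Suc k"] by simp
  qed (rule f)
  then have lim: "AE x in lebesgue. (\<lambda>k. f (r k) x) \<longlonglongrightarrow> lim (\<lambda>k. f (r k) x)"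
    by eventually_elim (simp add: convergent_LIMSEQ_iff)
  define g where "g x = lim (\<lambda>k. f (r k) x)" for x
  note [measurable] = L2_borel[OF f]
  have gm [measurable]: "g \<in> borel_measurable lebesgue"
    unfolding g_def by (rule borel_measurable_lim_metric) auto
  \<comment> \<open>Fatou is applied with \<open>n\<close> fixed and the subsequence running, so the
    bound holds for every \<open>n\<close> beyond \<open>K k\<close> and yields convergence of the
    whole sequence.\<close>
  have Fatou: "integrable lebesgue (\<lambda>x. (norm (f n x - g x))\<^sup>2) \<and> L2_norm (f n - g) \<le> (1/2) ^ k"
    if n: "n \<ge> K k" for n k
  proof -
    have "(\<integral>\<^sup>+x. ennreal ((norm (f n x - g x))\<^sup>2) \<partial>lebesgue)
        = (\<integral>\<^sup>+x. liminf (\<lambda>j. ennreal ((norm (f n x - f (r j) x))\<^sup>2)) \<partial>lebesgue)"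
    proof (rule nn_integral_cong_AE)
      show "AE x in lebesgue. ennreal ((norm (f n x - g x))\<^sup>2) = liminf (\<lambda>j. ennreal ((norm (f n x - f (r j) x))\<^sup>2))"
        using lim
      proof eventually_elim
        case (elim x)
        have "(\<lambda>j. ennreal ((norm (f n x - f (r j) x))\<^sup>2)) \<longlonglongrightarrow> ennreal ((norm (f n x - g x))\<^sup>2)"
          unfolding g_def using elim by (intro tendsto_ennrealI tendsto_intros)
        then show ?case by (intro lim_imp_Liminf[symmetric]) simp_all
      qed
    qed
    also have "\<dots> \<le> liminf (\<lambda>j. \<integral>\<^sup>+x. ennreal ((norm (f n x - f (r j) x))\<^sup>2) \<partial>lebesgue)"
      by (rule nn_integral_liminf) measurable
    also have "\<dots> \<le> ennreal (((1/2) ^ k)\<^sup>2)"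
    proof -
      have ev: "\<forall>\<^sub>F j in sequentially. (\<integral>\<^sup>+x. ennreal ((norm (f n x - f (r j) x))\<^sup>2) \<partial>lebesgue) \<le> ennreal (((1/2) ^ k)\<^sup>2)"
      proof (rule eventually_sequentiallyI[of k])
        fix j assume "k \<le> j"
        then have "K k \<le> r j" using rK[of k] monoD[OF rm, of k j] by simp
        then have l: "L2_norm (f n - f (r j)) \<le> (1/2) ^ k" using K[OF n] less_imp_le by blast
        have "(\<integral>\<^sup>+x. ennreal ((norm (f n x - f (r j) x))\<^sup>2) \<partial>lebesgue) = ennreal ((L2_norm (f n - f (r j)))\<^sup>2)"
          unfolding L2_norm_sq using L2_integrable[OF L2_diff[OF f[of n] f[of "r j"]]]
          by (subst nn_integral_eq_integral) auto
        also have "\<dots> \<le> ennreal (((1/2) ^ k)\<^sup>2)" using l by (intro ennreal_leI power_mono) auto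
        finally show "(\<integral>\<^sup>+x. ennreal ((norm (f n x - f (r j) x))\<^sup>2) \<partial>lebesgue) \<le> ennreal (((1/2) ^ k)\<^sup>2)" .
      qed
      show ?thesis
        by (rule order_trans[OF Liminf_le_Limsup[OF sequentially_bot] Limsup_bounded[OF ev]])
    qed
    finally have b: "(\<integral>\<^sup>+x. ennreal ((norm (f n x - g x))\<^sup>2) \<partial>lebesgue) \<le> ennreal (((1/2) ^ k)\<^sup>2)" .
    then have i: "integrable lebesgue (\<lambda>x. (norm (f n x - g x))\<^sup>2)"
      by (intro integrableI_nonneg) (auto intro: le_less_trans)
    have "(L2_norm (f n - g))\<^sup>2 \<le> ((1/2) ^ k)\<^sup>2"
      using b unfolding L2_norm_sq
      by (subst (asm) nn_integral_eq_integral) (use i in auto)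
    then have "L2_norm (f n - g) \<le> (1/2) ^ k" by (rule power2_le_imp_le) simp
    with i show ?thesis by simp
  qed
  have "f (K 0) - g \<in> L2" using Fatou[of 0 "K 0"] by (simp add: L2_def fun_diff_def)
  then have gL: "g \<in> L2" using L2_diff[OF f[of "K 0"], of "f (K 0) - g"] by (simp add: fun_diff_def)
  moreover have "(\<lambda>n. L2_norm (f n - g)) \<longlonglongrightarrow> 0"
  proof (rule LIMSEQ_I)
    fix e :: real assume "0 < e"
    then obtain k where k: "(1/2) ^ k < e" using one_less_inverse_iff real_arch_pow_inv[of e "1/2"] by auto
    then show "\<exists>no. \<forall>n\<ge>no. norm (L2_norm (f n - g) - 0) < e"
      using Fatou[of k] by (intro exI[of _ "K k"]) (auto intro: le_less_trans)
  qed
  ultimately show ?thesis by blast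
qed

lemma L2_parallelogram:
  assumes "f \<in> L2" "g \<in> L2"
  shows "(L2_norm (\<lambda>x. f x + g x))\<^sup>2 + (L2_norm (f - g))\<^sup>2 = 2 * (L2_norm f)\<^sup>2 + 2 * (L2_norm g)\<^sup>2"
proof -
  have "L2_inner (\<lambda>x. f x + g x) (\<lambda>x. f x + g x) + L2_inner (f - g) (f - g) = 2 * L2_inner f f + 2 * L2_inner g g"
    using assms by (simp add: L2_add L2_diff L2_inner_add_left L2_inner_add_right
        L2_inner_diff_left L2_inner_diff_right)
  then have "complex_of_real ((L2_norm (\<lambda>x. f x + g x))\<^sup>2 + (L2_norm (f - g))\<^sup>2) = complex_of_real (2 * (L2_norm f)\<^sup>2 + 2 * (L2_norm g)\<^sup>2)"
    using assms by (simp add: L2_inner_self L2_add L2_diff)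
  then show ?thesis using of_real_eq_iff by blast
qed

text \<open>A minimising sequence for the distance to $f$ is Cauchy, and its limit $h$ makes $f - h$ orthogonal to the subspace.\<close>

lemma L2_dense_subspace:
  fixes S :: "(real^'n \<Rightarrow> complex) set"
  assumes S: "S \<subseteq> L2" "S \<noteq> {}" and add: "\<And>f g. f \<in> S \<Longrightarrow> g \<in> S \<Longrightarrow> (\<lambda>x. f x + g x) \<in> S"
    and scale: "\<And>f c. f \<in> S \<Longrightarrow> (\<lambda>x. c * f x) \<in> S"
    and orth: "\<And>g. g \<in> L2 \<Longrightarrow> (\<And>s. s \<in> S \<Longrightarrow> L2_inner s g = 0) \<Longrightarrow> L2_norm g = 0"
    and f: "f \<in> L2"
  shows "\<exists>s. (\<forall>n. s n \<in> S) \<and> (\<lambda>n. L2_norm (s n - f)) \<longlonglongrightarrow> 0"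
proof -
  define d where "d = (INF s\<in>S. L2_norm (s - f))"
  have bdd: "bdd_below ((\<lambda>s. L2_norm (s - f)) ` S)" by (intro bdd_belowI[of _ 0]) auto
  have dle: "d \<le> L2_norm (s - f)" if "s \<in> S" for s unfolding d_def by (rule cINF_lower[OF bdd that])
  have d0: "0 \<le> d" unfolding d_def using S(2) by (intro cINF_greatest) auto
  have "\<exists>s\<in>S. L2_norm (s - f) < d + 1 / (real n + 1)" for n
  proof -
    have "d < d + 1 / (real n + 1)" by simp
    then show ?thesis unfolding d_def using cInf_lessD[of "(\<lambda>s. L2_norm (s - f)) ` S"] S(2) by auto
  qed
  then obtain s where sS: "\<And>n. s n \<in> S" and s: "\<And>n. L2_norm (s n - f) < d + 1 / (real n + 1)" by metis
  have sL: "s n \<in> L2" for n using sS S(1) by auto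
  \<comment> \<open>Parallelogram law for \<open>s m - f\<close> and \<open>s n - f\<close>: half
    their sum is the midpoint minus \<open>f\<close>, and the midpoint lies in \<open>S\<close>, so
    this half has norm at least \<open>d\<close>.\<close>
  have mid: "(L2_norm (s m - s n))\<^sup>2 \<le> 2 * (L2_norm (s m - f))\<^sup>2 + 2 * (L2_norm (s n - f))\<^sup>2 - 4 * d\<^sup>2" for m n
  proof -
    have 1: "(\<lambda>x. (s m - f) x + (s n - f) x) = (\<lambda>x. 2 * ((\<lambda>x. (1/2) * (s m x + s n x)) - f) x)"
      by (auto simp: field_simps)
    have 2: "(s m - f) - (s n - f) = s m - s n" by auto
    have "(\<lambda>x. (1/2) * (s m x + s n x)) \<in> S" by (intro scale add sS)
    then have "d\<^sup>2 \<le> (L2_norm ((\<lambda>x. (1/2) * (s m x + s n x)) - f))\<^sup>2"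
      using dle d0 by (intro power_mono) auto
    then have "4 * d\<^sup>2 \<le> (L2_norm (\<lambda>x. (s m - f) x + (s n - f) x))\<^sup>2"
      unfolding 1 L2_norm_scale by (simp add: power_mult_distrib fun_diff_def)
    then show ?thesis using L2_parallelogram[OF L2_diff[OF sL[of m] f] L2_diff[OF sL[of n] f]] unfolding 2 by simp
  qed
  have slim: "(\<lambda>n. d + 1 / (real n + 1)) \<longlonglongrightarrow> d"
    using tendsto_add[OF tendsto_const[of d] LIMSEQ_inverse_real_of_nat]
    by (simp add: inverse_eq_divide add.commute)
  have snlim: "(\<lambda>n. L2_norm (s n - f)) \<longlonglongrightarrow> d"
    by (rule tendsto_sandwich[OF _ _ tendsto_const slim])
      (auto intro!: always_eventually less_imp_le[OF s] dle sS)
  have "\<exists>h\<in>L2. (\<lambda>n. L2_norm (s n - h)) \<longlonglongrightarrow> 0"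
  proof (rule L2_complete[OF sL])
    fix e :: real assume e: "e > 0"
    have "(\<lambda>n. 2 * (L2_norm (s n - f))\<^sup>2 - 2 * d\<^sup>2) \<longlonglongrightarrow> 2 * d\<^sup>2 - 2 * d\<^sup>2"
      by (intro tendsto_intros snlim)
    then have "\<forall>\<^sub>F n in sequentially. 2 * (L2_norm (s n - f))\<^sup>2 - 2 * d\<^sup>2 < e\<^sup>2 / 2"
      by (rule order_tendstoD) (use e in simp)
    then obtain K where K: "\<And>n. n \<ge> K \<Longrightarrow> 2 * (L2_norm (s n - f))\<^sup>2 - 2 * d\<^sup>2 < e\<^sup>2 / 2"
      by (auto simp: eventually_sequentially)
    have "L2_norm (s m - s n) < e" if "m \<ge> K" "n \<ge> K" for m n
      using mid[of m n] K[OF that(1)] K[OF that(2)] e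
      by (intro power2_less_imp_less[of _ e]) auto
    then show "\<exists>K. \<forall>m\<ge>K. \<forall>n\<ge>K. L2_norm (s m - s n) < e" by blast
  qed
  then obtain h where h: "h \<in> L2" and sh: "(\<lambda>n. L2_norm (s n - h)) \<longlonglongrightarrow> 0" by blast
  define g where "g = f - h"
  have g: "g \<in> L2" unfolding g_def by (intro L2_diff f h)
  have gd: "L2_norm g \<le> d"
  proof (rule LIMSEQ_le_const)
    show "(\<lambda>n. L2_norm (s n - h) + L2_norm (s n - f)) \<longlonglongrightarrow> d" using tendsto_add[OF sh snlim] by simp
    show "\<exists>N. \<forall>n\<ge>N. L2_norm g \<le> L2_norm (s n - h) + L2_norm (s n - f)"
      unfolding g_def using L2_norm_triangle_diff[OF f sL h]
      by (intro exI[of _ 0]) (simp add: L2_norm_minus_commute[of f] add.commute)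
  qed
  \<comment> \<open>The limit \<open>h\<close> need not lie in \<open>S\<close>. Minimality is
    inherited in the limit: \<open>s n\<close> minus c t belongs to the subspace up to the sign of
    c, and replacing \<open>s n\<close> by \<open>h\<close> costs
    \<open>L2_norm (s n - h)\<close>.\<close>
  have dg: "d \<le> L2_norm (g - (\<lambda>x. c * t x))" if t: "t \<in> S" for t c
  proof (rule LIMSEQ_le_const2)
    have tL: "(\<lambda>x. c * t x) \<in> L2" using t S(1) by (intro L2_scale) auto
    show "(\<lambda>n. d - L2_norm (s n - h)) \<longlonglongrightarrow> d" using tendsto_diff[OF tendsto_const[of d] sh] by simp
    have "d - L2_norm (s n - h) \<le> L2_norm (g - (\<lambda>x. c * t x))" for n
    proof -
      have "(\<lambda>x. s n x + c * t x) \<in> S" using add[OF sS scale[OF t]] .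
      then have "d \<le> L2_norm ((\<lambda>x. s n x + c * t x) - f)" by (rule dle)
      also have "(\<lambda>x. s n x + c * t x) - f = (\<lambda>x. (s n - h) x + (\<lambda>x. (-1) * (g - (\<lambda>x. c * t x)) x) x)"
        by (auto simp: g_def)
      also have "L2_norm \<dots> \<le> L2_norm (s n - h) + L2_norm (\<lambda>x. (-1) * (g - (\<lambda>x. c * t x)) x)"
        by (intro L2_norm_triangle L2_diff L2_scale sL h g tL)
      also have "L2_norm (\<lambda>x. (-1) * (g - (\<lambda>x. c * t x)) x) = L2_norm (g - (\<lambda>x. c * t x))"
        by (subst L2_norm_scale) simp
      finally show ?thesis by (simp add: fun_diff_def)
    qed
    then show "\<exists>N. \<forall>n\<ge>N. d - L2_norm (s n - h) \<le> L2_norm (g - (\<lambda>x. c * t x))" by blast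
  qed
  have "L2_inner t g = 0" if t: "t \<in> S" for t
  proof (rule ccontr)
    assume nz: "L2_inner t g \<noteq> 0"
    define c where "c = L2_inner t g"
    have tL: "t \<in> L2" using t S(1) by auto
    \<comment> \<open>Subtracting the multiple \<tau> c of \<open>t\<close> lowers the squared norm
      by 2 \<tau> |c|^2 to first order. The summand 1 keeps \<tau> meaningful when \<open>t\<close>
      has norm 0 and makes \<tau> times the squared norm of \<open>t\<close> less than 1, so the
      quadratic term cannot compensate.\<close>
    define \<tau> where "\<tau> = 1 / ((L2_norm t)\<^sup>2 + 1)"
    have \<tau>: "\<tau> > 0" "\<tau> * (L2_norm t)\<^sup>2 < 1"
    proof -
      have "0 < (L2_norm t)\<^sup>2 + 1" using zero_le_power2[of "L2_norm t"] by linarith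
      then show "\<tau> > 0" "\<tau> * (L2_norm t)\<^sup>2 < 1" by (auto simp: \<tau>_def)
    qed
    let ?t = "\<lambda>x. (of_real \<tau> * c) * t x"
    have tt: "?t \<in> L2" by (intro L2_scale tL)
    have "complex_of_real ((L2_norm (g - ?t))\<^sup>2) = L2_inner (g - ?t) (g - ?t)"
      by (intro L2_inner_self[symmetric] L2_diff g tt)
    also have "\<dots> = L2_inner g g - (of_real \<tau> * c) * cnj c - (cnj (of_real \<tau> * c) * c - (of_real \<tau> * c) * (cnj (of_real \<tau> * c) * L2_inner t t))"
      using L2_inner_commute[of g t]
      by (simp only: L2_inner_diff_left L2_inner_diff_right g tt tL L2_diff L2_inner_scale_left L2_inner_scale_right c_def[symmetric])
        (simp only: algebra_simps)
    also have "\<dots> = of_real ((L2_norm g)\<^sup>2 - 2 * \<tau> * (norm c)\<^sup>2 + \<tau>\<^sup>2 * (norm c)\<^sup>2 * (L2_norm t)\<^sup>2)"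
    proof -
      have "complex_of_real ((norm c)\<^sup>2) = c * cnj c" by (rule complex_norm_square)
      then show ?thesis
        unfolding of_real_add of_real_diff of_real_mult by (simp add: L2_inner_self g tL power2_eq_square[of \<tau>])
    qed
    finally have eq: "(L2_norm (g - ?t))\<^sup>2 = (L2_norm g)\<^sup>2 - 2 * \<tau> * (norm c)\<^sup>2 + \<tau>\<^sup>2 * (norm c)\<^sup>2 * (L2_norm t)\<^sup>2"
      using of_real_eq_iff by blast
    have "(L2_norm g)\<^sup>2 \<le> (L2_norm (g - ?t))\<^sup>2" using gd dg[OF t, of "of_real \<tau> * c"] by (intro power_mono) auto
    then have "2 * \<tau> * (norm c)\<^sup>2 \<le> \<tau> * (norm c)\<^sup>2 * (\<tau> * (L2_norm t)\<^sup>2)"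
      unfolding eq by (simp add: power2_eq_square mult_ac)
    also have "\<dots> \<le> \<tau> * (norm c)\<^sup>2 * 1" using \<tau> by (intro mult_left_mono) auto
    finally have "\<tau> * (norm c)\<^sup>2 \<le> 0" by simp
    then show False using \<tau>(1) nz by (simp add: c_def mult_le_0_iff)
  qed
  then have "L2_norm g = 0" using orth[OF g] by blast
  then have "d = 0" using dg[of "s 0" 0] sS d0 by (simp add: fun_diff_def)
  then show ?thesis using snlim sS by blast
qed

subsection \<open>Criteria for essential self-adjointness\<close>

lemma graph_closureI:
  "\<lbrakk>v \<in> L2; w \<in> L2; \<And>n. s n \<in> G; (\<lambda>n. L2_norm (fst (s n) - v)) \<longlonglongrightarrow> 0; (\<lambda>n. L2_norm (snd (s n) - w)) \<longlonglongrightarrow> 0\<rbrakk>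
    \<Longrightarrow> (v, w) \<in> graph_closure G"
  unfolding graph_closure_def by blast

lemma L2_norm_self: "L2_norm (f - f) = 0"
  by (simp add: L2_norm_def)

lemma subset_graph_closure: "G \<subseteq> L2 \<times> L2 \<Longrightarrow> G \<subseteq> graph_closure G"
  by (auto intro!: graph_closureI[where s="\<lambda>n. (a, b)" for a b] simp: L2_norm_self)

lemma graph_adjoint_anti: "G \<subseteq> H \<Longrightarrow> graph_adjoint H \<subseteq> graph_adjoint G"
  by (auto simp: graph_adjoint_def)

text \<open>Both sides of the identity defining the adjoint are continuous along L^2-convergent
  pairs. Self-adjointness of the closure can therefore be decided on the adjoint of the original
  graph.\<close>

lemma graph_adjoint_closure:
  assumes G: "G \<subseteq> L2 \<times> L2"
  shows "graph_adjoint (graph_closure G) = graph_adjoint G"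
proof
  show "graph_adjoint (graph_closure G) \<subseteq> graph_adjoint G"
    by (intro graph_adjoint_anti subset_graph_closure G)
  show "graph_adjoint G \<subseteq> graph_adjoint (graph_closure G)"
  proof
    fix p assume p: "p \<in> graph_adjoint G"
    obtain v w where [simp]: "p = (v, w)" by (cases p)
    have v: "v \<in> L2" and w: "w \<in> L2" and adj: "\<And>u f. (u, f) \<in> G \<Longrightarrow> L2_inner f v = L2_inner u w"
      using p by (auto simp: graph_adjoint_def)
    have "L2_inner f v = L2_inner u w" if uf: "(u, f) \<in> graph_closure G" for u f
    proof -
      obtain s where u: "u \<in> L2" and f: "f \<in> L2" and s: "\<And>n. s n \<in> G"
        and lim: "(\<lambda>n. L2_norm (fst (s n) - u)) \<longlonglongrightarrow> 0" "(\<lambda>n. L2_norm (snd (s n) - f)) \<longlonglongrightarrow> 0"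
        using uf unfolding graph_closure_def by blast
      have sL: "fst (s n) \<in> L2" "snd (s n) \<in> L2" for n using subsetD[OF G s[of n]] by (auto simp: mem_Times_iff)
      have "(\<lambda>n. L2_inner (snd (s n)) v) \<longlonglongrightarrow> L2_inner f v"
        by (rule L2_inner_tendsto[OF sL(2) f v lim(2)])
      moreover have "(\<lambda>n. L2_inner (fst (s n)) w) \<longlonglongrightarrow> L2_inner u w"
        by (rule L2_inner_tendsto[OF sL(1) u w lim(1)])
      moreover have "L2_inner (snd (s n)) v = L2_inner (fst (s n)) w" for n
        using adj[of "fst (s n)" "snd (s n)"] s by simp
      ultimately show ?thesis using LIMSEQ_unique by simp
    qed
    then show "p \<in> graph_adjoint (graph_closure G)" using v w by (auto simp: graph_adjoint_def)
  qed
qed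

text \<open>The adjoint equals the self-adjoint closure and hence is contained in its own adjoint.
  Read contrapositively this is the obstruction for the necessary condition: two pairs of the
  adjoint that violate the identity exclude essential self-adjointness.\<close>

lemma essentially_self_adjoint_symmetric:
  assumes G: "G \<subseteq> L2 \<times> L2" and esa: "essentially_self_adjoint G"
    and "(v, w) \<in> graph_adjoint G" "(v', w') \<in> graph_adjoint G"
  shows "L2_inner w v' = L2_inner v w'"
proof -
  have eq: "graph_adjoint G = graph_closure G"
    using esa graph_adjoint_closure[OF G] by (simp add: essentially_self_adjoint_def self_adjoint_graph_def)
  then have "(v', w') \<in> graph_adjoint (graph_closure G)"
    using assms graph_adjoint_closure[OF G] by simp
  then show ?thesis using assms(3) unfolding eq by (auto simp: graph_adjoint_def)
qed

text \<open>Coercivity makes $(T+M)^{-1}$ bounded and the kernel condition makes the range of $T+M$ dense,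
  so every pair of the adjoint can be compared with a limit of pairs of $T$.\<close>

lemma essentially_self_adjoint_criterion:
  fixes T :: "(real^'n \<Rightarrow> complex) \<Rightarrow> real^'n \<Rightarrow> complex" and M :: real
  assumes D: "D \<noteq> {}" "\<And>u. u \<in> D \<Longrightarrow> u \<in> L2" "\<And>u. u \<in> D \<Longrightarrow> T u \<in> L2"
    and add: "\<And>u v. u \<in> D \<Longrightarrow> v \<in> D \<Longrightarrow> (\<lambda>x. u x + v x) \<in> D \<and> T (\<lambda>x. u x + v x) = (\<lambda>x. T u x + T v x)"
    and scale: "\<And>u c. u \<in> D \<Longrightarrow> (\<lambda>x. c * u x) \<in> D \<and> T (\<lambda>x. c * u x) = (\<lambda>x. c * T u x)"
    and sym: "\<And>u v. u \<in> D \<Longrightarrow> v \<in> D \<Longrightarrow> L2_inner (T u) v = L2_inner u (T v)"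
    and coercive: "\<And>u. u \<in> D \<Longrightarrow> (L2_norm u)\<^sup>2 \<le> Re (L2_inner (\<lambda>x. T u x + of_real M * u x) u)"
    and kernel: "\<And>z. z \<in> L2 \<Longrightarrow> (\<And>u. u \<in> D \<Longrightarrow> L2_inner (\<lambda>x. T u x + of_real M * u x) z = 0) \<Longrightarrow> L2_norm z = 0"
  shows "essentially_self_adjoint {(u, T u) | u. u \<in> D}" (is "essentially_self_adjoint ?G")
proof -
  have G: "?G \<subseteq> L2 \<times> L2" using D by auto
  define S where "S u = (\<lambda>x. T u x + of_real M * u x)" for u
  have SL: "S u \<in> L2" if "u \<in> D" for u unfolding S_def using that D by (intro L2_add L2_scale)
  have symG: "?G \<subseteq> graph_adjoint ?G" using D sym by (auto simp: graph_adjoint_def)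
  have clos: "graph_closure ?G \<subseteq> graph_adjoint ?G"
  proof
    fix p assume p: "p \<in> graph_closure ?G"
    obtain v w where [simp]: "p = (v, w)" by (cases p)
    have v: "v \<in> L2" and w: "w \<in> L2" using p by (auto simp: graph_closure_def)
    have "L2_inner f v = L2_inner u w" if uf: "(u, f) \<in> ?G" for u f
    proof -
      have "(u, f) \<in> graph_adjoint (graph_closure ?G)"
        using uf symG unfolding graph_adjoint_closure[OF G] by auto
      then have "L2_inner w u = L2_inner v f" using p by (auto simp: graph_adjoint_def)
      then show ?thesis using L2_inner_commute[of f v] L2_inner_commute[of u w] by simp
    qed
    then show "p \<in> graph_adjoint ?G" using v w by (auto simp: graph_adjoint_def)
  qed
  \<comment> \<open>Coercivity with Cauchy-Schwarz, divided by the norm of \<open>u\<close>: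
    convergence of \<open>S (u n)\<close> will force convergence of \<open>u n\<close>.\<close>
  have norm_le: "L2_norm u \<le> L2_norm (S u)" if u: "u \<in> D" for u
  proof -
    have "(L2_norm u)\<^sup>2 \<le> L2_norm (S u) * L2_norm u"
      using coercive[OF u] complex_Re_le_cmod[of "L2_inner (S u) u"] L2_inner_bound[OF SL[OF u] D(2)[OF u]]
      unfolding S_def by linarith
    then show ?thesis
      by (metis L2_norm_nonneg mult_le_cancel_right order_le_less power2_eq_square less_le_not_le)
  qed
  have sub: "(\<lambda>x. u x + (-1) * v x) \<in> D \<and> S (\<lambda>x. u x + (-1) * v x) = S u - S v" if "u \<in> D" "v \<in> D" for u v
    using add[OF that(1) conjunct1[OF scale[OF that(2), of "-1"]]] scale[OF that(2), of "-1"]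
    by (auto simp: S_def fun_eq_iff algebra_simps)
  have "graph_adjoint ?G \<subseteq> graph_closure ?G"
  proof
    fix p assume p: "p \<in> graph_adjoint ?G"
    obtain v w where [simp]: "p = (v, w)" by (cases p)
    have v: "v \<in> L2" and w: "w \<in> L2" and adj: "\<And>u. u \<in> D \<Longrightarrow> L2_inner (T u) v = L2_inner u w"
      using p by (auto simp: graph_adjoint_def)
    \<comment> \<open>\<open>f\<close> is the value at \<open>v\<close> of the adjoint shifted by
      \<open>M\<close>. Approximating it from the range of \<open>S\<close> produces an
      \<open>h\<close> in the domain of the closure with the same value, and the kernel condition
      then identifies \<open>v\<close> with \<open>h\<close>.\<close>
    define f where "f = (\<lambda>x. w x + of_real M * v x)"
    have f: "f \<in> L2" unfolding f_def by (intro L2_add L2_scale v w)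
    have "\<exists>s. (\<forall>n. s n \<in> S ` D) \<and> (\<lambda>n. L2_norm (s n - f)) \<longlonglongrightarrow> 0"
    proof (rule L2_dense_subspace[OF _ _ _ _ _ f])
      show "S ` D \<subseteq> L2" using SL by auto
      show "S ` D \<noteq> {}" using D by auto
      show "(\<lambda>x. f x + g x) \<in> S ` D" if "f \<in> S ` D" "g \<in> S ` D" for f g
      proof -
        obtain a b where ab: "a \<in> D" "b \<in> D" "f = S a" "g = S b" using \<open>f \<in> S ` D\<close> \<open>g \<in> S ` D\<close> by auto
        then have "(\<lambda>x. f x + g x) = S (\<lambda>x. a x + b x)"
          using add[of a b] by (auto simp: S_def fun_eq_iff algebra_simps)
        then show ?thesis using add[of a b] ab by auto
      qed
      show "(\<lambda>x. c * f x) \<in> S ` D" if "f \<in> S ` D" for f c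
      proof -
        obtain a where a: "a \<in> D" "f = S a" using \<open>f \<in> S ` D\<close> by auto
        then have "(\<lambda>x. c * f x) = S (\<lambda>x. c * a x)"
          using scale[of a c] by (auto simp: S_def fun_eq_iff algebra_simps)
        then show ?thesis using scale[of a c] a by auto
      qed
      show "L2_norm g = 0" if "g \<in> L2" "\<And>s. s \<in> S ` D \<Longrightarrow> L2_inner s g = 0" for g
        using that by (intro kernel) (auto simp: S_def)
    qed
    then obtain s where s: "\<And>n. s n \<in> S ` D" and sf: "(\<lambda>n. L2_norm (s n - f)) \<longlonglongrightarrow> 0" by blast
    from s have "\<forall>n. \<exists>u. u \<in> D \<and> s n = S u" by auto
    then obtain u where uD: "\<And>n. u n \<in> D" and su: "\<And>n. s n = S (u n)" by metis
    have uL: "u n \<in> L2" for n using uD D by auto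
    have sL: "s n \<in> L2" for n using su SL uD by auto
    have "\<exists>h\<in>L2. (\<lambda>n. L2_norm (u n - h)) \<longlonglongrightarrow> 0"
    proof (rule L2_complete[OF uL])
      fix e :: real assume e: "e > 0"
      then have "\<forall>\<^sub>F n in sequentially. L2_norm (s n - f) < e / 2" by (intro order_tendstoD[OF sf]) auto
      then obtain K where K: "\<And>n. n \<ge> K \<Longrightarrow> L2_norm (s n - f) < e / 2" by (auto simp: eventually_sequentially)
      have "L2_norm (u m - u n) < e" if "m \<ge> K" "n \<ge> K" for m n
      proof -
        have "L2_norm (u m - u n) = L2_norm (\<lambda>x. u m x + (-1) * u n x)" by (simp add: L2_norm_def)
        also have "\<dots> \<le> L2_norm (S (u m) - S (u n))" using sub[OF uD uD] norm_le by metis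
        also have "\<dots> \<le> L2_norm (S (u m) - f) + L2_norm (f - S (u n))"
          by (intro L2_norm_triangle_diff f SL uD)
        also have "\<dots> < e" using K[OF that(1)] K[OF that(2)] by (simp add: su L2_norm_minus_commute[of f])
        finally show ?thesis .
      qed
      then show "\<exists>K. \<forall>m\<ge>K. \<forall>n\<ge>K. L2_norm (u m - u n) < e" by blast
    qed
    then obtain h where h: "h \<in> L2" and uh: "(\<lambda>n. L2_norm (u n - h)) \<longlonglongrightarrow> 0" by blast
    define g where "g = (\<lambda>x. f x + of_real (- M) * h x)"
    have g: "g \<in> L2" unfolding g_def by (intro L2_add L2_scale f h)
    have Tg: "(\<lambda>n. L2_norm (T (u n) - g)) \<longlonglongrightarrow> 0"
    proof (rule Lim_null_comparison)
      show "(\<lambda>n. L2_norm (s n - f) + \<bar>M\<bar> * L2_norm (u n - h)) \<longlonglongrightarrow> 0"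
        using tendsto_add[OF sf tendsto_mult_right_zero[OF uh, of "\<bar>M\<bar>"]] by simp
      have "L2_norm (T (u n) - g) \<le> L2_norm (s n - f) + \<bar>M\<bar> * L2_norm (u n - h)" for n
      proof -
        have "T (u n) - g = (\<lambda>x. (s n - f) x + (\<lambda>x. (- of_real M) * (u n - h) x) x)"
          unfolding su S_def g_def by (auto simp: algebra_simps)
        then have "L2_norm (T (u n) - g) \<le> L2_norm (s n - f) + L2_norm (\<lambda>x. (- of_real M) * (u n - h) x)"
          by (simp only:) (intro L2_norm_triangle L2_diff L2_scale sL f uL h)
        then show ?thesis unfolding L2_norm_scale by (simp add: fun_diff_def)
      qed
      then show "\<forall>\<^sub>F n in sequentially. norm (L2_norm (T (u n) - g)) \<le> L2_norm (s n - f) + \<bar>M\<bar> * L2_norm (u n - h)"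
        by (intro always_eventually allI) simp
    qed
    have hg: "(h, g) \<in> graph_closure ?G"
      using uh Tg uD by (intro graph_closureI[OF h g, of "\<lambda>n. (u n, T (u n))"]) auto
    then have adj2: "\<And>u. u \<in> D \<Longrightarrow> L2_inner (T u) h = L2_inner u g"
      using clos by (auto simp: graph_adjoint_def)
    have "L2_norm (v - h) = 0"
    proof (rule kernel)
      show "v - h \<in> L2" by (intro L2_diff v h)
      fix q assume q: "q \<in> D"
      have 1: "L2_inner (\<lambda>x. T q x + of_real M * q x) y = L2_inner (T q) y + of_real M * L2_inner q y" if "y \<in> L2" for y
        using q D that by (subst L2_inner_add_left) (auto simp: L2_inner_scale_left intro!: L2_scale)
      have 2: "L2_inner q g = L2_inner q f - of_real M * L2_inner q h"
        unfolding g_def by (simp only: L2_inner_add_right[OF D(2)[OF q] f L2_scale[OF h]] L2_inner_scale_right) simp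
      have 3: "L2_inner q f = L2_inner q w + of_real M * L2_inner q v"
        unfolding f_def using q D v w by (subst L2_inner_add_right) (auto simp: L2_inner_scale_right intro!: L2_scale)
      show "L2_inner (\<lambda>x. T q x + of_real M * q x) (v - h) = 0"
        using q v h D by (simp add: L2_inner_diff_right SL[unfolded S_def] 1 adj adj2 2 3)
    qed
    \<comment> \<open>\<open>v\<close> and \<open>h\<close> agree only almost everywhere, so the
      approximating sequence is transferred to \<open>(v, w)\<close> through equality of
      norms.\<close>
    then have AE: "AE x in lebesgue. v x = h x"
      using L2_norm_eq_0[OF L2_diff[OF v h]] by simp
    then have AE2: "AE x in lebesgue. w x = g x"
      by eventually_elim (simp add: g_def f_def)
    have "L2_norm (u n - v) = L2_norm (u n - h)" for n
      by (rule L2_norm_AE_cong[OF L2_diff[OF uL v]]) (use AE in eventually_elim, simp)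
    moreover have "L2_norm (T (u n) - w) = L2_norm (T (u n) - g)" for n
      by (rule L2_norm_AE_cong[OF L2_diff[OF D(3)[OF uD] w]]) (use AE2 in eventually_elim, simp)
    ultimately show "p \<in> graph_closure ?G"
      using uh Tg uD by (simp, intro graph_closureI[OF v w, of "\<lambda>n. (u n, T (u n))"]) auto
  qed
  then have "graph_adjoint ?G = graph_closure ?G" using clos by blast
  then show ?thesis
    by (simp add: essentially_self_adjoint_def self_adjoint_graph_def graph_adjoint_closure[OF G])
qed

subsection \<open>Partial derivatives and integration by parts\<close>

lemma has_vector_derivative_at_0_iff:
  "(g has_vector_derivative d) (at 0) \<longleftrightarrow> ((\<lambda>t. (g t - g 0) /\<^sub>R t) \<longlongrightarrow> d) (at 0)"
proof -
  have "((\<lambda>t. (g t - g 0) /\<^sub>R t) \<longlongrightarrow> d) (at 0) \<longleftrightarrow> ((\<lambda>t. norm ((g t - g 0) /\<^sub>R t - d)) \<longlongrightarrow> 0) (at 0)"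
    by (subst tendsto_norm_zero_iff, subst LIM_zero_iff) (rule refl)
  also have "\<dots> \<longleftrightarrow> ((\<lambda>h. norm (g (0 + h) - g 0 - h *\<^sub>R d) / norm h) \<longlongrightarrow> 0) (at 0)"
  proof (rule filterlim_cong)
    have "norm ((g t - g 0) /\<^sub>R t - d) = norm (g (0 + t) - g 0 - t *\<^sub>R d) / norm t" if "t \<noteq> 0" for t :: real
    proof -
      have "(g t - g 0) /\<^sub>R t - d = (g (0 + t) - g 0 - t *\<^sub>R d) /\<^sub>R t"
        using that by (simp add: scaleR_diff_right)
      then show ?thesis by (simp add: divide_inverse mult.commute)
    qed
    then show "\<forall>\<^sub>F t in at 0. norm ((g t - g 0) /\<^sub>R t - d) = norm (g (0 + t) - g 0 - t *\<^sub>R d) / norm t"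
      by (simp add: eventually_at_filter)
  qed auto
  also have "\<dots> \<longleftrightarrow> (g has_vector_derivative d) (at 0)"
    unfolding has_vector_derivative_def has_derivative_at by (simp add: bounded_linear_scaleR_left)
  finally show ?thesis by simp
qed

text \<open>Only pure second derivatives enter the Laplacian, so differentiability along coordinate lines
  is enough and no Frechet derivatives are needed.\<close>

definition has_pd :: "'n \<Rightarrow> (real^'n::finite \<Rightarrow> 'b::real_normed_vector) \<Rightarrow> (real^'n \<Rightarrow> 'b) \<Rightarrow> (real^'n) set \<Rightarrow> bool" where
  "has_pd j f f' S \<longleftrightarrow> (\<forall>x\<in>S. ((\<lambda>t. f (x + t *\<^sub>R axis j 1)) has_vector_derivative f' x) (at 0))"

lemma has_pdD: "has_pd j f f' S \<Longrightarrow> x \<in> S \<Longrightarrow> ((\<lambda>t. f (x + t *\<^sub>R axis j 1)) has_vector_derivative f' x) (at 0)"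
  by (simp add: has_pd_def)

lemma has_pd_subset: "has_pd j f f' S \<Longrightarrow> T \<subseteq> S \<Longrightarrow> has_pd j f f' T"
  by (auto simp: has_pd_def)

lemma has_pd_along:
  assumes "has_pd j f f' S" "x + t *\<^sub>R axis j 1 \<in> S"
  shows "((\<lambda>s. f (x + s *\<^sub>R axis j 1)) has_vector_derivative f' (x + t *\<^sub>R axis j 1)) (at t)"
proof -
  have "((\<lambda>s. s - t) has_vector_derivative 1) (at t)"
    by (auto intro!: derivative_eq_intros)
  moreover have "((\<lambda>s. f (x + t *\<^sub>R axis j 1 + s *\<^sub>R axis j 1)) has_vector_derivative f' (x + t *\<^sub>R axis j 1)) (at (t - t))"
    using has_pdD[OF assms] by simp
  ultimately have "(((\<lambda>s. f (x + t *\<^sub>R axis j 1 + s *\<^sub>R axis j 1)) \<circ> (\<lambda>s. s - t)) has_vector_derivative 1 *\<^sub>R f' (x + t *\<^sub>R axis j 1)) (at t)"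
    by (rule vector_diff_chain_at)
  then show ?thesis by (simp add: o_def algebra_simps)
qed

lemma has_pd_unique: "has_pd j f f' S \<Longrightarrow> has_pd j f f'' S \<Longrightarrow> x \<in> S \<Longrightarrow> f' x = f'' x"
  using has_pdD vector_derivative_unique_at by metis

lemma has_pd_cong:
  assumes "has_pd j f f' S" "open S" "\<And>x. x \<in> S \<Longrightarrow> f x = g x" "\<And>x. x \<in> S \<Longrightarrow> f' x = g' x"
  shows "has_pd j g g' S"
  unfolding has_pd_def
proof
  fix x assume x: "x \<in> S"
  have "\<forall>\<^sub>F t in nhds 0. x + t *\<^sub>R axis j 1 \<in> S"
  proof (rule topological_tendstoD[of "\<lambda>t. x + t *\<^sub>R axis j 1" x])
    have "((\<lambda>t. x + t *\<^sub>R axis j (1::real)) \<longlongrightarrow> x + 0 *\<^sub>R axis j 1) (nhds 0)" by (intro tendsto_intros filterlim_ident)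
    then show "((\<lambda>t. x + t *\<^sub>R axis j (1::real)) \<longlongrightarrow> x) (nhds 0)" by simp
  qed (use x assms in auto)
  then have ev: "\<forall>\<^sub>F t in nhds 0. f (x + t *\<^sub>R axis j 1) = g (x + t *\<^sub>R axis j 1)"
    by eventually_elim (use assms in auto)
  have "((\<lambda>t. f (x + t *\<^sub>R axis j 1)) has_vector_derivative f' x) (at 0)" by (rule has_pdD[OF assms(1) x])
  then have "((\<lambda>t. g (x + t *\<^sub>R axis j 1)) has_vector_derivative f' x) (at 0)"
    by (rule has_vector_derivative_cong_ev[THEN iffD1, rotated 2])
      (use ev x assms(3) in \<open>auto elim: eventually_mono\<close>)
  then show "((\<lambda>t. g (x + t *\<^sub>R axis j 1)) has_vector_derivative g' x) (at 0)" using assms(4) x by simp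
qed

lemma has_pd_const: "has_pd j (\<lambda>x. c) (\<lambda>x. 0) S"
  by (simp add: has_pd_def)

lemma has_pd_add: "has_pd j f f' S \<Longrightarrow> has_pd j g g' S \<Longrightarrow> has_pd j (\<lambda>x. f x + g x) (\<lambda>x. f' x + g' x) S"
  unfolding has_pd_def by (intro ballI has_vector_derivative_add) auto

lemma has_pd_diff: "has_pd j f f' S \<Longrightarrow> has_pd j g g' S \<Longrightarrow> has_pd j (\<lambda>x. f x - g x) (\<lambda>x. f' x - g' x) S"
  unfolding has_pd_def by (intro ballI has_vector_derivative_diff) auto

lemma has_pd_sum: "(\<And>i. i \<in> I \<Longrightarrow> has_pd j (f i) (f' i) S) \<Longrightarrow> has_pd j (\<lambda>x. \<Sum>i\<in>I. f i x) (\<lambda>x. \<Sum>i\<in>I. f' i x) S"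
  by (induction I rule: infinite_finite_induct) (simp_all add: has_pd_const has_pd_add)

lemma has_pd_mult:
  fixes f g :: "real^'n::finite \<Rightarrow> 'b::real_normed_algebra"
  shows "has_pd j f f' S \<Longrightarrow> has_pd j g g' S \<Longrightarrow> has_pd j (\<lambda>x. f x * g x) (\<lambda>x. f x * g' x + f' x * g x) S"
  unfolding has_pd_def
proof
  fix x assume a: "\<forall>x\<in>S. ((\<lambda>t. f (x + t *\<^sub>R axis j 1)) has_vector_derivative f' x) (at 0)"
    "\<forall>x\<in>S. ((\<lambda>t. g (x + t *\<^sub>R axis j 1)) has_vector_derivative g' x) (at 0)" "x \<in> S"
  show "((\<lambda>t. f (x + t *\<^sub>R axis j 1) * g (x + t *\<^sub>R axis j 1)) has_vector_derivative f x * g' x + f' x * g x) (at 0)"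
    using has_vector_derivative_mult[OF a(1)[rule_format, OF a(3)] a(2)[rule_format, OF a(3)]] by simp
qed

lemma has_pd_linear: "bounded_linear L \<Longrightarrow> has_pd j f f' S \<Longrightarrow> has_pd j (\<lambda>x. L (f x)) (\<lambda>x. L (f' x)) S"
  unfolding has_pd_def using bounded_linear.has_vector_derivative by blast

lemma has_pd_chain:
  fixes f :: "real^'n::finite \<Rightarrow> real" and g :: "real \<Rightarrow> real"
  assumes "has_pd j f f' S" "\<And>x. x \<in> S \<Longrightarrow> (g has_real_derivative g' (f x)) (at (f x))"
  shows "has_pd j (\<lambda>x. g (f x)) (\<lambda>x. g' (f x) * f' x) S"
  unfolding has_pd_def
proof
  fix x assume x: "x \<in> S"
  have "((\<lambda>t. f (x + t *\<^sub>R axis j 1)) has_real_derivative f' x) (at 0)"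
    using has_pdD[OF assms(1) x] by (simp add: has_real_derivative_iff_has_vector_derivative)
  then have "((\<lambda>t. g (f (x + t *\<^sub>R axis j 1))) has_real_derivative g' (f x) * f' x) (at 0)"
    by (rule DERIV_chain2[rotated]) (use assms(2)[OF x] in simp)
  then show "((\<lambda>t. g (f (x + t *\<^sub>R axis j 1))) has_vector_derivative g' (f x) * f' x) (at 0)"
    by (simp add: has_real_derivative_iff_has_vector_derivative)
qed

lemma has_pd_dist_sq: "has_pd j (\<lambda>x. (norm (x - a))\<^sup>2) (\<lambda>x. 2 * (x - a) $ j) S"
  unfolding has_pd_def
proof
  fix x
  have "(norm (x + t *\<^sub>R axis j 1 - a))\<^sup>2 = (norm (x - a))\<^sup>2 + 2 * t * (x - a) $ j + t\<^sup>2" for t :: real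
  proof -
    have "x + t *\<^sub>R axis j 1 - a = (x - a) + t *\<^sub>R axis j 1" by simp
    then show ?thesis
      by (simp only: power2_norm_eq_inner inner_add_left inner_add_right)
        (simp add: inner_axis inner_commute[of "axis j 1"] power2_eq_square inner_axis_axis)
  qed
  then show "((\<lambda>t. (norm (x + t *\<^sub>R axis j 1 - a))\<^sup>2) has_vector_derivative 2 * (x - a) $ j) (at 0)"
    by (simp add: has_real_derivative_iff_has_vector_derivative[symmetric])
      (auto intro!: derivative_eq_intros)
qed

lemma has_pd_component: "has_pd j (\<lambda>x. (x - a) $ i) (\<lambda>x. if i = j then 1 else 0) S"
  unfolding has_pd_def has_real_derivative_iff_has_vector_derivative[symmetric]
  by (auto simp: axis_def intro!: derivative_eq_intros)

text \<open>The bridge from the Frechet-based \<open>partial_deriv\<close> of test functions to the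
  coordinate-line calculus: a Frechet derivative restricts to every coordinate line.\<close>

lemma has_pd_frechet:
  assumes "\<And>x. x \<in> S \<Longrightarrow> u differentiable (at x)"
  shows "has_pd j u (partial_deriv j u) S"
  unfolding has_pd_def
proof
  fix x assume x: "x \<in> S"
  have d: "(u has_derivative frechet_derivative u (at x)) (at (x + 0 *\<^sub>R axis j 1))"
    using assms[OF x] by (simp add: frechet_derivative_works)
  have "((\<lambda>t. x + t *\<^sub>R axis j (1::real)) has_derivative (\<lambda>t. t *\<^sub>R axis j 1)) (at 0)"
    by (auto intro!: derivative_eq_intros)
  then have "((\<lambda>t. u (x + t *\<^sub>R axis j 1)) has_derivative (\<lambda>t. frechet_derivative u (at x) (t *\<^sub>R axis j 1))) (at 0)"
    using has_derivative_compose d by blast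
  moreover have "linear (frechet_derivative u (at x))"
    using d has_derivative_linear by blast
  ultimately show "((\<lambda>t. u (x + t *\<^sub>R axis j 1)) has_vector_derivative partial_deriv j u x) (at 0)"
    by (simp add: has_vector_derivative_def partial_deriv_def linear_cmul)
qed

section \<open>Convolution with a compactly supported kernel\<close>

lemma distr_lborel_reflect: "distr lborel borel (\<lambda>y. x - y) = (lborel :: 'a::euclidean_space measure)"
proof -
  show ?thesis using lborel_affine[of "-1::real" x] by (simp add: density_1)
qed

lemma integral_reflect:
  fixes f :: "'a::euclidean_space \<Rightarrow> 'b::{banach, second_countable_topology}"
  assumes [measurable]: "f \<in> borel_measurable borel"
  shows "(LINT y|lborel. f (x - y)) = (LINT y|lborel. f y)"
  by (subst distr_lborel_reflect[of x, symmetric], subst integral_distr) auto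

text \<open>The density is real and the kernel vector-valued, so that one calculus covers both
  mollification of real functions and, with density 1, integrals of derivatives of complex
  functions.\<close>

definition conv :: "('a::euclidean_space \<Rightarrow> real) \<Rightarrow> ('a \<Rightarrow> 'b::{banach, second_countable_topology}) \<Rightarrow> 'a \<Rightarrow> 'b" where
  "conv v K x = (LINT y|lborel. v y *\<^sub>R K (x - y))"

definition loc_integrable :: "('a::euclidean_space \<Rightarrow> real) \<Rightarrow> bool" where
  "loc_integrable v \<longleftrightarrow> v \<in> borel_measurable borel \<and> (\<forall>\<rho>. integrable lborel (\<lambda>y. indicator (cball 0 \<rho>) y * v y))"

lemma compact_support_bounded:
  fixes K :: "'a::euclidean_space \<Rightarrow> 'b::real_normed_vector"
  assumes "continuous_on UNIV K" "\<And>z. norm z > \<epsilon> \<Longrightarrow> K z = 0"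
  obtains B where "B > 0" "\<And>z. norm (K z) \<le> B"
proof -
  have "bounded (K ` cball 0 \<epsilon>)"
    by (intro compact_imp_bounded compact_continuous_image continuous_on_subset[OF assms(1)]) auto
  then obtain B where B: "B > 0" "\<And>y. y \<in> K ` cball 0 \<epsilon> \<Longrightarrow> norm y \<le> B" by (auto simp: bounded_pos)
  have "norm (K z) \<le> B" for z using B assms(2)[of z] by (cases "norm z \<le> \<epsilon>") auto
  then show ?thesis using B(1) that by blast
qed

text \<open>A kernel supported in the ball of radius \<epsilon> sees \<open>v\<close> only on the
  ball of radius \<open>R + \<epsilon>\<close> while \<open>x\<close> stays in the ball of radius
  \<open>R\<close>. The right-hand side is thus independent of \<open>x\<close> and serves as the
  dominating function below.\<close>

lemma conv_bound:
  fixes K :: "'a::euclidean_space \<Rightarrow> 'b::real_normed_vector"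
  assumes "\<And>z. norm z > \<epsilon> \<Longrightarrow> K z = 0" "\<And>z. norm (K z) \<le> B" "norm x \<le> R"
  shows "norm (v y *\<^sub>R K (x - y)) \<le> B * norm (indicator (cball 0 (R + \<epsilon>)) y * v y)"
proof (cases "norm y \<le> R + \<epsilon>")
  case True
  then show ?thesis using assms(2)[of "x - y"] by (simp add: mult.commute[of B] mult_left_mono)
next
  case False
  have "norm y \<le> norm x + norm (x - y)" using norm_triangle_ineq4[of x "x - y"] by simp
  then have "norm (x - y) > \<epsilon>" using False assms(3) by linarith
  moreover have "0 \<le> B" using order_trans[OF norm_ge_zero assms(2)[of 0]] .
  ultimately show ?thesis using assms(1) by simp
qed

lemma conv_integrable:
  fixes K :: "'a::euclidean_space \<Rightarrow> 'b::{banach, second_countable_topology}"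
  assumes v: "loc_integrable v" and K: "continuous_on UNIV K" "\<And>z. norm z > \<epsilon> \<Longrightarrow> K z = 0"
  shows "integrable lborel (\<lambda>y. v y *\<^sub>R K (x - y))"
proof -
  have [measurable]: "v \<in> borel_measurable borel" "K \<in> borel_measurable borel"
    using v K by (auto simp: loc_integrable_def intro: borel_measurable_continuous_onI)
  obtain B where B: "B > 0" "\<And>z. norm (K z) \<le> B" using compact_support_bounded[OF K] by blast
  have "integrable lborel (\<lambda>y. B * norm (indicator (cball 0 (norm x + \<epsilon>)) y * v y))"
    using v by (auto simp: loc_integrable_def)
  then show ?thesis
  proof (rule Bochner_Integration.integrable_bound)
    show "AE y in lborel. norm (v y *\<^sub>R K (x - y)) \<le> norm (B * norm (indicator (cball 0 (norm x + \<epsilon>)) y * v y))"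
    proof (intro always_eventually allI)
      fix y
      have "norm (v y *\<^sub>R K (x - y)) \<le> B * norm (indicator (cball 0 (norm x + \<epsilon>)) y * v y)"
        by (rule conv_bound[OF K(2) B(2) order_refl])
      then show "norm (v y *\<^sub>R K (x - y)) \<le> norm (B * norm (indicator (cball 0 (norm x + \<epsilon>)) y * v y))"
        by simp
    qed
  qed measurable
qed

lemma continuous_conv:
  fixes K :: "'a::euclidean_space \<Rightarrow> 'b::{banach, second_countable_topology}"
  assumes v: "loc_integrable v" and K: "continuous_on UNIV K" "\<And>z. norm z > \<epsilon> \<Longrightarrow> K z = 0"
  shows "continuous_on UNIV (conv v K)"
  unfolding continuous_on_sequentially
proof (intro allI ballI impI)
  fix X :: "nat \<Rightarrow> 'a" and x assume "(\<forall>n. X n \<in> UNIV) \<and> X \<longlonglongrightarrow> x"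
  then have X: "X \<longlonglongrightarrow> x" by simp
  have [measurable]: "v \<in> borel_measurable borel" "K \<in> borel_measurable borel"
    using v K by (auto simp: loc_integrable_def intro: borel_measurable_continuous_onI)
  obtain B where B: "B > 0" "\<And>z. norm (K z) \<le> B" using compact_support_bounded[OF K] by blast
  obtain R where R: "\<And>n. norm (X n) \<le> R" using convergent_imp_Bseq[of X] X by (auto simp: convergent_def Bseq_def)
  show "((conv v K) \<circ> X) \<longlonglongrightarrow> conv v K x"
    unfolding o_def conv_def
  proof (rule integral_dominated_convergence)
    show "integrable lborel (\<lambda>y. B * norm (indicator (cball 0 (R + \<epsilon>)) y * v y))"
      using v by (auto simp: loc_integrable_def)
    have "(\<lambda>n. K (X n - y)) \<longlonglongrightarrow> K (x - y)" for y
      by (rule continuous_on_tendsto_compose[OF K(1) tendsto_diff[OF X tendsto_const]]) auto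
    then show "AE y in lborel. (\<lambda>n. v y *\<^sub>R K (X n - y)) \<longlonglongrightarrow> v y *\<^sub>R K (x - y)"
      by (intro always_eventually allI tendsto_intros)
    show "AE y in lborel. norm (v y *\<^sub>R K (X n - y)) \<le> B * norm (indicator (cball 0 (R + \<epsilon>)) y * v y)" for n
      by (intro always_eventually allI conv_bound[OF K(2) B(2) R])
  qed measurable
qed

text \<open>Dominated convergence for the difference quotients of the kernel. The mean value
  inequality bounds them by the supremum \<open>B\<close> of the derivative of \<open>K\<close>,
  uniformly in the step.\<close>

lemma has_pd_conv:
  fixes K :: "real^'n::finite \<Rightarrow> 'b::{banach, second_countable_topology}"
  assumes v: "loc_integrable v"
    and K: "continuous_on UNIV K" "\<And>z. norm z > \<epsilon> \<Longrightarrow> K z = 0"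
    and K': "continuous_on UNIV K'" "\<And>z. norm z > \<epsilon> \<Longrightarrow> K' z = 0"
    and d: "has_pd j K K' UNIV"
  shows "has_pd j (conv v K) (conv v K') UNIV"
  unfolding has_pd_def
proof
  fix x :: "real^'n"
  let ?e = "axis j 1 :: real^'n"
  have [measurable]: "v \<in> borel_measurable borel" "K \<in> borel_measurable borel" "K' \<in> borel_measurable borel"
    using v K K' by (auto simp: loc_integrable_def intro: borel_measurable_continuous_onI)
  obtain B where B: "B > 0" "\<And>z. norm (K' z) \<le> B" using compact_support_bounded[OF K'] by blast
  have lip: "norm (K (z + t *\<^sub>R ?e) - K z) \<le> B * \<bar>t\<bar>" for z t
  proof -
    have "norm (K (z + t *\<^sub>R ?e) - K (z + 0 *\<^sub>R ?e)) \<le> B * norm (t - 0)"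
    proof (rule differentiable_bound[of UNIV "\<lambda>s. K (z + s *\<^sub>R ?e)" "\<lambda>s h. h *\<^sub>R K' (z + s *\<^sub>R ?e)"])
      show "((\<lambda>s. K (z + s *\<^sub>R ?e)) has_derivative (\<lambda>h. h *\<^sub>R K' (z + s *\<^sub>R ?e))) (at s within UNIV)" for s
        using has_pd_along[OF d] by (simp add: has_vector_derivative_def)
      show "onorm (\<lambda>h. h *\<^sub>R K' (z + s *\<^sub>R ?e)) \<le> B" for s
        by (rule onorm_le) (use B in \<open>auto simp: mult.commute[of B] mult_left_mono\<close>)
    qed auto
    then show ?thesis by simp
  qed
  have "((\<lambda>t. (conv v K (x + t *\<^sub>R ?e) - conv v K x) /\<^sub>R t) \<longlongrightarrow> conv v K' x) (at 0)"
    unfolding tendsto_at_iff_sequentially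
  proof (intro allI impI)
    fix T :: "nat \<Rightarrow> real" assume T0: "\<forall>i. T i \<in> UNIV - {0}" and T: "T \<longlonglongrightarrow> 0"
    have sh: "x + t *\<^sub>R ?e - y = x - y + t *\<^sub>R ?e" for t y by simp
    obtain R where R: "\<And>n. \<bar>T n\<bar> \<le> R" using convergent_imp_Bseq[of T] T by (auto simp: convergent_def Bseq_def)
    have R0: "0 \<le> R" using R[of 0] by linarith
    have eq: "(conv v K (x + t *\<^sub>R ?e) - conv v K x) /\<^sub>R t = (LINT y|lborel. v y *\<^sub>R ((K (x + t *\<^sub>R ?e - y) - K (x - y)) /\<^sub>R t))" for t
    proof -
      have "conv v K (x + t *\<^sub>R ?e) - conv v K x = (LINT y|lborel. v y *\<^sub>R K (x + t *\<^sub>R ?e - y) - v y *\<^sub>R K (x - y))"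
        unfolding conv_def
        by (rule Bochner_Integration.integral_diff[symmetric]) (rule conv_integrable[OF v K], assumption)+
      then have "(conv v K (x + t *\<^sub>R ?e) - conv v K x) /\<^sub>R t = inverse t *\<^sub>R (LINT y|lborel. v y *\<^sub>R K (x + t *\<^sub>R ?e - y) - v y *\<^sub>R K (x - y))"
        by (simp only:)
      also have "\<dots> = (LINT y|lborel. inverse t *\<^sub>R (v y *\<^sub>R K (x + t *\<^sub>R ?e - y) - v y *\<^sub>R K (x - y)))"
        by (rule integral_scaleR_right[symmetric])
      also have "\<dots> = (LINT y|lborel. v y *\<^sub>R ((K (x + t *\<^sub>R ?e - y) - K (x - y)) /\<^sub>R t))"
        by (rule Bochner_Integration.integral_cong) (simp_all only: scaleR_diff_right scaleR_scaleR mult.commute)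
      finally show ?thesis .
    qed
    show "((\<lambda>t. (conv v K (x + t *\<^sub>R ?e) - conv v K x) /\<^sub>R t) \<circ> T) \<longlonglongrightarrow> conv v K' x"
      unfolding o_def eq unfolding conv_def
    proof (rule integral_dominated_convergence)
      show "integrable lborel (\<lambda>y. B * norm (indicator (cball 0 (norm x + (R + \<epsilon>))) y * v y))"
        using v by (auto simp: loc_integrable_def)
      show "AE y in lborel. (\<lambda>n. v y *\<^sub>R ((K (x + T n *\<^sub>R ?e - y) - K (x - y)) /\<^sub>R T n)) \<longlonglongrightarrow> v y *\<^sub>R K' (x - y)"
      proof (intro always_eventually allI tendsto_intros)
        fix y
        have "((\<lambda>t. (K (x - y + t *\<^sub>R ?e) - K (x - y)) /\<^sub>R t) \<longlongrightarrow> K' (x - y)) (at 0)"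
          using has_pdD[OF d, of "x - y"] by (simp add: has_vector_derivative_at_0_iff)
        then have "(\<lambda>n. (K (x - y + T n *\<^sub>R ?e) - K (x - y)) /\<^sub>R T n) \<longlonglongrightarrow> K' (x - y)"
          using T0 T unfolding tendsto_at_iff_sequentially o_def by simp
        then show "(\<lambda>n. (K (x + T n *\<^sub>R ?e - y) - K (x - y)) /\<^sub>R T n) \<longlonglongrightarrow> K' (x - y)"
          by (simp only: sh)
      qed
      fix n
      let ?Q = "\<lambda>z. (K (z + T n *\<^sub>R ?e) - K z) /\<^sub>R T n"
      \<comment> \<open>The steps \<open>T n\<close> are bounded by \<open>R\<close>, so all
        difference quotients vanish outside one ball and share one dominating function.\<close>
      have Q0: "?Q z = 0" if "norm z > R + \<epsilon>" for z
      proof -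
        have "norm z \<le> norm (z + T n *\<^sub>R ?e) + norm (T n *\<^sub>R ?e)" by (metis add_diff_cancel_right' norm_triangle_ineq4)
        then have "norm (z + T n *\<^sub>R ?e) > \<epsilon>" using that R[of n] by simp
        moreover have "norm z > \<epsilon>" using that R0 by simp
        ultimately show ?thesis using K(2) by simp
      qed
      have QB: "norm (?Q z) \<le> B" for z
        using lip[of z "T n"] T0 by (simp add: inverse_eq_divide pos_divide_le_eq mult.commute)
      have bd: "norm (v y *\<^sub>R ?Q (x - y)) \<le> B * norm (indicator (cball 0 (norm x + (R + \<epsilon>))) y * v y)" for y
        by (rule conv_bound[where K="?Q", OF Q0 QB order_refl])
      show "AE y in lborel. norm (v y *\<^sub>R ((K (x + T n *\<^sub>R ?e - y) - K (x - y)) /\<^sub>R T n))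
          \<le> B * norm (indicator (cball 0 (norm x + (R + \<epsilon>))) y * v y)"
        unfolding sh by (intro always_eventually allI bd)
    qed measurable
  qed
  then show "((\<lambda>t. conv v K (x + t *\<^sub>R ?e)) has_vector_derivative conv v K' x) (at 0)"
    by (simp add: has_vector_derivative_at_0_iff)
qed

text \<open>The convolution of \<open>F\<close> with the constant 1 is the integral of
  \<open>F\<close> at every point, by translation and reflection invariance, so its partial
  derivative is 0; by \<open>has_pd_conv\<close> that derivative is the integral of
  \<open>F'\<close>. Support in a compact \<open>C\<close> inside \<open>S\<close> lets the data be
  singular outside \<open>S\<close>.\<close>

lemma integral_pd_eq_0:
  fixes F :: "real^'n::finite \<Rightarrow> 'b::{banach, second_countable_topology}"
  assumes S: "open S" "compact C" "C \<subseteq> S"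
    and F: "continuous_on S F" "continuous_on S F'" "has_pd j F F' S"
    and 0: "\<And>x. x \<notin> C \<Longrightarrow> F x = 0" "\<And>x. x \<notin> C \<Longrightarrow> F' x = 0"
  shows "integrable lborel F'" "(LINT x|lborel. F' x) = 0"
proof -
  have oC: "open (- C)" using S(2) by (simp add: compact_imp_closed open_Compl)
  have U: "S \<union> - C = UNIV" using S by auto
  have ext: "continuous_on UNIV G" if "continuous_on S G" "\<And>x. x \<notin> C \<Longrightarrow> G x = 0" for G :: "real^'n \<Rightarrow> 'b"
  proof -
    have "continuous_on (- C) G" using that(2) by (subst continuous_on_cong[of _ "- C" G "\<lambda>x. 0"]) auto
    then show ?thesis using continuous_on_open_Un[OF S(1) oC that(1)] U by simp
  qed
  note c = ext[OF F(1) 0(1)] ext[OF F(2) 0(2)]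
  have pd: "has_pd j F F' UNIV"
  proof -
    have "has_pd j F F' (- C)" by (rule has_pd_cong[where f="\<lambda>x. 0" and f'="\<lambda>x. 0", OF has_pd_const oC]) (use 0 in auto)
    then show ?thesis using F(3) U by (auto simp: has_pd_def)
  qed
  obtain \<epsilon> where \<epsilon>: "\<And>x. x \<in> C \<Longrightarrow> norm x \<le> \<epsilon>" using compact_imp_bounded[OF S(2)] by (auto simp: bounded_iff)
  have z: "F z = 0" "F' z = 0" if "norm z > \<epsilon>" for z using \<epsilon>[of z] that 0 by (meson not_le)+
  have loc: "loc_integrable (\<lambda>x::real^'n. 1)"
    unfolding loc_integrable_def by (auto intro!: integrable_real_indicator emeasure_compact_finite[OF compact_cball])
  have [measurable]: "F \<in> borel_measurable borel" "F' \<in> borel_measurable borel"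
    using c by (auto intro: borel_measurable_continuous_onI)
  have "has_pd j (conv (\<lambda>x. 1) F) (conv (\<lambda>x. 1) F') UNIV"
    by (rule has_pd_conv[OF loc c(1) z(1) c(2) z(2) pd])
  moreover have "conv (\<lambda>x. 1) F = (\<lambda>x. LINT y|lborel. F y)"
    unfolding conv_def using integral_reflect[of F] by auto
  ultimately have "has_pd j (\<lambda>x. LINT y|lborel. F y) (conv (\<lambda>x. 1) F') UNIV" by simp
  then have "conv (\<lambda>x. 1) F' 0 = 0"
    using has_pd_unique[OF _ has_pd_const] by blast
  then show "(LINT x|lborel. F' x) = 0"
    unfolding conv_def using integral_reflect[of F' 0] by simp
  have "integrable lborel (\<lambda>y. (1::real) *\<^sub>R F' (0 - y))"
    by (rule conv_integrable[OF loc c(2) z(2)])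
  then have "integrable (distr lborel borel (\<lambda>y. 0 - y)) F'" by (subst integrable_distr_eq) auto
  then show "integrable lborel F'" by (simp only: distr_lborel_reflect)
qed

section \<open>Calculus of C^2 functions, with the derivatives carried along explicitly\<close>

definition C2_on :: "(real^'n::finite) set \<Rightarrow> (real^'n \<Rightarrow> 'b::real_normed_vector) \<Rightarrow> ('n \<Rightarrow> real^'n \<Rightarrow> 'b) \<Rightarrow> ('n \<Rightarrow> real^'n \<Rightarrow> 'b) \<Rightarrow> bool" where
  "C2_on S f Df D2f \<longleftrightarrow> continuous_on S f \<and> (\<forall>j. has_pd j f (Df j) S \<and> has_pd j (Df j) (D2f j) S \<and>
     continuous_on S (Df j) \<and> continuous_on S (D2f j))"

lemma C2_onD:
  assumes "C2_on S f Df D2f"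
  shows "continuous_on S f" "has_pd j f (Df j) S" "has_pd j (Df j) (D2f j) S"
    "continuous_on S (Df j)" "continuous_on S (D2f j)"
  using assms by (auto simp: C2_on_def)

lemma C2_on_subset: "C2_on S f Df D2f \<Longrightarrow> T \<subseteq> S \<Longrightarrow> C2_on T f Df D2f"
  unfolding C2_on_def by (meson continuous_on_subset has_pd_subset)

lemma C2_on_add:
  "C2_on S f Df D2f \<Longrightarrow> C2_on S g Dg D2g \<Longrightarrow>
    C2_on S (\<lambda>x. f x + g x) (\<lambda>j x. Df j x + Dg j x) (\<lambda>j x. D2f j x + D2g j x)"
  unfolding C2_on_def by (auto intro!: has_pd_add continuous_intros)

lemma C2_on_diff:
  "C2_on S f Df D2f \<Longrightarrow> C2_on S g Dg D2g \<Longrightarrow>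
    C2_on S (\<lambda>x. f x - g x) (\<lambda>j x. Df j x - Dg j x) (\<lambda>j x. D2f j x - D2g j x)"
  unfolding C2_on_def by (auto intro!: has_pd_diff continuous_intros)

lemma C2_on_sum:
  assumes "\<And>i. i \<in> I \<Longrightarrow> C2_on S (f i) (Df i) (D2f i)"
  shows "C2_on S (\<lambda>x. \<Sum>i\<in>I. f i x) (\<lambda>j x. \<Sum>i\<in>I. Df i j x) (\<lambda>j x. \<Sum>i\<in>I. D2f i j x)"
  using assms unfolding C2_on_def by (auto intro!: has_pd_sum continuous_intros)

lemma C2_on_mult:
  fixes f g :: "real^'n::finite \<Rightarrow> real"
  assumes "C2_on S f Df D2f" "C2_on S g Dg D2g"
  shows "C2_on S (\<lambda>x. f x * g x) (\<lambda>j x. f x * Dg j x + Df j x * g x)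
    (\<lambda>j x. f x * D2g j x + 2 * Df j x * Dg j x + D2f j x * g x)"
proof -
  note f = C2_onD[OF assms(1)] and g = C2_onD[OF assms(2)]
  have "has_pd j (\<lambda>x. f x * Dg j x + Df j x * g x)
      (\<lambda>x. (f x * D2g j x + Df j x * Dg j x) + (Df j x * Dg j x + D2f j x * g x)) S" for j
    by (intro has_pd_add has_pd_mult f g)
  moreover have "(\<lambda>x. (f x * D2g j x + Df j x * Dg j x) + (Df j x * Dg j x + D2f j x * g x))
      = (\<lambda>x. f x * D2g j x + 2 * Df j x * Dg j x + D2f j x * g x)" for j
    by auto
  ultimately show ?thesis
    unfolding C2_on_def by (auto intro!: has_pd_mult continuous_intros f g)
qed

lemma C2_on_chain:
  fixes f :: "real^'n::finite \<Rightarrow> real"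
  assumes f: "C2_on S f Df D2f"
    and g: "\<And>x. x \<in> S \<Longrightarrow> (g has_real_derivative g' (f x)) (at (f x))"
      "\<And>x. x \<in> S \<Longrightarrow> (g' has_real_derivative g'' (f x)) (at (f x))"
      "continuous_on (f ` S) g''"
  shows "C2_on S (\<lambda>x. g (f x)) (\<lambda>j x. g' (f x) * Df j x) (\<lambda>j x. g'' (f x) * (Df j x)\<^sup>2 + g' (f x) * D2f j x)"
proof -
  note f = C2_onD[OF f]
  have c0: "continuous_on (f ` S) g" "continuous_on (f ` S) g'"
    using g(1,2) by (auto intro!: continuous_at_imp_continuous_on DERIV_isCont)
  note c = continuous_on_compose2[OF c0(1) f(1) order_refl]
    continuous_on_compose2[OF c0(2) f(1) order_refl] continuous_on_compose2[OF g(3) f(1) order_refl]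
  have "has_pd j (\<lambda>x. g' (f x) * Df j x) (\<lambda>x. g' (f x) * D2f j x + (g'' (f x) * Df j x) * Df j x) S" for j
    by (intro has_pd_mult has_pd_chain f g)
  moreover have "(\<lambda>x. g' (f x) * D2f j x + (g'' (f x) * Df j x) * Df j x) = (\<lambda>x. g'' (f x) * (Df j x)\<^sup>2 + g' (f x) * D2f j x)" for j
    by (auto simp: power2_eq_square)
  ultimately show ?thesis
    unfolding C2_on_def by (auto intro!: has_pd_chain g continuous_intros f c)
qed

lemma C2_on_dist_sq: "C2_on S (\<lambda>x. (norm (x - a))\<^sup>2) (\<lambda>j x. 2 * (x - a) $ j) (\<lambda>j x. 2)"
proof -
  have "has_pd j (\<lambda>x. 2 * (x - a) $ j) (\<lambda>x. 2 * (if j = j then 1 else 0) + 0 * (x - a) $ j) S" for j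
    by (intro has_pd_mult has_pd_const has_pd_component)
  then show ?thesis unfolding C2_on_def
    by (auto intro!: has_pd_dist_sq continuous_intros simp del: vector_minus_component)
qed

text \<open>Profiles depend on the squared distance, a polynomial, so the centre needs no separate
  treatment when the profile is regular there. Summed over \<open>j\<close>, the second derivatives
  give the radial Laplacian 4 s g''(s) + 2 N g'(s) that recurs below.\<close>

lemma C2_on_radial:
  assumes g: "\<And>x. x \<in> S \<Longrightarrow> (g has_real_derivative g' ((norm (x - a))\<^sup>2)) (at ((norm (x - a))\<^sup>2))"
      "\<And>x. x \<in> S \<Longrightarrow> (g' has_real_derivative g'' ((norm (x - a))\<^sup>2)) (at ((norm (x - a))\<^sup>2))"
      "continuous_on ((\<lambda>x. (norm (x - a))\<^sup>2) ` S) g''"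
  shows "C2_on S (\<lambda>x. g ((norm (x - a))\<^sup>2)) (\<lambda>j x. 2 * g' ((norm (x - a))\<^sup>2) * (x - a) $ j)
     (\<lambda>j x. 4 * g'' ((norm (x - a))\<^sup>2) * ((x - a) $ j)\<^sup>2 + 2 * g' ((norm (x - a))\<^sup>2))"
  using C2_on_chain[OF C2_on_dist_sq[of S a], of g g' g''] g
  by (simp add: mult_ac power_mult_distrib del: vector_minus_component)

lemma sum_component_sq: "(\<Sum>j\<in>UNIV. ((x::real^'n::finite) $ j)\<^sup>2) = (norm x)\<^sup>2"
  by (simp add: norm_vec_def L2_set_def sum_nonneg)

lemma C2_on_linear:
  assumes L: "bounded_linear L" and f: "C2_on S f Df D2f"
  shows "C2_on S (\<lambda>x. L (f x)) (\<lambda>j x. L (Df j x)) (\<lambda>j x. L (D2f j x))"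
  using f unfolding C2_on_def
  by (auto intro!: has_pd_linear[OF L] bounded_linear.continuous_on[OF L])

text \<open>The integrand is the divergence of u grad v - v grad u. The support condition rests on
  \<open>u\<close> alone, so \<open>v\<close> may be singular at the boundary of \<open>S\<close>;
  later \<open>S\<close> is the complement of the poles.\<close>

lemma Green_identity:
  fixes u v :: "real^'n::finite \<Rightarrow> 'b::{real_normed_field, banach, second_countable_topology}"
  assumes S: "open S" "compact C" "C \<subseteq> S"
    and u: "C2_on S u Du D2u" and v: "C2_on S v Dv D2v"
    and 0: "\<And>x. x \<notin> C \<Longrightarrow> u x = 0" "\<And>j x. x \<notin> C \<Longrightarrow> Du j x = 0" "\<And>j x. x \<notin> C \<Longrightarrow> D2u j x = 0"
  shows "integrable lborel (\<lambda>x. u x * (\<Sum>j\<in>UNIV. D2v j x) - v x * (\<Sum>j\<in>UNIV. D2u j x))"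
    "(LINT x|lborel. u x * (\<Sum>j\<in>UNIV. D2v j x) - v x * (\<Sum>j\<in>UNIV. D2u j x)) = 0"
proof -
  note u = C2_onD[OF u] and v = C2_onD[OF v]
  have pd: "has_pd j (\<lambda>x. u x * Dv j x - v x * Du j x) (\<lambda>x. u x * D2v j x - v x * D2u j x) S" for j
  proof -
    have "has_pd j (\<lambda>x. u x * Dv j x - v x * Du j x)
      (\<lambda>x. (u x * D2v j x + Du j x * Dv j x) - (v x * D2u j x + Dv j x * Du j x)) S"
      by (intro has_pd_diff has_pd_mult u v)
    then show ?thesis by (simp add: mult.commute)
  qed
  have c: "continuous_on S (\<lambda>x. u x * Dv j x - v x * Du j x)" "continuous_on S (\<lambda>x. u x * D2v j x - v x * D2u j x)" for j
    by (intro continuous_intros u v)+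
  have I: "integrable lborel (\<lambda>x. u x * D2v j x - v x * D2u j x)" "(LINT x|lborel. u x * D2v j x - v x * D2u j x) = 0" for j
    by (intro integral_pd_eq_0[OF S c pd]; simp add: 0)+
  have eq: "(\<lambda>x. u x * (\<Sum>j\<in>UNIV. D2v j x) - v x * (\<Sum>j\<in>UNIV. D2u j x)) = (\<lambda>x. \<Sum>j\<in>UNIV. u x * D2v j x - v x * D2u j x)"
    by (simp add: sum_distrib_left sum_subtractf)
  show "integrable lborel (\<lambda>x. u x * (\<Sum>j\<in>UNIV. D2v j x) - v x * (\<Sum>j\<in>UNIV. D2u j x))"
    unfolding eq by (intro Bochner_Integration.integrable_sum I)
  show "(LINT x|lborel. u x * (\<Sum>j\<in>UNIV. D2v j x) - v x * (\<Sum>j\<in>UNIV. D2u j x)) = 0"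
    unfolding eq by (subst Bochner_Integration.integral_sum) (auto simp: I)
qed

lemma Cc_infty_C2:
  assumes "u \<in> Cc_infty \<Omega>"
  shows "C2_on UNIV u (\<lambda>j. partial_deriv j u) (\<lambda>j. partial_deriv j (partial_deriv j u))"
    "compact (tsupport u)" "tsupport u \<subseteq> \<Omega>"
    "x \<notin> tsupport u \<Longrightarrow> u x = 0" "x \<notin> tsupport u \<Longrightarrow> partial_deriv j u x = 0"
    "x \<notin> tsupport u \<Longrightarrow> partial_deriv j (partial_deriv j u) x = 0"
    "x \<notin> tsupport u \<Longrightarrow> laplacian u x = 0"
proof -
  have ck: "Ck_fun (Suc (Suc (Suc 0))) u" using assms unfolding Cc_infty_def smooth_fun_def by blast
  have d: "u differentiable (at x)" "partial_deriv j u differentiable (at x)"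
    "partial_deriv j (partial_deriv j u) differentiable (at x)" for x j
    using ck by (auto simp: differentiable_on_def)
  have c: "continuous_on UNIV u" "continuous_on UNIV (partial_deriv j u)"
    "continuous_on UNIV (partial_deriv j (partial_deriv j u))" for j
    using d by (auto intro!: continuous_at_imp_continuous_on differentiable_imp_continuous_within)
  show C2: "C2_on UNIV u (\<lambda>j. partial_deriv j u) (\<lambda>j. partial_deriv j (partial_deriv j u))"
    unfolding C2_on_def using d c by (auto intro!: has_pd_frechet)
  show "compact (tsupport u)" "tsupport u \<subseteq> \<Omega>" using assms by (auto simp: Cc_infty_def)
  have op: "open (- tsupport u)" by (simp add: tsupport_def open_Compl)
  show u0: "x \<notin> tsupport u \<Longrightarrow> u x = 0" for x
    unfolding tsupport_def using closure_subset[of "{x. u x \<noteq> 0}"] by auto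
  \<comment> \<open>The complement of the support is open, so vanishing there passes to coordinate
    derivatives; this is applied to \<open>u\<close> and then to its first derivatives.\<close>
  have zero: "f' x = 0" if f: "has_pd j f f' UNIV" "\<And>x. x \<notin> tsupport u \<Longrightarrow> f x = 0" and x: "x \<notin> tsupport u"
    for f f' :: "real^'a \<Rightarrow> complex" and x j
  proof -
    have "has_pd j f (\<lambda>x. 0) (- tsupport u)"
      by (rule has_pd_cong[OF has_pd_const[of j 0] op]) (use f(2) in auto)
    then show ?thesis using has_pd_unique[OF has_pd_subset[OF f(1)]] x by auto
  qed
  show u1: "x \<notin> tsupport u \<Longrightarrow> partial_deriv j u x = 0" for x j
    using zero[OF C2_onD(2)[OF C2] u0] by blast
  show u2: "x \<notin> tsupport u \<Longrightarrow> partial_deriv j (partial_deriv j u) x = 0" for x j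
    using zero[OF C2_onD(3)[OF C2] u1] by blast
  show "x \<notin> tsupport u \<Longrightarrow> laplacian u x = 0" by (simp add: laplacian_def u2)
qed

lemma continuous_AE_eq:
  fixes f g :: "'a::euclidean_space \<Rightarrow> 'b::t2_space"
  assumes "open S" "continuous_on S f" "continuous_on S g" "AE x in lborel. x \<in> S \<longrightarrow> f x = g x" "x \<in> S"
  shows "f x = g x"
proof (rule ccontr)
  assume neq: "f x \<noteq> g x"
  have "open (S \<inter> (\<lambda>x. (f x, g x)) -` {(x, y) | x y. x \<noteq> y})"
    by (intro continuous_open_preimage open_diagonal_complement continuous_intros assms)
  also have "S \<inter> (\<lambda>x. (f x, g x)) -` {(x, y) | x y. x \<noteq> y} = {x \<in> S. f x \<noteq> g x}" by auto
  finally have op: "open {x \<in> S. f x \<noteq> g x}" .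
  have "AE x in lebesgue. x \<notin> {x \<in> S. f x \<noteq> g x}"
    using AE_completion[OF assms(4)] by eventually_elim auto
  then have "negligible {x \<in> S. f x \<noteq> g x}"
    using AE_iff_null_sets[of "{x \<in> S. f x \<noteq> g x}" lebesgue] borel_open[OF op]
    unfolding negligible_iff_null_sets by auto
  then show False using open_not_negligible[OF op] neq assms(5) by blast
qed

lemma integral_pos_of_continuous:
  fixes f :: "'a::euclidean_space \<Rightarrow> real"
  assumes "integrable lborel f" "\<And>x. 0 \<le> f x" "open S" "continuous_on S f" "x \<in> S" "f x \<noteq> 0"
  shows "0 < (LINT x|lborel. f x)"
proof (rule ccontr)
  assume "\<not> 0 < (LINT x|lborel. f x)"
  moreover have "0 \<le> (LINT x|lborel. f x)" by (rule Bochner_Integration.integral_nonneg_AE) (simp add: assms(2))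
  ultimately have "(LINT x|lborel. f x) = 0" by simp
  then have "AE x in lborel. f x = 0" using integral_nonneg_eq_0_iff_AE[OF assms(1)] assms(2) by auto
  then have "AE x in lborel. x \<in> S \<longrightarrow> f x = 0" by eventually_elim simp
  then show False using continuous_AE_eq[OF assms(3,4) continuous_on_const _ assms(5)] assms(6) by blast
qed

subsection \<open>Smooth mollifiers\<close>

text \<open>Level 0 is vacuous because differentiability at the next level already supplies
  continuity; smoothness asks for all levels.\<close>

fun Ck1 :: "nat \<Rightarrow> (real \<Rightarrow> real) \<Rightarrow> bool" where
  "Ck1 0 g = True"
| "Ck1 (Suc m) g = (\<exists>g'. (\<forall>x. (g has_real_derivative g' x) (at x)) \<and> Ck1 m g')"

lemma Ck1_Suc: "Ck1 (Suc m) g \<Longrightarrow> Ck1 m g"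
  by (induction m arbitrary: g) fastforce+

lemma Ck1_const: "Ck1 m (\<lambda>x. c)"
proof (induction m arbitrary: c)
  case (Suc m)
  show ?case unfolding Ck1.simps by (rule exI[of _ "\<lambda>x. 0"]) (use Suc in auto)
qed simp

lemma Ck1_add: "Ck1 m f \<Longrightarrow> Ck1 m g \<Longrightarrow> Ck1 m (\<lambda>x. f x + g x)"
proof (induction m arbitrary: f g)
  case (Suc m)
  obtain f' g' where "\<forall>x. (f has_real_derivative f' x) (at x)" "Ck1 m f'"
    "\<forall>x. (g has_real_derivative g' x) (at x)" "Ck1 m g'"
    using Suc.prems by auto
  then show ?case using Suc.IH[of f' g']
    unfolding Ck1.simps by (intro exI[of _ "\<lambda>x. f' x + g' x"]) (auto intro!: derivative_intros)
qed simp

lemma Ck1_mult: "Ck1 m f \<Longrightarrow> Ck1 m g \<Longrightarrow> Ck1 m (\<lambda>x. f x * g x)"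
proof (induction m arbitrary: f g)
  case (Suc m)
  obtain f' g' where d: "\<forall>x. (f has_real_derivative f' x) (at x)" "Ck1 m f'"
    "\<forall>x. (g has_real_derivative g' x) (at x)" "Ck1 m g'"
    using Suc.prems by auto
  have "Ck1 m (\<lambda>x. f' x * g x + g' x * f x)"
    using Suc.IH[OF d(2) Ck1_Suc[OF Suc.prems(2)]] Suc.IH[OF d(4) Ck1_Suc[OF Suc.prems(1)]]
    by (rule Ck1_add)
  then show ?case using d
    unfolding Ck1.simps by (intro exI[of _ "\<lambda>x. f' x * g x + g' x * f x"]) (auto intro!: DERIV_mult)
qed simp

lemma Ck1_affine: "Ck1 m f \<Longrightarrow> Ck1 m (\<lambda>x. f (a + b * x))"
proof (induction m arbitrary: f)
  case (Suc m)
  obtain f' where d: "\<forall>x. (f has_real_derivative f' x) (at x)" "Ck1 m f'"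
    using Suc.prems by auto
  have "((\<lambda>x. f (a + b * x)) has_real_derivative f' (a + b * x) * b) (at x)" for x
    by (rule DERIV_chain2[of f _ "\<lambda>x. a + b * x"]) (use d in \<open>auto intro!: derivative_eq_intros\<close>)
  moreover have "Ck1 m (\<lambda>x. f' (a + b * x) * b)" by (intro Ck1_mult Ck1_const Suc.IH d)
  ultimately show ?case unfolding Ck1.simps by (intro exI[of _ "\<lambda>x. f' (a + b * x) * b"] conjI allI)
qed simp

definition smooth1 :: "(real \<Rightarrow> real) \<Rightarrow> bool" where "smooth1 g \<longleftrightarrow> (\<forall>m. Ck1 m g)"

lemma smooth1_deriv:
  assumes "smooth1 g"
  obtains g' where "\<And>x. (g has_real_derivative g' x) (at x)" "smooth1 g'"
proof -
  have "Ck1 (Suc m) g" for m using assms by (auto simp: smooth1_def simp del: Ck1.simps)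
  then obtain h where h: "\<And>m x. (g has_real_derivative h m x) (at x)" "\<And>m. Ck1 m (h m)"
    unfolding Ck1.simps by metis
  have "h m = h 0" for m using DERIV_unique[OF h(1) h(1)] by auto
  then show ?thesis using that[of "h 0"] h unfolding smooth1_def by metis
qed

text \<open>The factor (1/t)^n makes the family closed under differentiation up to linear
  combinations, so smoothness follows by one induction. The case n = 0 is the classical
  e^(-1/t).\<close>

definition flat_exp :: "nat \<Rightarrow> real \<Rightarrow> real" where
  "flat_exp n t = (if t > 0 then (1/t) ^ n * exp (- (1/t)) else 0)"

lemma flat_exp_deriv: "(flat_exp n has_real_derivative flat_exp (n + 2) t - real n * flat_exp (n + 1) t) (at t)"
proof (cases "t = 0")
  case False
  show ?thesis
  proof (cases "t > 0")
    case True
    have pw: "((\<lambda>t. (1/t) ^ n) has_real_derivative - real n * (1/t) ^ (n + 1)) (at t)"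
    proof (induction n)
      case (Suc n)
      have "((\<lambda>t. (1/t) * (1/t) ^ n) has_real_derivative - (1/t)\<^sup>2 * (1/t) ^ n + (- real n * (1/t) ^ (n + 1)) * (1/t)) (at t)"
        using True by (intro DERIV_mult Suc) (auto intro!: derivative_eq_intros simp: power2_eq_square)
      then show ?case using True by (simp add: power2_eq_square algebra_simps add_divide_distrib diff_divide_distrib)
    qed simp
    have "((\<lambda>t. exp (- (1/t))) has_real_derivative exp (- (1/t)) * (1/t)\<^sup>2) (at t)"
      using True by (auto intro!: derivative_eq_intros simp: power2_eq_square)
    from DERIV_mult[OF pw this]
    have "((\<lambda>t. (1/t) ^ n * exp (- (1/t))) has_real_derivative flat_exp (n + 2) t - real n * flat_exp (n + 1) t) (at t)"
      using True by (simp add: flat_exp_def power_add power2_eq_square mult_ac)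
    then show ?thesis
      by (rule has_field_derivative_transform_within_open[of _ _ _ "{0<..}"]) (use True in \<open>auto simp: flat_exp_def\<close>)
  next
    case f: False
    have "((\<lambda>t. 0) has_real_derivative flat_exp (n + 2) t - real n * flat_exp (n + 1) t) (at t)"
      using f by (auto simp: flat_exp_def)
    then show ?thesis
      by (rule has_field_derivative_transform_within_open[of _ _ _ "{..<0}"]) (use f False in \<open>auto simp: flat_exp_def\<close>)
  qed
next
  case True
  have "((\<lambda>h. flat_exp n h / h) \<longlongrightarrow> 0) (at 0)"
  proof (rule filterlim_split_at)
    have "((\<lambda>h. 0::real) \<longlongrightarrow> 0) (at_left (0::real))" by simp
    then show "((\<lambda>h. flat_exp n h / h) \<longlongrightarrow> 0) (at_left 0)"
      by (rule Lim_transform_eventually) (auto simp: eventually_at_filter flat_exp_def)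
    \<comment> \<open>With y = 1/h the difference quotient at 0 from the right becomes y^(n+1) /
      e^y.\<close>
    have "((\<lambda>y::real. y ^ (n + 1) / exp y) \<longlongrightarrow> 0) at_top" by (rule tendsto_power_div_exp_0)
    then have "((\<lambda>h::real. (inverse h) ^ (n + 1) / exp (inverse h)) \<longlongrightarrow> 0) (at_right 0)"
      by (rule filterlim_compose[OF _ filterlim_inverse_at_top_right])
    then show "((\<lambda>h. flat_exp n h / h) \<longlongrightarrow> 0) (at_right 0)"
      by (rule Lim_transform_eventually)
        (auto simp: eventually_at_filter flat_exp_def exp_minus field_simps)
  qed
  then show ?thesis using True unfolding DERIV_def by (simp add: flat_exp_def)
qed

lemma Ck1_flat_exp: "Ck1 m (flat_exp n)"
proof (induction m arbitrary: n)
  case (Suc m)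
  have "Ck1 m (\<lambda>t. flat_exp (n + 2) t + (- real n) * flat_exp (n + 1) t)"
    by (intro Ck1_add Ck1_mult Ck1_const Suc)
  then show ?case unfolding Ck1.simps
    using flat_exp_deriv[of n] by (intro exI[of _ "\<lambda>t. flat_exp (n + 2) t + (- real n) * flat_exp (n + 1) t"]) auto
qed simp

lemma smooth_bump:
  assumes "\<delta> > 0"
  obtains b b' b'' where "smooth1 b" "smooth1 b'" "smooth1 b''"
    "\<And>x. (b has_real_derivative b' x) (at x)" "\<And>x. (b' has_real_derivative b'' x) (at x)"
    "\<And>t. \<bar>t\<bar> > \<delta> \<Longrightarrow> b t = 0 \<and> b' t = 0 \<and> b'' t = (0::real)" "\<And>t. b t \<ge> 0" "b 0 > 0"
proof -
  define b where "b t = flat_exp 0 (\<delta> + 1 * t) * flat_exp 0 (\<delta> + (-1) * t)" for t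
  have "smooth1 b" unfolding smooth1_def b_def by (intro allI Ck1_mult Ck1_affine Ck1_flat_exp)
  then obtain b' where b': "\<And>x. (b has_real_derivative b' x) (at x)" "smooth1 b'" using smooth1_deriv by blast
  obtain b'' where b'': "\<And>x. (b' has_real_derivative b'' x) (at x)" "smooth1 b''" using smooth1_deriv[OF b'(2)] by blast
  have b0: "b t = 0" if "\<bar>t\<bar> > \<delta>" for t using that by (auto simp: b_def flat_exp_def)
  have op: "open {t::real. \<bar>t\<bar> > \<delta>}" by (intro open_Collect_less continuous_intros)
  have z: "f' t = 0" if "\<And>x. (f has_real_derivative f' x) (at x)" "\<And>t. \<bar>t\<bar> > \<delta> \<Longrightarrow> f t = 0" "\<bar>t\<bar> > \<delta>" for f f' :: "real \<Rightarrow> real" and t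
  proof -
    have "((\<lambda>t. 0) has_real_derivative f' t) (at t)"
      by (rule has_field_derivative_transform_within_open[OF that(1) op]) (use that in auto)
    then show ?thesis by (metis DERIV_const DERIV_unique)
  qed
  have "b' t = 0" if "\<bar>t\<bar> > \<delta>" for t by (rule z[OF b'(1) b0 that])
  moreover then have "b'' t = 0" if "\<bar>t\<bar> > \<delta>" for t using z[OF b''(1) _ that] by blast
  ultimately show ?thesis
    using that[of b b' b''] \<open>smooth1 b\<close> b' b'' b0 assms by (auto simp: b_def flat_exp_def)
qed

text \<open>A product of one-variable factors, because a partial derivative then merely replaces one
  factor. Membership of mollifiers in \<open>Cc_infty\<close> reduces in this way to smoothness on
  the line.\<close>

definition prod_fun :: "real \<Rightarrow> ('n::finite \<Rightarrow> real \<Rightarrow> real) \<Rightarrow> real^'n \<Rightarrow> real" where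
  "prod_fun c g x = c * (\<Prod>j\<in>UNIV. g j (x $ j))"

lemma has_pd_prod_fun:
  fixes g :: "'n::finite \<Rightarrow> real \<Rightarrow> real"
  assumes "\<And>x. (g i has_real_derivative g' x) (at x)"
  shows "has_pd i (prod_fun c g) (prod_fun c (g(i := g'))) S"
  unfolding has_pd_def has_real_derivative_iff_has_vector_derivative[symmetric]
proof
  fix x :: "real^'n"
  have 1: "prod_fun c g (x + t *\<^sub>R axis i 1) = c * (g i (x $ i + t) * (\<Prod>j\<in>UNIV - {i}. g j (x $ j)))" for t
    unfolding prod_fun_def by (subst prod.remove[of _ i]) (auto simp: axis_def intro!: prod.cong)
  have 2: "prod_fun c (g(i := g')) x = c * (g' (x $ i) * (\<Prod>j\<in>UNIV - {i}. g j (x $ j)))"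
    unfolding prod_fun_def by (subst prod.remove[of _ i]) (auto intro!: prod.cong)
  have "((\<lambda>t. g i (x $ i + t)) has_real_derivative g' (x $ i)) (at 0)"
    by (rule DERIV_chain2[of "g i" _ "\<lambda>t. x $ i + t", THEN DERIV_cong]) (auto intro!: derivative_eq_intros simp: assms)
  then show "((\<lambda>t. prod_fun c g (x + t *\<^sub>R axis i 1)) has_real_derivative prod_fun c (g(i := g')) x) (at 0)"
    unfolding 1 2 by (auto intro!: derivative_eq_intros)
qed

lemma Ck_prod_fun:
  fixes g :: "'n::finite \<Rightarrow> real \<Rightarrow> real"
  shows
  "(\<And>j. smooth1 (g j)) \<Longrightarrow> Ck_fun m (\<lambda>x. complex_of_real (prod_fun c g x))"
  "(\<And>j. smooth1 (g j)) \<Longrightarrow> (\<And>x. (g i has_real_derivative g' x) (at x)) \<Longrightarrow>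
    partial_deriv i (\<lambda>x. complex_of_real (prod_fun c g x)) = (\<lambda>x. complex_of_real (prod_fun c (g(i := g')) x))"
proof -
  have diff: "(\<lambda>x. complex_of_real (prod_fun c g x)) differentiable (at x)" if "\<And>j. smooth1 (g j)" for g :: "'n \<Rightarrow> real \<Rightarrow> real" and x
  proof -
    have "\<exists>g'. \<forall>x. (g j has_real_derivative g' x) (at x)" for j using smooth1_deriv[OF that[of j]] by metis
    then have "g j differentiable (at t)" for j t
      using real_differentiable_def by blast
    then have "(\<lambda>x. g j (x $ j)) differentiable (at x)" for j
      by (intro differentiable_compose[of "g j" "\<lambda>x. x $ j"]) (auto intro: bounded_linear_imp_differentiable bounded_linear_vec_nth)
    then have "\<forall>j. \<exists>D. ((\<lambda>x. g j (x $ j)) has_derivative D) (at x)" by (auto simp: differentiable_def)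
    then obtain D where "\<And>j. ((\<lambda>x. g j (x $ j)) has_derivative D j) (at x)" by metis
    then have "(\<lambda>x. \<Prod>j\<in>UNIV. g j (x $ j)) differentiable (at x)"
      using has_derivative_prod[of UNIV "\<lambda>j x. g j (x $ j)" D x UNIV] unfolding differentiable_def by blast
    then have "(\<lambda>x. c * (\<Prod>j\<in>UNIV. g j (x $ j))) differentiable (at x)" by (intro differentiable_mult) auto
    then show ?thesis unfolding prod_fun_def
      using bounded_linear.has_derivative[OF bounded_linear_of_real] unfolding differentiable_def by blast
  qed
  have pd: "partial_deriv i (\<lambda>x. complex_of_real (prod_fun c g x)) = (\<lambda>x. complex_of_real (prod_fun c (g(i := g')) x))"
    if "\<And>j. smooth1 (g j)" "\<And>x. (g i has_real_derivative g' x) (at x)" for g :: "'n \<Rightarrow> real \<Rightarrow> real" and g' i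
  proof
    fix x
    have 1: "has_pd i (\<lambda>x. complex_of_real (prod_fun c g x)) (partial_deriv i (\<lambda>x. complex_of_real (prod_fun c g x))) UNIV"
      by (intro has_pd_frechet diff that)
    have 2: "has_pd i (\<lambda>x. complex_of_real (prod_fun c g x)) (\<lambda>x. complex_of_real (prod_fun c (g(i := g')) x)) UNIV"
      by (intro has_pd_linear[OF bounded_linear_of_real] has_pd_prod_fun that)
    show "partial_deriv i (\<lambda>x. complex_of_real (prod_fun c g x)) x = complex_of_real (prod_fun c (g(i := g')) x)"
      by (rule has_pd_unique[OF 1 2]) simp
  qed
  show "(\<And>j. smooth1 (g j)) \<Longrightarrow> Ck_fun m (\<lambda>x. complex_of_real (prod_fun c g x))"
  proof (induction m arbitrary: g)
    case 0
    have "continuous_on UNIV (\<lambda>x. complex_of_real (prod_fun c g x))"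
      using diff[OF 0] by (intro continuous_at_imp_continuous_on ballI differentiable_imp_continuous_within)
    then show ?case by simp
  next
    case (Suc m)
    have "Ck_fun m (partial_deriv i (\<lambda>x. complex_of_real (prod_fun c g x)))" for i
    proof -
      obtain g' where g': "\<And>x. (g i has_real_derivative g' x) (at x)" "smooth1 g'" using smooth1_deriv[OF Suc.prems[of i]] by blast
      show ?thesis unfolding pd[where g=g and i=i and g'=g', OF Suc.prems g'(1)]
        by (rule Suc.IH) (use Suc.prems g' in auto)
    qed
    then show ?case using diff[OF Suc.prems] by (simp add: differentiable_on_def)
  qed
  show "(\<And>j. smooth1 (g j)) \<Longrightarrow> (\<And>x. (g i has_real_derivative g' x) (at x)) \<Longrightarrow>
    partial_deriv i (\<lambda>x. complex_of_real (prod_fun c g x)) = (\<lambda>x. complex_of_real (prod_fun c (g(i := g')) x))"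
    by (rule pd)
qed

text \<open>The same function plays two roles: a kernel with explicit derivatives for smoothing,
  and, reflected and translated, an admissible test function. The last two clauses connect the
  roles: inserting the test function into the weak equation gives the equation of the mollified
  function at \<open>x\<close>.\<close>

definition mollifier :: "real \<Rightarrow> (real^'n::finite \<Rightarrow> real) \<Rightarrow> ('n \<Rightarrow> real^'n \<Rightarrow> real) \<Rightarrow> ('n \<Rightarrow> real^'n \<Rightarrow> real) \<Rightarrow> bool" where
  "mollifier \<epsilon> \<eta> D\<eta> D2\<eta> \<longleftrightarrow> C2_on UNIV \<eta> D\<eta> D2\<eta> \<and> (\<forall>z. 0 \<le> \<eta> z) \<and> (LINT z|lborel. \<eta> z) = 1 \<and>
    (\<forall>z. norm z > \<epsilon> \<longrightarrow> \<eta> z = 0 \<and> (\<forall>j. D\<eta> j z = 0 \<and> D2\<eta> j z = 0)) \<and>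
    (\<forall>x S. cball x \<epsilon> \<subseteq> S \<longrightarrow> (\<lambda>y. complex_of_real (\<eta> (x - y))) \<in> Cc_infty S) \<and>
    (\<forall>x y. laplacian (\<lambda>y. complex_of_real (\<eta> (x - y))) y = complex_of_real (\<Sum>j\<in>UNIV. D2\<eta> j (x - y)))"

lemma mollifier_exists:
  assumes "\<epsilon> > 0"
  shows "\<exists>(\<eta> :: real^'n::finite \<Rightarrow> real) D\<eta> D2\<eta>. mollifier \<epsilon> \<eta> D\<eta> D2\<eta>"
proof -
  \<comment> \<open>The Euclidean norm is at most the sum of the moduli of the coordinates, so the
    cube of half-width \<delta> lies in the ball of radius \<epsilon>.\<close>
  define \<delta> where "\<delta> = \<epsilon> / CARD('n)"
  have \<delta>: "\<delta> > 0" unfolding \<delta>_def using assms by simp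
  obtain b b' b'' where sm: "smooth1 b" "smooth1 b'" "smooth1 b''"
    and d1: "\<And>x. (b has_real_derivative b' x) (at x)" and d2: "\<And>x. (b' has_real_derivative b'' x) (at x)"
    and z: "\<And>t. \<bar>t\<bar> > \<delta> \<Longrightarrow> b t = 0 \<and> b' t = 0 \<and> b'' t = (0::real)" and nn: "\<And>t. b t \<ge> 0" and p: "b 0 > 0"
    using smooth_bump[OF \<delta>] by metis
  have big: "\<exists>j. \<bar>x $ j\<bar> > \<delta>" if "norm x > \<epsilon>" for x :: "real^'n"
  proof (rule ccontr)
    assume "\<not> ?thesis"
    then have "(\<Sum>j\<in>UNIV. \<bar>x $ j\<bar>) \<le> (\<Sum>j\<in>(UNIV::'n set). \<delta>)" by (intro sum_mono) (simp add: not_less)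
    also have "\<dots> = \<epsilon>" by (simp add: \<delta>_def)
    finally show False using norm_le_l1_cart[of x] that by linarith
  qed
  have pz: "prod_fun c g x = 0" if "norm x > \<epsilon>" "\<And>j t. \<bar>t\<bar> > \<delta> \<Longrightarrow> g j t = 0" for c g and x :: "real^'n"
    using big[OF that(1)] that(2) unfolding prod_fun_def by (metis (mono_tags, lifting) finite mult_zero_right prod_zero UNIV_I)
  have cont: "continuous_on UNIV (prod_fun c g)" if "\<And>j. smooth1 (g j)" for c and g :: "'n \<Rightarrow> real \<Rightarrow> real"
  proof -
    have "continuous_on UNIV (g j)" for j
      using smooth1_deriv[OF that[of j]] by (metis DERIV_isCont continuous_at_imp_continuous_on)
    then have "continuous_on UNIV (\<lambda>x. g j (x $ j))" for j
      by (rule continuous_on_compose2) (auto intro: continuous_intros)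
    then show ?thesis unfolding prod_fun_def by (intro continuous_intros)
  qed
  define B where "B = prod_fun 1 (\<lambda>j::'n. b)"
  have Bc: "continuous_on UNIV B" unfolding B_def by (intro cont sm)
  have Bz: "B x = 0" if "norm x > \<epsilon>" for x unfolding B_def using that z by (intro pz) auto
  have "integrable lborel (\<lambda>y. (1::real) *\<^sub>R B (0 - y))"
    by (rule conv_integrable[OF _ Bc Bz])
      (auto simp: loc_integrable_def intro!: integrable_real_indicator emeasure_compact_finite[OF compact_cball])
  then have "integrable (distr lborel borel (\<lambda>y. 0 - y)) B"
    using Bc by (subst integrable_distr_eq) (auto intro: borel_measurable_continuous_onI)
  then have Bi: "integrable lborel B" by (simp only: distr_lborel_reflect)
  define I where "I = (LINT x|lborel. B x)"
  have I: "I > 0" unfolding I_def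
    by (rule integral_pos_of_continuous[OF Bi _ open_UNIV Bc, of 0])
      (use nn p in \<open>auto simp: B_def prod_fun_def intro!: prod_nonneg\<close>)
  define \<eta> where "\<eta> = prod_fun (1 / I) (\<lambda>j::'n. b)"
  define D\<eta> where "D\<eta> i = prod_fun (1 / I) ((\<lambda>j::'n. b)(i := b'))" for i
  define D2\<eta> where "D2\<eta> i = prod_fun (1 / I) ((\<lambda>j::'n. b)(i := b''))" for i
  have "\<eta> = (\<lambda>x. B x / I)" by (auto simp: \<eta>_def B_def prod_fun_def)
  then have "(LINT z|lborel. \<eta> z) = 1" using I by (simp add: I_def)
  moreover have "C2_on UNIV \<eta> D\<eta> D2\<eta>"
  proof -
    have "has_pd i (D\<eta> i) (D2\<eta> i) UNIV" for i
      using has_pd_prod_fun[of "(\<lambda>j::'n. b)(i := b')" i b'' "1 / I" UNIV] d2 by (simp add: D\<eta>_def D2\<eta>_def)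
    moreover have "has_pd i \<eta> (D\<eta> i) UNIV" for i
      unfolding \<eta>_def D\<eta>_def by (rule has_pd_prod_fun) (rule d1)
    moreover have "continuous_on UNIV \<eta>" "continuous_on UNIV (D\<eta> i)" "continuous_on UNIV (D2\<eta> i)" for i
      unfolding \<eta>_def D\<eta>_def D2\<eta>_def by (intro cont; use sm in auto)+
    ultimately show ?thesis by (auto simp: C2_on_def)
  qed
  moreover have "0 \<le> \<eta> x" for x unfolding \<eta>_def prod_fun_def using I nn by (auto intro!: prod_nonneg divide_nonneg_nonneg)
  moreover have \<eta>z: "\<eta> x = 0" "D\<eta> j x = 0" "D2\<eta> j x = 0" if "norm x > \<epsilon>" for x j
    unfolding \<eta>_def D\<eta>_def D2\<eta>_def using that z by (intro pz; auto)+
  moreover have refl: "(\<lambda>y. \<eta> (x - y)) = prod_fun (1 / I) (\<lambda>j t. b (x $ j + (-1) * t))" for x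
    by (auto simp: \<eta>_def prod_fun_def)
  have smr: "smooth1 (\<lambda>t. f (x + (-1) * t))" if "smooth1 f" for f x
    using that Ck1_affine unfolding smooth1_def by blast
  have dr: "((\<lambda>t. f (x + (-1) * t)) has_real_derivative - f' (x + (-1) * t)) (at t)"
    if "\<And>t. (f has_real_derivative f' t) (at t)" for f f' and x t :: real
    by (rule DERIV_chain2[of f _ "\<lambda>t. x + (-1) * t", THEN DERIV_cong]) (use that in \<open>auto intro!: derivative_eq_intros\<close>)
  have "(\<lambda>y. complex_of_real (\<eta> (x - y))) \<in> Cc_infty S" if S: "cball x \<epsilon> \<subseteq> S" for x S
  proof -
    have "{y. complex_of_real (\<eta> (x - y)) \<noteq> 0} \<subseteq> cball x \<epsilon>"
      using \<eta>z(1) by (auto simp: dist_norm not_less[symmetric])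
    then have sub: "tsupport (\<lambda>y. complex_of_real (\<eta> (x - y))) \<subseteq> cball x \<epsilon>"
      unfolding tsupport_def by (rule closure_minimal) simp
    have "compact (tsupport (\<lambda>y. complex_of_real (\<eta> (x - y))))"
      using bounded_subset[OF bounded_cball sub] by (auto simp: compact_eq_bounded_closed tsupport_def)
    moreover have "smooth_fun (\<lambda>y. complex_of_real (\<eta> (x - y)))"
      unfolding smooth_fun_def fun_cong[OF refl] by (intro allI Ck_prod_fun smr sm)
    ultimately show ?thesis using sub S by (auto simp: Cc_infty_def)
  qed
  moreover have "laplacian (\<lambda>y. complex_of_real (\<eta> (x - y))) y = complex_of_real (\<Sum>j\<in>UNIV. D2\<eta> j (x - y))" for x y
  proof -
    let ?g = "\<lambda>j t. b (x $ j + (-1) * t)"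
    have "partial_deriv i (partial_deriv i (\<lambda>y. complex_of_real (\<eta> (x - y)))) y = complex_of_real (D2\<eta> i (x - y))" for i
    proof -
      \<comment> \<open>The reflection changes the sign at each differentiation; after two of them
        the signs cancel.\<close>
      have 1: "partial_deriv i (\<lambda>y. complex_of_real (\<eta> (x - y)))
        = (\<lambda>y. complex_of_real (prod_fun (1 / I) (?g(i := (\<lambda>t. - b' (x $ i + (-1) * t)))) y))"
        unfolding fun_cong[OF refl] by (rule Ck_prod_fun(2)) (use smr[OF sm(1)] dr[OF d1] in auto)
      have "smooth1 (\<lambda>t. (-1) * b' (x $ i + (-1) * t))"
        using smr[OF sm(2)] unfolding smooth1_def by (intro allI Ck1_mult Ck1_const) blast
      then have sm': "smooth1 (\<lambda>t. - b' (x $ i + (-1) * t))" by simp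
      have dd: "((\<lambda>t. - b' (x $ i + (-1) * t)) has_real_derivative b'' (x $ i + (-1) * t)) (at t)" for t
        using DERIV_minus[OF dr[OF d2]] by simp
      have "partial_deriv i (partial_deriv i (\<lambda>y. complex_of_real (\<eta> (x - y))))
        = (\<lambda>y. complex_of_real (prod_fun (1 / I) (?g(i := (\<lambda>t. - b' (x $ i + (-1) * t)), i := (\<lambda>t. b'' (x $ i + (-1) * t)))) y))"
        unfolding 1 by (rule Ck_prod_fun(2)) (use smr[OF sm(1)] sm' dd in auto)
      then show ?thesis unfolding D2\<eta>_def prod_fun_def
        by (auto intro!: prod.cong)
    qed
    then show ?thesis by (simp add: laplacian_def)
  qed
  ultimately have "mollifier \<epsilon> \<eta> D\<eta> D2\<eta>" unfolding mollifier_def by blast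
  then show ?thesis by blast
qed

section \<open>Real square-integrable Borel functions and their mollification\<close>

definition sq_int :: "('a::euclidean_space \<Rightarrow> real) \<Rightarrow> bool" where
  "sq_int f \<longleftrightarrow> f \<in> borel_measurable borel \<and> integrable lborel (\<lambda>x. (f x)\<^sup>2)"

lemma sq_intD: "sq_int f \<Longrightarrow> f \<in> borel_measurable borel" "sq_int f \<Longrightarrow> integrable lborel (\<lambda>x. (f x)\<^sup>2)"
  by (auto simp: sq_int_def)

lemma sq_int_mult: "sq_int f \<Longrightarrow> sq_int g \<Longrightarrow> integrable lborel (\<lambda>x. f x * g x)"
  by (intro square_integrable_mult) (auto simp: sq_int_def)

lemma sq_int_bound:
  assumes "sq_int f" "g \<in> borel_measurable borel" "\<And>x. \<bar>g x\<bar> \<le> c * \<bar>f x\<bar>"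
  shows "sq_int g"
proof -
  note [measurable] = sq_intD(1)[OF assms(1)] assms(2)
  have "(g x)\<^sup>2 \<le> (c * \<bar>f x\<bar>)\<^sup>2" for x
    using power_mono[OF assms(3)[of x] abs_ge_zero, of 2] by simp
  then have le: "(g x)\<^sup>2 \<le> c\<^sup>2 * (f x)\<^sup>2" for x by (simp add: power_mult_distrib)
  have "integrable lborel (\<lambda>x. c\<^sup>2 * (f x)\<^sup>2)" using sq_intD(2)[OF assms(1)] by simp
  then have "integrable lborel (\<lambda>x. (g x)\<^sup>2)"
    by (rule Bochner_Integration.integrable_bound) (use le in auto)
  then show ?thesis using assms(2) by (simp add: sq_int_def)
qed

lemma sq_int_diff: assumes "sq_int f" "sq_int g" shows "sq_int (\<lambda>x. f x - g x)"
proof -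
  note [measurable] = assms[THEN sq_intD(1)]
  have "integrable lborel (\<lambda>x. (f x)\<^sup>2 - 2 * (f x * g x) + (g x)\<^sup>2)"
    using sq_int_mult[OF assms] assms by (intro Bochner_Integration.integrable_add Bochner_Integration.integrable_diff) (auto simp: sq_int_def)
  then show ?thesis by (simp add: sq_int_def power2_diff mult.assoc algebra_simps)
qed

lemma integrable_indicator_cball: "integrable lborel (indicator (cball (0::'a::euclidean_space) \<rho>) :: 'a \<Rightarrow> real)"
  by (rule integrable_real_indicator) (simp add: borel_closed, rule emeasure_compact_finite[OF compact_cball])

lemma sq_int_indicator: "sq_int (indicator (cball 0 \<rho>) :: 'a::euclidean_space \<Rightarrow> real)"
proof -
  have eq: "(\<lambda>x::'a. (indicator (cball 0 \<rho>) x :: real)\<^sup>2) = indicator (cball 0 \<rho>)" by (auto simp: indicator_def)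
  have "(indicator (cball 0 \<rho>) :: 'a \<Rightarrow> real) \<in> borel_measurable borel"
    by (intro borel_measurable_indicator) (simp add: borel_closed)
  then show ?thesis unfolding sq_int_def eq using integrable_indicator_cball by blast
qed

lemma sq_int_continuous:
  fixes f :: "'a::euclidean_space \<Rightarrow> real"
  assumes "continuous_on UNIV f" "\<And>z. norm z > \<epsilon> \<Longrightarrow> f z = 0"
  shows "sq_int f"
proof -
  obtain B where B: "B > 0" "\<And>z. norm (f z) \<le> B" using compact_support_bounded[OF assms] by blast
  have m: "f \<in> borel_measurable borel" using assms(1) by (rule borel_measurable_continuous_onI)
  show ?thesis
  proof (rule sq_int_bound[OF _ m])
    show "sq_int (indicator (cball 0 \<epsilon>) :: 'a \<Rightarrow> real)" by (rule sq_int_indicator)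
    show "\<bar>f x\<bar> \<le> B * \<bar>indicator (cball 0 \<epsilon>) x\<bar>" for x
      using B(2)[of x] assms(2)[of x] by (auto simp: indicator_def not_le)
  qed
qed

lemma sq_int_loc_integrable: "sq_int f \<Longrightarrow> loc_integrable f"
  using sq_int_mult[OF sq_int_indicator] by (auto simp: loc_integrable_def sq_intD(1))

lemma sq_int_abs_mult_le:
  assumes "sq_int f" "sq_int g"
  shows "(LINT x|lborel. \<bar>f x * g x\<bar>) \<le> sqrt (LINT x|lborel. (f x)\<^sup>2) * sqrt (LINT x|lborel. (g x)\<^sup>2)"
  using real_le_rsqrt[OF Cauchy_Schwarz_integral[of f lborel g]] assms by (simp add: sq_int_def real_sqrt_mult)

lemma sq_sum3_le: "(a + b - c)\<^sup>2 \<le> 3 * a\<^sup>2 + 3 * b\<^sup>2 + 3 * (c::real)\<^sup>2"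
proof -
  have "0 \<le> (a - b)\<^sup>2 + (a + c)\<^sup>2 + (b + c)\<^sup>2" by simp
  then show ?thesis by (simp add: power2_eq_square algebra_simps)
qed

text \<open>Truncation in value and in space makes the function bounded with bounded support; being
  measurable it is then an almost-everywhere limit of continuous functions. Dominated convergence
  handles both steps.\<close>

lemma sq_int_dense:
  fixes f :: "'a::euclidean_space \<Rightarrow> real"
  assumes f: "sq_int f" and e: "e > 0"
  shows "\<exists>g \<rho>. continuous_on UNIV g \<and> (\<forall>x. norm x > \<rho> \<longrightarrow> g x = 0) \<and> (LINT x|lborel. (f x - g x)\<^sup>2) < e"
proof -
  note fm [measurable] = sq_intD(1)[OF f]
  have [measurable]: "cball (0::'a) r \<in> sets borel" for r by (simp add: borel_closed)
  define c where "c n y = max (- real n) (min (real n) y)" for n y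
  have cb: "\<bar>c n y\<bar> \<le> n" for n y by (auto simp: c_def)
  have cc: "c n y = y" if "\<bar>y\<bar> \<le> n" for n y using that by (auto simp: c_def)
  have cy: "\<bar>y - c n y\<bar> \<le> \<bar>y\<bar>" for n y by (auto simp: c_def max_def min_def)
  define h where "h n x = indicator (cball 0 (real n)) x * c n (f x)" for n x
  have hm [measurable]: "h n \<in> borel_measurable borel" for n unfolding h_def c_def by measurable
  have "(\<lambda>n. LINT x|lborel. (f x - h n x)\<^sup>2) \<longlonglongrightarrow> (LINT x|(lborel::'a measure). 0)"
  proof (rule integral_dominated_convergence)
    show "integrable lborel (\<lambda>x. (f x)\<^sup>2)" by (rule sq_intD(2)[OF f])
    have "\<bar>f x - h n x\<bar> \<le> \<bar>f x\<bar>" for n x unfolding h_def using cy[of "f x" n] by (auto simp: indicator_def)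
    then show "AE x in lborel. norm ((f x - h n x)\<^sup>2) \<le> (f x)\<^sup>2" for n by (simp add: abs_le_square_iff)
    have "(\<lambda>n. (f x - h n x)\<^sup>2) \<longlonglongrightarrow> 0" for x
    proof (rule tendsto_eventually, rule eventually_sequentiallyI)
      fix n assume "nat \<lceil>norm x + \<bar>f x\<bar>\<rceil> \<le> n"
      then have "norm x + \<bar>f x\<bar> \<le> real n" by linarith
      then have "norm x \<le> n" "\<bar>f x\<bar> \<le> n" using norm_ge_zero[of x] abs_ge_zero[of "f x"] by linarith+
      then show "(f x - h n x)\<^sup>2 = 0" by (simp add: h_def cc)
    qed
    then show "AE x in lborel. (\<lambda>n. (f x - h n x)\<^sup>2) \<longlonglongrightarrow> 0" by simp
  qed measurable
  then have "\<forall>\<^sub>F n in sequentially. (LINT x|lborel. (f x - h n x)\<^sup>2) < e / 4"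
    using e by (intro order_tendstoD) auto
  then obtain n where n: "(LINT x|lborel. (f x - h n x)\<^sup>2) < e / 4" by (auto simp: eventually_sequentially)
  have "h n measurable_on UNIV"
    using measurable_on_iff_borel_measurable[of UNIV "h n"] hm[of n] by (simp add: measurable_completion lebesgue_on_UNIV_eq)
  then obtain N G where N: "negligible N" and G: "\<And>k. continuous_on UNIV (G k)"
    and lim: "\<And>x. x \<notin> N \<Longrightarrow> (\<lambda>k. G k x) \<longlonglongrightarrow> h n x"
    unfolding measurable_on_def by auto
  \<comment> \<open>The \<open>G k\<close> come without a bound and without a support condition.
    Clamping by \<open>c n\<close> and multiplying by \<open>w\<close>, which is 1 on the ball of
    radius \<open>n\<close>, supplies both and keeps the limit \<open>h n\<close>.\<close>
  define w where "w x = max 0 (min 1 (real n + 1 - norm x))" for x :: 'a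
  define g where "g k x = c n (G k x) * w x" for k x
  have gc: "continuous_on UNIV (g k)" for k
    unfolding g_def c_def w_def by (intro continuous_intros G)
  have g0: "g k x = 0" if "norm x > real n + 1" for k x using that by (simp add: g_def w_def)
  have w1: "0 \<le> w x" "w x \<le> 1" for x by (auto simp: w_def)
  have gb: "\<bar>g k x\<bar> \<le> n" for k x
    using mult_mono[OF cb[of n "G k x"] w1(2)[of x]] w1(1)[of x] by (auto simp: g_def abs_mult)
  have hb: "\<bar>h n x\<bar> \<le> n" for x using cb[of n "f x"] by (auto simp: h_def indicator_def)
  have [measurable]: "g k \<in> borel_measurable borel" for k using gc by (rule borel_measurable_continuous_onI)
  have "(\<lambda>k. LINT x|lborel. (h n x - g k x)\<^sup>2) \<longlonglongrightarrow> (LINT x|(lborel::'a measure). 0)"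
  proof (rule integral_dominated_convergence)
    show "integrable lborel (\<lambda>x::'a. (2 * real n)\<^sup>2 * indicator (cball 0 (real n + 1)) x)"
      by (simp add: integrable_indicator_cball)
    show "AE x in lborel. norm ((h n x - g k x)\<^sup>2) \<le> (2 * real n)\<^sup>2 * indicator (cball 0 (real n + 1)) x" for k
    proof (intro always_eventually allI)
      fix x
      show "norm ((h n x - g k x)\<^sup>2) \<le> (2 * real n)\<^sup>2 * indicator (cball 0 (real n + 1)) x"
      proof (cases "norm x \<le> real n + 1")
        case True
        have "\<bar>h n x - g k x\<bar> \<le> 2 * real n" using hb[of x] gb[of k x] by linarith
        from power_mono[OF this, of 2] have "(h n x - g k x)\<^sup>2 \<le> (2 * real n)\<^sup>2" by simp
        then show ?thesis using True by simp
      next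
        case False
        then show ?thesis using g0[of x k] by (simp add: h_def)
      qed
    qed
    have "(\<lambda>k. (h n x - g k x)\<^sup>2) \<longlonglongrightarrow> 0" if "x \<notin> N" for x
    proof -
      have "(\<lambda>k. g k x) \<longlonglongrightarrow> c n (h n x) * w x"
        unfolding g_def c_def by (intro tendsto_intros lim that)
      also have "c n (h n x) * w x = h n x" using cc[OF hb[of x]] by (auto simp: h_def w_def indicator_def)
      finally have "(\<lambda>k. (h n x - g k x)\<^sup>2) \<longlonglongrightarrow> (h n x - h n x)\<^sup>2" by (intro tendsto_intros)
      then show ?thesis by simp
    qed
    moreover have "AE x in lborel. x \<notin> N"
    proof -
      have "AE x in lebesgue. x \<notin> N" using N by (simp add: negligible_iff_null_sets AE_not_in)
      then show ?thesis by (simp add: AE_completion_iff)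
    qed
    ultimately show "AE x in lborel. (\<lambda>k. (h n x - g k x)\<^sup>2) \<longlonglongrightarrow> 0" by (auto elim: eventually_mono)
  qed measurable
  then have "\<forall>\<^sub>F k in sequentially. (LINT x|lborel. (h n x - g k x)\<^sup>2) < e / 4"
    using e by (intro order_tendstoD) auto
  then obtain k where k: "(LINT x|lborel. (h n x - g k x)\<^sup>2) < e / 4" by (auto simp: eventually_sequentially)
  have "sq_int (h n)"
  proof (rule sq_int_bound[OF f hm])
    show "\<bar>h n x\<bar> \<le> 1 * \<bar>f x\<bar>" for x by (auto simp: h_def c_def indicator_def max_def min_def)
  qed
  have gs: "sq_int (g k)" by (rule sq_int_continuous[OF gc g0])
  note s = sq_int_diff[OF f \<open>sq_int (h n)\<close>, THEN sq_intD(2)] sq_int_diff[OF \<open>sq_int (h n)\<close> gs, THEN sq_intD(2)]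
  have "(LINT x|lborel. (f x - g k x)\<^sup>2) \<le> (LINT x|lborel. 2 * (f x - h n x)\<^sup>2 + 2 * (h n x - g k x)\<^sup>2)"
  proof (rule integral_mono)
    show "(f x - g k x)\<^sup>2 \<le> 2 * (f x - h n x)\<^sup>2 + 2 * (h n x - g k x)\<^sup>2" for x
      using zero_le_power2[of "(f x - h n x) - (h n x - g k x)"] by (simp add: power2_eq_square algebra_simps)
  qed (use s sq_int_diff[OF f gs, THEN sq_intD(2)] in auto)
  also have "\<dots> < e" using n k s by simp
  finally show ?thesis using gc g0 by blast
qed

definition unit_kernel :: "real \<Rightarrow> ('a::euclidean_space \<Rightarrow> real) \<Rightarrow> bool" where
  "unit_kernel \<epsilon> \<eta> \<longleftrightarrow> continuous_on UNIV \<eta> \<and> (\<forall>z. 0 \<le> \<eta> z) \<and> (LINT z|lborel. \<eta> z) = 1 \<and> (\<forall>z. norm z > \<epsilon> \<longrightarrow> \<eta> z = 0)"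

lemma mollifier_unit_kernel: "mollifier \<epsilon> \<eta> D D2 \<Longrightarrow> unit_kernel \<epsilon> \<eta>"
  by (auto simp: mollifier_def unit_kernel_def C2_on_def)

lemma distr_lborel_shift: "distr lborel borel (\<lambda>x. x - y) = (lborel :: 'a::euclidean_space measure)"
  using lborel_affine[of "1::real" "- y"] by (simp add: density_1)

lemma unit_kernelD:
  assumes "unit_kernel \<epsilon> \<eta>"
  shows "continuous_on UNIV \<eta>" "0 \<le> \<eta> z" "norm z > \<epsilon> \<Longrightarrow> \<eta> z = 0" "integrable lborel \<eta>"
    "(LINT y|lborel. \<eta> (x - y)) = 1" "integrable lborel (\<lambda>y. \<eta> (x - y))" "(\<integral>\<^sup>+x. ennreal (\<eta> (x - y)) \<partial>lborel) = 1"
proof -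
  show c: "continuous_on UNIV \<eta>" and "0 \<le> \<eta> z" "norm z > \<epsilon> \<Longrightarrow> \<eta> z = 0" using assms by (auto simp: unit_kernel_def)
  have [measurable]: "\<eta> \<in> borel_measurable borel" using c by (rule borel_measurable_continuous_onI)
  have one: "(LINT z|lborel. \<eta> z) = 1" using assms by (simp add: unit_kernel_def)
  then show i: "integrable lborel \<eta>" using not_integrable_integral_eq by fastforce
  show "(LINT y|lborel. \<eta> (x - y)) = 1" using integral_reflect[of \<eta> x] one by simp
  have "integrable (distr lborel borel (\<lambda>y. x - y)) \<eta>" using i by (simp only: distr_lborel_reflect)
  then show "integrable lborel (\<lambda>y. \<eta> (x - y))" by (subst (asm) integrable_distr_eq) auto
  have "(\<integral>\<^sup>+x. ennreal (\<eta> (x - y)) \<partial>lborel) = (\<integral>\<^sup>+x. ennreal (\<eta> x) \<partial>distr lborel borel (\<lambda>x. x - y))"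
    by (subst nn_integral_distr) auto
  also have "\<dots> = 1" unfolding distr_lborel_shift
    using assms one by (subst nn_integral_eq_integral[OF i]) (auto simp: unit_kernel_def)
  finally show "(\<integral>\<^sup>+x. ennreal (\<eta> (x - y)) \<partial>lborel) = 1" .
qed

text \<open>Young's inequality with an L^1 kernel of mass 1: splitting \<eta> into two square roots,
  Cauchy-Schwarz bounds the square of the average by the average of the square, and integrating over
  \<open>x\<close> with the order of integration exchanged restores the L^2 norm.\<close>

lemma conv_sq_int:
  fixes h :: "'a::euclidean_space \<Rightarrow> real"
  assumes h: "sq_int h" and \<eta>: "unit_kernel \<epsilon> \<eta>"
  shows "sq_int (conv h \<eta>)" "(LINT x|lborel. (conv h \<eta> x)\<^sup>2) \<le> (LINT x|lborel. (h x)\<^sup>2)"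
proof -
  note k = unit_kernelD[OF \<eta>]
  note hm [measurable] = sq_intD(1)[OF h]
  have \<eta>m [measurable]: "\<eta> \<in> borel_measurable borel" using k(1) by (rule borel_measurable_continuous_onI)
  have cm [measurable]: "conv h \<eta> \<in> borel_measurable borel"
    by (rule borel_measurable_continuous_onI[OF continuous_conv[OF sq_int_loc_integrable[OF h] k(1,3)]])
  have li: "loc_integrable (\<lambda>y. (h y)\<^sup>2)"
    unfolding loc_integrable_def
  proof (intro conjI allI)
    fix \<rho> show "integrable lborel (\<lambda>y. indicator (cball 0 \<rho>) y * (h y)\<^sup>2)"
      by (rule Bochner_Integration.integrable_bound[OF sq_intD(2)[OF h]]) (auto simp: indicator_def)
  qed measurable
  have i2: "integrable lborel (\<lambda>y. (h y)\<^sup>2 * \<eta> (x - y))" for x using conv_integrable[OF li k(1,3)] by simp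
  have pt: "(conv h \<eta> x)\<^sup>2 \<le> (LINT y|lborel. (h y)\<^sup>2 * \<eta> (x - y))" for x
  proof -
    let ?f = "\<lambda>y. h y * sqrt (\<eta> (x - y))" and ?g = "\<lambda>y. sqrt (\<eta> (x - y))"
    have f2: "(\<lambda>y. (?f y)\<^sup>2) = (\<lambda>y. (h y)\<^sup>2 * \<eta> (x - y))" and g2: "(\<lambda>y. (?g y)\<^sup>2) = (\<lambda>y. \<eta> (x - y))"
      using k(2) by (auto simp: power_mult_distrib)
    have "(LINT y|lborel. \<bar>?f y * ?g y\<bar>)\<^sup>2 \<le> (LINT y|lborel. (?f y)\<^sup>2) * (LINT y|lborel. (?g y)\<^sup>2)"
      by (rule Cauchy_Schwarz_integral) (unfold f2 g2, auto intro: i2 k)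
    moreover have "\<bar>conv h \<eta> x\<bar> \<le> (LINT y|lborel. \<bar>?f y * ?g y\<bar>)"
    proof -
      have "\<bar>conv h \<eta> x\<bar> \<le> (LINT y|lborel. \<bar>h y * \<eta> (x - y)\<bar>)"
        unfolding conv_def using integral_norm_bound[of lborel "\<lambda>y. h y * \<eta> (x - y)"] by simp
      also have "(\<lambda>y. \<bar>h y * \<eta> (x - y)\<bar>) = (\<lambda>y. \<bar>?f y * ?g y\<bar>)"
        using k(2) by (auto simp: abs_mult mult.assoc)
      finally show ?thesis .
    qed
    ultimately show ?thesis unfolding f2 g2 k(5)
      using power_mono[of "\<bar>conv h \<eta> x\<bar>" _ 2] by fastforce
  qed
  have "(\<integral>\<^sup>+x. ennreal ((conv h \<eta> x)\<^sup>2) \<partial>lborel) \<le> (\<integral>\<^sup>+x. \<integral>\<^sup>+y. ennreal ((h y)\<^sup>2 * \<eta> (x - y)) \<partial>lborel \<partial>lborel)"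
  proof (rule nn_integral_mono)
    fix x
    have "ennreal ((conv h \<eta> x)\<^sup>2) \<le> ennreal (LINT y|lborel. (h y)\<^sup>2 * \<eta> (x - y))" by (rule ennreal_leI[OF pt])
    also have "\<dots> = (\<integral>\<^sup>+y. ennreal ((h y)\<^sup>2 * \<eta> (x - y)) \<partial>lborel)"
      by (rule nn_integral_eq_integral[symmetric, OF i2]) (use k(2) in auto)
    finally show "ennreal ((conv h \<eta> x)\<^sup>2) \<le> (\<integral>\<^sup>+y. ennreal ((h y)\<^sup>2 * \<eta> (x - y)) \<partial>lborel)" .
  qed
  also have "\<dots> = (\<integral>\<^sup>+y. \<integral>\<^sup>+x. ennreal ((h y)\<^sup>2 * \<eta> (x - y)) \<partial>lborel \<partial>lborel)"
    by (rule lborel_pair.Fubini'[symmetric]) measurable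
  also have "\<dots> = (\<integral>\<^sup>+y. ennreal ((h y)\<^sup>2) \<partial>lborel)"
  proof (rule nn_integral_cong)
    fix y
    have "(\<integral>\<^sup>+x. ennreal ((h y)\<^sup>2 * \<eta> (x - y)) \<partial>lborel) = ennreal ((h y)\<^sup>2) * (\<integral>\<^sup>+x. ennreal (\<eta> (x - y)) \<partial>lborel)"
      using k(2) by (simp add: ennreal_mult nn_integral_cmult)
    then show "(\<integral>\<^sup>+x. ennreal ((h y)\<^sup>2 * \<eta> (x - y)) \<partial>lborel) = ennreal ((h y)\<^sup>2)" by (simp add: k(7))
  qed
  also have "\<dots> = ennreal (LINT x|lborel. (h x)\<^sup>2)"
    by (rule nn_integral_eq_integral[OF sq_intD(2)[OF h]]) auto
  finally have le: "(\<integral>\<^sup>+x. ennreal ((conv h \<eta> x)\<^sup>2) \<partial>lborel) \<le> ennreal (LINT x|lborel. (h x)\<^sup>2)" .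
  then have i: "integrable lborel (\<lambda>x. (conv h \<eta> x)\<^sup>2)"
    by (intro integrableI_nonneg) (auto intro: le_less_trans)
  then show "sq_int (conv h \<eta>)" by (simp add: sq_int_def)
  show "(LINT x|lborel. (conv h \<eta> x)\<^sup>2) \<le> (LINT x|lborel. (h x)\<^sup>2)"
    using le by (subst (asm) nn_integral_eq_integral[OF i]) auto
qed

lemma conv_diff:
  assumes "loc_integrable f" "loc_integrable g" "continuous_on UNIV K" "\<And>z. norm z > \<epsilon> \<Longrightarrow> K z = 0"
  shows "conv (\<lambda>x. f x - g x) K x = conv f K x - conv g K x"
  unfolding conv_def scaleR_diff_left
  by (rule Bochner_Integration.integral_diff) (rule conv_integrable[OF _ assms(3,4)], use assms in auto)+

text \<open>Uniform continuity treats a continuous approximant, and the contraction property of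
  \<open>conv_sq_int\<close> treats the remainder. The threshold \<open>d\<close> depends on
  \<open>f\<close> and \<open>e\<close> but not on the kernel, so any sequence of mollifiers may be
  inserted.\<close>

lemma conv_approx:
  fixes f :: "'a::euclidean_space \<Rightarrow> real"
  assumes f: "sq_int f" and e: "e > 0"
  shows "\<exists>d>0. \<forall>\<epsilon>\<le>d. \<forall>\<eta>. unit_kernel \<epsilon> \<eta> \<longrightarrow> (LINT x|lborel. (conv f \<eta> x - f x)\<^sup>2) < e"
proof -
  obtain g \<rho> where g: "continuous_on UNIV g" and g0: "\<And>x. norm x > \<rho> \<Longrightarrow> g x = 0"
    and fg: "(LINT x|lborel. (f x - g x)\<^sup>2) < e / 12"
    using sq_int_dense[OF f, of "e / 12"] e by auto
  have gs: "sq_int g" by (rule sq_int_continuous[OF g g0])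
  define h where "h x = f x - g x" for x
  have hs: "sq_int h" unfolding h_def by (rule sq_int_diff[OF f gs])
  \<comment> \<open>Three contributions of at most \<open>e / 4\<close> each: 3 \<tau>^2 m equals
    \<open>e / 4\<close>, and the remainder \<open>h\<close> enters twice with squared norm below
    \<open>e / 12\<close>. The summand 1 keeps \<open>m\<close> positive.\<close>
  define m where "m = measure lborel (cball (0::'a) (\<rho> + 1)) + 1"
  have m: "m > 0" unfolding m_def by (simp add: add_nonneg_pos)
  define \<tau> where "\<tau> = sqrt (e / (12 * m))"
  have \<tau>: "\<tau> > 0" unfolding \<tau>_def using e m by simp
  have "uniformly_continuous_on UNIV g"
  proof -
    have "\<exists>d>0. \<forall>x y. dist x y < d \<longrightarrow> dist (g x) (g y) < r" if "r > 0" for r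
    proof -
      have "uniformly_continuous_on (cball 0 (\<rho> + 1)) g"
        by (intro compact_uniformly_continuous continuous_on_subset[OF g]) auto
      then obtain d where d: "d > 0" "\<And>x y. x \<in> cball 0 (\<rho> + 1) \<Longrightarrow> y \<in> cball 0 (\<rho> + 1) \<Longrightarrow> dist x y < d \<Longrightarrow> dist (g x) (g y) < r"
        unfolding uniformly_continuous_on_def using \<open>r > 0\<close> by (metis dist_commute)
      have "dist (g x) (g y) < r" if "dist x y < min d 1" for x y
      proof (cases "x \<in> cball 0 (\<rho> + 1) \<and> y \<in> cball 0 (\<rho> + 1)")
        case True then show ?thesis using d that by auto
      next
        case False
        have "norm x \<le> norm y + dist x y" "norm y \<le> norm x + dist x y"
          by (simp_all add: dist_norm norm_triangle_sub norm_minus_commute) (metis norm_minus_commute norm_triangle_sub)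
        then have "norm x > \<rho>" "norm y > \<rho>" using False that by auto
        then show ?thesis using g0 \<open>r > 0\<close> by simp
      qed
      then show ?thesis using d(1) by (intro exI[of _ "min d 1"]) auto
    qed
    then show ?thesis unfolding uniformly_continuous_on_def by (metis dist_commute UNIV_I)
  qed
  then obtain d where d: "d > 0" "\<And>x y. dist x y < d \<Longrightarrow> dist (g x) (g y) < \<tau>"
    using \<tau> unfolding uniformly_continuous_on_def by (metis UNIV_I)
  show ?thesis
  proof (intro exI[of _ "min (d / 2) 1"] conjI allI impI)
    show "min (d / 2) 1 > 0" using d by simp
    fix \<epsilon> \<eta> assume \<epsilon>: "\<epsilon> \<le> min (d / 2) 1" and \<eta>: "unit_kernel \<epsilon> (\<eta> :: 'a \<Rightarrow> real)"
    note k = unit_kernelD[OF \<eta>]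
    have cg: "\<bar>conv g \<eta> x - g x\<bar> \<le> \<tau> * indicator (cball 0 (\<rho> + 1)) x" for x
    proof -
      have "conv g \<eta> x - g x = (LINT y|lborel. g y * \<eta> (x - y)) - (LINT y|lborel. g x * \<eta> (x - y))"
        by (simp add: conv_def k(5))
      also have "\<dots> = (LINT y|lborel. (g y - g x) * \<eta> (x - y))"
        using conv_integrable[OF sq_int_loc_integrable[OF gs] k(1,3)] k(6)
        by (subst Bochner_Integration.integral_diff[symmetric]) (auto simp: left_diff_distrib)
      finally have eq: "conv g \<eta> x - g x = (LINT y|lborel. (g y - g x) * \<eta> (x - y))" .
      have "norm ((g y - g x) * \<eta> (x - y)) \<le> \<tau> * indicator (cball 0 (\<rho> + 1)) x * \<eta> (x - y)" for y
      proof (cases "norm (x - y) \<le> \<epsilon>")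
        case True
        then have "dist y x < d" using \<epsilon> d(1) by (simp add: dist_norm norm_minus_commute)
        then have 1: "\<bar>g y - g x\<bar> \<le> \<tau>" using d(2) by (fastforce simp: dist_real_def)
        have 2: "g y - g x = 0" if "x \<notin> cball 0 (\<rho> + 1)"
        proof -
          have "norm x \<le> norm y + norm (x - y)" by (metis norm_triangle_sub)
          then have "norm y > \<rho>" "norm x > \<rho>" using that True \<epsilon> by auto
          then show ?thesis using g0 by simp
        qed
        have "\<bar>g y - g x\<bar> \<le> \<tau> * indicator (cball 0 (\<rho> + 1)) x" using 1 2 by (auto simp: indicator_def)
        then show ?thesis using k(2)[of "x - y"] by (simp add: abs_mult mult_right_mono)
      next
        case False
        then show ?thesis using k(3)[of "x - y"] by simp
      qed
      then have "\<bar>conv g \<eta> x - g x\<bar> \<le> (LINT y|lborel. \<tau> * indicator (cball 0 (\<rho> + 1)) x * \<eta> (x - y))"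
        unfolding eq real_norm_def[symmetric]
        by (intro order_trans[OF integral_norm_bound] integral_mono') (use k(2,6) \<tau> in auto)
      then show ?thesis by (simp add: k(5))
    qed
    have li: "loc_integrable f" "loc_integrable g" by (intro sq_int_loc_integrable f gs)+
    have dec: "conv f \<eta> x - f x = (conv g \<eta> x - g x) + conv h \<eta> x - h x" for x
      unfolding h_def using conv_diff[OF li k(1,3)] by simp
    have "(LINT x|lborel. (conv f \<eta> x - f x)\<^sup>2) \<le> (LINT x|lborel. 3 * (\<tau>\<^sup>2 * indicator (cball (0::'a) (\<rho> + 1)) x) + 3 * (conv h \<eta> x)\<^sup>2 + 3 * (h x)\<^sup>2)"
    proof (rule integral_mono)
      show "integrable lborel (\<lambda>x. (conv f \<eta> x - f x)\<^sup>2)"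
        by (intro sq_intD(2) sq_int_diff conv_sq_int[OF f \<eta>] f)
      show "integrable lborel (\<lambda>x. 3 * (\<tau>\<^sup>2 * indicator (cball (0::'a) (\<rho> + 1)) x) + 3 * (conv h \<eta> x)\<^sup>2 + 3 * (h x)\<^sup>2)"
        using sq_intD(2)[OF hs] sq_intD(2)[OF conv_sq_int(1)[OF hs \<eta>]]
        by (simp add: integrable_indicator_cball)
      fix x
      have "\<bar>conv g \<eta> x - g x\<bar>\<^sup>2 \<le> (\<tau> * indicator (cball 0 (\<rho> + 1)) x)\<^sup>2" by (rule power_mono[OF cg]) simp
      then have "(conv g \<eta> x - g x)\<^sup>2 \<le> \<tau>\<^sup>2 * indicator (cball 0 (\<rho> + 1)) x"
        by (cases "x \<in> cball 0 (\<rho> + 1)") auto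
      then show "(conv f \<eta> x - f x)\<^sup>2 \<le> 3 * (\<tau>\<^sup>2 * indicator (cball (0::'a) (\<rho> + 1)) x) + 3 * (conv h \<eta> x)\<^sup>2 + 3 * (h x)\<^sup>2"
        unfolding dec using sq_sum3_le[of "conv g \<eta> x - g x" "conv h \<eta> x" "h x"] by linarith
    qed
    also have "\<dots> = 3 * (\<tau>\<^sup>2 * measure lborel (cball (0::'a) (\<rho> + 1))) + 3 * (LINT x|lborel. (conv h \<eta> x)\<^sup>2) + 3 * (LINT x|lborel. (h x)\<^sup>2)"
      using sq_intD(2)[OF hs] sq_intD(2)[OF conv_sq_int(1)[OF hs \<eta>]]
      by (simp add: integrable_indicator_cball)
    also have "\<dots> < e"
    proof -
      have "\<tau>\<^sup>2 * measure lborel (cball (0::'a) (\<rho> + 1)) \<le> \<tau>\<^sup>2 * m" unfolding m_def by (intro mult_left_mono) auto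
      also have "\<tau>\<^sup>2 * m = e / 12" unfolding \<tau>_def using e m by simp
      finally show ?thesis using conv_sq_int(2)[OF hs \<eta>] fg e unfolding h_def by linarith
    qed
    finally show "(LINT x|lborel. (conv f \<eta> x - f x)\<^sup>2) < e" .
  qed
qed

lemma conv_tendsto:
  fixes f :: "'a::euclidean_space \<Rightarrow> real"
  assumes f: "sq_int f" and \<epsilon>: "\<epsilon> \<longlonglongrightarrow> 0" and \<eta>: "\<And>n. unit_kernel (\<epsilon> n) (\<eta> n)"
  shows "(\<lambda>n. LINT x|lborel. (conv f (\<eta> n) x - f x)\<^sup>2) \<longlonglongrightarrow> 0"
proof (rule order_tendstoI)
  fix a :: real assume "a < 0"
  then show "\<forall>\<^sub>F n in sequentially. a < (LINT x|lborel. (conv f (\<eta> n) x - f x)\<^sup>2)"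
    by (intro always_eventually allI) (auto intro: less_le_trans)
next
  fix a :: real assume "0 < a"
  then obtain d where d: "d > 0" "\<And>\<epsilon> \<eta>. \<epsilon> \<le> d \<Longrightarrow> unit_kernel \<epsilon> \<eta> \<Longrightarrow> (LINT x|lborel. (conv f \<eta> x - f x)\<^sup>2) < a"
    using conv_approx[OF f] by metis
  have "\<forall>\<^sub>F n in sequentially. \<epsilon> n < d" using order_tendstoD(2)[OF \<epsilon> d(1)] .
  then show "\<forall>\<^sub>F n in sequentially. (LINT x|lborel. (conv f (\<eta> n) x - f x)\<^sup>2) < a"
    by eventually_elim (rule d(2)[OF less_imp_le \<eta>])
qed

subsection \<open>Kato's inequality\<close>

lemma DERIV_Lipschitz:
  fixes f :: "real \<Rightarrow> real"
  assumes "\<And>x. (f has_real_derivative f' x) (at x)" "\<And>x. \<bar>f' x\<bar> \<le> B"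
  shows "\<bar>f a - f c\<bar> \<le> B * \<bar>a - c\<bar>"
  using field_differentiable_bound[of UNIV f f' B a c] assms by (auto simp: has_field_derivative_at_within)

definition reg_abs :: "real \<Rightarrow> real \<Rightarrow> real" where "reg_abs \<delta> s = sqrt (s\<^sup>2 + \<delta>\<^sup>2)"

text \<open>The two Lipschitz constants fix the order of the limits in Kato's inequality: 1 for the
  regularised modulus, but 1/\<delta> for its derivative, so the mollification must be removed while
  \<delta> is still fixed.\<close>

lemma reg_abs:
  assumes \<delta>: "\<delta> > 0"
  shows "reg_abs \<delta> s \<ge> \<delta>" "reg_abs \<delta> s > 0" "reg_abs \<delta> s \<ge> \<bar>s\<bar>" "reg_abs \<delta> s \<le> \<bar>s\<bar> + \<delta>"
    "(reg_abs \<delta> has_real_derivative s / reg_abs \<delta> s) (at s)"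
    "((\<lambda>s. s / reg_abs \<delta> s) has_real_derivative \<delta>\<^sup>2 / (reg_abs \<delta> s) ^ 3) (at s)"
    "\<bar>s / reg_abs \<delta> s\<bar> \<le> 1" "0 \<le> \<delta>\<^sup>2 / (reg_abs \<delta> s) ^ 3"
    "\<bar>reg_abs \<delta> a - reg_abs \<delta> c\<bar> \<le> \<bar>a - c\<bar>" "\<bar>a / reg_abs \<delta> a - c / reg_abs \<delta> c\<bar> \<le> \<bar>a - c\<bar> / \<delta>"
proof -
  show 1: "reg_abs \<delta> s \<ge> \<delta>" for s unfolding reg_abs_def by (rule real_le_rsqrt) simp
  then show p: "reg_abs \<delta> s > 0" for s using \<delta> less_le_trans by blast
  show 2: "reg_abs \<delta> s \<ge> \<bar>s\<bar>" for s unfolding reg_abs_def by (rule real_le_rsqrt) simp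
  show "reg_abs \<delta> s \<le> \<bar>s\<bar> + \<delta>" unfolding reg_abs_def
    by (rule real_le_lsqrt) (use \<delta> in \<open>auto simp: power2_sum\<close>)
  have pos: "s\<^sup>2 + \<delta>\<^sup>2 > 0" for s using \<delta> by (simp add: add_nonneg_pos)
  show d1: "(reg_abs \<delta> has_real_derivative s / reg_abs \<delta> s) (at s)" for s
    unfolding reg_abs_def[abs_def] using pos[of s]
    by (auto intro!: derivative_eq_intros simp: field_simps)
  have sq: "(reg_abs \<delta> s)\<^sup>2 = s\<^sup>2 + \<delta>\<^sup>2" for s unfolding reg_abs_def using pos[of s] by simp
  show d2: "((\<lambda>s. s / reg_abs \<delta> s) has_real_derivative \<delta>\<^sup>2 / (reg_abs \<delta> s) ^ 3) (at s)" for s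
  proof -
    have "((\<lambda>s. s / reg_abs \<delta> s) has_real_derivative (1 * reg_abs \<delta> s - s * (s / reg_abs \<delta> s)) / (reg_abs \<delta> s * reg_abs \<delta> s)) (at s)"
      using p[of s] by (intro DERIV_divide d1 DERIV_ident) auto
    moreover have "(1 * reg_abs \<delta> s - s * (s / reg_abs \<delta> s)) / (reg_abs \<delta> s * reg_abs \<delta> s) = ((reg_abs \<delta> s)\<^sup>2 - s\<^sup>2) / (reg_abs \<delta> s) ^ 3"
      using p[of s] by (simp add: field_simps power2_eq_square power3_eq_cube)
    ultimately show ?thesis using sq[of s] by simp
  qed
  show b1: "\<bar>s / reg_abs \<delta> s\<bar> \<le> 1" for s using 2[of s] p[of s] by (simp add: abs_divide)
  show b2: "0 \<le> \<delta>\<^sup>2 / (reg_abs \<delta> s) ^ 3" for s using p[of s] by simp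
  have "\<delta>\<^sup>2 / (reg_abs \<delta> s) ^ 3 \<le> 1 / \<delta>" for s
  proof -
    have "\<delta> ^ 3 \<le> (reg_abs \<delta> s) ^ 3" using 1 \<delta> by (intro power_mono) auto
    then show ?thesis using \<delta> p[of s] by (simp add: field_simps power2_eq_square power3_eq_cube)
  qed
  then have b3: "\<bar>\<delta>\<^sup>2 / (reg_abs \<delta> s) ^ 3\<bar> \<le> 1 / \<delta>" for s unfolding abs_of_nonneg[OF b2] .
  show "\<bar>reg_abs \<delta> a - reg_abs \<delta> c\<bar> \<le> \<bar>a - c\<bar>" using DERIV_Lipschitz[OF d1 b1] by simp
  show "\<bar>a / reg_abs \<delta> a - c / reg_abs \<delta> c\<bar> \<le> \<bar>a - c\<bar> / \<delta>" using DERIV_Lipschitz[OF d2 b3] by simp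
qed

lemma C2_on_conv:
  assumes v: "loc_integrable v" and \<eta>: "C2_on UNIV \<eta> D\<eta> D2\<eta>"
    and z: "\<And>z. norm z > \<epsilon> \<Longrightarrow> \<eta> z = 0" "\<And>j z. norm z > \<epsilon> \<Longrightarrow> D\<eta> j z = 0" "\<And>j z. norm z > \<epsilon> \<Longrightarrow> D2\<eta> j z = 0"
  shows "C2_on UNIV (conv v \<eta>) (\<lambda>j. conv v (D\<eta> j)) (\<lambda>j. conv v (D2\<eta> j))"
  unfolding C2_on_def
  by (intro conjI allI has_pd_conv[OF v] continuous_conv[OF v])
    (use C2_onD[OF \<eta>] z in blast)+

text \<open>Mollify $v$, use $\Delta \beta(w) \ge \beta'(w) \Delta w$ for the convex regularisation
  $\beta(s) = \sqrt{s^2 + \delta^2}$ of the modulus, and let first the mollification parameter and then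
  $\delta$ tend to zero.\<close>

lemma Kato_inequality:
  fixes v g \<phi> :: "real^'n::finite \<Rightarrow> real"
  assumes v: "sq_int v" and g: "sq_int g"
    and \<phi>: "C2_on UNIV \<phi> D\<phi> D2\<phi>" and pos: "\<And>x. 0 \<le> \<phi> x"
    and C: "compact C" "\<And>x. x \<notin> C \<Longrightarrow> \<phi> x = 0" "\<And>j x. x \<notin> C \<Longrightarrow> D\<phi> j x = 0" "\<And>j x. x \<notin> C \<Longrightarrow> D2\<phi> j x = 0"
    and d: "d > 0"
    and weak: "\<And>\<epsilon> \<eta> D\<eta> D2\<eta> x. \<epsilon> \<le> d \<Longrightarrow> mollifier \<epsilon> \<eta> D\<eta> D2\<eta> \<Longrightarrow> x \<in> C \<Longrightarrow>
      (\<Sum>j\<in>UNIV. conv v (D2\<eta> j) x) = - conv g \<eta> x"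
  shows "integrable lborel (\<lambda>x. \<bar>v x\<bar> * (\<Sum>j\<in>UNIV. D2\<phi> j x) + sgn (v x) * g x * \<phi> x)"
    "0 \<le> (LINT x|lborel. \<bar>v x\<bar> * (\<Sum>j\<in>UNIV. D2\<phi> j x) + sgn (v x) * g x * \<phi> x)"
proof -
  define L where "L x = (\<Sum>j\<in>UNIV. D2\<phi> j x)" for x
  obtain \<rho> where \<rho>: "\<And>x. x \<in> C \<Longrightarrow> norm x \<le> \<rho>" using compact_imp_bounded[OF C(1)] by (auto simp: bounded_iff)
  have Lc: "continuous_on UNIV L" unfolding L_def using C2_onD(5)[OF \<phi>] by (intro continuous_intros)
  have L0: "L x = 0" if "norm x > \<rho>" for x using \<rho>[of x] C(4)[of x] that by (force simp: L_def)
  have \<phi>0: "\<phi> x = 0" if "norm x > \<rho>" for x using \<rho>[of x] C(2)[of x] that by force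
  have Ls: "sq_int L" by (rule sq_int_continuous[OF Lc L0])
  have \<phi>s: "sq_int \<phi>" by (rule sq_int_continuous[OF C2_onD(1)[OF \<phi>] \<phi>0])
  note m [measurable] = sq_intD(1)[OF v] sq_intD(1)[OF g] sq_intD(1)[OF Ls] sq_intD(1)[OF \<phi>s]
  obtain B where B: "B > 0" "\<And>x. norm (\<phi> x) \<le> B"
    using compact_support_bounded[OF C2_onD(1)[OF \<phi>] \<phi>0] by blast
  have g\<phi>: "sq_int (\<lambda>x. g x * \<phi> x)"
  proof (rule sq_int_bound[OF g])
    show "\<bar>g x * \<phi> x\<bar> \<le> B * \<bar>g x\<bar>" for x
      using mult_left_mono[OF B(2)[of x] abs_ge_zero[of "g x"]] by (simp add: abs_mult mult.commute)
  qed measurable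
  have Li: "integrable lborel (\<lambda>x. \<bar>L x\<bar>)"
  proof -
    have "(\<lambda>x. indicator (cball 0 \<rho>) x * L x) = L" using L0 by (auto simp: indicator_def fun_eq_iff not_le)
    then show ?thesis using sq_int_mult[OF sq_int_indicator Ls, of \<rho>] by simp
  qed
  have ivL: "integrable lborel (\<lambda>x. \<bar>v x\<bar> * \<bar>L x\<bar>)" using integrable_abs[OF sq_int_mult[OF v Ls]] by (simp add: abs_mult)
  have ig\<phi>: "integrable lborel (\<lambda>x. \<bar>g x * \<phi> x\<bar>)" using integrable_abs[OF sq_int_mult[OF g \<phi>s]] .
  \<comment> \<open>The integrand of the claim with modulus and sign replaced by their
    regularisations; its arguments allow inserting both the mollified and the original
    functions.\<close>
  define A where "A \<delta> f h x = reg_abs \<delta> (f x) * L x + (f x / reg_abs \<delta> (f x)) * h x * \<phi> x" for \<delta> and f h :: "real^'n \<Rightarrow> real" and x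
  have Ab: "\<bar>A \<delta> f h x\<bar> \<le> \<bar>f x\<bar> * \<bar>L x\<bar> + \<delta> * \<bar>L x\<bar> + \<bar>h x * \<phi> x\<bar>" if "\<delta> > 0" for \<delta> f h x
  proof -
    have "\<bar>A \<delta> f h x\<bar> \<le> reg_abs \<delta> (f x) * \<bar>L x\<bar> + \<bar>f x / reg_abs \<delta> (f x)\<bar> * \<bar>h x * \<phi> x\<bar>"
      unfolding A_def using reg_abs(2)[OF that, of "f x"]
      by (intro order_trans[OF abs_triangle_ineq]) (simp add: abs_mult)
    also have "\<dots> \<le> (\<bar>f x\<bar> + \<delta>) * \<bar>L x\<bar> + 1 * \<bar>h x * \<phi> x\<bar>"
      using reg_abs(4,7)[OF that, of "f x"] by (intro add_mono mult_right_mono) auto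
    finally show ?thesis by (simp add: algebra_simps)
  qed
  have Am: "A \<delta> f h \<in> borel_measurable borel" if [measurable]: "f \<in> borel_measurable borel" "h \<in> borel_measurable borel" for \<delta> f h
    unfolding A_def reg_abs_def by measurable
  have Ai: "integrable lborel (A \<delta> f h)" if "\<delta> > 0" and f: "sq_int f" and h: "sq_int h" for \<delta> f h
  proof (rule Bochner_Integration.integrable_bound)
    show "integrable lborel (\<lambda>x. \<bar>f x\<bar> * \<bar>L x\<bar> + \<delta> * \<bar>L x\<bar> + \<bar>h x * \<phi> x\<bar>)"
      using integrable_abs[OF sq_int_mult[OF f Ls]] integrable_abs[OF sq_int_mult[OF h \<phi>s]] Li
      by (intro Bochner_Integration.integrable_add) (auto simp: abs_mult)
    show "A \<delta> f h \<in> borel_measurable lborel" using Am[OF sq_intD(1)[OF f] sq_intD(1)[OF h]] by simp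
    show "AE x in lborel. norm (A \<delta> f h x) \<le> norm (\<bar>f x\<bar> * \<bar>L x\<bar> + \<delta> * \<bar>L x\<bar> + \<bar>h x * \<phi> x\<bar>)"
      using Ab[OF that(1)] by (intro always_eventually allI) (simp add: order_trans[OF _ abs_ge_self])
  qed
  define \<epsilon> where "\<epsilon> n = d / (real n + 1)" for n
  have \<epsilon>: "\<epsilon> n > 0" "\<epsilon> n \<le> d" for n using d by (auto simp: \<epsilon>_def field_simps)
  have \<epsilon>lim: "\<epsilon> \<longlonglongrightarrow> 0"
    using tendsto_mult_right_zero[OF LIMSEQ_inverse_real_of_nat, of d] by (simp add: \<epsilon>_def[abs_def] divide_inverse add.commute)
  have "\<forall>n. \<exists>\<eta> D\<eta> D2\<eta>. mollifier (\<epsilon> n) (\<eta> :: real^'n \<Rightarrow> real) D\<eta> D2\<eta>" using mollifier_exists \<epsilon>(1) by blast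
  then obtain \<eta> D\<eta> D2\<eta> where mo: "\<And>n. mollifier (\<epsilon> n) (\<eta> n :: real^'n \<Rightarrow> real) (D\<eta> n) (D2\<eta> n)" by metis
  note uk = mollifier_unit_kernel[OF mo]
  define w where "w n = conv v (\<eta> n)" for n
  define gn where "gn n = conv g (\<eta> n)" for n
  have ws: "sq_int (w n)" and gs: "sq_int (gn n)" for n unfolding w_def gn_def by (rule conv_sq_int[OF _ uk]; fact)+
  have wC2: "C2_on UNIV (w n) (\<lambda>j. conv v (D\<eta> n j)) (\<lambda>j. conv v (D2\<eta> n j))" for n
    unfolding w_def using mo[of n]
    by (intro C2_on_conv[OF sq_int_loc_integrable[OF v], where \<epsilon>="\<epsilon> n"]) (auto simp: mollifier_def)
  have main_n: "0 \<le> (LINT x|lborel. A \<delta> (w n) (gn n) x)" if \<delta>: "\<delta> > 0" for \<delta> n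
  proof -
    let ?Dw = "\<lambda>j. conv v (D\<eta> n j)" and ?D2w = "\<lambda>j. conv v (D2\<eta> n j)"
    let ?w = "w n"
    have cont: "continuous_on (?w ` UNIV) (\<lambda>s. \<delta>\<^sup>2 / (reg_abs \<delta> s) ^ 3)"
      using reg_abs(2)[OF \<delta>] unfolding reg_abs_def by (intro continuous_intros) (metis less_irrefl power_eq_0_iff)
    have ch: "C2_on UNIV (\<lambda>x. reg_abs \<delta> (?w x)) (\<lambda>j x. ?w x / reg_abs \<delta> (?w x) * ?Dw j x)
      (\<lambda>j x. \<delta>\<^sup>2 / (reg_abs \<delta> (?w x)) ^ 3 * (?Dw j x)\<^sup>2 + ?w x / reg_abs \<delta> (?w x) * ?D2w j x)"
      by (rule C2_on_chain[OF wC2 reg_abs(5)[OF \<delta>] reg_abs(6)[OF \<delta>] cont])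
    let ?S = "\<lambda>x. \<Sum>j\<in>UNIV. \<delta>\<^sup>2 / (reg_abs \<delta> (?w x)) ^ 3 * (?Dw j x)\<^sup>2 + ?w x / reg_abs \<delta> (?w x) * ?D2w j x"
    note G = Green_identity[OF open_UNIV C(1) subset_UNIV \<phi> ch C(2,3,4)]
    have "- A \<delta> ?w (gn n) x \<le> \<phi> x * ?S x - reg_abs \<delta> (?w x) * L x" for x
    proof (cases "x \<in> C")
      case True
      have "?S x = \<delta>\<^sup>2 / (reg_abs \<delta> (?w x)) ^ 3 * (\<Sum>j\<in>UNIV. (?Dw j x)\<^sup>2) + ?w x / reg_abs \<delta> (?w x) * (\<Sum>j\<in>UNIV. ?D2w j x)"
        by (simp add: sum.distrib sum_distrib_left)
      also have "(\<Sum>j\<in>UNIV. ?D2w j x) = - gn n x" unfolding gn_def by (rule weak[OF \<epsilon>(2) mo True])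
      finally have "?S x \<ge> - (?w x / reg_abs \<delta> (?w x) * gn n x)"
        using mult_nonneg_nonneg[OF reg_abs(8)[OF \<delta>, of "?w x"] sum_nonneg[of UNIV "\<lambda>j. (?Dw j x)\<^sup>2"]] by simp
      then have "\<phi> x * ?S x \<ge> \<phi> x * - (?w x / reg_abs \<delta> (?w x) * gn n x)" by (intro mult_left_mono pos)
      then show ?thesis by (simp add: A_def mult_ac)
    next
      case False
      then show ?thesis by (simp add: A_def C)
    qed
    then have "(LINT x|lborel. - A \<delta> ?w (gn n) x) \<le> (LINT x|lborel. \<phi> x * ?S x - reg_abs \<delta> (?w x) * L x)"
      using G(1) Ai[OF \<delta> ws gs] by (intro integral_mono) (auto simp: L_def)
    also have "\<dots> = 0" using G(2) by (simp add: L_def)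
    finally show ?thesis by simp
  qed
  have main_\<delta>: "0 \<le> (LINT x|lborel. A \<delta> v g x)" if \<delta>: "\<delta> > 0" for \<delta>
  proof -
    let ?N = "\<lambda>f::real^'n\<Rightarrow>real. sqrt (LINT x|lborel. (f x)\<^sup>2)"
    have lim: "(\<lambda>n. ?N (\<lambda>x. w n x - v x)) \<longlonglongrightarrow> 0" "(\<lambda>n. ?N (\<lambda>x. gn n x - g x)) \<longlonglongrightarrow> 0"
      using tendsto_real_sqrt[OF conv_tendsto[OF v \<epsilon>lim uk]] tendsto_real_sqrt[OF conv_tendsto[OF g \<epsilon>lim uk]]
      by (simp_all add: w_def gn_def)
    have "(\<lambda>n. LINT x|lborel. A \<delta> (w n) (gn n) x) \<longlonglongrightarrow> (LINT x|lborel. A \<delta> v g x)"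
    proof (rule LIM_zero_cancel, rule Lim_null_comparison)
      let ?R = "\<lambda>n. ?N (\<lambda>x. w n x - v x) * ?N L + ?N (\<lambda>x. gn n x - g x) * ?N \<phi> + 1 / \<delta> * (?N (\<lambda>x. w n x - v x) * ?N (\<lambda>x. g x * \<phi> x))"
      have "(\<lambda>n. ?R n) \<longlonglongrightarrow> 0 * ?N L + 0 * ?N \<phi> + 1 / \<delta> * (0 * ?N (\<lambda>x. g x * \<phi> x))"
        by (intro tendsto_intros lim)
      then show "(\<lambda>n. ?R n) \<longlonglongrightarrow> 0" by simp
      have "norm ((LINT x|lborel. A \<delta> (w n) (gn n) x) - (LINT x|lborel. A \<delta> v g x)) \<le> ?R n" for n
      proof -
        note wv = sq_int_diff[OF ws[of n] v] and gg = sq_int_diff[OF gs[of n] g]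
        let ?a = "\<lambda>x. \<bar>(w n x - v x) * L x\<bar>" and ?b = "\<lambda>x. \<bar>(gn n x - g x) * \<phi> x\<bar>"
          and ?c = "\<lambda>x. \<bar>(w n x - v x) * (g x * \<phi> x)\<bar>"
        have i: "integrable lborel ?a" "integrable lborel ?b" "integrable lborel ?c"
          by (intro integrable_abs sq_int_mult wv gg Ls \<phi>s g\<phi>)+
        have pt: "norm (A \<delta> (w n) (gn n) x - A \<delta> v g x) \<le> ?a x + ?b x + 1 / \<delta> * ?c x" for x
        proof -
          let ?p = "reg_abs \<delta> (w n x)" and ?q = "reg_abs \<delta> (v x)"
          have eq: "A \<delta> (w n) (gn n) x - A \<delta> v g x = (?p - ?q) * L x + (w n x / ?p) * ((gn n x - g x) * \<phi> x)
             + (w n x / ?p - v x / ?q) * (g x * \<phi> x)"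
            by (simp add: A_def algebra_simps)
          have 1: "\<bar>(?p - ?q) * L x\<bar> \<le> ?a x" unfolding abs_mult
            by (intro mult_right_mono reg_abs(9)[OF \<delta>]) simp
          have 2: "\<bar>(w n x / ?p) * ((gn n x - g x) * \<phi> x)\<bar> \<le> 1 * ?b x" unfolding abs_mult[of "w n x / ?p"]
            by (intro mult_right_mono reg_abs(7)[OF \<delta>]) simp
          have "\<bar>(w n x / ?p - v x / ?q) * (g x * \<phi> x)\<bar> \<le> \<bar>w n x - v x\<bar> / \<delta> * \<bar>g x * \<phi> x\<bar>"
            unfolding abs_mult[of "w n x / ?p - v x / ?q"]
            by (intro mult_right_mono reg_abs(10)[OF \<delta>]) simp
          also have "\<dots> = 1 / \<delta> * ?c x" by (simp add: abs_mult)
          finally have 3: "\<bar>(w n x / ?p - v x / ?q) * (g x * \<phi> x)\<bar> \<le> 1 / \<delta> * ?c x" .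
          have tri: "\<bar>a + b + c\<bar> \<le> a' + b' + c'" if "\<bar>a\<bar> \<le> a'" "\<bar>b\<bar> \<le> 1 * b'" "\<bar>c\<bar> \<le> c'" for a b c a' b' c' :: real
            using that by linarith
          show ?thesis unfolding eq real_norm_def by (rule tri[OF 1 2 3])
        qed
        have "norm ((LINT x|lborel. A \<delta> (w n) (gn n) x) - (LINT x|lborel. A \<delta> v g x)) = norm (LINT x|lborel. A \<delta> (w n) (gn n) x - A \<delta> v g x)"
          using Ai[OF \<delta> ws gs] Ai[OF \<delta> v g] by simp
        also have "\<dots> \<le> (LINT x|lborel. norm (A \<delta> (w n) (gn n) x - A \<delta> v g x))" by (rule integral_norm_bound)
        also have "\<dots> \<le> (LINT x|lborel. ?a x + ?b x + 1 / \<delta> * ?c x)"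
          using Ai[OF \<delta> ws gs] Ai[OF \<delta> v g] i by (intro integral_mono pt) auto
        also have "\<dots> = (LINT x|lborel. ?a x) + (LINT x|lborel. ?b x) + 1 / \<delta> * (LINT x|lborel. ?c x)"
          using i by simp
        also have "\<dots> \<le> ?R n"
          using \<delta> by (intro add_mono mult_left_mono sq_int_abs_mult_le wv gg Ls \<phi>s g\<phi>) auto
        finally show ?thesis .
      qed
      then show "\<forall>\<^sub>F n in sequentially. norm ((LINT x|lborel. A \<delta> (w n) (gn n) x) - (LINT x|lborel. A \<delta> v g x)) \<le> ?R n"
        by simp
    qed
    then show ?thesis by (rule LIMSEQ_le_const) (use main_n[OF \<delta>] in blast)
  qed
  define \<Delta> where "\<Delta> m = 1 / (real m + 1)" for m
  have \<Delta>: "\<Delta> m > 0" "\<Delta> m \<le> 1" for m by (auto simp: \<Delta>_def)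
  have \<Delta>lim: "\<Delta> \<longlonglongrightarrow> 0" using LIMSEQ_inverse_real_of_nat by (simp add: \<Delta>_def[abs_def] inverse_eq_divide add.commute)
  let ?F = "\<lambda>x. \<bar>v x\<bar> * L x + sgn (v x) * g x * \<phi> x"
  have lim: "AE x in lborel. (\<lambda>m. A (\<Delta> m) v g x) \<longlonglongrightarrow> ?F x"
  proof (intro always_eventually allI)
    fix x
    have "(\<lambda>m. reg_abs (\<Delta> m) (v x)) \<longlonglongrightarrow> sqrt ((v x)\<^sup>2 + 0\<^sup>2)"
      unfolding reg_abs_def by (intro tendsto_intros \<Delta>lim)
    then have l1: "(\<lambda>m. reg_abs (\<Delta> m) (v x)) \<longlonglongrightarrow> \<bar>v x\<bar>" by simp
    \<comment> \<open>Where \<open>v\<close> vanishes the quotients are all 0, in accordance with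
      \<open>sgn 0 = 0\<close>.\<close>
    have l2: "(\<lambda>m. v x / reg_abs (\<Delta> m) (v x)) \<longlonglongrightarrow> sgn (v x)"
    proof (cases "v x = 0")
      case False
      then have "(\<lambda>m. v x / reg_abs (\<Delta> m) (v x)) \<longlonglongrightarrow> v x / \<bar>v x\<bar>" by (intro tendsto_intros l1) auto
      then show ?thesis by (simp add: sgn_div_norm divide_inverse mult.commute)
    qed simp
    show "(\<lambda>m. A (\<Delta> m) v g x) \<longlonglongrightarrow> ?F x" unfolding A_def by (intro tendsto_intros l1 l2)
  qed
  have dom: "AE x in lborel. norm (A (\<Delta> m) v g x) \<le> \<bar>v x\<bar> * \<bar>L x\<bar> + \<bar>L x\<bar> + \<bar>g x * \<phi> x\<bar>" for m
  proof (intro always_eventually allI)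
    fix x
    have "\<Delta> m * \<bar>L x\<bar> \<le> 1 * \<bar>L x\<bar>" by (intro mult_right_mono \<Delta>) simp
    then show "norm (A (\<Delta> m) v g x) \<le> \<bar>v x\<bar> * \<bar>L x\<bar> + \<bar>L x\<bar> + \<bar>g x * \<phi> x\<bar>"
      using Ab[OF \<Delta>(1)[of m], of v g x] by simp
  qed
  have domi: "integrable lborel (\<lambda>x. \<bar>v x\<bar> * \<bar>L x\<bar> + \<bar>L x\<bar> + \<bar>g x * \<phi> x\<bar>)"
    using ivL Li ig\<phi> by simp
  have Fm: "?F \<in> borel_measurable lborel" by measurable
  have Am': "A (\<Delta> m) v g \<in> borel_measurable lborel" for m using Am[of v g "\<Delta> m"] by simp
  show "integrable lborel (\<lambda>x. \<bar>v x\<bar> * (\<Sum>j\<in>UNIV. D2\<phi> j x) + sgn (v x) * g x * \<phi> x)"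
    using integrable_dominated_convergence[OF Fm Am' domi lim dom] by (simp add: L_def)
  have "(\<lambda>m. LINT x|lborel. A (\<Delta> m) v g x) \<longlonglongrightarrow> (LINT x|lborel. ?F x)"
    by (rule integral_dominated_convergence[OF Fm Am' domi lim dom])
  then have "0 \<le> (LINT x|lborel. ?F x)" by (rule LIMSEQ_le_const) (use main_\<delta>[OF \<Delta>(1)] in blast)
  then show "0 \<le> (LINT x|lborel. \<bar>v x\<bar> * (\<Sum>j\<in>UNIV. D2\<phi> j x) + sgn (v x) * g x * \<phi> x)" by (simp add: L_def)
qed

subsection \<open>Positive supersolutions\<close>

lemma continuous_on_extend_zero:
  assumes S: "open S" "compact C" "C \<subseteq> S" and "continuous_on S G" "\<And>x. x \<notin> C \<Longrightarrow> G x = 0"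
  shows "continuous_on UNIV (G :: 'a::euclidean_space \<Rightarrow> 'b::real_normed_vector)"
proof -
  have oC: "open (- C)" using S(2) by (simp add: compact_imp_closed open_Compl)
  have "continuous_on (- C) G" using assms(5) by (subst continuous_on_cong[of _ "- C" G "\<lambda>x. 0"]) auto
  then have "continuous_on (S \<union> - C) G" by (rule continuous_on_open_Un[OF S(1) oC assms(4)])
  moreover have "S \<union> - C = UNIV" using S(3) by auto
  ultimately show ?thesis by simp
qed

lemma integrable_extend_zero:
  assumes S: "open S" "compact C" "C \<subseteq> S" and "continuous_on S G" "\<And>x. x \<notin> C \<Longrightarrow> G x = 0"
  shows "sq_int G" "integrable lborel (G :: 'a::euclidean_space \<Rightarrow> real)"
proof -
  have c: "continuous_on UNIV G" by (rule continuous_on_extend_zero[OF assms])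
  obtain \<rho> where \<rho>: "\<And>x. norm x > \<rho> \<Longrightarrow> x \<notin> C"
    using compact_imp_bounded[OF S(2)] by (auto simp: bounded_iff) (meson not_le)
  show s: "sq_int G" by (rule sq_int_continuous[OF c]) (use \<rho> assms(5) in blast)
  have "(\<lambda>x. indicator (cball 0 \<rho>) x * G x) = G" using \<rho> assms(5) by (force simp: indicator_def fun_eq_iff not_le)
  then show "integrable lborel G" using sq_int_mult[OF sq_int_indicator s, of \<rho>] by simp
qed

text \<open>This makes the weight times a cutoff a C^2 function on the whole space although the
  weight itself is controlled only off the poles.\<close>

lemma C2_on_extend_zero:
  fixes f :: "real^'n::finite \<Rightarrow> 'b::real_normed_vector"
  assumes S: "open S" "compact C" "C \<subseteq> S" and f: "C2_on S f Df D2f"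
    and 0: "\<And>x. x \<notin> C \<Longrightarrow> f x = 0" "\<And>j x. x \<notin> C \<Longrightarrow> Df j x = 0" "\<And>j x. x \<notin> C \<Longrightarrow> D2f j x = 0"
  shows "C2_on UNIV f Df D2f"
proof -
  have oC: "open (- C)" using S(2) by (simp add: compact_imp_closed open_Compl)
  have U: "S \<union> - C = UNIV" using S by auto
  have pd: "has_pd j G G' UNIV" if "has_pd j G G' S" "\<And>x. x \<notin> C \<Longrightarrow> G x = 0" "\<And>x. x \<notin> C \<Longrightarrow> G' x = 0"
    for j and G G' :: "real^'n \<Rightarrow> 'b"
  proof -
    have "has_pd j G G' (- C)" by (rule has_pd_cong[where f="\<lambda>x. 0" and f'="\<lambda>x. 0", OF has_pd_const oC]) (use that in auto)
    then show ?thesis using that(1) U by (auto simp: has_pd_def)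
  qed
  show ?thesis unfolding C2_on_def
    using C2_onD[OF f] 0 by (auto intro!: pd continuous_on_extend_zero[OF S])
qed

text \<open>With $\Phi = e^L$ this says $-\int u\,\Delta u \ge -\int u^2\, \Delta\Phi/\Phi$; the defect is
  $\int \Phi^2 |\nabla(u/\Phi)|^2$.\<close>

lemma ground_state_inequality:
  fixes u L :: "real^'n::finite \<Rightarrow> real"
  assumes S: "open S" "compact C" "C \<subseteq> S" and L: "C2_on S L DL D2L" and u: "C2_on S u Du D2u"
    and 0: "\<And>x. x \<notin> C \<Longrightarrow> u x = 0" "\<And>j x. x \<notin> C \<Longrightarrow> Du j x = 0" "\<And>j x. x \<notin> C \<Longrightarrow> D2u j x = 0"
  defines "G \<equiv> \<lambda>x. u x * (\<Sum>j\<in>UNIV. D2u j x) - (u x)\<^sup>2 * ((\<Sum>j\<in>UNIV. D2L j x) + (\<Sum>j\<in>UNIV. (DL j x)\<^sup>2))"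
  shows "integrable lborel G" "(LINT x|lborel. G x) \<le> 0"
proof -
  note L = C2_onD[OF L] and u = C2_onD[OF u]
  \<comment> \<open>Derivative of the \<open>j\<close>-th component of the field u grad u - u^2 grad
    L, so its integral vanishes. The divergence of this field exceeds \<open>G\<close> by exactly
    the sum of squares \<open>R\<close>.\<close>
  define F' where "F' j x = (u x * D2u j x + Du j x * Du j x) - ((u x * u x) * D2L j x + (u x * Du j x + Du j x * u x) * DL j x)" for j x
  have pd: "has_pd j (\<lambda>x. u x * Du j x - (u x * u x) * DL j x) (F' j) S" for j
    unfolding F'_def[abs_def] by (intro has_pd_diff has_pd_mult u L)
  have c: "continuous_on S (\<lambda>x. u x * Du j x - (u x * u x) * DL j x)" "continuous_on S (F' j)" for j
    unfolding F'_def[abs_def] by (intro continuous_intros u L)+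
  have I: "integrable lborel (F' j)" "(LINT x|lborel. F' j x) = 0" for j
    by (intro integral_pd_eq_0[OF S c pd]; simp add: 0 F'_def)+
  define R where "R x = (\<Sum>j\<in>UNIV. (Du j x - u x * DL j x)\<^sup>2)" for x
  have R: "integrable lborel R"
    by (rule integrable_extend_zero[OF S]) (auto simp: R_def 0 intro!: continuous_intros u L)
  have eq: "G = (\<lambda>x. (\<Sum>j\<in>UNIV. F' j x) - R x)"
  proof
    fix x
    have "F' j x - (Du j x - u x * DL j x)\<^sup>2 = u x * D2u j x - (u x)\<^sup>2 * (D2L j x + (DL j x)\<^sup>2)" for j
      by (simp add: F'_def power2_eq_square algebra_simps)
    then have "(\<Sum>j\<in>UNIV. F' j x) - R x = (\<Sum>j\<in>UNIV. u x * D2u j x - (u x)\<^sup>2 * (D2L j x + (DL j x)\<^sup>2))"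
      by (simp add: R_def sum_subtractf[symmetric])
    then show "G x = (\<Sum>j\<in>UNIV. F' j x) - R x"
      by (simp add: G_def sum_subtractf sum_distrib_left sum.distrib distrib_left)
  qed
  show "integrable lborel G" unfolding eq using I R by simp
  have "(LINT x|lborel. R x) \<ge> 0" by (rule Bochner_Integration.integral_nonneg_AE) (simp add: R_def sum_nonneg)
  then show "(LINT x|lborel. G x) \<le> 0" unfolding eq using I R
    by (subst Bochner_Integration.integral_diff) (auto simp: Bochner_Integration.integral_sum)
qed

subsection \<open>Twice differentiable cutoff functions\<close>

text \<open>The cube of the positive part is C^2, and piecewise polynomial formulas keep all later
  constants explicit. C^2 suffices here because the cutoffs multiply the weight and the singular
  solutions; test functions come from mollifiers.\<close>

definition pcube :: "real \<Rightarrow> real" where "pcube y = (max 0 y) ^ 3"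
definition pcube' :: "real \<Rightarrow> real" where "pcube' y = 3 * (max 0 y)\<^sup>2"
definition pcube'' :: "real \<Rightarrow> real" where "pcube'' y = 6 * max 0 y"

lemma DERIV_max_power: "((\<lambda>y::real. (max 0 y) ^ Suc (Suc n)) has_real_derivative real (Suc (Suc n)) * (max 0 y) ^ Suc n) (at y)"
proof (cases "y = 0")
  case False
  show ?thesis
  proof (cases "y > 0")
    case True
    have "((\<lambda>y::real. y ^ Suc (Suc n)) has_real_derivative real (Suc (Suc n)) * (max 0 y) ^ Suc n) (at y)"
      using DERIV_pow[of "Suc (Suc n)" y] True by simp
    then show ?thesis
      by (rule has_field_derivative_transform_within_open[of _ _ _ "{0<..}"]) (use True in auto)
  next
    case f: False
    have "((\<lambda>y::real. 0) has_real_derivative real (Suc (Suc n)) * (max 0 y) ^ Suc n) (at y)"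
      using f by auto
    then show ?thesis
      by (rule has_field_derivative_transform_within_open[of _ _ _ "{..<0}"]) (use f False in auto)
  qed
next
  case True
  have "((\<lambda>h::real. (max 0 h) ^ Suc (Suc n) / h) \<longlongrightarrow> 0) (at 0)"
  proof (rule Lim_null_comparison)
    have "\<bar>(max 0 h) ^ Suc (Suc n) / h\<bar> \<le> \<bar>h\<bar> ^ Suc n" if "h \<noteq> 0" for h :: real
    proof (cases "h > 0")
      case True then show ?thesis by (simp add: abs_mult)
    next
      case False
      then have "max 0 h = 0" by simp
      then show ?thesis by (simp del: power_Suc)
    qed
    then show "\<forall>\<^sub>F h in at 0. norm ((max 0 h) ^ Suc (Suc n) / h) \<le> \<bar>h\<bar> ^ Suc n"
      by (simp add: eventually_at_filter)
    have "((\<lambda>h::real. \<bar>h\<bar> ^ Suc n) \<longlongrightarrow> \<bar>0\<bar> ^ Suc n) (at 0)" by (intro tendsto_intros)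
    then show "((\<lambda>h::real. \<bar>h\<bar> ^ Suc n) \<longlongrightarrow> 0) (at 0)" by simp
  qed
  then show ?thesis using True unfolding DERIV_def by simp
qed

lemma DERIV_pcube [derivative_intros]:
  "(pcube has_real_derivative pcube' y) (at y)" "(pcube' has_real_derivative pcube'' y) (at y)"
  using DERIV_max_power[of 1 y] DERIV_cmult[OF DERIV_max_power[of 0 y], of 3]
  by (simp_all add: pcube_def[abs_def] pcube'_def[abs_def] pcube''_def numeral_eq_Suc)

lemma pcube_simps:
  "y \<le> 0 \<Longrightarrow> pcube y = 0" "y \<le> 0 \<Longrightarrow> pcube' y = 0" "y \<le> 0 \<Longrightarrow> pcube'' y = 0"
  "0 \<le> pcube y" "0 \<le> pcube' y" "0 \<le> pcube'' y" "y \<le> z \<Longrightarrow> pcube y \<le> pcube z"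
  "pcube 1 = 1" "y \<ge> 1 \<Longrightarrow> pcube y \<ge> y"
proof -
  show "y \<ge> 1 \<Longrightarrow> pcube y \<ge> y" using self_le_power[of y 3] by (simp add: pcube_def)
qed (auto simp: pcube_def pcube'_def pcube''_def intro: power_mono)

lemma continuous_pcube: "continuous_on S pcube" "continuous_on S pcube'" "continuous_on S pcube''"
  unfolding pcube_def[abs_def] pcube'_def[abs_def] pcube''_def[abs_def] by (intro continuous_intros)+

text \<open>The inner cube glues to the constant 1 at s = 1 and the outer cube glues to 0 at s = 2,
  both twice differentiably.\<close>

definition cutoff :: "real \<Rightarrow> real" where "cutoff s = pcube (1 - pcube (s - 1))"
definition cutoff' :: "real \<Rightarrow> real" where "cutoff' s = - (pcube' (1 - pcube (s - 1)) * pcube' (s - 1))"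
definition cutoff'' :: "real \<Rightarrow> real" where
  "cutoff'' s = pcube'' (1 - pcube (s - 1)) * (pcube' (s - 1))\<^sup>2 - pcube' (1 - pcube (s - 1)) * pcube'' (s - 1)"

lemma DERIV_cut: "(cutoff has_real_derivative cutoff' s) (at s)" "(cutoff' has_real_derivative cutoff'' s) (at s)"
proof -
  have 1: "((\<lambda>s. s - 1) has_real_derivative 1) (at s)" by (auto intro!: derivative_eq_intros)
  have 2: "((\<lambda>s. pcube (s - 1)) has_real_derivative pcube' (s - 1)) (at s)"
    using DERIV_chain2[OF DERIV_pcube(1) 1] by simp
  have 3: "((\<lambda>s. 1 - pcube (s - 1)) has_real_derivative - pcube' (s - 1)) (at s)"
    using DERIV_diff[OF DERIV_const[of 1] 2] by simp
  have 4: "((\<lambda>s. pcube' (s - 1)) has_real_derivative pcube'' (s - 1)) (at s)"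
    using DERIV_chain2[OF DERIV_pcube(2) 1] by simp
  show "(cutoff has_real_derivative cutoff' s) (at s)"
    using DERIV_chain2[OF DERIV_pcube(1) 3] by (simp add: cutoff_def[abs_def] cutoff'_def)
  have "((\<lambda>s. - (pcube' (1 - pcube (s - 1)) * pcube' (s - 1))) has_real_derivative
     - (pcube'' (1 - pcube (s - 1)) * - pcube' (s - 1) * pcube' (s - 1) + pcube'' (s - 1) * pcube' (1 - pcube (s - 1)))) (at s)"
    by (intro DERIV_minus DERIV_mult DERIV_chain2[OF DERIV_pcube(2) 3] 4)
  then show "(cutoff' has_real_derivative cutoff'' s) (at s)"
    by (simp add: cutoff'_def[abs_def] cutoff''_def power2_eq_square mult_ac)
qed

lemma continuous_cut: "continuous_on S cutoff" "continuous_on S cutoff'" "continuous_on S cutoff''"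
proof -
  have c: "continuous_on S (\<lambda>s. pcube (s - 1))" "continuous_on S (\<lambda>s. pcube' (s - 1))" "continuous_on S (\<lambda>s. pcube'' (s - 1))"
    by (rule continuous_on_compose2[OF continuous_pcube(1)[of UNIV]] continuous_on_compose2[OF continuous_pcube(2)[of UNIV]]
        continuous_on_compose2[OF continuous_pcube(3)[of UNIV]]; (intro continuous_intros)?; simp)+
  have d: "continuous_on S (\<lambda>s. pcube (1 - pcube (s - 1)))" "continuous_on S (\<lambda>s. pcube' (1 - pcube (s - 1)))" "continuous_on S (\<lambda>s. pcube'' (1 - pcube (s - 1)))"
    by (rule continuous_on_compose2[OF continuous_pcube(1)[of UNIV]] continuous_on_compose2[OF continuous_pcube(2)[of UNIV]]
        continuous_on_compose2[OF continuous_pcube(3)[of UNIV]]; (intro continuous_intros c)?; simp)+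
  show "continuous_on S cutoff" "continuous_on S cutoff'" "continuous_on S cutoff''"
    unfolding cutoff_def[abs_def] cutoff'_def[abs_def] cutoff''_def[abs_def] by (intro continuous_intros c d)+
qed

lemma cutoff_simps:
  "s \<le> 1 \<Longrightarrow> cutoff s = 1" "s \<le> 1 \<Longrightarrow> cutoff' s = 0" "s \<le> 1 \<Longrightarrow> cutoff'' s = 0"
  "s \<ge> 2 \<Longrightarrow> cutoff s = 0" "s \<ge> 2 \<Longrightarrow> cutoff' s = 0" "s \<ge> 2 \<Longrightarrow> cutoff'' s = 0"
  "0 \<le> cutoff s" "cutoff s \<le> 1" "s \<le> t \<Longrightarrow> cutoff t \<le> cutoff s" "cutoff' s \<le> 0"
proof -
  have g: "1 - pcube (s - 1) \<le> 0" if "s \<ge> 2"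
    using pcube_simps(7)[of 1 "s - 1"] pcube_simps(8) that by simp
  show "s \<ge> 2 \<Longrightarrow> cutoff s = 0" "s \<ge> 2 \<Longrightarrow> cutoff' s = 0" "s \<ge> 2 \<Longrightarrow> cutoff'' s = 0"
    using g by (auto simp: cutoff_def cutoff'_def cutoff''_def pcube_simps)
  show "s \<le> t \<Longrightarrow> cutoff t \<le> cutoff s" unfolding cutoff_def by (intro pcube_simps(7) diff_mono) (auto intro: pcube_simps(7))
  have "cutoff s \<le> pcube 1" unfolding cutoff_def by (rule pcube_simps(7)) (simp add: pcube_simps)
  then show "cutoff s \<le> 1" by (simp add: pcube_simps)
qed (auto simp: cutoff_def cutoff'_def cutoff''_def pcube_simps mult_nonneg_nonneg)

text \<open>A point of strict decrease, which later makes the flux integral strictly positive and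
  not just nonnegative.\<close>

lemma cutoff'_neg: "cutoff' (3 / 2) < 0"
  by (simp add: cutoff'_def pcube'_def pcube_def power2_eq_square power3_eq_cube)

lemma cutoff_bounded: obtains B where "B > 0" "\<And>s. \<bar>cutoff' s\<bar> \<le> B" "\<And>s. \<bar>cutoff'' s\<bar> \<le> B"
proof -
  have bd: "\<exists>B>0. \<forall>s. \<bar>f s\<bar> \<le> B" if fc: "continuous_on UNIV f" and "\<And>s. s \<le> 1 \<Longrightarrow> f s = 0" "\<And>s. s \<ge> 2 \<Longrightarrow> f s = 0" for f :: "real \<Rightarrow> real"
  proof -
    have "f z = 0" if "norm z > 2" for z
      using that \<open>\<And>s. s \<le> 1 \<Longrightarrow> f s = 0\<close> \<open>\<And>s. s \<ge> 2 \<Longrightarrow> f s = 0\<close> by (cases "z \<ge> 2") auto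
    then obtain B where "B > 0" "\<And>z. norm (f z) \<le> B" using compact_support_bounded[OF fc] by metis
    then show ?thesis by auto
  qed
  obtain B1 B2 where "B1 > 0" "\<forall>s. \<bar>cutoff' s\<bar> \<le> B1" "B2 > 0" "\<forall>s. \<bar>cutoff'' s\<bar> \<le> B2"
    using bd[of cutoff'] bd[of cutoff''] continuous_cut cutoff_simps by metis
  then show ?thesis using that[of "max B1 B2"] by (auto simp: le_max_iff_disj)
qed

subsection \<open>Radial profiles of the weight\<close>

text \<open>The variable is the squared distance, so -(\<alpha>/2) ln s is the logarithm of
  |x-a|^(-\<alpha>). Working with the logarithm of the weight turns the product over the poles into
  a sum.\<close>

definition plog :: "real \<Rightarrow> real \<Rightarrow> real \<Rightarrow> real" where
  "plog \<alpha> d s = - (\<alpha> / 2) * (ln s * cutoff (s / d))"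
definition plog' :: "real \<Rightarrow> real \<Rightarrow> real \<Rightarrow> real" where
  "plog' \<alpha> d s = - (\<alpha> / 2) * (cutoff (s / d) / s + ln s * (cutoff' (s / d) / d))"
definition plog'' :: "real \<Rightarrow> real \<Rightarrow> real \<Rightarrow> real" where
  "plog'' \<alpha> d s = - (\<alpha> / 2) * (- cutoff (s / d) / s\<^sup>2 + 2 * (cutoff' (s / d) / d) / s + ln s * (cutoff'' (s / d) / d\<^sup>2))"

lemma DERIV_cut_scaled:
  assumes "d \<noteq> 0"
  shows "((\<lambda>s. cutoff (s / d)) has_real_derivative cutoff' (s / d) / d) (at s)"
    "((\<lambda>s. cutoff' (s / d) / d) has_real_derivative cutoff'' (s / d) / d\<^sup>2) (at s)"
proof -
  have 1: "((\<lambda>s. s / d) has_real_derivative 1 / d) (at s)" using assms by (auto intro!: derivative_eq_intros)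
  show "((\<lambda>s. cutoff (s / d)) has_real_derivative cutoff' (s / d) / d) (at s)"
    using DERIV_chain2[OF DERIV_cut(1) 1] by simp
  show "((\<lambda>s. cutoff' (s / d) / d) has_real_derivative cutoff'' (s / d) / d\<^sup>2) (at s)"
    using DERIV_cdivide[OF DERIV_chain2[OF DERIV_cut(2) 1], of d] by (simp add: power2_eq_square)
qed

lemma continuous_cut_scaled:
  "d \<noteq> 0 \<Longrightarrow> continuous_on S (\<lambda>s. cutoff (s / d))" "d \<noteq> 0 \<Longrightarrow> continuous_on S (\<lambda>s. cutoff' (s / d))" "d \<noteq> 0 \<Longrightarrow> continuous_on S (\<lambda>s. cutoff'' (s / d))"
  by (rule continuous_on_compose2[OF continuous_cut(1)[of UNIV]] continuous_on_compose2[OF continuous_cut(2)[of UNIV]]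
        continuous_on_compose2[OF continuous_cut(3)[of UNIV]]; (intro continuous_intros)?; simp)+

lemma DERIV_plog:
  assumes "d > 0" "s > 0"
  shows "(plog \<alpha> d has_real_derivative plog' \<alpha> d s) (at s)" "(plog' \<alpha> d has_real_derivative plog'' \<alpha> d s) (at s)"
proof -
  note c = DERIV_cut_scaled[of d s]
  have l: "(ln has_real_derivative 1 / s) (at s)" using assms by (auto intro!: derivative_eq_intros)
  have "((\<lambda>s. ln s * cutoff (s / d)) has_real_derivative 1 / s * cutoff (s / d) + cutoff' (s / d) / d * ln s) (at s)"
    using assms by (intro DERIV_mult l c) auto
  from DERIV_cmult[OF this, of "- (\<alpha> / 2)"]
  show "(plog \<alpha> d has_real_derivative plog' \<alpha> d s) (at s)"
    unfolding plog_def[abs_def] plog'_def by (simp add: mult_ac)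
  have "((\<lambda>s. cutoff (s / d) / s) has_real_derivative (cutoff' (s / d) / d * s - cutoff (s / d) * 1) / (s * s)) (at s)"
    using assms by (intro DERIV_divide c DERIV_ident) auto
  moreover have "((\<lambda>s. ln s * (cutoff' (s / d) / d)) has_real_derivative 1 / s * (cutoff' (s / d) / d) + cutoff'' (s / d) / d\<^sup>2 * ln s) (at s)"
    using assms by (intro DERIV_mult l c) auto
  ultimately have "((\<lambda>s. cutoff (s / d) / s + ln s * (cutoff' (s / d) / d)) has_real_derivative
     (cutoff' (s / d) / d * s - cutoff (s / d) * 1) / (s * s) + (1 / s * (cutoff' (s / d) / d) + cutoff'' (s / d) / d\<^sup>2 * ln s)) (at s)"
    by (rule DERIV_add)
  moreover have "(cutoff' (s / d) / d * s - cutoff (s / d) * 1) / (s * s) + (1 / s * (cutoff' (s / d) / d) + cutoff'' (s / d) / d\<^sup>2 * ln s)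
     = - cutoff (s / d) / s\<^sup>2 + 2 * (cutoff' (s / d) / d) / s + ln s * (cutoff'' (s / d) / d\<^sup>2)"
    using assms by (simp add: power2_eq_square diff_divide_distrib)
  ultimately show "(plog' \<alpha> d has_real_derivative plog'' \<alpha> d s) (at s)"
    unfolding plog'_def[abs_def] plog''_def by (intro DERIV_cmult) simp
qed

lemma continuous_plog:
  assumes "d > 0"
  shows "continuous_on {0<..} (plog' \<alpha> d)" "continuous_on {0<..} (plog'' \<alpha> d)"
  unfolding plog'_def[abs_def] plog''_def[abs_def] using assms
  by (intro continuous_intros continuous_cut_scaled; force)+

lemma plog_simps:
  assumes "d > 0"
  shows "s \<ge> 2 * d \<Longrightarrow> plog \<alpha> d s = 0" "s \<ge> 2 * d \<Longrightarrow> plog' \<alpha> d s = 0" "s \<ge> 2 * d \<Longrightarrow> plog'' \<alpha> d s = 0"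
    "s \<le> d \<Longrightarrow> plog \<alpha> d s = - (\<alpha> / 2) * ln s" "s \<le> d \<Longrightarrow> plog' \<alpha> d s = - (\<alpha> / 2) / s" "s \<le> d \<Longrightarrow> plog'' \<alpha> d s = (\<alpha> / 2) / s\<^sup>2"
proof -
  have "s \<ge> 2 * d \<Longrightarrow> s / d \<ge> 2" "s \<le> d \<Longrightarrow> s / d \<le> 1" using assms by (simp_all add: field_simps)
  then show "s \<ge> 2 * d \<Longrightarrow> plog \<alpha> d s = 0" "s \<ge> 2 * d \<Longrightarrow> plog' \<alpha> d s = 0" "s \<ge> 2 * d \<Longrightarrow> plog'' \<alpha> d s = 0"
    "s \<le> d \<Longrightarrow> plog \<alpha> d s = - (\<alpha> / 2) * ln s" "s \<le> d \<Longrightarrow> plog' \<alpha> d s = - (\<alpha> / 2) / s" "s \<le> d \<Longrightarrow> plog'' \<alpha> d s = (\<alpha> / 2) / s\<^sup>2"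
    by (auto simp: plog_def plog'_def plog''_def cutoff_simps)
qed

text \<open>Near a pole $e^L = |x - a|^{-\alpha}$, and $\Delta |x|^{-\alpha} = -\alpha(N-2-\alpha)|x|^{-\alpha-2}$.\<close>

lemma plog_supersolution:
  assumes d: "d > 0"
  shows "\<exists>C. \<forall>s>0. 4 * s * plog'' \<alpha> d s + 2 * N * plog' \<alpha> d s + 4 * s * (plog' \<alpha> d s)\<^sup>2 \<le> - (\<alpha> * (N - 2 - \<alpha>)) / s + C"
proof -
  \<comment> \<open>For a radial L with profile g the first three terms are \<Delta>L + |grad L|^2,
    that is e^(-L) \<Delta> e^L; adding the Hardy term leaves a function to be bounded. It vanishes
    near the pole, is continuous on the transition zone, and beyond it is the Hardy term
    alone.\<close>
  define h where "h s = 4 * s * plog'' \<alpha> d s + 2 * N * plog' \<alpha> d s + 4 * s * (plog' \<alpha> d s)\<^sup>2 + \<alpha> * (N - 2 - \<alpha>) / s" for s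
  have "continuous_on {d..2 * d} h"
    unfolding h_def using d
    by (intro continuous_intros continuous_on_subset[OF continuous_plog(1)[OF d]] continuous_on_subset[OF continuous_plog(2)[OF d]]) auto
  then have "bounded (h ` {d..2 * d})" by (intro compact_imp_bounded compact_continuous_image) auto
  then obtain B where B: "\<forall>s\<in>{d..2 * d}. \<bar>h s\<bar> \<le> B" by (auto simp: bounded_iff)
  have "h s \<le> max 0 (max B (\<bar>\<alpha> * (N - 2 - \<alpha>)\<bar> / (2 * d)))" if s: "s > 0" for s
  proof -
    consider "s \<le> d" | "s \<in> {d..2 * d}" | "s \<ge> 2 * d" by force
    then show ?thesis
    proof cases
      case 1
      \<comment> \<open>The coefficients of 1/s cancel: 2\<alpha> - N\<alpha> + \<alpha>^2 =
        -\<alpha>(N-2-\<alpha>).\<close>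
      have "h s = 0" unfolding h_def plog_simps(5,6)[OF d 1] using s
        by (simp add: field_simps power2_eq_square)
      then show ?thesis by simp
    next
      case 2
      then show ?thesis using bspec[OF B 2] by (auto simp: le_max_iff_disj)
    next
      case 3
      have "h s = \<alpha> * (N - 2 - \<alpha>) / s" unfolding h_def plog_simps(2,3)[OF d 3] by simp
      also have "\<dots> \<le> \<bar>\<alpha> * (N - 2 - \<alpha>)\<bar> / (2 * d)" using s 3 d by (intro frac_le) auto
      finally show ?thesis by (auto simp: le_max_iff_disj)
    qed
  qed
  moreover have "- (\<alpha> * (N - 2 - \<alpha>)) / s = - (\<alpha> * (N - 2 - \<alpha>) / s)" for s by (rule minus_divide_left[symmetric])
  ultimately show ?thesis unfolding h_def
    by (intro exI[of _ "max 0 (max B (\<bar>\<alpha> * (N - 2 - \<alpha>)\<bar> / (2 * d)))"] allI impI) (simp only:, smt (verit))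
qed

text \<open>Logarithm of (1 + \<open>pcube\<close> (s/d - 1))^(-m): the weight equals 1 up to
  squared radius \<open>d\<close> and decays polynomially beyond. The decay is what makes the outer
  cutoff error vanish, as \<open>v\<close> is known only to be square-integrable at
  infinity.\<close>

definition ilog :: "real \<Rightarrow> real \<Rightarrow> real \<Rightarrow> real" where
  "ilog m d s = - m * ln (1 + pcube (s / d - 1))"
definition ilog' :: "real \<Rightarrow> real \<Rightarrow> real \<Rightarrow> real" where
  "ilog' m d s = - m * (pcube' (s / d - 1) / d / (1 + pcube (s / d - 1)))"
definition ilog'' :: "real \<Rightarrow> real \<Rightarrow> real \<Rightarrow> real" where
  "ilog'' m d s = - m * (pcube'' (s / d - 1) / d\<^sup>2 / (1 + pcube (s / d - 1)) - (pcube' (s / d - 1) / d / (1 + pcube (s / d - 1)))\<^sup>2)"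

lemma DERIV_ilog:
  assumes "d > 0"
  shows "(ilog m d has_real_derivative ilog' m d s) (at s)" "(ilog' m d has_real_derivative ilog'' m d s) (at s)"
proof -
  have 1: "((\<lambda>s. s / d - 1) has_real_derivative 1 / d) (at s)" using assms by (auto intro!: derivative_eq_intros)
  let ?P = "\<lambda>s. 1 + pcube (s / d - 1)"
  have p: "?P s > 0" for s using pcube_simps(4)[of "s / d - 1"] by linarith
  have 2: "(?P has_real_derivative pcube' (s / d - 1) / d) (at s)"
    using DERIV_add[OF DERIV_const[of 1] DERIV_chain2[OF DERIV_pcube(1) 1]] by simp
  have 3: "((\<lambda>s. pcube' (s / d - 1) / d) has_real_derivative pcube'' (s / d - 1) / d\<^sup>2) (at s)"
    using DERIV_cdivide[OF DERIV_chain2[OF DERIV_pcube(2) 1], of d] by (simp add: power2_eq_square)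
  have "((\<lambda>s. ln (?P s)) has_real_derivative 1 / ?P s * (pcube' (s / d - 1) / d)) (at s)"
    by (rule DERIV_chain2[OF DERIV_ln_divide[OF p] 2])
  from DERIV_cmult[OF this, of "- m"]
  show "(ilog m d has_real_derivative ilog' m d s) (at s)"
    unfolding ilog_def[abs_def] ilog'_def by (simp add: mult.commute)
  have "((\<lambda>s. pcube' (s / d - 1) / d / ?P s) has_real_derivative
     (pcube'' (s / d - 1) / d\<^sup>2 * ?P s - pcube' (s / d - 1) / d * (pcube' (s / d - 1) / d)) / (?P s * ?P s)) (at s)"
    using p[of s] by (intro DERIV_divide 2 3) auto
  moreover have "(pcube'' (s / d - 1) / d\<^sup>2 * ?P s - pcube' (s / d - 1) / d * (pcube' (s / d - 1) / d)) / (?P s * ?P s)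
    = pcube'' (s / d - 1) / d\<^sup>2 / ?P s - (pcube' (s / d - 1) / d / ?P s)\<^sup>2"
    using p[of s] by (simp add: power2_eq_square diff_divide_distrib mult_ac)
  ultimately show "(ilog' m d has_real_derivative ilog'' m d s) (at s)"
    unfolding ilog'_def[abs_def] ilog''_def by (intro DERIV_cmult) simp
qed

lemma continuous_ilog: "d > 0 \<Longrightarrow> continuous_on S (ilog'' m d)"
proof -
  assume d: "d > 0"
  have c: "continuous_on S (\<lambda>s. pcube (s / d - 1))" "continuous_on S (\<lambda>s. pcube' (s / d - 1))" "continuous_on S (\<lambda>s. pcube'' (s / d - 1))"
    by (rule continuous_on_compose2[OF continuous_pcube(1)[of UNIV]] continuous_on_compose2[OF continuous_pcube(2)[of UNIV]]
        continuous_on_compose2[OF continuous_pcube(3)[of UNIV]]; (intro continuous_intros)?; use d in simp)+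
  have p: "1 + pcube (s / d - 1) \<noteq> 0" for s using pcube_simps(4)[of "s / d - 1"] by linarith
  show ?thesis unfolding ilog''_def[abs_def] using d p by (intro continuous_intros c) auto
qed

lemma ilog_simps:
  assumes "d > 0" "s \<le> d" shows "ilog m d s = 0" "ilog' m d s = 0" "ilog'' m d s = 0"
proof -
  have "s / d - 1 \<le> 0" using assms by simp
  then show "ilog m d s = 0" "ilog' m d s = 0" "ilog'' m d s = 0"
    by (simp_all add: ilog_def ilog'_def ilog''_def pcube_simps)
qed

text \<open>With y the positive part of t, both y and y^2 are at most 1 + y^3. The factor t + 1
  \<le> y + 1 then contributes twice the coefficient: 6 = 2 * 3 and 12 = 2 * 6.\<close>

lemma pcube_ratio_bounds:
  assumes t: "t \<ge> - 1"
  shows "(t + 1) * (pcube' t / (1 + pcube t)) \<le> 6" "pcube' t / (1 + pcube t) \<le> 3" "(t + 1) * (pcube'' t / (1 + pcube t)) \<le> 12"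
proof -
  define y where "y = max 0 t"
  have y: "y \<ge> 0" by (simp add: y_def)
  have p: "1 + y ^ 3 > 0" using y by (simp add: add_pos_nonneg)
  have b: "y\<^sup>2 \<le> 1 + y ^ 3" "y \<le> 1 + y ^ 3"
  proof -
    show "y\<^sup>2 \<le> 1 + y ^ 3"
    proof (cases "y \<le> 1")
      case True then have "y\<^sup>2 \<le> 1" using y by (simp add: power_le_one)
      then show ?thesis using y zero_le_power[OF y, of 3] by linarith
    next
      case False then have "y\<^sup>2 \<le> y ^ 3" by (intro power_increasing) auto
      then show ?thesis by linarith
    qed
    show "y \<le> 1 + y ^ 3"
    proof (cases "y \<le> 1")
      case True then show ?thesis using zero_le_power[OF y, of 3] by linarith
    next
      case False then have "y \<le> y ^ 3" by (intro self_le_power) auto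
      then show ?thesis by linarith
    qed
  qed
  have y3: "y * y\<^sup>2 = y ^ 3" "y * y = y\<^sup>2" by (simp_all add: power2_eq_square power3_eq_cube)
  have t1: "0 \<le> t + 1" "t + 1 \<le> y + 1" using t by (auto simp: y_def)
  have e: "pcube' t = 3 * y\<^sup>2" "pcube'' t = 6 * y" "pcube t = y ^ 3" by (simp_all add: pcube_def pcube'_def pcube''_def y_def)
  have "(t + 1) * (3 * y\<^sup>2) \<le> (y + 1) * (3 * y\<^sup>2)" using t1 by (intro mult_right_mono) auto
  also have "\<dots> \<le> 6 * (1 + y ^ 3)" using b y3 by (simp add: distrib_right)
  finally show "(t + 1) * (pcube' t / (1 + pcube t)) \<le> 6" unfolding e using p by (simp add: pos_divide_le_eq)
  show "pcube' t / (1 + pcube t) \<le> 3" unfolding e using p b by (simp add: pos_divide_le_eq)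
  have "(t + 1) * (6 * y) \<le> (y + 1) * (6 * y)" using t1 y by (intro mult_right_mono) auto
  also have "\<dots> \<le> 12 * (1 + y ^ 3)" using b y3 by (simp add: distrib_right)
  finally show "(t + 1) * (pcube'' t / (1 + pcube t)) \<le> 12" unfolding e using p by (simp add: pos_divide_le_eq)
qed

text \<open>Writing s = d (t + 1) reduces everything to the ratios above. The second derivative is
  bounded from above, which is the direction a supersolution requires; its square term gives 6 * 3 =
  18.\<close>

lemma ilog_bounds:
  assumes d: "d > 0" and m: "m \<ge> 0" and s: "s \<ge> 0"
  shows "\<bar>s * ilog' m d s\<bar> \<le> 6 * m" "\<bar>ilog' m d s\<bar> \<le> 3 * m / d" "s * ilog'' m d s \<le> 18 * m / d"
proof -
  define t where "t = s / d - 1"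
  have t: "t \<ge> - 1" using s d by (simp add: t_def)
  have st: "s = d * (t + 1)" using d by (simp add: t_def)
  define A where "A = pcube' t / (1 + pcube t)"
  define B where "B = pcube'' t / (1 + pcube t)"
  have A0: "A \<ge> 0" unfolding A_def by (intro divide_nonneg_nonneg) (auto simp: pcube_simps)
  have B0: "B \<ge> 0" unfolding B_def by (intro divide_nonneg_nonneg) (auto simp: pcube_simps)
  note b = pcube_ratio_bounds[OF t, folded A_def B_def]
  have e1: "ilog' m d s = - m * (A / d)" unfolding ilog'_def A_def t_def by simp
  have e2: "ilog'' m d s = - m * (B / d\<^sup>2 - (A / d)\<^sup>2)" unfolding ilog''_def A_def B_def t_def by (simp add: mult.commute)
  have sd: "s / d = t + 1" by (simp add: t_def)
  have "s * ilog' m d s = - (m * (s / d * A))" unfolding e1 by simp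
  then have "s * ilog' m d s = - (m * ((t + 1) * A))" unfolding sd .
  moreover have "0 \<le> m * ((t + 1) * A)" using m t A0 by simp
  moreover have "m * ((t + 1) * A) \<le> m * 6" using b m by (intro mult_left_mono) auto
  ultimately show "\<bar>s * ilog' m d s\<bar> \<le> 6 * m" by simp
  have "m * A \<le> m * 3" using b m by (intro mult_left_mono) auto
  then show "\<bar>ilog' m d s\<bar> \<le> 3 * m / d" unfolding e1 using d m A0
    by (simp add: abs_mult divide_right_mono mult.commute)
  have "s * ilog'' m d s = m / d * ((s / d * A) * A - s / d * B)"
    unfolding e2 using d by (simp add: power2_eq_square field_simps)
  also have "\<dots> = m / d * (((t + 1) * A) * A - (t + 1) * B)" unfolding sd ..
  also have "\<dots> \<le> m / d * (6 * 3 - 0)"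
    using b A0 B0 t m d by (intro mult_left_mono diff_mono mult_mono) auto
  finally show "s * ilog'' m d s \<le> 18 * m / d" by (simp add: mult.commute)
qed

lemma ilog_supersolution:
  assumes d: "d > 0" and m: "m \<ge> 0"
  shows "\<exists>C. \<forall>s\<ge>0. 4 * s * ilog'' m d s + 2 * N * ilog' m d s + 4 * s * (ilog' m d s)\<^sup>2 \<le> C"
proof (intro exI allI impI)
  fix s :: real assume s: "s \<ge> 0"
  note b = ilog_bounds[OF d m s]
  have 1: "2 * N * ilog' m d s \<le> 2 * \<bar>N\<bar> * (3 * m / d)"
  proof -
    have "N * ilog' m d s \<le> \<bar>N * ilog' m d s\<bar>" by simp
    also have "\<dots> \<le> \<bar>N\<bar> * (3 * m / d)" unfolding abs_mult by (intro mult_left_mono b) simp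
    finally show ?thesis by simp
  qed
  have "s * (ilog' m d s)\<^sup>2 \<le> \<bar>s * ilog' m d s\<bar> * \<bar>ilog' m d s\<bar>" using s by (simp add: abs_mult power2_eq_square)
  also have "\<dots> \<le> (6 * m) * (3 * m / d)" using b m d by (intro mult_mono) auto
  finally have 2: "s * (ilog' m d s)\<^sup>2 \<le> (6 * m) * (3 * m / d)" .
  show "4 * s * ilog'' m d s + 2 * N * ilog' m d s + 4 * s * (ilog' m d s)\<^sup>2
    \<le> 4 * (18 * m / d) + 2 * \<bar>N\<bar> * (3 * m / d) + 4 * ((6 * m) * (3 * m / d))"
    using 1 2 b(3) by (simp only: mult.assoc)
qed

text \<open>For t \<ge> 1 the lower bound \<open>pcube t\<close> \<ge> t already gives decay like
  s^(-m), and with m = N this beats the growth of the volume.\<close>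

lemma exp_ilog_le:
  fixes m :: nat
  assumes d: "d > 0" and s: "s \<ge> 2 * d"
  shows "exp (ilog (real m) d s) \<le> (2 * d / s) ^ m"
proof -
  define t where "t = s / d - 1"
  have s0: "s > 0" using d s by linarith
  have t: "t \<ge> 1" "t \<ge> s / (2 * d)" using s d by (auto simp: t_def field_simps)
  have "s / (2 * d) \<le> 1 + pcube t" using pcube_simps(9)[OF t(1)] t(2) by linarith
  then have le: "1 / (1 + pcube t) \<le> 2 * d / s" using s0 d
    by (metis (no_types, lifting) divide_pos_pos frac_le inverse_eq_divide inverse_divide le_imp_inverse_le mult_pos_pos zero_less_numeral)
  have p: "1 + pcube t > 0" using pcube_simps(4)[of t] by linarith
  have "exp (ilog (real m) d s) = inverse (exp (real m * ln (1 + pcube t)))"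
    by (simp add: ilog_def t_def exp_minus)
  also have "exp (real m * ln (1 + pcube t)) = (1 + pcube t) ^ m"
    using p by (simp add: exp_of_nat_mult)
  also have "inverse ((1 + pcube t) ^ m) = (1 / (1 + pcube t)) ^ m" by (simp add: inverse_eq_divide power_one_over)
  also have "\<dots> \<le> (2 * d / s) ^ m" using le p by (intro power_mono) auto
  finally show ?thesis .
qed

subsection \<open>The multipolar weight\<close>

text \<open>The profile of a pole lives on squared distance below 2\<delta>^2, inside the ball of
  radius 2\<delta>. Separation by 4\<delta> makes these balls disjoint, and the ball of radius
  \<rho> contains them all, so at each point at most one of the pole profiles and the decay profile
  is active.\<close>

locale poles =
  fixes k :: nat and a :: "nat \<Rightarrow> real^'n::finite" and \<delta> \<rho> :: real
  assumes \<delta>: "\<delta> > 0" and \<rho>: "\<rho> > 0"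
    and sep: "\<And>i i'. i < k \<Longrightarrow> i' < k \<Longrightarrow> i \<noteq> i' \<Longrightarrow> 4 * \<delta> \<le> norm (a i - a i')"
    and inside: "\<And>i. i < k \<Longrightarrow> norm (a i) + 2 * \<delta> \<le> \<rho>"
begin

definition N :: real where "N = real CARD('n)"
definition \<alpha> :: real where "\<alpha> = N / 2 - 2"
definition \<theta> :: real where "\<theta> = \<alpha> * (N - 2 - \<alpha>)"
definition \<Omega> :: "(real^'n) set" where "\<Omega> = UNIV - a ` {..<k}"

abbreviation sq :: "nat \<Rightarrow> real^'n \<Rightarrow> real" where "sq i x \<equiv> (norm (x - a i))\<^sup>2"
abbreviation sq0 :: "real^'n \<Rightarrow> real" where "sq0 x \<equiv> (norm (x - 0))\<^sup>2"

definition L :: "real^'n \<Rightarrow> real" where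
  "L x = (\<Sum>i<k. plog \<alpha> (\<delta>\<^sup>2) (sq i x)) + ilog N (\<rho>\<^sup>2) (sq0 x)"
definition DL :: "'n \<Rightarrow> real^'n \<Rightarrow> real" where
  "DL j x = (\<Sum>i<k. 2 * plog' \<alpha> (\<delta>\<^sup>2) (sq i x) * (x - a i) $ j) + 2 * ilog' N (\<rho>\<^sup>2) (sq0 x) * (x - 0) $ j"
definition D2L :: "'n \<Rightarrow> real^'n \<Rightarrow> real" where
  "D2L j x = (\<Sum>i<k. 4 * plog'' \<alpha> (\<delta>\<^sup>2) (sq i x) * ((x - a i) $ j)\<^sup>2 + 2 * plog' \<alpha> (\<delta>\<^sup>2) (sq i x))
     + (4 * ilog'' N (\<rho>\<^sup>2) (sq0 x) * ((x - 0) $ j)\<^sup>2 + 2 * ilog' N (\<rho>\<^sup>2) (sq0 x))"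
text \<open>For the weight \<Phi> = e^L this is \<Delta>\<Phi> / \<Phi>.\<close>

definition Q :: "real^'n \<Rightarrow> real" where
  "Q x = (\<Sum>j\<in>UNIV. D2L j x) + (\<Sum>j\<in>UNIV. (DL j x)\<^sup>2)"

lemma open_\<Omega>: "open \<Omega>"
  unfolding \<Omega>_def by (intro open_Diff open_UNIV finite_imp_closed) auto

lemma N_pos: "N > 0" by (simp add: N_def)

lemma sq_pos: "x \<in> \<Omega> \<Longrightarrow> i < k \<Longrightarrow> sq i x > 0"
  by (auto simp: \<Omega>_def)

lemma sq_less: "sq i x < 2 * \<delta>\<^sup>2 \<Longrightarrow> norm (x - a i) < 2 * \<delta>"
proof -
  assume "sq i x < 2 * \<delta>\<^sup>2"
  moreover have "0 < \<delta>\<^sup>2" using \<delta> by simp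
  ultimately have "sq i x < 4 * \<delta>\<^sup>2" by linarith
  then have "sq i x < (2 * \<delta>)\<^sup>2" by (simp only: power_mult_distrib) simp
  then show "norm (x - a i) < 2 * \<delta>" by (rule power2_less_imp_less) (use \<delta> in simp)
qed

lemma sq_other:
  assumes "sq i x < 2 * \<delta>\<^sup>2" "i < k" "i' < k" "i' \<noteq> i"
  shows "2 * \<delta>\<^sup>2 \<le> sq i' x"
proof (rule ccontr)
  assume "\<not> ?thesis"
  then have "norm (x - a i') < 2 * \<delta>" by (intro sq_less) simp
  moreover have "norm (x - a i) < 2 * \<delta>" by (rule sq_less[OF assms(1)])
  moreover have "norm (a i - a i') \<le> norm (x - a i') + norm (x - a i)"
    using norm_triangle_ineq4[of "x - a i'" "x - a i"] by simp
  ultimately show False using sep[OF assms(2,3)] assms(4) by auto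
qed

lemma sq0_near:
  assumes "sq i x < 2 * \<delta>\<^sup>2" "i < k"
  shows "sq0 x \<le> \<rho>\<^sup>2"
proof -
  have "norm x \<le> norm (x - a i) + norm (a i)" using norm_triangle_ineq[of "x - a i" "a i"] by simp
  then have "norm x \<le> \<rho>" using sq_less[OF assms(1)] inside[OF assms(2)] by linarith
  then show ?thesis using \<rho> by (simp add: power_mono)
qed

lemma \<delta>2: "\<delta>\<^sup>2 > 0" and \<rho>2: "\<rho>\<^sup>2 > 0" using \<delta> \<rho> by auto

lemma C2_L: "C2_on \<Omega> L DL D2L"
proof -
  have p: "C2_on \<Omega> (\<lambda>x. plog \<alpha> (\<delta>\<^sup>2) (sq i x)) (\<lambda>j x. 2 * plog' \<alpha> (\<delta>\<^sup>2) (sq i x) * (x - a i) $ j)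
     (\<lambda>j x. 4 * plog'' \<alpha> (\<delta>\<^sup>2) (sq i x) * ((x - a i) $ j)\<^sup>2 + 2 * plog' \<alpha> (\<delta>\<^sup>2) (sq i x))" if "i < k" for i
    by (rule C2_on_radial)
      (use sq_pos[OF _ that] in \<open>auto intro!: DERIV_plog \<delta>2 continuous_on_subset[OF continuous_plog(2)[OF \<delta>2]]\<close>)
  have q: "C2_on \<Omega> (\<lambda>x. ilog N (\<rho>\<^sup>2) (sq0 x)) (\<lambda>j x. 2 * ilog' N (\<rho>\<^sup>2) (sq0 x) * (x - 0) $ j)
     (\<lambda>j x. 4 * ilog'' N (\<rho>\<^sup>2) (sq0 x) * ((x - 0) $ j)\<^sup>2 + 2 * ilog' N (\<rho>\<^sup>2) (sq0 x))"
    by (rule C2_on_radial) (intro DERIV_ilog \<rho>2 continuous_ilog)+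
  show ?thesis unfolding L_def[abs_def] DL_def[abs_def] D2L_def[abs_def]
    by (intro C2_on_add C2_on_sum q) (use p in auto)
qed

lemma DL_near:
  assumes "sq i x < 2 * \<delta>\<^sup>2" "i < k"
  shows "DL j x = 2 * plog' \<alpha> (\<delta>\<^sup>2) (sq i x) * (x - a i) $ j" "L x = plog \<alpha> (\<delta>\<^sup>2) (sq i x)"
proof -
  have z: "plog' \<alpha> (\<delta>\<^sup>2) (sq i' x) = 0" "plog \<alpha> (\<delta>\<^sup>2) (sq i' x) = 0" if "i' \<in> {..<k} - {i}" for i'
    using sq_other[OF assms] that plog_simps[OF \<delta>2] by auto
  have y: "ilog' N (\<rho>\<^sup>2) (sq0 x) = 0" "ilog N (\<rho>\<^sup>2) (sq0 x) = 0" using ilog_simps[OF \<rho>2 sq0_near[OF assms]] by auto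
  show "DL j x = 2 * plog' \<alpha> (\<delta>\<^sup>2) (sq i x) * (x - a i) $ j"
    unfolding DL_def y using z assms(2) by (subst sum.remove[of _ i]) auto
  show "L x = plog \<alpha> (\<delta>\<^sup>2) (sq i x)"
    unfolding L_def y using z assms(2) by (subst sum.remove[of _ i]) auto
qed

lemma L_far:
  assumes "\<forall>i<k. 2 * \<delta>\<^sup>2 \<le> sq i x"
  shows "DL j x = 2 * ilog' N (\<rho>\<^sup>2) (sq0 x) * (x - 0) $ j" "L x = ilog N (\<rho>\<^sup>2) (sq0 x)"
  unfolding DL_def L_def using assms plog_simps[OF \<delta>2] by auto

text \<open>There are no cross terms in the squared gradient, because at each point at most one of
  the profiles has a nonzero derivative.\<close>

lemma sum_DL_sq:
  "(\<Sum>j\<in>UNIV. (DL j x)\<^sup>2) = (\<Sum>i<k. 4 * sq i x * (plog' \<alpha> (\<delta>\<^sup>2) (sq i x))\<^sup>2) + 4 * sq0 x * (ilog' N (\<rho>\<^sup>2) (sq0 x))\<^sup>2"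
proof (cases "\<exists>i<k. sq i x < 2 * \<delta>\<^sup>2")
  case True
  then obtain i where i: "i < k" "sq i x < 2 * \<delta>\<^sup>2" by blast
  have y: "ilog' N (\<rho>\<^sup>2) (sq0 x) = 0" using ilog_simps[OF \<rho>2 sq0_near[OF i(2,1)]] by auto
  have z: "plog' \<alpha> (\<delta>\<^sup>2) (sq i' x) = 0" if "i' \<in> {..<k} - {i}" for i'
    using sq_other[OF i(2,1)] that plog_simps[OF \<delta>2] by auto
  have "(\<Sum>j\<in>UNIV. (DL j x)\<^sup>2) = 4 * (plog' \<alpha> (\<delta>\<^sup>2) (sq i x))\<^sup>2 * (\<Sum>j\<in>UNIV. ((x - a i) $ j)\<^sup>2)"
    unfolding DL_near[OF i(2,1)] by (simp add: power_mult_distrib sum_distrib_left)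
  also have "\<dots> = 4 * sq i x * (plog' \<alpha> (\<delta>\<^sup>2) (sq i x))\<^sup>2" by (simp only: sum_component_sq mult_ac)
  also have "\<dots> = (\<Sum>i<k. 4 * sq i x * (plog' \<alpha> (\<delta>\<^sup>2) (sq i x))\<^sup>2)"
    using z i(1) by (subst sum.remove[of _ i]) auto
  finally show ?thesis unfolding y by simp
next
  case False
  then have f: "\<forall>i<k. 2 * \<delta>\<^sup>2 \<le> sq i x" by force
  have "(\<Sum>j\<in>UNIV. (DL j x)\<^sup>2) = 4 * (ilog' N (\<rho>\<^sup>2) (sq0 x))\<^sup>2 * (\<Sum>j\<in>UNIV. ((x - 0) $ j)\<^sup>2)"
    unfolding L_far[OF f] by (simp add: power_mult_distrib sum_distrib_left)
  also have "\<dots> = 4 * sq0 x * (ilog' N (\<rho>\<^sup>2) (sq0 x))\<^sup>2" by (simp only: sum_component_sq mult_ac)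
  finally show ?thesis using f plog_simps(2)[OF \<delta>2] by simp
qed

lemma sum_radial_second:
  "(\<Sum>j\<in>UNIV. 4 * g'' * ((y::real^'n) $ j)\<^sup>2 + 2 * g') = 4 * (norm y)\<^sup>2 * g'' + 2 * N * g'"
proof -
  have "(\<Sum>j\<in>UNIV. 4 * g'' * (y $ j)\<^sup>2 + 2 * g') = 4 * g'' * (\<Sum>j\<in>UNIV. (y $ j)\<^sup>2) + 2 * N * g'"
    by (simp add: sum.distrib sum_distrib_left N_def)
  then show ?thesis unfolding sum_component_sq by (simp add: mult_ac)
qed

text \<open>Nothing couples the poles: the Laplacian of L is additive and, by
  \<open>sum_DL_sq\<close>, so is the squared gradient. The one-variable estimates are simply
  added.\<close>

lemma Q_bound: "\<exists>C. \<forall>x\<in>\<Omega>. Q x \<le> - (\<Sum>i<k. \<theta> / sq i x) + C"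
proof -
  obtain C1 where C1: "\<And>s. s > 0 \<Longrightarrow> 4 * s * plog'' \<alpha> (\<delta>\<^sup>2) s + 2 * N * plog' \<alpha> (\<delta>\<^sup>2) s + 4 * s * (plog' \<alpha> (\<delta>\<^sup>2) s)\<^sup>2 \<le> - \<theta> / s + C1"
    using plog_supersolution[OF \<delta>2, of \<alpha> N] unfolding \<theta>_def by blast
  obtain C2 where C2: "\<And>s. s \<ge> 0 \<Longrightarrow> 4 * s * ilog'' N (\<rho>\<^sup>2) s + 2 * N * ilog' N (\<rho>\<^sup>2) s + 4 * s * (ilog' N (\<rho>\<^sup>2) s)\<^sup>2 \<le> C2"
    using ilog_supersolution[OF \<rho>2, of N N] N_pos by auto
  have "Q x \<le> - (\<Sum>i<k. \<theta> / sq i x) + (real k * C1 + C2)" if x: "x \<in> \<Omega>" for x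
  proof -
    have "(\<Sum>j\<in>UNIV. D2L j x) = (\<Sum>i<k. \<Sum>j\<in>UNIV. 4 * plog'' \<alpha> (\<delta>\<^sup>2) (sq i x) * ((x - a i) $ j)\<^sup>2 + 2 * plog' \<alpha> (\<delta>\<^sup>2) (sq i x))
       + (\<Sum>j\<in>UNIV. 4 * ilog'' N (\<rho>\<^sup>2) (sq0 x) * ((x - 0) $ j)\<^sup>2 + 2 * ilog' N (\<rho>\<^sup>2) (sq0 x))"
      unfolding D2L_def by (subst sum.swap) (simp only: sum.distrib)
    then have "Q x = (\<Sum>i<k. 4 * sq i x * plog'' \<alpha> (\<delta>\<^sup>2) (sq i x) + 2 * N * plog' \<alpha> (\<delta>\<^sup>2) (sq i x) + 4 * sq i x * (plog' \<alpha> (\<delta>\<^sup>2) (sq i x))\<^sup>2)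
       + (4 * sq0 x * ilog'' N (\<rho>\<^sup>2) (sq0 x) + 2 * N * ilog' N (\<rho>\<^sup>2) (sq0 x) + 4 * sq0 x * (ilog' N (\<rho>\<^sup>2) (sq0 x))\<^sup>2)"
      unfolding Q_def sum_DL_sq sum_radial_second by (simp add: sum.distrib)
    also have "\<dots> \<le> (\<Sum>i<k. - \<theta> / sq i x + C1) + C2"
      using sq_pos[OF x] by (intro add_mono sum_mono C1 C2) auto
    finally show ?thesis by (simp add: sum_subtractf)
  qed
  then show ?thesis by blast
qed

section \<open>Cutoffs away from the poles and from infinity\<close>

definition chi :: "nat \<Rightarrow> real^'n \<Rightarrow> real" where
  "chi n x = cutoff (sq0 x / real n) - (\<Sum>i<k. cutoff (sq i x / (1 / real n)))"
definition Dchi :: "nat \<Rightarrow> 'n \<Rightarrow> real^'n \<Rightarrow> real" where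
  "Dchi n j x = 2 * (cutoff' (sq0 x / real n) / real n) * (x - 0) $ j
     - (\<Sum>i<k. 2 * (cutoff' (sq i x / (1 / real n)) / (1 / real n)) * (x - a i) $ j)"
definition D2chi :: "nat \<Rightarrow> 'n \<Rightarrow> real^'n \<Rightarrow> real" where
  "D2chi n j x = (4 * (cutoff'' (sq0 x / real n) / (real n)\<^sup>2) * ((x - 0) $ j)\<^sup>2 + 2 * (cutoff' (sq0 x / real n) / real n))
     - (\<Sum>i<k. 4 * (cutoff'' (sq i x / (1 / real n)) / (1 / real n)\<^sup>2) * ((x - a i) $ j)\<^sup>2 + 2 * (cutoff' (sq i x / (1 / real n)) / (1 / real n)))"

lemma C2_chi: assumes n: "n > 0" shows "C2_on UNIV (chi n) (Dchi n) (D2chi n)"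
proof -
  have c: "C2_on UNIV (\<lambda>x. cutoff ((norm (x - b))\<^sup>2 / d)) (\<lambda>j x. 2 * (cutoff' ((norm (x - b))\<^sup>2 / d) / d) * (x - b) $ j)
     (\<lambda>j x. 4 * (cutoff'' ((norm (x - b))\<^sup>2 / d) / d\<^sup>2) * ((x - b) $ j)\<^sup>2 + 2 * (cutoff' ((norm (x - b))\<^sup>2 / d) / d))"
    if d: "d \<noteq> 0" for d and b :: "real^'n"
    by (rule C2_on_radial[where g="\<lambda>s. cutoff (s / d)" and g'="\<lambda>s. cutoff' (s / d) / d" and g''="\<lambda>s. cutoff'' (s / d) / d\<^sup>2"])
      (use d in \<open>auto intro!: DERIV_cut_scaled continuous_intros continuous_cut_scaled\<close>)
  show ?thesis unfolding chi_def[abs_def] Dchi_def[abs_def] D2chi_def[abs_def]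
    by (intro C2_on_diff C2_on_sum c) (use n in auto)
qed

definition Ksup :: "nat \<Rightarrow> (real^'n) set" where
  "Ksup n = {x. sq0 x \<le> 2 * real n \<and> (\<forall>i<k. 1 / real n \<le> sq i x)}"

lemma compact_Ksup: "compact (Ksup n)"
proof -
  have "closed (Ksup n)" unfolding Ksup_def
    by (intro closed_Collect_conj closed_Collect_all closed_Collect_imp closed_Collect_le open_Collect_const continuous_intros)
  moreover have "norm x \<le> sqrt (2 * real n)" if "x \<in> Ksup n" for x
    using that unfolding Ksup_def by (intro real_le_rsqrt) auto
  ultimately show ?thesis unfolding compact_eq_bounded_closed bounded_iff by blast
qed

lemma Ksup_\<Omega>: "n > 0 \<Longrightarrow> Ksup n \<subseteq> \<Omega>"
  by (auto simp: Ksup_def \<Omega>_def)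

text \<open>The first bound puts the pole shells where the weight is a pure power. The second puts
  the pole neighbourhoods where the outer cutoff is 1, and the outer shell where the decay estimate
  \<open>exp_ilog_le\<close> applies.\<close>

definition large :: "nat \<Rightarrow> bool" where "large n \<longleftrightarrow> n > 0 \<and> 2 / real n \<le> \<delta>\<^sup>2 \<and> 2 * \<rho>\<^sup>2 \<le> real n"

lemma large_mono: "large m \<Longrightarrow> m \<le> n \<Longrightarrow> large n"
proof -
  assume m: "large m" and mn: "m \<le> n"
  then have "2 / real n \<le> 2 / real m" by (intro divide_left_mono) (auto simp: large_def)
  then show "large n" using m mn by (auto simp: large_def)
qed

lemma large_exists: "\<exists>m. large m"
proof -
  obtain m :: nat where m: "max (2 / \<delta>\<^sup>2) (max (2 * \<rho>\<^sup>2) 1) \<le> real m" using real_arch_simple by blast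
  then have "m > 0" "2 / \<delta>\<^sup>2 \<le> real m" "2 * \<rho>\<^sup>2 \<le> real m" by auto
  then show ?thesis using \<delta>2 by (intro exI[of _ m]) (auto simp: large_def field_simps)
qed

lemma cutoff_near:
  assumes n: "large n" and i: "i < k" and s: "sq i x < 2 / real n"
  shows "cutoff (sq0 x / real n) = 1" "cutoff' (sq0 x / real n) = 0" "cutoff'' (sq0 x / real n) = 0"
    "\<And>i'. i' < k \<Longrightarrow> i' \<noteq> i \<Longrightarrow> cutoff (sq i' x / (1 / real n)) = 0 \<and> cutoff' (sq i' x / (1 / real n)) = 0 \<and> cutoff'' (sq i' x / (1 / real n)) = 0"
    "sq i x < \<delta>\<^sup>2"
proof -
  show 1: "sq i x < \<delta>\<^sup>2" using s n by (auto simp: large_def)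
  then have 2: "sq i x < 2 * \<delta>\<^sup>2" using \<delta>2 by linarith
  have "sq0 x \<le> real n" using sq0_near[OF 2 i] n \<rho>2 by (auto simp: large_def)
  then have "sq0 x / real n \<le> 1" using n by (auto simp: large_def)
  then show "cutoff (sq0 x / real n) = 1" "cutoff' (sq0 x / real n) = 0" "cutoff'' (sq0 x / real n) = 0"
    by (simp_all add: cutoff_simps)
  fix i' assume i': "i' < k" "i' \<noteq> i"
  have "2 / real n \<le> sq i' x" using sq_other[OF 2 i i'] n \<delta>2 unfolding large_def by linarith
  then have "2 \<le> sq i' x / (1 / real n)" using n by (auto simp: large_def field_simps)
  then show "cutoff (sq i' x / (1 / real n)) = 0 \<and> cutoff' (sq i' x / (1 / real n)) = 0 \<and> cutoff'' (sq i' x / (1 / real n)) = 0"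
    by (simp add: cutoff_simps)
qed

lemma cutoff_pole_far:
  assumes "n > 0" "2 / real n \<le> sq i x"
  shows "cutoff (sq i x / (1 / real n)) = 0 \<and> cutoff' (sq i x / (1 / real n)) = 0 \<and> cutoff'' (sq i x / (1 / real n)) = 0"
proof -
  have "2 \<le> sq i x / (1 / real n)" using assms by (auto simp: field_simps)
  then show ?thesis by (simp add: cutoff_simps)
qed

lemma chi_near:
  assumes n: "large n" and i: "i < k" and s: "sq i x < 2 / real n"
  shows "chi n x = 1 - cutoff (sq i x / (1 / real n))"
    "Dchi n j x = - (2 * (cutoff' (sq i x / (1 / real n)) / (1 / real n)) * (x - a i) $ j)"
    "D2chi n j x = - (4 * (cutoff'' (sq i x / (1 / real n)) / (1 / real n)\<^sup>2) * ((x - a i) $ j)\<^sup>2 + 2 * (cutoff' (sq i x / (1 / real n)) / (1 / real n)))"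
  unfolding chi_def Dchi_def D2chi_def cutoff_near(1-3)[OF n i s]
  using cutoff_near(4)[OF n i s] i by (subst sum.remove[of _ i]; force)+

lemma chi_far:
  assumes n: "large n" and s: "\<forall>i<k. 2 / real n \<le> sq i x"
  shows "chi n x = cutoff (sq0 x / real n)"
    "Dchi n j x = 2 * (cutoff' (sq0 x / real n) / real n) * (x - 0) $ j"
    "D2chi n j x = 4 * (cutoff'' (sq0 x / real n) / (real n)\<^sup>2) * ((x - 0) $ j)\<^sup>2 + 2 * (cutoff' (sq0 x / real n) / real n)"
  unfolding chi_def Dchi_def D2chi_def
  using cutoff_pole_far[of n] s n by (simp_all add: large_def)

lemma chi_outside:
  assumes n: "large n" and x: "x \<notin> Ksup n"
  shows "chi n x = 0 \<and> Dchi n j x = 0 \<and> D2chi n j x = 0"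
proof -
  have n0: "n > 0" using n by (simp add: large_def)
  show ?thesis
  proof (cases "\<exists>i<k. sq i x < 2 / real n")
    case True
    then obtain i where i: "i < k" "sq i x < 2 / real n" by blast
    have "sq i x < 2 * \<delta>\<^sup>2" using cutoff_near(5)[OF n i] \<delta>2 by linarith
    then have "sq0 x \<le> 2 * real n" using sq0_near[OF _ i(1)] n \<rho>2 by (fastforce simp: large_def)
    then obtain i' where i': "i' < k" "sq i' x < 1 / real n" using x by (auto simp: Ksup_def not_le)
    moreover have "1 / real n \<le> 2 / real n" by (simp add: divide_right_mono)
    ultimately have "sq i' x < 2 / real n" by linarith
    moreover have "sq i' x / (1 / real n) \<le> 1" using i'(2) n0 by (simp add: field_simps)
    ultimately show ?thesis using chi_near[OF n i'(1)] by (simp add: cutoff_simps)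
  next
    case False
    then have f: "\<forall>i<k. 2 / real n \<le> sq i x" by force
    have "1 / real n \<le> 2 / real n" by (simp add: divide_right_mono)
    then have "2 * real n < sq0 x" using x f by (auto simp: Ksup_def not_le intro: order_trans)
    then have "2 \<le> sq0 x / real n" using n0 by (simp add: field_simps)
    then show ?thesis using chi_far[OF n f] by (simp add: cutoff_simps)
  qed
qed

text \<open>A difference of cutoffs can serve in place of a product: for large \<open>n\<close> the
  pole cutoffs have disjoint supports contained in the set where the outer cutoff equals 1. The
  difference keeps derivatives and monotonicity in \<open>n\<close> simple.\<close>

lemma chi_nonneg: assumes n: "large n" shows "0 \<le> chi n x"
proof (cases "\<exists>i<k. sq i x < 2 / real n")
  case True
  then obtain i where i: "i < k" "sq i x < 2 / real n" by blast
  show ?thesis unfolding chi_near(1)[OF n i] using cutoff_simps(8) by simp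
next
  case False
  then have f: "\<forall>i<k. 2 / real n \<le> sq i x" by force
  show ?thesis unfolding chi_far(1)[OF n f] by (rule cutoff_simps)
qed

text \<open>Monotonicity lets a fixed test function be compared with later ones, whose error terms
  become arbitrarily small.\<close>

lemma chi_mono: assumes "0 < m" "m \<le> n" shows "chi m x \<le> chi n x"
proof -
  have "sq0 x / real n \<le> sq0 x / real m" using assms by (intro divide_left_mono) auto
  moreover have "sq i x / (1 / real m) \<le> sq i x / (1 / real n)" for i
    using assms by (simp add: mult_left_mono)
  ultimately show ?thesis unfolding chi_def by (intro diff_mono sum_mono cutoff_simps(9))
qed

lemma chi_eventually_pos:
  assumes x: "x \<in> \<Omega>" shows "\<exists>n. large n \<and> chi n x = 1"
proof -
  obtain m where m: "large m" using large_exists by blast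
  have "\<forall>i\<in>{..<k}. \<exists>n0::nat. \<forall>n\<ge>n0. 2 / real n \<le> sq i x"
  proof
    fix i assume "i \<in> {..<k}"
    then have p: "sq i x > 0" using sq_pos[OF x] by simp
    obtain n0 :: nat where n0: "2 / sq i x < real n0" using reals_Archimedean2 by blast
    have n0': "n0 > 0" using n0 p by (metis divide_nonneg_pos less_le_not_le not_gr_zero of_nat_0 zero_le_numeral)
    have "2 / real n \<le> sq i x" if "n \<ge> n0" for n
    proof -
      have "2 < real n0 * sq i x" using n0 p by (simp add: divide_less_eq)
      also have "\<dots> \<le> real n * sq i x" using that by (intro mult_right_mono) auto
      finally show ?thesis using that n0' by (simp add: divide_le_eq mult.commute)
    qed
    then show "\<exists>n0::nat. \<forall>n\<ge>n0. 2 / real n \<le> sq i x" by blast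
  qed
  then obtain n0 where n0: "\<And>i n. i < k \<Longrightarrow> n \<ge> n0 i \<Longrightarrow> 2 / real n \<le> sq i x" by (metis lessThan_iff)
  obtain p :: nat where p: "sq0 x \<le> real p" using real_arch_simple by blast
  define n where "n = max (max m p) (Max (insert 0 (n0 ` {..<k})))"
  have 1: "large n" by (rule large_mono[OF m]) (simp add: n_def)
  have 2: "\<forall>i<k. 2 / real n \<le> sq i x"
  proof (intro allI impI n0)
    fix i assume "i < k"
    then have "n0 i \<le> Max (insert 0 (n0 ` {..<k}))" by (intro Max_ge) auto
    then show "n0 i \<le> n" by (simp add: n_def)
  qed
  have "sq0 x / real n \<le> 1"
  proof -
    have "real p \<le> real n" by (simp add: n_def)
    then show ?thesis using p 1 by (simp add: large_def divide_le_eq)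
  qed
  then have "chi n x = 1" unfolding chi_far(1)[OF 1 2] by (simp add: cutoff_simps)
  with 1 show ?thesis by blast
qed

text \<open>The error terms created by the cutoff; the exponent $N/4 = 1 + \alpha/2$ is exactly the one for which
  they stay bounded in $L^2$ on the shells around the poles.\<close>

definition err :: "nat \<Rightarrow> real^'n \<Rightarrow> real" where
  "err n x = exp (L x) * (2 * (\<Sum>j\<in>UNIV. DL j x * Dchi n j x) + (\<Sum>j\<in>UNIV. D2chi n j x))"

text \<open>On the shell 1/n < |x-a|^2 < 2/n the weight is of size n^(\<alpha>/2), and both error
  terms, the mixed gradient term and the Laplacian of the cutoff, contribute a factor n. Closer to
  the pole the cutoff is constant and the error is 0.\<close>

lemma err_near:
  obtains K where "K \<ge> 0" "\<And>n i x. large n \<Longrightarrow> i < k \<Longrightarrow> sq i x < 2 / real n \<Longrightarrow> x \<in> \<Omega> \<Longrightarrow> \<bar>err n x\<bar> \<le> K * real n powr (N / 4)"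
proof -
  obtain B where B: "B > 0" "\<And>s. \<bar>cutoff' s\<bar> \<le> B" "\<And>s. \<bar>cutoff'' s\<bar> \<le> B" using cutoff_bounded by blast
  define K where "K = 2 powr (\<bar>\<alpha>\<bar> / 2) * (4 * \<bar>\<alpha>\<bar> * B + (8 * B + 2 * N * B))"
  have K0: "K \<ge> 0" unfolding K_def using B(1) N_pos by (auto intro!: mult_nonneg_nonneg add_nonneg_nonneg)
  have "\<bar>err n x\<bar> \<le> K * real n powr (N / 4)" if n: "large n" and i: "i < k" and s: "sq i x < 2 / real n" and x: "x \<in> \<Omega>" for n i x
  proof (cases "1 / real n < sq i x")
    case False
    have n0: "real n > 0" using n by (simp add: large_def)
    then have "sq i x / (1 / real n) \<le> 1" using False by (simp add: field_simps not_less)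
    then have "err n x = 0" unfolding err_def chi_near[OF n i s] by (simp add: cutoff_simps)
    then show ?thesis using K0 by simp
  next
    case True
    define s where "s = sq i x"
    have n0: "real n > 0" using n by (simp add: large_def)
    have sp: "s > 0" "1 / real n < s" "s < 2 / real n" using sq_pos[OF x i] True \<open>sq i x < 2 / real n\<close> by (auto simp: s_def)
    have ns: "real n * s \<le> 2" using sp(3) n0 by (simp add: field_simps)
    have sd: "s < \<delta>\<^sup>2" unfolding s_def by (rule cutoff_near(5)[OF n i \<open>sq i x < 2 / real n\<close>])
    have sd2: "sq i x < 2 * \<delta>\<^sup>2" using sd \<delta>2 unfolding s_def by linarith
    let ?c1 = "cutoff' (s / (1 / real n))" and ?c2 = "cutoff'' (s / (1 / real n))"
    have p': "plog' \<alpha> (\<delta>\<^sup>2) s = - (\<alpha> / 2) / s" and p: "plog \<alpha> (\<delta>\<^sup>2) s = - (\<alpha> / 2) * ln s"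
      using plog_simps(4,5)[OF \<delta>2] sd by auto
    have "(\<Sum>j\<in>UNIV. DL j x * Dchi n j x) = (\<Sum>j\<in>UNIV. (2 * \<alpha> * real n * ?c1 / s) * ((x - a i) $ j)\<^sup>2)"
      unfolding DL_near[OF sd2 i] chi_near[OF n i \<open>sq i x < 2 / real n\<close>] s_def[symmetric] p'
      by (intro sum.cong refl) (simp add: power2_eq_square)
    also have "\<dots> = (2 * \<alpha> * real n * ?c1 / s) * s"
      unfolding sum_distrib_left[symmetric] sum_component_sq s_def[symmetric] ..
    finally have 1: "(\<Sum>j\<in>UNIV. DL j x * Dchi n j x) = 2 * \<alpha> * real n * ?c1" using sp by simp
    have "(\<Sum>j\<in>UNIV. D2chi n j x) = - (4 * s * (?c2 / (1 / real n)\<^sup>2) + 2 * N * (?c1 / (1 / real n)))"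
      unfolding chi_near[OF n i \<open>sq i x < 2 / real n\<close>] sum_negf sum_radial_second s_def[symmetric] ..
    then have 2: "(\<Sum>j\<in>UNIV. D2chi n j x) = - (real n * (4 * (real n * s) * ?c2 + 2 * N * ?c1))"
      using n0 by (simp add: field_simps power2_eq_square)
    have e: "err n x = exp (L x) * (real n * (4 * \<alpha> * ?c1 - (4 * (real n * s) * ?c2 + 2 * N * ?c1)))"
      unfolding err_def 1 2 by (simp add: algebra_simps)
    have b1: "\<bar>4 * \<alpha> * ?c1\<bar> \<le> 4 * \<bar>\<alpha>\<bar> * B" unfolding abs_mult using B(2) by (intro mult_mono) auto
    have b2: "\<bar>4 * (real n * s) * ?c2\<bar> \<le> 8 * B"
      unfolding abs_mult[of "4 * (real n * s)"] using ns sp(1) n0 B by (intro mult_mono) (auto simp: abs_mult mult.commute)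
    have b3: "\<bar>2 * N * ?c1\<bar> \<le> 2 * N * B" unfolding abs_mult[of "2 * N"] using N_pos B(2) by (intro mult_mono) auto
    have b: "\<bar>4 * \<alpha> * ?c1 - (4 * (real n * s) * ?c2 + 2 * N * ?c1)\<bar> \<le> 4 * \<bar>\<alpha>\<bar> * B + (8 * B + 2 * N * B)"
      using b1 b2 b3 by linarith
    \<comment> \<open>On the shell n s lies between 1 and 2, so ln s and - ln n differ by at most ln
      2. The modulus of \<alpha> covers both signs; \<alpha> is negative for N = 3.\<close>
    have "exp (L x) \<le> 2 powr (\<bar>\<alpha>\<bar> / 2) * real n powr (\<alpha> / 2)"
    proof -
      have "ln (1 / real n) \<le> ln s" "ln s \<le> ln (2 / real n)"
        using sp n0 by (subst ln_le_cancel_iff; simp)+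
      then have l1: "- ln (real n) \<le> ln s" and l2: "ln s \<le> ln 2 - ln (real n)"
        using n0 by (simp_all add: ln_div)
      have "\<bar>ln s + ln (real n)\<bar> \<le> ln 2" using l1 l2 by simp
      then have "\<bar>\<alpha> / 2\<bar> * \<bar>ln s + ln (real n)\<bar> \<le> \<bar>\<alpha> / 2\<bar> * ln 2" by (intro mult_left_mono) auto
      then have "- (\<alpha> / 2) * (ln s + ln (real n)) \<le> \<bar>\<alpha>\<bar> / 2 * ln 2"
        using abs_ge_self[of "- (\<alpha> / 2) * (ln s + ln (real n))"] by (simp add: abs_mult)
      moreover have "- (\<alpha> / 2) * (ln s + ln (real n)) = - (\<alpha> / 2) * ln s - \<alpha> / 2 * ln (real n)"
        by (simp add: distrib_left)
      ultimately have "L x \<le> \<bar>\<alpha>\<bar> / 2 * ln 2 + \<alpha> / 2 * ln (real n)"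
        unfolding DL_near(2)[OF sd2 i] s_def[symmetric] p by linarith
      then have "exp (L x) \<le> exp (\<bar>\<alpha>\<bar> / 2 * ln 2 + \<alpha> / 2 * ln (real n))" by simp
      also have "\<dots> = 2 powr (\<bar>\<alpha>\<bar> / 2) * real n powr (\<alpha> / 2)" using n0 by (simp add: exp_add powr_def)
      finally show ?thesis .
    qed
    then have "\<bar>err n x\<bar> \<le> (2 powr (\<bar>\<alpha>\<bar> / 2) * real n powr (\<alpha> / 2)) * (real n * (4 * \<bar>\<alpha>\<bar> * B + (8 * B + 2 * N * B)))"
      unfolding e abs_mult using b n0 by (intro mult_mono) (auto intro: mult_nonneg_nonneg)
    also have "\<dots> = K * (real n powr (\<alpha> / 2) * real n powr 1)" using n0 by (simp add: K_def)
    also have "real n powr (\<alpha> / 2) * real n powr 1 = real n powr (N / 4)"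
    proof -
      have "\<alpha> / 2 + 1 = N / 4" by (simp add: \<alpha>_def field_simps)
      then show ?thesis unfolding powr_add[symmetric] by (simp only:)
    qed
    finally show ?thesis .
  qed
  then show ?thesis using that K0 by blast
qed

text \<open>The outer error lives on n \<le> |x|^2 \<le> 2n, where the derivatives of the cutoff
  stay bounded and the weight is at most a constant times n^(-N).\<close>

lemma err_far:
  obtains K where "K \<ge> 0" "\<And>n x. large n \<Longrightarrow> \<forall>i<k. 2 / real n \<le> sq i x \<Longrightarrow> \<bar>err n x\<bar> \<le> K * (1 / real n) ^ CARD('n)"
    "\<And>n x. large n \<Longrightarrow> \<forall>i<k. 2 / real n \<le> sq i x \<Longrightarrow> sq0 x > 2 * real n \<Longrightarrow> err n x = 0"
proof -
  obtain B where B: "B > 0" "\<And>s. \<bar>cutoff' s\<bar> \<le> B" "\<And>s. \<bar>cutoff'' s\<bar> \<le> B" using cutoff_bounded by blast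
  define K1 where "K1 = 48 * N * B + (8 * B + 2 * N * B)"
  \<comment> \<open>The cutoff derivatives leave a factor 1/n, which is bounded through n \<ge>
    2\<rho>^2; the last factor is the constant from the decay of the weight.\<close>
  define K where "K = K1 * (1 / (2 * \<rho>\<^sup>2) + 1) * (2 * \<rho>\<^sup>2) ^ CARD('n)"
  have K10: "K1 \<ge> 0" unfolding K1_def using B(1) N_pos by (auto intro!: add_nonneg_nonneg)
  have K0: "K \<ge> 0" unfolding K_def using K10 by (auto intro!: mult_nonneg_nonneg add_nonneg_nonneg)
  have z: "err n x = 0" if n: "large n" and f: "\<forall>i<k. 2 / real n \<le> sq i x" and o: "sq0 x < real n \<or> sq0 x > 2 * real n" for n x
  proof -
    have n0: "real n > 0" using n by (simp add: large_def)
    have "sq0 x / real n \<le> 1 \<or> 2 \<le> sq0 x / real n" using o n0 by (auto simp: field_simps)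
    then show ?thesis unfolding err_def chi_far[OF n f] by (auto simp: cutoff_simps)
  qed
  have "\<bar>err n x\<bar> \<le> K * (1 / real n) ^ CARD('n)" if n: "large n" and f: "\<forall>i<k. 2 / real n \<le> sq i x" for n x
  proof (cases "sq0 x < real n \<or> sq0 x > 2 * real n")
    case True
    then show ?thesis using z[OF n f] K0 by simp
  next
    case False
    define s where "s = sq0 x"
    have n0: "real n > 0" using n by (simp add: large_def)
    have s: "real n \<le> s" "s \<le> 2 * real n" "s \<ge> 0" using False by (auto simp: s_def)
    have nr: "2 * \<rho>\<^sup>2 \<le> real n" using n by (simp add: large_def)
    have far: "\<forall>i<k. 2 * \<delta>\<^sup>2 \<le> sq i x"
    proof (rule ccontr)
      assume "\<not> ?thesis"
      then have "s \<le> \<rho>\<^sup>2" unfolding s_def using sq0_near by force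
      then show False using s nr \<rho>2 by linarith
    qed
    let ?c1 = "cutoff' (s / real n)" and ?c2 = "cutoff'' (s / real n)" and ?m = "ilog' N (\<rho>\<^sup>2) s"
    have "(\<Sum>j\<in>UNIV. DL j x * Dchi n j x) = (\<Sum>j\<in>UNIV. (4 * ?m * ?c1 / real n) * ((x - 0) $ j)\<^sup>2)"
      unfolding L_far[OF far] chi_far[OF n f] s_def[symmetric]
      by (intro sum.cong refl) (simp add: power2_eq_square)
    also have "\<dots> = (4 * ?m * ?c1 / real n) * s"
      unfolding sum_distrib_left[symmetric] sum_component_sq s_def[symmetric] ..
    finally have 1: "(\<Sum>j\<in>UNIV. DL j x * Dchi n j x) = 4 * (s * ?m) * ?c1 / real n" by simp
    have "(\<Sum>j\<in>UNIV. D2chi n j x) = 4 * s * (?c2 / (real n)\<^sup>2) + 2 * N * (?c1 / real n)"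
      unfolding chi_far[OF n f] sum_radial_second s_def[symmetric] ..
    then have 2: "(\<Sum>j\<in>UNIV. D2chi n j x) = (4 * (s / real n) * ?c2 + 2 * N * ?c1) / real n"
      using n0 by (simp add: field_simps power2_eq_square)
    have e: "err n x = exp (L x) * ((8 * (s * ?m) * ?c1 + (4 * (s / real n) * ?c2 + 2 * N * ?c1)) / real n)"
      unfolding err_def 1 2 by (simp add: add_divide_distrib)
    have m: "\<bar>s * ?m\<bar> \<le> 6 * N" using ilog_bounds(1)[OF \<rho>2 _ s(3), of N] N_pos by simp
    have b1: "\<bar>8 * (s * ?m) * ?c1\<bar> \<le> 48 * N * B"
      unfolding abs_mult[of "8 * (s * ?m)"] using m B N_pos by (intro mult_mono) (auto simp: abs_mult)
    have sn: "s / real n \<le> 2" "0 \<le> s / real n" using s n0 by (auto simp: field_simps)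
    have b2: "\<bar>4 * (s / real n) * ?c2\<bar> \<le> 8 * B"
      unfolding abs_mult[of "4 * (s / real n)"] using sn B by (intro mult_mono) (auto simp: abs_mult)
    have b3: "\<bar>2 * N * ?c1\<bar> \<le> 2 * N * B" unfolding abs_mult[of "2 * N"] using N_pos B(2) by (intro mult_mono) auto
    have b: "\<bar>8 * (s * ?m) * ?c1 + (4 * (s / real n) * ?c2 + 2 * N * ?c1)\<bar> \<le> K1"
      unfolding K1_def by (rule order_trans[OF abs_triangle_ineq add_mono[OF b1 order_trans[OF abs_triangle_ineq add_mono[OF b2 b3]]]])
    have "exp (L x) \<le> (2 * \<rho>\<^sup>2 / s) ^ CARD('n)"
      unfolding L_far[OF far] s_def[symmetric] N_def using s nr by (intro exp_ilog_le \<rho>2) auto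
    also have "\<dots> \<le> (2 * \<rho>\<^sup>2 / real n) ^ CARD('n)"
      using s n0 \<rho>2 by (intro power_mono divide_left_mono) auto
    finally have ex: "exp (L x) \<le> (2 * \<rho>\<^sup>2) ^ CARD('n) * (1 / real n) ^ CARD('n)" by (simp add: power_divide)
    have "1 / real n \<le> 1 / (2 * \<rho>\<^sup>2) + 1" using nr \<rho>2 n0 by (intro add_increasing2 divide_left_mono) auto
    then have "K1 * (1 / real n) \<le> K1 * (1 / (2 * \<rho>\<^sup>2) + 1)" by (rule mult_left_mono[OF _ K10])
    moreover have "\<bar>(8 * (s * ?m) * ?c1 + (4 * (s / real n) * ?c2 + 2 * N * ?c1)) / real n\<bar> \<le> K1 * (1 / real n)"
      using b n0 by (simp add: abs_divide divide_right_mono)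
    ultimately have "\<bar>(8 * (s * ?m) * ?c1 + (4 * (s / real n) * ?c2 + 2 * N * ?c1)) / real n\<bar> \<le> K1 * (1 / (2 * \<rho>\<^sup>2) + 1)" by linarith
    then have "\<bar>err n x\<bar> \<le> ((2 * \<rho>\<^sup>2) ^ CARD('n) * (1 / real n) ^ CARD('n)) * (K1 * (1 / (2 * \<rho>\<^sup>2) + 1))"
      unfolding e abs_mult using ex by (intro mult_mono) auto
    then show ?thesis by (simp add: K_def mult_ac)
  qed
  then show ?thesis using that K0 z by blast
qed

end

section \<open>Integrals of a square-integrable function over small and large balls\<close>

lemma integral_abs_cball_le:
  fixes v :: "'a::euclidean_space \<Rightarrow> real"
  assumes v: "sq_int v" and r: "r \<ge> 0"
  shows "integrable lborel (\<lambda>x. \<bar>v x\<bar> * indicator (cball b r) x)"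
    "(LINT x|lborel. \<bar>v x\<bar> * indicator (cball b r) x)
       \<le> sqrt (LINT x|lborel. (v x)\<^sup>2 * indicator (cball b r) x) * sqrt (unit_ball_vol DIM('a) * r ^ DIM('a))"
    "integrable lborel (\<lambda>x. (v x)\<^sup>2 * indicator (cball b r) x)"
proof -
  note [measurable] = sq_intD(1)[OF v]
  have [measurable]: "cball b r \<in> sets borel" by (simp add: borel_closed)
  have ind: "integrable lborel (indicator (cball b r) :: 'a \<Rightarrow> real)"
    by (rule integrable_real_indicator) (simp add: borel_closed, rule emeasure_compact_finite[OF compact_cball])
  have i2: "(\<lambda>x. (indicator (cball b r) x :: real)\<^sup>2) = indicator (cball b r)" by (auto simp: indicator_def)
  have si: "sq_int (indicator (cball b r) :: 'a \<Rightarrow> real)" unfolding sq_int_def i2 using ind by auto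
  have vi: "sq_int (\<lambda>x. v x * indicator (cball b r) x)"
    by (rule sq_int_bound[OF v, of _ 1]) (auto simp: indicator_def)
  have e: "(\<lambda>x. (v x * indicator (cball b r) x)\<^sup>2) = (\<lambda>x. (v x)\<^sup>2 * indicator (cball b r) x)" by (auto simp: indicator_def)
  show "integrable lborel (\<lambda>x. (v x)\<^sup>2 * indicator (cball b r) x)" using sq_intD(2)[OF vi] unfolding e .
  have e2: "(\<lambda>x. \<bar>(v x * indicator (cball b r) x) * indicator (cball b r) x\<bar>) = (\<lambda>x. \<bar>v x\<bar> * indicator (cball b r) x)"
    by (auto simp: indicator_def)
  show "integrable lborel (\<lambda>x. \<bar>v x\<bar> * indicator (cball b r) x)"
    using integrable_abs[OF sq_int_mult[OF vi si]] unfolding e2 .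
  show "(LINT x|lborel. \<bar>v x\<bar> * indicator (cball b r) x)
       \<le> sqrt (LINT x|lborel. (v x)\<^sup>2 * indicator (cball b r) x) * sqrt (unit_ball_vol DIM('a) * r ^ DIM('a))"
    using sq_int_abs_mult_le[OF vi si] unfolding e e2 i2 using r by (simp add: content_cball)
qed

text \<open>Dominated convergence, the centre being a null set. This is the only source of smallness
  at the poles, where the powers of n cancel exactly.\<close>

lemma integral_shrinking_cball_tendsto:
  fixes v :: "'a::euclidean_space \<Rightarrow> real"
  assumes v: "sq_int v" and r: "r \<longlonglongrightarrow> 0"
  shows "(\<lambda>n. LINT x|lborel. (v x)\<^sup>2 * indicator (cball b (r n)) x) \<longlonglongrightarrow> 0"
proof -
  note [measurable] = sq_intD(1)[OF v]
  have [measurable]: "cball b (r n) \<in> sets borel" for n by (simp add: borel_closed)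
  have "(\<lambda>n. LINT x|lborel. (v x)\<^sup>2 * indicator (cball b (r n)) x) \<longlonglongrightarrow> (LINT x|(lborel::'a measure). 0)"
  proof (rule integral_dominated_convergence)
    show "integrable lborel (\<lambda>x. (v x)\<^sup>2)" by (rule sq_intD(2)[OF v])
    show "AE x in lborel. norm ((v x)\<^sup>2 * indicator (cball b (r n)) x) \<le> (v x)\<^sup>2" for n
      by (intro always_eventually allI) (auto simp: indicator_def)
    have "AE x in lborel. x \<noteq> b" by (rule AE_lborel_singleton)
    then show "AE x in lborel. (\<lambda>n. (v x)\<^sup>2 * indicator (cball b (r n)) x) \<longlonglongrightarrow> 0"
    proof eventually_elim
      case (elim x)
      then have "dist b x > 0" by simp
      then have "\<forall>\<^sub>F n in sequentially. r n < dist b x" by (rule order_tendstoD(2)[OF r])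
      then show "(\<lambda>n. (v x)\<^sup>2 * indicator (cball b (r n)) x) \<longlonglongrightarrow> 0"
        by (intro tendsto_eventually, eventually_elim) simp
    qed
  qed measurable
  then show ?thesis by simp
qed

lemma AE_notin_finite: "finite A \<Longrightarrow> AE x in (lborel :: 'a::euclidean_space measure). x \<notin> A"
  by (rule AE_not_in[OF finite_imp_null_set_lborel])

context poles
begin

lemma AE_\<Omega>: "AE x in lborel. x \<in> \<Omega>"
  using AE_notin_finite[of "a ` {..<k}"] by (auto simp: \<Omega>_def)

text \<open>The ground state inequality for the weight e^L, integrated with the pointwise bound on Q
  + q. For q = V - M it is coercivity of -\<Delta> - V + M on real functions.\<close>

lemma form_bound:
  fixes u q :: "real^'n \<Rightarrow> real"
  assumes C: "compact C" "C \<subseteq> \<Omega>" and u: "C2_on UNIV u Du D2u"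
    and 0: "\<And>x. x \<notin> C \<Longrightarrow> u x = 0" "\<And>j x. x \<notin> C \<Longrightarrow> Du j x = 0" "\<And>j x. x \<notin> C \<Longrightarrow> D2u j x = 0"
    and q: "AE x in lborel. x \<in> \<Omega> \<longrightarrow> Q x + q x \<le> -1" and qu: "integrable lborel (\<lambda>x. q x * (u x)\<^sup>2)"
  shows "(LINT x|lborel. u x * (\<Sum>j\<in>UNIV. D2u j x)) + (LINT x|lborel. q x * (u x)\<^sup>2) \<le> - (LINT x|lborel. (u x)\<^sup>2)"
proof -
  note G = ground_state_inequality[OF open_\<Omega> C C2_L C2_on_subset[OF u subset_UNIV] 0]
  have i: "integrable lborel (\<lambda>x. u x * (\<Sum>j\<in>UNIV. D2u j x))" "integrable lborel (\<lambda>x. (u x)\<^sup>2)"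
    by (rule integrable_extend_zero(2)[OF open_UNIV C(1) subset_UNIV];
        auto intro!: continuous_intros C2_onD(1,5)[OF u] simp: 0)+
  have "(LINT x|lborel. u x * (\<Sum>j\<in>UNIV. D2u j x) + q x * (u x)\<^sup>2)
    \<le> (LINT x|lborel. (u x * (\<Sum>j\<in>UNIV. D2u j x) - (u x)\<^sup>2 * ((\<Sum>j\<in>UNIV. D2L j x) + (\<Sum>j\<in>UNIV. (DL j x)\<^sup>2))) - (u x)\<^sup>2)"
  proof (rule integral_mono_AE)
    show "AE x in lborel. u x * (\<Sum>j\<in>UNIV. D2u j x) + q x * (u x)\<^sup>2
      \<le> (u x * (\<Sum>j\<in>UNIV. D2u j x) - (u x)\<^sup>2 * ((\<Sum>j\<in>UNIV. D2L j x) + (\<Sum>j\<in>UNIV. (DL j x)\<^sup>2))) - (u x)\<^sup>2"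
      using q AE_\<Omega>
    proof eventually_elim
      case (elim x)
      then have "(u x)\<^sup>2 * (Q x + q x) \<le> (u x)\<^sup>2 * -1" by (intro mult_left_mono) auto
      then show ?case by (simp add: Q_def algebra_simps)
    qed
  qed (use i qu G in auto)
  also have "\<dots> \<le> - (LINT x|lborel. (u x)\<^sup>2)" using G i by simp
  finally show ?thesis using i qu by simp
qed

lemma err_integral_tendsto:
  assumes v: "sq_int v"
  obtains e T where "T \<longlonglongrightarrow> 0" "\<And>n x. large n \<Longrightarrow> x \<in> \<Omega> \<Longrightarrow> \<bar>err n x\<bar> \<le> e n x"
    "\<And>n. large n \<Longrightarrow> integrable lborel (\<lambda>x. \<bar>v x\<bar> * e n x)" "\<And>n. large n \<Longrightarrow> (LINT x|lborel. \<bar>v x\<bar> * e n x) \<le> T n"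
proof -
  obtain K1 where K1: "K1 \<ge> 0" "\<And>n i x. large n \<Longrightarrow> i < k \<Longrightarrow> sq i x < 2 / real n \<Longrightarrow> x \<in> \<Omega> \<Longrightarrow> \<bar>err n x\<bar> \<le> K1 * real n powr (N / 4)"
    using err_near by blast
  obtain K2 where K2: "K2 \<ge> 0" "\<And>n x. large n \<Longrightarrow> \<forall>i<k. 2 / real n \<le> sq i x \<Longrightarrow> \<bar>err n x\<bar> \<le> K2 * (1 / real n) ^ CARD('n)"
    "\<And>n x. large n \<Longrightarrow> \<forall>i<k. 2 / real n \<le> sq i x \<Longrightarrow> sq0 x > 2 * real n \<Longrightarrow> err n x = 0"
    using err_far by blast
  let ?I = "\<lambda>b r x. indicator (cball b r) x :: real"
  \<comment> \<open>The shells are enlarged to balls, whose volumes are available in closed form;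
    the sum over the poles is harmless since all its terms are nonnegative.\<close>
  define e where "e n x = (\<Sum>i<k. K1 * real n powr (N / 4) * ?I (a i) (sqrt (2 / real n)) x)
     + K2 * (1 / real n) ^ CARD('n) * ?I 0 (sqrt (2 * real n)) x" for n and x :: "real^'n"
  define U where "U = sqrt (unit_ball_vol (real CARD('n)))"
  have U0: "0 \<le> U" unfolding U_def by (simp add: unit_ball_vol_nonneg)
  \<comment> \<open>Cauchy-Schwarz on a ball of squared radius t gives the volume factor U t^(N/4).
    Near a pole n^(N/4) (2/n)^(N/4) is constant and the local L^2 mass supplies the limit 0; at
    infinity n^(-N) (2n)^(N/4) is of order n^(-3N/4).\<close>
  define T where "T n = (\<Sum>i<k. K1 * (sqrt (LINT x|lborel. (v x)\<^sup>2 * ?I (a i) (sqrt (2 / real n)) x) * (U * 2 powr (N / 4))))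
     + K2 * (sqrt (LINT x|lborel. (v x)\<^sup>2) * (U * (2 powr (N / 4) * real n powr (- (3 * N / 4)))))" for n :: nat
  have "T \<longlonglongrightarrow> (\<Sum>i<k. K1 * (sqrt 0 * (U * 2 powr (N / 4)))) + K2 * (sqrt (LINT x|lborel. (v x)\<^sup>2) * (U * (2 powr (N / 4) * 0)))"
    unfolding T_def
  proof (intro tendsto_intros integral_shrinking_cball_tendsto[OF v])
    have "(\<lambda>n. sqrt (2 * inverse (real n))) \<longlonglongrightarrow> sqrt (2 * 0)"
      by (intro tendsto_intros lim_inverse_n)
    then show "(\<lambda>n. sqrt (2 / real n)) \<longlonglongrightarrow> 0" by (simp add: divide_inverse)
    show "(\<lambda>n. real n powr (- (3 * N / 4))) \<longlonglongrightarrow> 0"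
      by (rule tendsto_neg_powr) (use N_pos filterlim_real_sequentially in auto)
  qed
  then have T0: "T \<longlonglongrightarrow> 0" by simp
  have eb: "\<bar>err n x\<bar> \<le> e n x" if n: "large n" and x: "x \<in> \<Omega>" for n x
  proof (cases "\<exists>i<k. sq i x < 2 / real n")
    case True
    then obtain i where i: "i < k" "sq i x < 2 / real n" by blast
    have "norm (x - a i) \<le> sqrt (2 / real n)" using i(2) by (intro real_le_rsqrt) simp
    then have m: "x \<in> cball (a i) (sqrt (2 / real n))" by (simp add: dist_norm norm_minus_commute)
    have "\<bar>err n x\<bar> \<le> K1 * real n powr (N / 4) * ?I (a i) (sqrt (2 / real n)) x"
      using K1(2)[OF n i x] m by simp
    also have "\<dots> \<le> (\<Sum>i<k. K1 * real n powr (N / 4) * ?I (a i) (sqrt (2 / real n)) x)"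
      using i(1) K1(1) by (intro member_le_sum) auto
    also have "\<dots> \<le> e n x" unfolding e_def using K2(1) by simp
    finally show ?thesis .
  next
    case False
    then have f: "\<forall>i<k. 2 / real n \<le> sq i x" by force
    have "\<bar>err n x\<bar> \<le> K2 * (1 / real n) ^ CARD('n) * ?I 0 (sqrt (2 * real n)) x"
    proof (cases "sq0 x > 2 * real n")
      case True
      then show ?thesis using K2(3)[OF n f] K2(1) by simp
    next
      case False
      then have "norm x \<le> sqrt (2 * real n)" by (intro real_le_rsqrt) simp
      then show ?thesis using K2(2)[OF n f] by simp
    qed
    also have "\<dots> \<le> e n x" unfolding e_def using K1(1) by (simp add: sum_nonneg)
    finally show ?thesis .
  qed
  have ve: "(\<lambda>x. \<bar>v x\<bar> * e n x) = (\<lambda>x. (\<Sum>i<k. K1 * real n powr (N / 4) * (\<bar>v x\<bar> * ?I (a i) (sqrt (2 / real n)) x))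
     + K2 * (1 / real n) ^ CARD('n) * (\<bar>v x\<bar> * ?I 0 (sqrt (2 * real n)) x))" for n
    unfolding e_def by (simp add: distrib_left sum_distrib_left mult_ac)
  note vb = integral_abs_cball_le[OF v]
  have ei: "integrable lborel (\<lambda>x. \<bar>v x\<bar> * e n x)" for n
    unfolding ve by (intro Bochner_Integration.integrable_add Bochner_Integration.integrable_sum integrable_mult_right vb) auto
  have eT: "(LINT x|lborel. \<bar>v x\<bar> * e n x) \<le> T n" if n: "large n" for n
  proof -
    have n0: "real n > 0" using n by (simp add: large_def)
    have sqrtpow: "sqrt (unit_ball_vol (real DIM(real^'n)) * (sqrt t) ^ DIM(real^'n)) = U * t powr (N / 4)" if t: "t > 0" for t
    proof -
      have "(sqrt t) ^ CARD('n) = t powr (N / 2)"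
        using t by (simp add: N_def powr_half_sqrt[symmetric] powr_realpow[symmetric] powr_powr)
      moreover have "sqrt (t powr (N / 2)) = t powr (N / 4)" using t by (simp add: powr_half_sqrt[symmetric] powr_powr)
      ultimately show ?thesis by (simp add: U_def real_sqrt_mult)
    qed
    have near: "K1 * real n powr (N / 4) * (LINT x|lborel. \<bar>v x\<bar> * ?I (a i) (sqrt (2 / real n)) x)
      \<le> K1 * (sqrt (LINT x|lborel. (v x)\<^sup>2 * ?I (a i) (sqrt (2 / real n)) x) * (U * 2 powr (N / 4)))" for i
    proof -
      have "(LINT x|lborel. \<bar>v x\<bar> * ?I (a i) (sqrt (2 / real n)) x)
        \<le> sqrt (LINT x|lborel. (v x)\<^sup>2 * ?I (a i) (sqrt (2 / real n)) x) * (U * (2 / real n) powr (N / 4))"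
        using vb(2)[of "sqrt (2 / real n)" "a i"] sqrtpow[of "2 / real n"] n0 by simp
      then have "K1 * real n powr (N / 4) * (LINT x|lborel. \<bar>v x\<bar> * ?I (a i) (sqrt (2 / real n)) x)
        \<le> K1 * real n powr (N / 4) * (sqrt (LINT x|lborel. (v x)\<^sup>2 * ?I (a i) (sqrt (2 / real n)) x) * (U * (2 / real n) powr (N / 4)))"
        using K1(1) by (intro mult_left_mono) auto
      also have "\<dots> = K1 * (sqrt (LINT x|lborel. (v x)\<^sup>2 * ?I (a i) (sqrt (2 / real n)) x) * (U * (real n powr (N / 4) * (2 / real n) powr (N / 4))))"
        by (simp add: mult_ac)
      also have "real n powr (N / 4) * (2 / real n) powr (N / 4) = 2 powr (N / 4)"
        using n0 by (simp add: powr_mult[symmetric])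
      finally show ?thesis .
    qed
    have far: "K2 * (1 / real n) ^ CARD('n) * (LINT x|lborel. \<bar>v x\<bar> * ?I 0 (sqrt (2 * real n)) x)
      \<le> K2 * (sqrt (LINT x|lborel. (v x)\<^sup>2) * (U * (2 powr (N / 4) * real n powr (- (3 * N / 4)))))"
    proof -
      have "(LINT x|lborel. (v x)\<^sup>2 * ?I 0 (sqrt (2 * real n)) x) \<le> (LINT x|lborel. (v x)\<^sup>2)"
        using vb(3)[of "sqrt (2 * real n)" 0] sq_intD(2)[OF v] by (intro integral_mono) (auto simp: indicator_def)
      then have s: "sqrt (LINT x|lborel. (v x)\<^sup>2 * ?I 0 (sqrt (2 * real n)) x) \<le> sqrt (LINT x|lborel. (v x)\<^sup>2)"
        by simp
      have "(LINT x|lborel. \<bar>v x\<bar> * ?I 0 (sqrt (2 * real n)) x)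
        \<le> sqrt (LINT x|lborel. (v x)\<^sup>2 * ?I 0 (sqrt (2 * real n)) x) * (U * (2 * real n) powr (N / 4))"
        using vb(2)[of "sqrt (2 * real n)" 0] sqrtpow[of "2 * real n"] n0 by simp
      also have "\<dots> \<le> sqrt (LINT x|lborel. (v x)\<^sup>2) * (U * (2 * real n) powr (N / 4))"
        using s U0 by (intro mult_right_mono) auto
      finally have "K2 * (1 / real n) ^ CARD('n) * (LINT x|lborel. \<bar>v x\<bar> * ?I 0 (sqrt (2 * real n)) x)
        \<le> K2 * (1 / real n) ^ CARD('n) * (sqrt (LINT x|lborel. (v x)\<^sup>2) * (U * (2 * real n) powr (N / 4)))"
        using K2(1) by (intro mult_left_mono) auto
      also have "\<dots> = K2 * (sqrt (LINT x|lborel. (v x)\<^sup>2) * (U * ((2 * real n) powr (N / 4) * (1 / real n) ^ CARD('n))))"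
        by (simp add: mult_ac)
      also have "(2 * real n) powr (N / 4) * (1 / real n) ^ CARD('n) = 2 powr (N / 4) * real n powr (- (3 * N / 4))"
      proof -
        have "(1 / real n) ^ CARD('n) = real n powr (- N)"
          using n0 by (simp add: N_def powr_minus powr_realpow power_one_over inverse_eq_divide)
        moreover have "real n powr (N / 4) * real n powr (- N) = real n powr (- (3 * N / 4))"
          unfolding powr_add[symmetric] by simp
        ultimately show ?thesis using n0 by (simp add: powr_mult mult.assoc)
      qed
      finally show ?thesis .
    qed
    have i1: "integrable lborel (\<lambda>x. \<bar>v x\<bar> * ?I b (sqrt t) x)" if "t \<ge> 0" for b t using vb(1)[of "sqrt t" b] that by simp
    have "(LINT x|lborel. \<bar>v x\<bar> * e n x) = (\<Sum>i<k. K1 * real n powr (N / 4) * (LINT x|lborel. \<bar>v x\<bar> * ?I (a i) (sqrt (2 / real n)) x))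
     + K2 * (1 / real n) ^ CARD('n) * (LINT x|lborel. \<bar>v x\<bar> * ?I 0 (sqrt (2 * real n)) x)"
      unfolding ve
      by (subst Bochner_Integration.integral_add)
        (auto simp: i1 intro!: Bochner_Integration.integrable_sum integrable_mult_right)
    also have "\<dots> \<le> T n" unfolding T_def by (intro add_mono sum_mono near far)
    finally show ?thesis .
  qed
  show ?thesis using that T0 eb ei eT by blast
qed

text \<open>The hypothesis \<open>weak\<close> expresses \<Delta>v = -q v, tested with mollifiers
  only. Kato's inequality with e^L \<open>chi n\<close> as test function gives 0 \<le>
  \<integral>|v| ((Q + q) e^L \<open>chi n\<close> + \<open>err n\<close>), and Q + q \<le> -1
  bounds the integral of |v| e^L \<open>chi n\<close> by that of |v| times the error.\<close>

lemma kernel_trivial: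
  fixes v q :: "real^'n \<Rightarrow> real"
  assumes v: "sq_int v" and qm: "q \<in> borel_measurable borel"
    and qb: "\<And>c. c > 0 \<Longrightarrow> \<exists>B. AE x in lborel. (\<forall>i<k. c \<le> sq i x) \<longrightarrow> \<bar>q x\<bar> \<le> B"
    and qQ: "AE x in lborel. x \<in> \<Omega> \<longrightarrow> Q x + q x \<le> -1"
    and weak: "\<And>\<epsilon> \<eta> D\<eta> D2\<eta> x. mollifier \<epsilon> \<eta> D\<eta> D2\<eta> \<Longrightarrow> cball x \<epsilon> \<subseteq> \<Omega> \<Longrightarrow>
      (LINT y|lborel. v y * (\<Sum>j\<in>UNIV. D2\<eta> j (x - y))) = - (LINT y|lborel. q y * v y * \<eta> (x - y))"
  shows "AE x in lborel. v x = 0"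
proof -
  note [measurable] = qm sq_intD(1)[OF v]
  obtain e T where T: "T \<longlonglongrightarrow> 0" and eb: "\<And>n x. large n \<Longrightarrow> x \<in> \<Omega> \<Longrightarrow> \<bar>err n x\<bar> \<le> e n x"
    and ei: "\<And>n. large n \<Longrightarrow> integrable lborel (\<lambda>x. \<bar>v x\<bar> * e n x)" and eT: "\<And>n. large n \<Longrightarrow> (LINT x|lborel. \<bar>v x\<bar> * e n x) \<le> T n"
    by (rule err_integral_tendsto[OF v]) (rule that)
  define \<phi> where "\<phi> n x = exp (L x) * chi n x" for n x
  define D\<phi> where "D\<phi> n j x = exp (L x) * Dchi n j x + (exp (L x) * DL j x) * chi n x" for n j x
  define D2\<phi> where "D2\<phi> n j x = exp (L x) * D2chi n j x + 2 * (exp (L x) * DL j x) * Dchi n j x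
     + (exp (L x) * (DL j x)\<^sup>2 + exp (L x) * D2L j x) * chi n x" for n j x
  have \<phi>0: "\<phi> n x = 0" "D\<phi> n j x = 0" "D2\<phi> n j x = 0" if "large n" "x \<notin> Ksup n" for n j x
    using chi_outside[OF that] by (auto simp: \<phi>_def D\<phi>_def D2\<phi>_def)
  have C2: "C2_on UNIV (\<phi> n) (D\<phi> n) (D2\<phi> n)" if n: "large n" for n
  proof (rule C2_on_extend_zero[OF open_\<Omega> compact_Ksup Ksup_\<Omega>])
    show "0 < n" using n by (simp add: large_def)
    have "C2_on \<Omega> (\<lambda>x. exp (L x)) (\<lambda>j x. exp (L x) * DL j x) (\<lambda>j x. exp (L x) * (DL j x)\<^sup>2 + exp (L x) * D2L j x)"
      by (rule C2_on_chain[OF C2_L]) (auto intro!: derivative_eq_intros continuous_intros)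
    moreover have "C2_on \<Omega> (chi n) (Dchi n) (D2chi n)" using C2_chi[of n] n by (auto simp: large_def intro: C2_on_subset)
    ultimately show "C2_on \<Omega> (\<phi> n) (D\<phi> n) (D2\<phi> n)"
      unfolding \<phi>_def[abs_def] D\<phi>_def[abs_def] D2\<phi>_def[abs_def] by (rule C2_on_mult)
  qed (use \<phi>0[OF n] in auto)
  \<comment> \<open>Product rule for the Laplacian: derivatives on the weight alone produce Q, and
    all terms in which the cutoff is differentiated are collected in \<open>err\<close>.\<close>
  have lap: "(\<Sum>j\<in>UNIV. D2\<phi> n j x) = \<phi> n x * Q x + err n x" for n x
  proof -
    have "(\<Sum>j\<in>UNIV. D2\<phi> n j x) = exp (L x) * (\<Sum>j\<in>UNIV. D2chi n j x) + 2 * (exp (L x) * (\<Sum>j\<in>UNIV. DL j x * Dchi n j x))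
      + (exp (L x) * (\<Sum>j\<in>UNIV. (DL j x)\<^sup>2) + exp (L x) * (\<Sum>j\<in>UNIV. D2L j x)) * chi n x"
      unfolding D2\<phi>_def by (simp add: sum.distrib sum_distrib_left sum_distrib_right mult_ac distrib_left distrib_right)
    then show ?thesis by (simp add: \<phi>_def Q_def err_def algebra_simps)
  qed
  have pos: "0 \<le> \<phi> n x" if "large n" for n x unfolding \<phi>_def using chi_nonneg[OF that] by simp
  have bound: "integrable lborel (\<lambda>x. \<bar>v x\<bar> * \<phi> n x) \<and> (LINT x|lborel. \<bar>v x\<bar> * \<phi> n x) \<le> T n" if n: "large n" for n
  proof -
    have n0: "n > 0" using n by (simp add: large_def)
    \<comment> \<open>q is bounded only away from the poles, so q v is truncated to obtain a
      square-integrable right-hand side. \<Gamma> halves the radius of the holes of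
      \<open>Ksup n\<close>; mollifiers of radius at most half of n^(-1/2) centred in
      \<open>Ksup n\<close> therefore do not notice the truncation.\<close>
    define \<Gamma> where "\<Gamma> = {y. \<forall>i<k. 1 / (4 * real n) \<le> sq i y}"
    have "closed \<Gamma>" unfolding \<Gamma>_def
      by (intro closed_Collect_all closed_Collect_imp closed_Collect_le open_Collect_const continuous_intros)
    then have [measurable]: "\<Gamma> \<in> sets borel" by (rule borel_closed)
    define g where "g y = indicator \<Gamma> y * (q y * v y)" for y
    obtain B where B: "AE x in lborel. (\<forall>i<k. 1 / (4 * real n) \<le> sq i x) \<longrightarrow> \<bar>q x\<bar> \<le> B"
      using qb[of "1 / (4 * real n)"] n0 by auto
    have gs: "sq_int g"
    proof -
      have ae: "AE x in lborel. norm ((g x)\<^sup>2) \<le> norm (B\<^sup>2 * (v x)\<^sup>2)"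
        using B
      proof eventually_elim
        case (elim x)
        show ?case
        proof (cases "x \<in> \<Gamma>")
          case True
          then have "\<bar>q x\<bar> \<le> B" using elim by (simp add: \<Gamma>_def)
          then have "(q x)\<^sup>2 \<le> B\<^sup>2" using power_mono[of "\<bar>q x\<bar>" B 2] by simp
          then show ?thesis using True by (simp add: g_def power_mult_distrib mult_right_mono)
        qed (simp add: g_def)
      qed
      have vi: "integrable lborel (\<lambda>x. B\<^sup>2 * (v x)\<^sup>2)" using sq_intD(2)[OF v] by simp
      have gm: "g \<in> borel_measurable borel" unfolding g_def by measurable
      then have "integrable lborel (\<lambda>x. (g x)\<^sup>2)"
        by (intro Bochner_Integration.integrable_bound[OF vi _ ae]) measurable
      then show ?thesis using gm by (simp add: sq_int_def)
    qed
    define d where "d = sqrt (1 / real n) / 2"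
    have d: "d > 0" using n0 by (simp add: d_def)
    have near: "1 / (4 * real n) \<le> sq i y" if "x \<in> Ksup n" "norm (x - y) \<le> d" "i < k" for x y i
    proof -
      have "sqrt (1 / real n) \<le> norm (x - a i)" using that by (intro real_le_lsqrt) (auto simp: Ksup_def)
      moreover have "norm (x - a i) \<le> norm (x - y) + norm (y - a i)" using norm_triangle_ineq[of "x - y" "y - a i"] by simp
      ultimately have "d \<le> norm (y - a i)" using that(2) unfolding d_def by linarith
      then have "d\<^sup>2 \<le> sq i y" using d by (intro power_mono) auto
      then show ?thesis using n0 by (simp add: d_def power_divide)
    qed
    have wk: "(\<Sum>j\<in>UNIV. conv v (D2\<eta> j) x) = - conv g \<eta> x"
      if \<epsilon>: "\<epsilon> \<le> d" and mo: "mollifier \<epsilon> \<eta> D\<eta> D2\<eta>" and x: "x \<in> Ksup n" for \<epsilon> \<eta> D\<eta> D2\<eta> x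
    proof -
      have c: "C2_on UNIV \<eta> D\<eta> D2\<eta>" and z: "\<And>z. norm z > \<epsilon> \<Longrightarrow> \<eta> z = 0" "\<And>j z. norm z > \<epsilon> \<Longrightarrow> D2\<eta> j z = 0"
        using mo by (auto simp: mollifier_def)
      have sub: "cball x \<epsilon> \<subseteq> \<Omega>"
      proof
        fix y assume "y \<in> cball x \<epsilon>"
        then have "norm (x - y) \<le> d" using \<epsilon> by (simp add: dist_norm)
        then have y: "1 / (4 * real n) \<le> sq i y" if "i < k" for i using near[OF x _ that] by blast
        have "y \<noteq> a i" if "i < k" for i
        proof
          assume "y = a i"
          then show False using y[OF that] n0 by simp
        qed
        then show "y \<in> \<Omega>" unfolding \<Omega>_def by auto
      qed
      have "(\<Sum>j\<in>UNIV. conv v (D2\<eta> j) x) = (LINT y|lborel. (\<Sum>j\<in>UNIV. v y *\<^sub>R D2\<eta> j (x - y)))"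
        unfolding conv_def
        by (rule Bochner_Integration.integral_sum[symmetric], rule conv_integrable[OF sq_int_loc_integrable[OF v] C2_onD(5)[OF c]])
          (use z in blast)
      also have "\<dots> = (LINT y|lborel. v y * (\<Sum>j\<in>UNIV. D2\<eta> j (x - y)))" by (simp add: sum_distrib_left)
      also have "\<dots> = - (LINT y|lborel. q y * v y * \<eta> (x - y))" by (rule weak[OF mo sub])
      also have "(LINT y|lborel. q y * v y * \<eta> (x - y)) = conv g \<eta> x"
        unfolding conv_def
      proof (rule Bochner_Integration.integral_cong[OF refl])
        fix y
        show "q y * v y * \<eta> (x - y) = g y *\<^sub>R \<eta> (x - y)"
        proof (cases "norm (x - y) \<le> \<epsilon>")
          case True
          then have "y \<in> \<Gamma>" using near[OF x] \<epsilon> by (simp add: \<Gamma>_def)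
          then show ?thesis by (simp add: g_def)
        qed (use z in auto)
      qed
      finally show ?thesis .
    qed
    note Ka = Kato_inequality[OF v gs C2[OF n] pos[OF n] compact_Ksup \<phi>0(1)[OF n] \<phi>0(2)[OF n] \<phi>0(3)[OF n] d wk]
    let ?F = "\<lambda>x. \<bar>v x\<bar> * (\<Sum>j\<in>UNIV. D2\<phi> n j x) + sgn (v x) * g x * \<phi> n x"
    have F: "integrable lborel ?F" "0 \<le> (LINT x|lborel. ?F x)" by (rule Ka; blast)+
    have obt: "compact (Ksup n)" by (rule compact_Ksup)
    have \<phi>i: "integrable lborel (\<lambda>x. \<bar>v x\<bar> * \<phi> n x)"
    proof -
      have "sq_int (\<phi> n)"
        by (rule integrable_extend_zero(1)[OF open_UNIV obt subset_UNIV C2_onD(1)[OF C2[OF n]] \<phi>0(1)[OF n]])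
      then have "integrable lborel (\<lambda>x. \<bar>v x * \<phi> n x\<bar>)" by (intro integrable_abs sq_int_mult v)
      then show ?thesis using pos[OF n] by (simp add: abs_mult)
    qed
    have "(LINT x|lborel. ?F x) \<le> (LINT x|lborel. \<bar>v x\<bar> * e n x - \<bar>v x\<bar> * \<phi> n x)"
    proof (rule integral_mono_AE[OF F(1)])
      show "integrable lborel (\<lambda>x. \<bar>v x\<bar> * e n x - \<bar>v x\<bar> * \<phi> n x)" using ei[OF n] \<phi>i by simp
      show "AE x in lborel. ?F x \<le> \<bar>v x\<bar> * e n x - \<bar>v x\<bar> * \<phi> n x"
        using qQ AE_\<Omega>
      proof eventually_elim
        case (elim x)
        have g\<phi>: "sgn (v x) * g x * \<phi> n x = \<bar>v x\<bar> * \<phi> n x * q x"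
        proof (cases "x \<in> Ksup n")
          case True
          then have "x \<in> \<Gamma>" using near[OF True, of x] d by (simp add: \<Gamma>_def)
          then show ?thesis by (simp add: g_def abs_sgn[of "v x"] mult_ac)
        qed (simp add: \<phi>0[OF n])
        have "?F x = \<bar>v x\<bar> * \<phi> n x * (Q x + q x) + \<bar>v x\<bar> * err n x"
          unfolding lap g\<phi> by (simp add: algebra_simps)
        also have "\<dots> \<le> \<bar>v x\<bar> * \<phi> n x * -1 + \<bar>v x\<bar> * e n x"
        proof (intro add_mono mult_left_mono)
          show "Q x + q x \<le> -1" using elim by blast
          show "err n x \<le> e n x" using eb[OF n, of x] elim by force
        qed (use pos[OF n] in auto)
        finally show ?case by simp
      qed
    qed
    then have "(LINT x|lborel. \<bar>v x\<bar> * \<phi> n x) \<le> (LINT x|lborel. \<bar>v x\<bar> * e n x)"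
      using F(2) ei[OF n] \<phi>i by simp
    then show ?thesis using eT[OF n] \<phi>i by simp
  qed
  \<comment> \<open>The integral for a fixed m is at most the integral for every n \<ge> m, hence at
    most \<open>T n\<close>, which tends to 0.\<close>
  have zero: "AE x in lborel. \<bar>v x\<bar> * \<phi> m x = 0" if m: "large m" for m
  proof -
    have m0: "m > 0" using m by (simp add: large_def)
    have "(LINT x|lborel. \<bar>v x\<bar> * \<phi> m x) \<le> 0"
    proof (rule LIMSEQ_le_const[OF T])
      show "\<exists>N. \<forall>n\<ge>N. (LINT x|lborel. \<bar>v x\<bar> * \<phi> m x) \<le> T n"
      proof (intro exI[of _ m] allI impI)
        fix n assume mn: "n \<ge> m"
        have n: "large n" by (rule large_mono[OF m mn])
        have "(LINT x|lborel. \<bar>v x\<bar> * \<phi> m x) \<le> (LINT x|lborel. \<bar>v x\<bar> * \<phi> n x)"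
          using bound[OF m] bound[OF n] chi_mono[OF m0 mn]
          by (intro integral_mono) (auto simp: \<phi>_def intro!: mult_left_mono)
        then show "(LINT x|lborel. \<bar>v x\<bar> * \<phi> m x) \<le> T n" using bound[OF n] by linarith
      qed
    qed
    moreover have "0 \<le> (LINT x|lborel. \<bar>v x\<bar> * \<phi> m x)"
      by (rule Bochner_Integration.integral_nonneg_AE) (use pos[OF m] in auto)
    ultimately have "(LINT x|lborel. \<bar>v x\<bar> * \<phi> m x) = 0" by simp
    then show ?thesis
      using integral_nonneg_eq_0_iff_AE[of lborel "\<lambda>x. \<bar>v x\<bar> * \<phi> m x"] bound[OF m] pos[OF m] by auto
  qed
  then have "AE x in lborel. \<forall>m. large m \<longrightarrow> \<bar>v x\<bar> * \<phi> m x = 0"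
    unfolding AE_all_countable by (intro allI) (metis (mono_tags, lifting) AE_I2 eventually_mono)
  then show ?thesis using AE_\<Omega>
  proof eventually_elim
    case (elim x)
    then obtain m where m: "large m" "chi m x = 1" using chi_eventually_pos by blast
    then have "\<bar>v x\<bar> * \<phi> m x = 0" using elim by blast
    then show ?case using m by (simp add: \<phi>_def)
  qed
qed

end

subsection \<open>Schroedinger operators with locally bounded potential off a finite set\<close>

lemma partial_deriv_add:
  assumes "\<And>x. u differentiable (at x)" "\<And>x. v differentiable (at x)"
  shows "partial_deriv j (\<lambda>x. u x + v x) = (\<lambda>x. partial_deriv j u x + partial_deriv j v x)"
proof
  fix x
  have "((\<lambda>x. u x + v x) has_derivative (\<lambda>h. frechet_derivative u (at x) h + frechet_derivative v (at x) h)) (at x)"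
    using assms by (intro has_derivative_add) (simp_all add: frechet_derivative_works[symmetric])
  then show "partial_deriv j (\<lambda>x. u x + v x) x = partial_deriv j u x + partial_deriv j v x"
    unfolding partial_deriv_def using frechet_derivative_at by metis
qed

lemma partial_deriv_scale:
  assumes "\<And>x. u differentiable (at x)"
  shows "partial_deriv j (\<lambda>x. c * u x) = (\<lambda>x. c * partial_deriv j u x)"
proof
  fix x
  have "((\<lambda>x. c * u x) has_derivative (\<lambda>h. c * frechet_derivative u (at x) h)) (at x)"
    using assms[of x] by (auto intro!: derivative_eq_intros simp: frechet_derivative_works)
  then show "partial_deriv j (\<lambda>x. c * u x) x = c * partial_deriv j u x"
    unfolding partial_deriv_def using frechet_derivative_at by metis
qed

lemma Ck_fun_add: "Ck_fun m u \<Longrightarrow> Ck_fun m v \<Longrightarrow> Ck_fun m (\<lambda>x. u x + v x)"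
proof (induction m arbitrary: u v)
  case (Suc m)
  then show ?case
    by (simp add: differentiable_on_def partial_deriv_add differentiable_add)
qed (simp add: continuous_on_add)

lemma Ck_fun_scale: "Ck_fun m u \<Longrightarrow> Ck_fun m (\<lambda>x. c * u x)"
proof (induction m arbitrary: u)
  case (Suc m)
  then show ?case
    by (simp add: differentiable_on_def partial_deriv_scale differentiable_mult)
qed (simp add: continuous_on_mult_left)

lemma Cc_infty_differentiable:
  assumes "u \<in> Cc_infty S" shows "u differentiable (at x)" "partial_deriv j u differentiable (at x)"
proof -
  have "Ck_fun (Suc (Suc 0)) u" using assms unfolding Cc_infty_def smooth_fun_def by blast
  then show "u differentiable (at x)" "partial_deriv j u differentiable (at x)" by (auto simp: differentiable_on_def)
qed

lemma Cc_infty_scale: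
  assumes "u \<in> Cc_infty S"
  shows "(\<lambda>x. c * u x) \<in> Cc_infty S" "laplacian (\<lambda>x. c * u x) = (\<lambda>x. c * laplacian u x)"
proof -
  have sub: "tsupport (\<lambda>x. c * u x) \<subseteq> tsupport u" unfolding tsupport_def by (intro closure_mono) auto
  have "compact (tsupport (\<lambda>x. c * u x))"
  proof -
    have "closed (tsupport (\<lambda>x. c * u x))" by (simp add: tsupport_def)
    then show ?thesis using compact_Int_closed[of "tsupport u"] sub assms
      by (metis (no_types, lifting) Cc_infty_def inf.absorb_iff2 mem_Collect_eq)
  qed
  then show "(\<lambda>x. c * u x) \<in> Cc_infty S"
    using assms sub by (auto simp: Cc_infty_def smooth_fun_def intro: Ck_fun_scale)
  show "laplacian (\<lambda>x. c * u x) = (\<lambda>x. c * laplacian u x)"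
    unfolding laplacian_def using Cc_infty_differentiable[OF assms]
    by (simp add: partial_deriv_scale sum_distrib_left)
qed

lemma Cc_infty_add:
  assumes "u \<in> Cc_infty S" "v \<in> Cc_infty S"
  shows "(\<lambda>x. u x + v x) \<in> Cc_infty S" "laplacian (\<lambda>x. u x + v x) = (\<lambda>x. laplacian u x + laplacian v x)"
proof -
  have sub: "tsupport (\<lambda>x. u x + v x) \<subseteq> tsupport u \<union> tsupport v"
    unfolding tsupport_def closure_Un[symmetric] by (intro closure_mono) auto
  have "compact (tsupport (\<lambda>x. u x + v x))"
  proof -
    have "closed (tsupport (\<lambda>x. u x + v x))" by (simp add: tsupport_def)
    moreover have "compact (tsupport u \<union> tsupport v)" using assms by (auto simp: Cc_infty_def)
    ultimately show ?thesis using compact_Int_closed sub by (metis inf.absorb_iff2)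
  qed
  then show "(\<lambda>x. u x + v x) \<in> Cc_infty S"
    using assms sub by (auto simp: Cc_infty_def smooth_fun_def intro: Ck_fun_add)
  show "laplacian (\<lambda>x. u x + v x) = (\<lambda>x. laplacian u x + laplacian v x)"
    unfolding laplacian_def using Cc_infty_differentiable[OF assms(1)] Cc_infty_differentiable[OF assms(2)]
    by (simp add: partial_deriv_add sum.distrib)
qed

lemma zero_Cc_infty: "(\<lambda>x::real^'n::finite. 0) \<in> Cc_infty S"
proof -
  have "Ck_fun m (\<lambda>x::real^'n. 0)" for m
  proof (induction m)
    case (Suc m)
    have "partial_deriv j (\<lambda>x::real^'n. 0) = (\<lambda>x. 0)" for j
      unfolding partial_deriv_def by simp
    then show ?case using Suc by simp
  qed simp
  then show ?thesis by (simp add: Cc_infty_def smooth_fun_def tsupport_def)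
qed

lemma L2_continuous:
  fixes u :: "real^'n::finite \<Rightarrow> complex"
  assumes "continuous_on UNIV u" "compact C" "\<And>x. x \<notin> C \<Longrightarrow> u x = 0"
  shows "u \<in> L2"
proof -
  have "integrable lborel (\<lambda>x. (norm (u x))\<^sup>2)"
    by (rule integrable_extend_zero(2)[OF open_UNIV assms(2) subset_UNIV]) (use assms in \<open>auto intro!: continuous_intros\<close>)
  then have "integrable lebesgue (\<lambda>x. (norm (u x))\<^sup>2)"
    using assms(1) by (subst integrable_completion) (auto intro: borel_measurable_continuous_onI continuous_intros)
  moreover have "u \<in> borel_measurable lebesgue"
    using borel_measurable_continuous_onI[OF assms(1)] by (intro measurable_completion) simp
  ultimately show ?thesis by (simp add: L2_def)
qed

lemma lebesgue_integral_lborel: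
  fixes f :: "'a::euclidean_space \<Rightarrow> 'b::{banach, second_countable_topology}"
  assumes "integrable lborel f"
  shows "integrable lebesgue f" "integral\<^sup>L lebesgue f = integral\<^sup>L lborel f"
  using assms borel_measurable_integrable[OF assms] by (auto simp: integrable_completion integral_completion)

section \<open>The operator on test functions and its symmetry\<close>

definition loc_bounded_on :: "(real^'n::finite) set \<Rightarrow> (real^'n \<Rightarrow> real) \<Rightarrow> bool" where
  "loc_bounded_on S V \<longleftrightarrow> V \<in> borel_measurable lebesgue \<and>
     (\<forall>C. compact C \<longrightarrow> C \<subseteq> S \<longrightarrow> (\<exists>B. AE x in lebesgue. x \<in> C \<longrightarrow> \<bar>V x\<bar> \<le> B))"

lemma loc_bounded_mult_L2:
  assumes V: "loc_bounded_on S V" and u: "u \<in> L2" "compact C" "C \<subseteq> S" "\<And>x. x \<notin> C \<Longrightarrow> u x = 0"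
  shows "(\<lambda>x. complex_of_real (V x) * u x) \<in> L2"
proof -
  obtain B where B: "AE x in lebesgue. x \<in> C \<longrightarrow> \<bar>V x\<bar> \<le> B" using V u by (auto simp: loc_bounded_on_def)
  have [measurable]: "V \<in> borel_measurable lebesgue" "u \<in> borel_measurable lebesgue"
    using V u by (auto simp: loc_bounded_on_def L2_def)
  show ?thesis
  proof (rule L2_dominated[OF u(1)])
    show "AE x in lebesgue. norm (complex_of_real (V x) * u x) \<le> B * norm (u x)"
      using B
    proof eventually_elim
      case (elim x)
      then show ?case using u(4)[of x] by (cases "x \<in> C") (auto simp: norm_mult intro: mult_right_mono)
    qed
  qed measurable
qed

definition schroed :: "(real^'n::finite \<Rightarrow> real) \<Rightarrow> (real^'n \<Rightarrow> complex) \<Rightarrow> real^'n \<Rightarrow> complex" where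
  "schroed V u = (\<lambda>x. - laplacian u x - complex_of_real (V x) * u x)"

lemma schroedinger_graph_alt: "schroedinger_graph V D = {(u, schroed V u) | u. u \<in> D}"
  by (simp add: schroedinger_graph_def schroed_def)

lemma Cc_infty_L2:
  assumes u: "u \<in> Cc_infty S"
  shows "u \<in> L2" "laplacian u \<in> L2"
proof -
  note c = Cc_infty_C2[OF u]
  show "u \<in> L2" by (rule L2_continuous[OF C2_onD(1)[OF c(1)] c(2) c(4)])
  have "continuous_on UNIV (laplacian u)"
    unfolding laplacian_def[abs_def] by (intro continuous_intros C2_onD(5)[OF c(1)])
  then show "laplacian u \<in> L2" by (rule L2_continuous[OF _ c(2) c(7)])
qed

lemma schroed_L2:
  assumes V: "loc_bounded_on S V" and u: "u \<in> Cc_infty S"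
  shows "(\<lambda>x. complex_of_real (V x) * u x) \<in> L2" "schroed V u \<in> L2"
proof -
  note c = Cc_infty_C2[OF u]
  show Vu: "(\<lambda>x. complex_of_real (V x) * u x) \<in> L2"
    by (rule loc_bounded_mult_L2[OF V Cc_infty_L2(1)[OF u] c(2,3,4)])
  have "(\<lambda>x. (-1) * laplacian u x) - (\<lambda>x. complex_of_real (V x) * u x) \<in> L2"
    by (intro L2_diff L2_scale Cc_infty_L2(2)[OF u] Vu)
  then show "schroed V u \<in> L2" by (simp add: schroed_def fun_diff_def)
qed

text \<open>\<open>v\<close> is required to be C^2 on \<open>S\<close> only, since the support of a
  test function stays inside \<open>S\<close>. This covers both the symmetry of the operator and the
  singular solutions, which are not differentiable at the poles.\<close>

lemma schroed_Green:
  fixes v :: "real^'n::finite \<Rightarrow> complex"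
  assumes S: "open S" and V: "loc_bounded_on S V" and u: "u \<in> Cc_infty S"
    and v: "C2_on S v Dv D2v" "v \<in> L2"
    and w: "w \<in> L2" "\<And>x. x \<in> S \<Longrightarrow> w x = - (\<Sum>j\<in>UNIV. D2v j x) - complex_of_real (V x) * v x"
  shows "L2_inner (schroed V u) v = L2_inner u w"
proof -
  note c = Cc_infty_C2[OF u]
  have cn: "C2_on S (\<lambda>x. cnj (u x)) (\<lambda>j x. cnj (partial_deriv j u x)) (\<lambda>j x. cnj (partial_deriv j (partial_deriv j u) x))"
    by (rule C2_on_linear[OF bounded_linear_cnj C2_on_subset[OF c(1) subset_UNIV]])
  have G: "integrable lborel (\<lambda>x. cnj (u x) * (\<Sum>j\<in>UNIV. D2v j x) - v x * (\<Sum>j\<in>UNIV. cnj (partial_deriv j (partial_deriv j u) x)))"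
    "(LINT x|lborel. cnj (u x) * (\<Sum>j\<in>UNIV. D2v j x) - v x * (\<Sum>j\<in>UNIV. cnj (partial_deriv j (partial_deriv j u) x))) = 0"
    by (rule Green_identity[OF S c(2,3) cn v(1)]; simp add: c)+
  have eq: "cnj (schroed V u x) * v x - cnj (u x) * w x
    = cnj (u x) * (\<Sum>j\<in>UNIV. D2v j x) - v x * (\<Sum>j\<in>UNIV. cnj (partial_deriv j (partial_deriv j u) x))" for x
  proof (cases "x \<in> S")
    case True
    then show ?thesis unfolding w(2)[OF True] by (simp add: schroed_def laplacian_def algebra_simps)
  next
    case False
    then have "x \<notin> tsupport u" using c(3) by auto
    then show ?thesis by (simp add: c schroed_def)
  qed
  have "L2_inner (schroed V u) v - L2_inner u w = (LINT x|lebesgue. cnj (schroed V u x) * v x - cnj (u x) * w x)"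
    unfolding L2_inner_def
    by (rule Bochner_Integration.integral_diff[symmetric]) (intro L2_mult_integrable schroed_L2[OF V u] Cc_infty_L2[OF u] v w)+
  also have "\<dots> = 0" unfolding eq using lebesgue_integral_lborel(2)[OF G(1)] G(2) by simp
  finally show ?thesis by simp
qed

lemma schroed_symmetric:
  assumes S: "open S" and V: "loc_bounded_on S V" and u: "u \<in> Cc_infty S" and v: "v \<in> Cc_infty S"
  shows "L2_inner (schroed V u) v = L2_inner u (schroed V v)"
  by (rule schroed_Green[OF S V u C2_on_subset[OF Cc_infty_C2(1)[OF v] subset_UNIV] Cc_infty_L2(1)[OF v] schroed_L2(2)[OF V v]])
    (simp add: schroed_def laplacian_def)

text \<open>L^2 is built on Lebesgue measurable functions, whereas translations and mollification
  are carried out with Borel functions; the two levels meet through this choice of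
  representative.\<close>

lemma borel_representative:
  fixes f :: "'a::euclidean_space \<Rightarrow> real"
  assumes "f \<in> borel_measurable lebesgue"
  obtains g where "g \<in> borel_measurable borel" "AE x in lebesgue. f x = g x"
proof -
  obtain g where "g \<in> borel_measurable lborel" "AE x in lborel. f x = g x"
    using completion_ex_borel_measurable_real[OF assms] by blast
  then show ?thesis using that[of g] by (auto intro: AE_completion)
qed

section \<open>Essential self-adjointness from a weight\<close>

context poles
begin

lemma compact_away_from_poles:
  assumes C: "compact C" "C \<subseteq> \<Omega>"
  shows "\<exists>c>0. \<forall>x\<in>C. \<forall>i<k. c \<le> sq i x"
proof -
  have "\<exists>c>0. \<forall>x\<in>C. c \<le> sq i x" if i: "i < k" for i
  proof -
    have "a i \<notin> C" using C(2) i by (auto simp: \<Omega>_def)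
    then obtain d where d: "d > 0" "\<And>x. x \<in> C \<Longrightarrow> d \<le> dist (a i) x"
      using separate_point_closed[of C "a i"] compact_imp_closed[OF C(1)] by metis
    have "d\<^sup>2 \<le> sq i x" if "x \<in> C" for x
      using d(2)[OF that] d(1) by (intro power_mono) (auto simp: dist_norm norm_minus_commute)
    then show ?thesis using d(1) by (intro exI[of _ "d\<^sup>2"]) auto
  qed
  then obtain c where c: "\<And>i. i < k \<Longrightarrow> c i > 0" "\<And>i x. i < k \<Longrightarrow> x \<in> C \<Longrightarrow> c i \<le> sq i x" by metis
  \<comment> \<open>The extra element 1 keeps the set nonempty when there is no pole.\<close>
  have fin: "finite (insert 1 (c ` {..<k}))" by simp
  have "Min (insert 1 (c ` {..<k})) > 0" using c(1) by (subst Min_gr_iff) auto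
  moreover have "Min (insert 1 (c ` {..<k})) \<le> sq i x" if "i < k" "x \<in> C" for i x
  proof -
    have "Min (insert 1 (c ` {..<k})) \<le> c i" using that by (intro Min_le) auto
    then show ?thesis using c(2)[OF that] by linarith
  qed
  ultimately show ?thesis by blast
qed

lemma loc_bounded_on_\<Omega>:
  assumes Vm: "V \<in> borel_measurable lebesgue"
    and Vb: "\<And>c. c > 0 \<Longrightarrow> \<exists>B. AE x in lebesgue. (\<forall>i<k. c \<le> sq i x) \<longrightarrow> \<bar>V x\<bar> \<le> B"
  shows "loc_bounded_on \<Omega> V"
  unfolding loc_bounded_on_def
proof (intro conjI allI impI Vm)
  fix C assume "compact C" "C \<subseteq> \<Omega>"
  then obtain c where c: "c > 0" "\<forall>x\<in>C. \<forall>i<k. c \<le> sq i x" using compact_away_from_poles by blast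
  obtain B where "AE x in lebesgue. (\<forall>i<k. c \<le> sq i x) \<longrightarrow> \<bar>V x\<bar> \<le> B" using Vb[OF c(1)] by blast
  then have "AE x in lebesgue. x \<in> C \<longrightarrow> \<bar>V x\<bar> \<le> B" by eventually_elim (use c(2) in blast)
  then show "\<exists>B. AE x in lebesgue. x \<in> C \<longrightarrow> \<bar>V x\<bar> \<le> B" by blast
qed

text \<open>One pointwise inequality between V and the weight feeds both analytic conditions of the
  criterion: \<open>form_bound\<close> turns it into coercivity and \<open>kernel_trivial\<close>
  into density of the range.\<close>

lemma essentially_self_adjoint_of_weight:
  fixes V :: "real^'n \<Rightarrow> real"
  assumes Vm: "V \<in> borel_measurable lebesgue"
    and Vb: "\<And>c. c > 0 \<Longrightarrow> \<exists>B. AE x in lebesgue. (\<forall>i<k. c \<le> sq i x) \<longrightarrow> \<bar>V x\<bar> \<le> B"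
    and VQ: "AE x in lebesgue. x \<in> \<Omega> \<longrightarrow> Q x + V x \<le> M - 1"
  shows "essentially_self_adjoint (schroedinger_graph V (Cc_infty \<Omega>))"
proof -
  obtain V0 where V0m [measurable]: "V0 \<in> borel_measurable borel" and V0: "AE x in lebesgue. V x = V0 x"
    using borel_representative[OF Vm] by blast
  note [measurable] = Vm
  \<comment> \<open>A Borel representative of V shifted by M. The inequality for the weight becomes
    Q + q \<le> -1, the form used in \<open>form_bound\<close> and
    \<open>kernel_trivial\<close>.\<close>
  define q where "q x = V0 x - M" for x
  have qm [measurable]: "q \<in> borel_measurable borel" unfolding q_def by measurable
  have qb: "\<exists>B. AE x in lborel. (\<forall>i<k. c \<le> sq i x) \<longrightarrow> \<bar>q x\<bar> \<le> B" if c: "c > 0" for c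
  proof -
    obtain B where B: "AE x in lebesgue. (\<forall>i<k. c \<le> sq i x) \<longrightarrow> \<bar>V x\<bar> \<le> B" using Vb[OF c] by blast
    have "AE x in lebesgue. (\<forall>i<k. c \<le> sq i x) \<longrightarrow> \<bar>q x\<bar> \<le> B + \<bar>M\<bar>"
      using B V0 by eventually_elim (auto simp: q_def)
    then show ?thesis by (auto simp: AE_completion_iff)
  qed
  have qQ: "AE x in lborel. x \<in> \<Omega> \<longrightarrow> Q x + q x \<le> -1"
  proof -
    have "AE x in lebesgue. x \<in> \<Omega> \<longrightarrow> Q x + q x \<le> -1"
      using VQ V0 by eventually_elim (auto simp: q_def)
    then show ?thesis by (simp add: AE_completion_iff)
  qed
  have V: "loc_bounded_on \<Omega> V" by (rule loc_bounded_on_\<Omega>[OF Vm Vb])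
  let ?D = "Cc_infty \<Omega>"
  show ?thesis unfolding schroedinger_graph_alt
  proof (rule essentially_self_adjoint_criterion[where M=M])
    show "?D \<noteq> {}" using zero_Cc_infty by blast
    show "u \<in> ?D \<Longrightarrow> u \<in> L2" for u by (rule Cc_infty_L2)
    show "u \<in> ?D \<Longrightarrow> schroed V u \<in> L2" for u by (rule schroed_L2[OF V])
    show "u \<in> ?D \<Longrightarrow> v \<in> ?D \<Longrightarrow> (\<lambda>x. u x + v x) \<in> ?D \<and> schroed V (\<lambda>x. u x + v x) = (\<lambda>x. schroed V u x + schroed V v x)" for u v
      using Cc_infty_add[of u \<Omega> v] by (auto simp: schroed_def algebra_simps)
    show "u \<in> ?D \<Longrightarrow> (\<lambda>x. c * u x) \<in> ?D \<and> schroed V (\<lambda>x. c * u x) = (\<lambda>x. c * schroed V u x)" for u c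
      using Cc_infty_scale[of u \<Omega> c] by (auto simp: schroed_def algebra_simps)
    show "u \<in> ?D \<Longrightarrow> v \<in> ?D \<Longrightarrow> L2_inner (schroed V u) v = L2_inner u (schroed V v)" for u v
      by (rule schroed_symmetric[OF open_\<Omega> V])
    fix u assume u: "u \<in> ?D"
    show "(L2_norm u)\<^sup>2 \<le> Re (L2_inner (\<lambda>x. schroed V u x + complex_of_real M * u x) u)"
    proof -
      note c = Cc_infty_C2[OF u]
      \<comment> \<open>\<open>l\<close> stands for Re or Im. The Laplacian and the real potential
        commute with it, so the complex form is the sum of two real ones.\<close>
      have part: "(LINT x|lborel. (l (u x))\<^sup>2) \<le> - (LINT x|lborel. l (u x) * l (laplacian u x)) - (LINT x|lborel. q x * (l (u x))\<^sup>2)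
          \<and> integrable lborel (\<lambda>x. (l (u x))\<^sup>2) \<and> integrable lborel (\<lambda>x. l (u x) * l (laplacian u x)) \<and> integrable lborel (\<lambda>x. q x * (l (u x))\<^sup>2)"
        if l: "bounded_linear l" for l :: "complex \<Rightarrow> real"
      proof -
        have l0: "l 0 = 0" using l by (simp add: linear_simps)
        have C2: "C2_on UNIV (\<lambda>x. l (u x)) (\<lambda>j x. l (partial_deriv j u x)) (\<lambda>j x. l (partial_deriv j (partial_deriv j u) x))"
          by (rule C2_on_linear[OF l c(1)])
        have suml: "(\<Sum>j\<in>UNIV. l (partial_deriv j (partial_deriv j u) x)) = l (laplacian u x)" for x
          unfolding laplacian_def using l by (simp add: linear_sum bounded_linear.linear)
        have lc: "continuous_on UNIV (\<lambda>x. l (laplacian u x))"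
          unfolding suml[symmetric] by (intro continuous_intros C2_onD(5)[OF C2])
        have i1: "integrable lborel (\<lambda>x. (l (u x))\<^sup>2)"
          by (rule integrable_extend_zero(2)[OF open_UNIV c(2) subset_UNIV])
            (auto intro!: continuous_intros C2_onD(1)[OF C2] simp: c l0)
        have i2: "integrable lborel (\<lambda>x. l (u x) * l (laplacian u x))"
          by (rule integrable_extend_zero(2)[OF open_UNIV c(2) subset_UNIV])
            (auto intro!: continuous_intros C2_onD(1)[OF C2] lc simp: c l0)
        have lm [measurable]: "(\<lambda>x. l (u x)) \<in> borel_measurable borel"
          by (rule borel_measurable_continuous_onI[OF C2_onD(1)[OF C2]])
        obtain r where r: "r > 0" "\<forall>x\<in>tsupport u. \<forall>i<k. r \<le> sq i x" using compact_away_from_poles[OF c(2,3)] by blast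
        obtain B where B: "AE x in lborel. (\<forall>i<k. r \<le> sq i x) \<longrightarrow> \<bar>q x\<bar> \<le> B" using qb[OF r(1)] by blast
        have ae: "AE x in lborel. norm (q x * (l (u x))\<^sup>2) \<le> norm (B * (l (u x))\<^sup>2)"
          using B
        proof eventually_elim
          case (elim x)
          show ?case
          proof (cases "x \<in> tsupport u")
            case True
            then have "\<bar>q x\<bar> \<le> \<bar>B\<bar>" using elim r(2) by force
            then show ?thesis by (simp add: abs_mult mult_right_mono)
          qed (simp add: c l0)
        qed
        have i3': "integrable lborel (\<lambda>x. B * (l (u x))\<^sup>2)" using i1 by simp
        have i3: "integrable lborel (\<lambda>x. q x * (l (u x))\<^sup>2)"
          by (rule Bochner_Integration.integrable_bound[OF i3' _ ae]) measurable
        have "(LINT x|lborel. l (u x) * l (laplacian u x)) + (LINT x|lborel. q x * (l (u x))\<^sup>2) \<le> - (LINT x|lborel. (l (u x))\<^sup>2)"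
          using form_bound[OF c(2,3) C2 _ _ _ qQ i3] unfolding suml by (simp add: c l0)
        then show ?thesis using i1 i2 i3 by simp
      qed
      note R = part[OF bounded_linear_Re] and I = part[OF bounded_linear_Im]
      let ?f = "\<lambda>x. schroed V u x + complex_of_real M * u x"
      have fL: "?f \<in> L2" by (intro L2_add L2_scale schroed_L2[OF V u] Cc_infty_L2[OF u])
      have "Re (L2_inner ?f u) = (LINT x|lebesgue. Re (cnj (?f x) * u x))"
        unfolding L2_inner_def by (rule integral_Re[symmetric]) (rule L2_mult_integrable[OF fL Cc_infty_L2(1)[OF u]])
      also have "\<dots> = (LINT x|lebesgue. - (Re (u x) * Re (laplacian u x)) - q x * (Re (u x))\<^sup>2 + (- (Im (u x) * Im (laplacian u x)) - q x * (Im (u x))\<^sup>2))"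
      proof (rule integral_cong_AE)
        show "AE x in lebesgue. Re (cnj (?f x) * u x) = - (Re (u x) * Re (laplacian u x)) - q x * (Re (u x))\<^sup>2 + (- (Im (u x) * Im (laplacian u x)) - q x * (Im (u x))\<^sup>2)"
          using V0 by eventually_elim (simp add: schroed_def q_def power2_eq_square algebra_simps)
        show "(\<lambda>x. Re (cnj (?f x) * u x)) \<in> borel_measurable lebesgue"
          using borel_measurable_integrable[OF L2_mult_integrable[OF fL Cc_infty_L2(1)[OF u]]] by measurable
        show "(\<lambda>x. - (Re (u x) * Re (laplacian u x)) - q x * (Re (u x))\<^sup>2 + (- (Im (u x) * Im (laplacian u x)) - q x * (Im (u x))\<^sup>2)) \<in> borel_measurable lebesgue"
          by (rule borel_measurable_integrable, rule lebesgue_integral_lborel(1))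
            (use R I in \<open>intro Bochner_Integration.integrable_add Bochner_Integration.integrable_diff Bochner_Integration.integrable_minus; blast\<close>)
      qed
      also have "\<dots> = (LINT x|lborel. - (Re (u x) * Re (laplacian u x)) - q x * (Re (u x))\<^sup>2 + (- (Im (u x) * Im (laplacian u x)) - q x * (Im (u x))\<^sup>2))"
        by (rule lebesgue_integral_lborel(2))
          (use R I in \<open>intro Bochner_Integration.integrable_add Bochner_Integration.integrable_diff Bochner_Integration.integrable_minus; blast\<close>)
      also have "\<dots> = (- (LINT x|lborel. Re (u x) * Re (laplacian u x)) - (LINT x|lborel. q x * (Re (u x))\<^sup>2))
          + (- (LINT x|lborel. Im (u x) * Im (laplacian u x)) - (LINT x|lborel. q x * (Im (u x))\<^sup>2))"
        using R I by simp
      finally have 1: "Re (L2_inner ?f u) = \<dots>" .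
      have "(L2_norm u)\<^sup>2 = (LINT x|lborel. (Re (u x))\<^sup>2 + (Im (u x))\<^sup>2)"
        unfolding L2_norm_sq cmod_power2 by (rule lebesgue_integral_lborel(2)) (use R I in auto)
      also have "\<dots> = (LINT x|lborel. (Re (u x))\<^sup>2) + (LINT x|lborel. (Im (u x))\<^sup>2)" using R I by simp
      finally have 2: "(L2_norm u)\<^sup>2 = \<dots>" .
      show ?thesis unfolding 1 2 using R I by linarith
    qed
  next
    fix z :: "real^'n \<Rightarrow> complex" assume z: "z \<in> L2"
      and orth: "\<And>u. u \<in> ?D \<Longrightarrow> L2_inner (\<lambda>x. schroed V u x + complex_of_real M * u x) z = 0"
    \<comment> \<open>Kato's inequality is applied to Re z and Im z separately. The mollifiers used
      as test functions are real, and so are V and M; hence each part satisfies the weak equation by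
      itself.\<close>
    have part: "AE x in lebesgue. l (z x) = 0"
      if l: "bounded_linear l" and le: "\<And>y. \<bar>l y\<bar> \<le> norm y" and lr: "\<And>(r::real) y. l (of_real r * y) = r * l y" for l :: "complex \<Rightarrow> real"
    proof -
      note [measurable] = L2_borel[OF z]
      have lm: "(\<lambda>x. l (z x)) \<in> borel_measurable lebesgue"
        by (rule borel_measurable_continuous_on[OF linear_continuous_on[OF l] L2_borel[OF z]])
      obtain v where v [measurable]: "v \<in> borel_measurable borel" and vz: "AE x in lebesgue. l (z x) = v x"
        using borel_representative[OF lm] by blast
      have "integrable lebesgue (\<lambda>x. (v x)\<^sup>2)"
      proof (rule Bochner_Integration.integrable_bound[OF L2_integrable[OF z]])
        show "AE x in lebesgue. norm ((v x)\<^sup>2) \<le> norm ((norm (z x))\<^sup>2)"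
          using vz
        proof eventually_elim
          case (elim x)
          then show ?case using power_mono[OF le[of "z x"] abs_ge_zero, of 2] by simp
        qed
        show "(\<lambda>x. (v x)\<^sup>2) \<in> borel_measurable lebesgue" by (intro measurable_completion) measurable
      qed
      then have vs: "sq_int v" unfolding sq_int_def by (subst (asm) integrable_completion) auto
      have "AE x in lborel. v x = 0"
      proof (rule kernel_trivial[OF vs qm qb qQ])
        fix \<epsilon> and \<eta> :: "real^'n \<Rightarrow> real" and D\<eta> D2\<eta> and x :: "real^'n" assume mo: "mollifier \<epsilon> \<eta> D\<eta> D2\<eta>" and sub: "cball x \<epsilon> \<subseteq> \<Omega>"
        let ?u = "\<lambda>y. complex_of_real (\<eta> (x - y))"
        have uD: "?u \<in> ?D" and lap: "laplacian ?u = (\<lambda>y. complex_of_real (\<Sum>j\<in>UNIV. D2\<eta> j (x - y)))"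
          using mo sub by (auto simp: mollifier_def fun_eq_iff)
        have C2: "C2_on UNIV \<eta> D\<eta> D2\<eta>" and z0: "\<And>j z. norm z > \<epsilon> \<Longrightarrow> D2\<eta> j z = 0"
          using mo by (auto simp: mollifier_def)
        let ?S = "\<lambda>y. \<Sum>j\<in>UNIV. D2\<eta> j (x - y)"
        let ?f = "\<lambda>y. schroed V ?u y + complex_of_real M * ?u y"
        have f: "?f y = complex_of_real (- ?S y - V y * \<eta> (x - y) + M * \<eta> (x - y))" for y
          by (simp add: schroed_def lap)
        have fL: "?f \<in> L2" by (intro L2_add L2_scale schroed_L2[OF V uD] Cc_infty_L2[OF uD])
        have fz: "integrable lebesgue (\<lambda>y. cnj (?f y) * z y)" by (rule L2_mult_integrable[OF fL z])
        have pt: "l (cnj (?f y) * z y) = (- ?S y - V y * \<eta> (x - y) + M * \<eta> (x - y)) * l (z y)" for y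
          unfolding f complex_cnj_complex_of_real lr ..
        have int: "integrable lebesgue (\<lambda>y. (- ?S y - V y * \<eta> (x - y) + M * \<eta> (x - y)) * l (z y))"
          using integrable_bounded_linear[OF l fz] unfolding pt .
        have "(LINT y|lebesgue. (- ?S y - V y * \<eta> (x - y) + M * \<eta> (x - y)) * l (z y)) = l (LINT y|lebesgue. cnj (?f y) * z y)"
          unfolding pt[symmetric] by (rule integral_bounded_linear[OF l fz])
        also have "\<dots> = 0" using orth[OF uD] l by (simp add: L2_inner_def linear_simps)
        finally have 0: "(LINT y|lebesgue. (- ?S y - V y * \<eta> (x - y) + M * \<eta> (x - y)) * l (z y)) = 0" .
        have \<eta>m [measurable]: "\<eta> \<in> borel_measurable borel" "D2\<eta> j \<in> borel_measurable borel" for j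
          using C2_onD(1,5)[OF C2] by (auto intro: borel_measurable_continuous_onI)
        let ?h = "\<lambda>y. - (v y * ?S y) - q y * v y * \<eta> (x - y)"
        have hm: "?h \<in> borel_measurable borel" by measurable
        have ae: "AE y in lebesgue. (- ?S y - V y * \<eta> (x - y) + M * \<eta> (x - y)) * l (z y) = ?h y"
          using vz V0 by eventually_elim (simp add: q_def algebra_simps)
        have hm': "?h \<in> borel_measurable lebesgue" using hm by (intro measurable_completion) simp
        have hi: "integrable lebesgue ?h" by (rule integrable_cong_AE_imp[OF int hm']) (use ae in \<open>auto elim: eventually_mono\<close>)
        have h0: "(LINT y|lebesgue. ?h y) = 0"
          using integral_cong_AE[OF borel_measurable_integrable[OF int] hm' ae] 0 by simp
        have hi': "integrable lborel ?h" using hi hm by (subst (asm) integrable_completion) auto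
        have h0': "(LINT y|lborel. ?h y) = 0" using h0 lebesgue_integral_lborel(2)[OF hi'] by simp
        have Si: "integrable lborel (\<lambda>y. v y * ?S y)"
        proof -
          have "integrable lborel (\<lambda>y. v y *\<^sub>R D2\<eta> j (x - y))" for j
            by (rule conv_integrable[OF sq_int_loc_integrable[OF vs] C2_onD(5)[OF C2] z0])
          then have "integrable lborel (\<lambda>y. \<Sum>j\<in>UNIV. v y *\<^sub>R D2\<eta> j (x - y))" by (intro Bochner_Integration.integrable_sum)
          then show ?thesis by (simp add: sum_distrib_left)
        qed
        have qi: "integrable lborel (\<lambda>y. q y * v y * \<eta> (x - y))"
          using Bochner_Integration.integrable_add[OF hi' Si] by simp
        show "(LINT y|lborel. v y * ?S y) = - (LINT y|lborel. q y * v y * \<eta> (x - y))"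
          using h0' Si qi by simp
      qed
      then have "AE x in lebesgue. v x = 0" by (rule AE_completion)
      then show ?thesis using vz by eventually_elim simp
    qed
    have "AE x in lebesgue. Re (z x) = 0" by (rule part[OF bounded_linear_Re]) (auto simp: abs_Re_le_cmod)
    moreover have "AE x in lebesgue. Im (z x) = 0" by (rule part[OF bounded_linear_Im]) (auto simp: abs_Im_le_cmod)
    ultimately have "AE x in lebesgue. z x = (\<lambda>x. 0) x" by eventually_elim (simp add: complex_eq_iff)
    then have "L2_norm z = L2_norm (\<lambda>x::real^'n. 0::complex)" by (rule L2_norm_AE_cong[OF z])
    then show "L2_norm z = 0" by (simp add: L2_norm_def)
  qed
qed

end

subsection \<open>Singular solutions near a pole\<close>

text \<open>On a dyadic shell the power is comparable to its value at the outer radius. The maximum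
  covers both monotonicities: for p \<ge> 0 the inner radius is the worst case, otherwise the outer
  one.\<close>

lemma powr_shell_bound:
  fixes t \<tau> p :: real
  assumes "\<tau> > 0" "\<tau> / 2 < t" "t \<le> \<tau>"
  shows "t powr (- p) \<le> max 1 (2 powr p) * \<tau> powr (- p)"
proof (cases "p \<ge> 0")
  case True
  have "t powr (- p) \<le> (\<tau> / 2) powr (- p)" using assms True by (intro powr_mono2') auto
  also have "\<dots> = 2 powr p * \<tau> powr (- p)" using assms by (simp add: powr_divide powr_minus divide_simps)
  also have "\<dots> \<le> max 1 (2 powr p) * \<tau> powr (- p)" by (intro mult_right_mono) auto
  finally show ?thesis .
next
  case False
  have "t powr (- p) \<le> \<tau> powr (- p)" using assms False by (intro powr_mono2) auto
  also have "\<dots> = 1 * \<tau> powr (- p)" by simp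
  also have "\<dots> \<le> max 1 (2 powr p) * \<tau> powr (- p)" by (intro mult_right_mono) auto
  finally show ?thesis .
qed

lemma dyadic_shell:
  fixes t r :: real
  assumes "0 < t" "t \<le> r"
  shows "\<exists>n. r * (1 / 2) ^ Suc n < t \<and> t \<le> r * (1 / 2) ^ n"
proof -
  have r: "r > 0" using assms by linarith
  obtain m where "(1 / 2 :: real) ^ m < t / r" using real_arch_pow_inv[of "t / r" "1 / 2"] assms r by auto
  then have m: "r * (1 / 2) ^ m < t" using r by (simp add: field_simps)
  define n where "n = (LEAST n. r * (1 / 2) ^ n < t)"
  have 1: "r * (1 / 2) ^ n < t" unfolding n_def by (rule LeastI[of _ m]) (rule m)
  have "n \<noteq> 0" using 1 assms(2) by (intro notI) simp
  then obtain l where l: "n = Suc l" by (cases n) auto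
  have "\<not> r * (1 / 2) ^ l < t" using not_less_Least[of l "\<lambda>n. r * (1 / 2) ^ n < t"] l unfolding n_def by simp
  then show ?thesis using 1 l by (intro exI[of _ l]) simp
qed

text \<open>Dyadic decomposition around the centre: the n-th ball has volume proportional to the
  N-th power of its radius, so the contributions form a geometric series with ratio
  2^(-(N-p)).\<close>

lemma integrable_norm_powr:
  fixes b :: "'a::euclidean_space"
  assumes p: "p < real DIM('a)" and r: "r > 0"
  shows "integrable lborel (\<lambda>x. indicator (cball b r) x * norm (x - b) powr (- p))"
proof -
  have cb [measurable]: "cball b t \<in> sets borel" for t by (simp add: borel_closed)
  define M where "M = max 1 (2 powr p)"
  define \<tau> where "\<tau> n = r * (1 / 2) ^ n" for n
  have \<tau>: "\<tau> n > 0" for n using r by (simp add: \<tau>_def)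
  define U where "U = unit_ball_vol (real DIM('a))"
  have U: "U \<ge> 0" unfolding U_def by (simp add: unit_ball_vol_nonneg)
  have M: "M \<ge> 0" by (simp add: M_def)
  define x0 where "x0 = real DIM('a) - p"
  define c where "c n = M * \<tau> n powr (- p)" for n
  have le: "ennreal (indicator (cball b r) x * norm (x - b) powr (- p)) \<le> (\<Sum>n. ennreal (c n) * indicator (cball b (\<tau> n)) x)" for x
  proof (cases "x \<in> cball b r \<and> x \<noteq> b")
    case True
    then have "0 < norm (x - b)" "norm (x - b) \<le> r" by (auto simp: dist_norm norm_minus_commute)
    then obtain n where n: "r * (1 / 2) ^ Suc n < norm (x - b)" "norm (x - b) \<le> r * (1 / 2) ^ n" using dyadic_shell by blast
    have "norm (x - b) powr (- p) \<le> c n" unfolding c_def M_def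
      using n by (intro powr_shell_bound \<tau>) (auto simp: \<tau>_def)
    moreover have "x \<in> cball b (\<tau> n)" using n(2) by (simp add: \<tau>_def dist_norm norm_minus_commute)
    ultimately have "ennreal (indicator (cball b r) x * norm (x - b) powr (- p)) \<le> ennreal (c n) * indicator (cball b (\<tau> n)) x"
      using True by (simp add: ennreal_leI)
    also have "\<dots> \<le> (\<Sum>n. ennreal (c n) * indicator (cball b (\<tau> n)) x)"
    proof -
      define F where "F m = ennreal (c m) * indicator (cball b (\<tau> m)) x" for m
      have "(\<Sum>m\<in>{n}. F m) \<le> suminf F" by (rule sum_le_suminf) auto
      then have "F n \<le> suminf F" by simp
      then show ?thesis unfolding F_def[abs_def] .
    qed
    finally show ?thesis .
  next
    case False
    \<comment> \<open>At the centre the integrand is 0, because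
      \<open>0 powr (- p) = 0\<close>.\<close>
    then have z: "indicator (cball b r) x * norm (x - b) powr (- p) = 0" by auto
    show ?thesis unfolding z by simp
  qed
  have "(\<integral>\<^sup>+x. ennreal (indicator (cball b r) x * norm (x - b) powr (- p)) \<partial>lborel) \<le> (\<integral>\<^sup>+x. (\<Sum>n. ennreal (c n) * indicator (cball b (\<tau> n)) x) \<partial>lborel)"
    by (intro nn_integral_mono le)
  also have "\<dots> = (\<Sum>n. \<integral>\<^sup>+x. ennreal (c n) * indicator (cball b (\<tau> n)) x \<partial>lborel)"
    by (rule nn_integral_suminf) measurable
  also have "\<dots> = (\<Sum>n. ennreal (M * U * r powr x0 * ((1 / 2) powr x0) ^ n))"
  proof (rule suminf_cong)
    fix n
    have "(\<integral>\<^sup>+x. ennreal (c n) * indicator (cball b (\<tau> n)) x \<partial>lborel) = ennreal (c n) * emeasure lborel (cball b (\<tau> n))"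
      by (simp add: nn_integral_cmult_indicator)
    also have "\<dots> = ennreal (c n * (U * \<tau> n ^ DIM('a)))"
      using \<tau>[of n] M U unfolding U_def by (subst emeasure_cball) (auto simp: ennreal_mult c_def)
    also have "c n * (U * \<tau> n ^ DIM('a)) = M * U * (\<tau> n powr (- p) * \<tau> n powr (real DIM('a)))"
      using \<tau>[of n] by (simp add: c_def powr_realpow)
    also have "\<tau> n powr (- p) * \<tau> n powr (real DIM('a)) = \<tau> n powr x0"
      unfolding powr_add[symmetric] x0_def by simp
    also have "\<tau> n powr x0 = r powr x0 * ((1 / 2) powr x0) ^ n"
      using r unfolding \<tau>_def by (simp add: powr_mult powr_realpow[symmetric] powr_powr mult.commute)
    finally show "(\<integral>\<^sup>+x. ennreal (c n) * indicator (cball b (\<tau> n)) x \<partial>lborel) = ennreal (M * U * r powr x0 * ((1 / 2) powr x0) ^ n)"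
      by (simp add: mult.assoc)
  qed
  also have "\<dots> < \<infinity>"
  proof -
    have "(1 / 2 :: real) powr x0 < 1 powr x0" using p by (intro powr_less_mono2) (auto simp: x0_def)
    then have "summable (\<lambda>n. ((1 / 2 :: real) powr x0) ^ n)" by (intro summable_geometric) simp
    then have "summable (\<lambda>n. M * U * r powr x0 * ((1 / 2 :: real) powr x0) ^ n)" by (rule summable_mult)
    then have "(\<Sum>n. ennreal (M * U * r powr x0 * ((1 / 2) powr x0) ^ n)) = ennreal (\<Sum>n. M * U * r powr x0 * ((1 / 2) powr x0) ^ n)"
      using M U by (intro suminf_ennreal2) auto
    then show ?thesis by simp
  qed
  finally show ?thesis by (intro integrableI_nonneg) auto
qed

text \<open>At the pole itself these functions take the junk value \<open>0 powr e = 0\<close>.\<close>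

definition sing :: "real \<Rightarrow> real \<Rightarrow> real \<Rightarrow> real" where
  "sing d e s = cutoff (s / d) * s powr e"
definition sing' :: "real \<Rightarrow> real \<Rightarrow> real \<Rightarrow> real" where
  "sing' d e s = cutoff' (s / d) / d * s powr e + e * s powr (e - 1) * cutoff (s / d)"
definition sing'' :: "real \<Rightarrow> real \<Rightarrow> real \<Rightarrow> real" where
  "sing'' d e s = cutoff'' (s / d) / d\<^sup>2 * s powr e + 2 * (e * s powr (e - 1)) * (cutoff' (s / d) / d)
     + e * (e - 1) * s powr (e - 2) * cutoff (s / d)"

lemma DERIV_sing:
  assumes d: "d > 0" and s: "s > 0"
  shows "(sing d e has_real_derivative sing' d e s) (at s)" "(sing' d e has_real_derivative sing'' d e s) (at s)"
proof -
  have p: "((\<lambda>s. s powr c) has_real_derivative c * s powr (c - 1)) (at s)" for c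
    using s by (rule has_real_derivative_powr)
  note c = DERIV_cut_scaled[of d s]
  have dn: "d \<noteq> 0" using d by simp
  show "(sing d e has_real_derivative sing' d e s) (at s)"
    unfolding sing_def[abs_def] sing'_def by (rule DERIV_mult[OF c(1)[OF dn] p])
  have p': "((\<lambda>s. e * s powr (e - 1)) has_real_derivative e * ((e - 1) * s powr (e - 2))) (at s)"
    using DERIV_cmult[OF p[of "e - 1"], of e] by simp
  have "((\<lambda>s. cutoff' (s / d) / d * s powr e + e * s powr (e - 1) * cutoff (s / d)) has_real_derivative
     (cutoff'' (s / d) / d\<^sup>2 * s powr e + e * s powr (e - 1) * (cutoff' (s / d) / d)) +
     (e * ((e - 1) * s powr (e - 2)) * cutoff (s / d) + cutoff' (s / d) / d * (e * s powr (e - 1)))) (at s)"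
    by (intro DERIV_add DERIV_mult c[OF dn] p p')
  then show "(sing' d e has_real_derivative sing'' d e s) (at s)"
    unfolding sing'_def[abs_def] sing''_def by (simp add: algebra_simps)
qed

lemma continuous_sing:
  assumes "d > 0"
  shows "continuous_on {0<..} (sing d e)" "continuous_on {0<..} (sing' d e)" "continuous_on {0<..} (sing'' d e)"
  unfolding sing_def[abs_def] sing'_def[abs_def] sing''_def[abs_def] using assms
  by (intro continuous_intros continuous_cut_scaled; force)+

lemma sing_simps:
  assumes "d > 0"
  shows "s \<ge> 2 * d \<Longrightarrow> sing d e s = 0" "s \<ge> 2 * d \<Longrightarrow> sing' d e s = 0" "s \<ge> 2 * d \<Longrightarrow> sing'' d e s = 0"
    "s \<le> d \<Longrightarrow> sing d e s = s powr e" "s \<le> d \<Longrightarrow> sing' d e s = e * s powr (e - 1)"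
    "s \<le> d \<Longrightarrow> sing'' d e s = e * (e - 1) * s powr (e - 2)" "\<bar>sing d e s\<bar> \<le> s powr e"
    "sing d e 0 = 0" "sing' d e 0 = 0" "sing'' d e 0 = 0"
proof -
  have "s \<ge> 2 * d \<Longrightarrow> s / d \<ge> 2" "s \<le> d \<Longrightarrow> s / d \<le> 1" using assms by (simp_all add: field_simps)
  then show "s \<ge> 2 * d \<Longrightarrow> sing d e s = 0" "s \<ge> 2 * d \<Longrightarrow> sing' d e s = 0" "s \<ge> 2 * d \<Longrightarrow> sing'' d e s = 0"
    "s \<le> d \<Longrightarrow> sing d e s = s powr e" "s \<le> d \<Longrightarrow> sing' d e s = e * s powr (e - 1)"
    "s \<le> d \<Longrightarrow> sing'' d e s = e * (e - 1) * s powr (e - 2)"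
    by (auto simp: sing_def sing'_def sing''_def cutoff_simps)
  show "\<bar>sing d e s\<bar> \<le> s powr e"
    using mult_right_mono[OF cutoff_simps(8)[of "s / d"], of "s powr e"] cutoff_simps(7)[of "s / d"]
    by (simp add: sing_def abs_mult)
qed (auto simp: sing_def sing'_def sing''_def)

section \<open>Elements of the adjoint that violate symmetry\<close>

context poles
begin

text \<open>The radial Laplacian of a cut-off singular solution, as a function of s =
  |x-a|^2.\<close>

definition lap :: "real \<Rightarrow> real \<Rightarrow> real" where
  "lap e s = 4 * s * sing'' (\<delta>\<^sup>2) e s + 2 * N * sing' (\<delta>\<^sup>2) e s"

definition shell :: "nat \<Rightarrow> real \<Rightarrow> real \<Rightarrow> (real^'n) set" where
  "shell i p q = {x. p \<le> sq i x \<and> sq i x \<le> q}"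

lemma compact_shell: "compact (shell i p q)"
proof -
  have "closed (shell i p q)" unfolding shell_def
    by (intro closed_Collect_conj closed_Collect_le continuous_intros)
  moreover have "norm x \<le> sqrt q + norm (a i)" if "x \<in> shell i p q" for x
  proof -
    have "norm (x - a i) \<le> sqrt q" using that unfolding shell_def by (intro real_le_rsqrt) auto
    then show ?thesis using norm_triangle_ineq[of "x - a i" "a i"] by simp
  qed
  ultimately show ?thesis unfolding compact_eq_bounded_closed bounded_iff by blast
qed

lemma shell_sub: "p > 0 \<Longrightarrow> shell i p q \<subseteq> UNIV - {a i}"
  by (auto simp: shell_def)

lemma radial_continuous:
  assumes "continuous_on {0<..} f"
  shows "continuous_on (UNIV - {a i}) (\<lambda>x. f (sq i x))"
  by (rule continuous_on_compose2[OF assms]) (auto intro!: continuous_intros)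

text \<open>The indicial equation in the variable s: with e = -\<gamma>/2 the hypothesis reads
  \<gamma>^2 - (N-2)\<gamma> + \<kappa> = 0, which characterises the powers |x|^(-\<gamma>)
  annihilated by \<Delta> + \<kappa>/|x|^2.\<close>

lemma lap_indicial:
  assumes e: "4 * e\<^sup>2 + (2 * N - 4) * e + \<kappa> = 0" and s: "0 < s" "s \<le> \<delta>\<^sup>2"
  shows "lap e s + \<kappa> * sing (\<delta>\<^sup>2) e s / s = 0"
proof -
  have p: "s powr (e - 1) = s powr e / s" "s powr (e - 2) = s powr e / s\<^sup>2"
    using s by (simp_all add: powr_diff powr_numeral)
  have "lap e s + \<kappa> * sing (\<delta>\<^sup>2) e s / s = s powr e / s * (4 * e\<^sup>2 + (2 * N - 4) * e + \<kappa>)"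
    unfolding lap_def sing_simps(4,5,6)[OF \<delta>2 s(2)] p using s(1) by (simp add: field_simps power2_eq_square)
  then show ?thesis using e by simp
qed

text \<open>The condition on \<open>- 4 * e\<close> is 2\<gamma> < N, square integrability at the
  pole. The singular terms of \<Delta>v and V v are each too large there, but they cancel by the
  indicial equation; what remains is a function supported on a shell and a bounded multiple of
  v.\<close>

lemma singular_in_adjoint:
  assumes i: "i < k" and V: "loc_bounded_on \<Omega> V"
    and Vi: "AE x in lebesgue. sq i x < 2 * \<delta>\<^sup>2 \<longrightarrow> \<bar>V x - \<kappa> / sq i x\<bar> \<le> B"
    and e: "4 * e\<^sup>2 + (2 * N - 4) * e + \<kappa> = 0" "- 4 * e < N"
  shows "((\<lambda>x. complex_of_real (sing (\<delta>\<^sup>2) e (sq i x))), (\<lambda>x. complex_of_real (- lap e (sq i x) - V x * sing (\<delta>\<^sup>2) e (sq i x))))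
    \<in> graph_adjoint (schroedinger_graph V (Cc_infty \<Omega>))" (is "(?v, ?w) \<in> _")
proof -
  let ?d = "\<delta>\<^sup>2"
  let ?S = "UNIV - {a i}"
  have oS: "open ?S" by (simp add: open_Diff)
  have Vm [measurable]: "V \<in> borel_measurable lebesgue" using V by (simp add: loc_bounded_on_def)
  have v_cont: "continuous_on ?S ?v"
    by (intro continuous_intros radial_continuous continuous_sing \<delta>2)
  have v_m0: "?v \<in> borel_measurable borel"
  proof -
    have "(\<lambda>x. indicator ?S x *\<^sub>R ?v x) \<in> borel_measurable borel"
      by (rule borel_measurable_continuous_on_indicator[OF _ v_cont]) (simp add: borel_open[OF oS])
    moreover have "(\<lambda>x. indicator ?S x *\<^sub>R ?v x) = ?v" by (auto simp: indicator_def sing_simps(8)[OF \<delta>2] fun_eq_iff)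
    ultimately show ?thesis by simp
  qed
  then have vm [measurable]: "?v \<in> borel_measurable lebesgue" by (intro measurable_completion) simp
  have vL: "?v \<in> L2"
  proof -
    \<comment> \<open>The square of s^e is |x-a|^(4e), which gives the exponent passed to
      \<open>integrable_norm_powr\<close>.\<close>
    have I: "integrable lborel (\<lambda>x. indicator (cball (a i) (2 * \<delta>)) x * norm (x - a i) powr (- (- 4 * e)))"
      using e(2) \<delta> by (intro integrable_norm_powr) (auto simp: N_def)
    have "integrable lborel (\<lambda>x. (norm (?v x))\<^sup>2)"
    proof (rule Bochner_Integration.integrable_bound[OF I])
      show "(\<lambda>x. (norm (?v x))\<^sup>2) \<in> borel_measurable lborel" using v_m0 by measurable
      show "AE x in lborel. norm ((norm (?v x))\<^sup>2) \<le> norm (indicator (cball (a i) (2 * \<delta>)) x * norm (x - a i) powr (- (- 4 * e)))"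
      proof (intro always_eventually allI)
        fix x
        show "norm ((norm (?v x))\<^sup>2) \<le> norm (indicator (cball (a i) (2 * \<delta>)) x * norm (x - a i) powr (- (- 4 * e)))"
        proof (cases "sq i x < 2 * ?d \<and> x \<noteq> a i")
          case True
          then have "norm (x - a i) < 2 * \<delta>" by (intro sq_less) simp
          then have m: "x \<in> cball (a i) (2 * \<delta>)" by (simp add: dist_norm norm_minus_commute)
          have "(norm (?v x))\<^sup>2 \<le> (sq i x powr e)\<^sup>2"
            using sing_simps(7)[OF \<delta>2, of e "sq i x"] by (intro power_mono) auto
          also have "(sq i x powr e)\<^sup>2 = norm (x - a i) powr (4 * e)"
          proof -
            have n: "norm (x - a i) > 0" using True by simp
            have "(sq i x powr e)\<^sup>2 = ((norm (x - a i) powr 2) powr e) powr 2"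
              using n by (simp add: powr_numeral)
            also have "\<dots> = norm (x - a i) powr (2 * e * 2)" by (simp only: powr_powr)
            also have "2 * e * 2 = 4 * e" by simp
            finally show ?thesis .
          qed
          finally show ?thesis using m by simp
        next
          case False
          then have "?v x = 0" using sing_simps(1)[OF \<delta>2, of "sq i x" e] sing_simps(8)[OF \<delta>2] by force
          then show ?thesis by simp
        qed
      qed
    qed
    then have "integrable lebesgue (\<lambda>x. (norm (?v x))\<^sup>2)" by (rule lebesgue_integral_lborel)
    then show ?thesis using vm by (simp add: L2_def)
  qed
  \<comment> \<open>The Laplacian plus the exact inverse-square term. It vanishes for s \<le>
    \<delta>^2 by the indicial equation and for s \<ge> 2\<delta>^2 by the cutoff, so only a compact
    shell away from the pole remains.\<close>
  define h where "h s = lap e s + \<kappa> * sing ?d e s / s" for s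
  have hL: "(\<lambda>x. complex_of_real (h (sq i x))) \<in> L2"
  proof (rule L2_continuous[OF continuous_on_extend_zero[OF oS compact_shell[of i ?d "2 * ?d"] shell_sub[OF \<delta>2]] compact_shell[of i ?d "2 * ?d"]])
    have "continuous_on {0<..} h" unfolding h_def[abs_def] lap_def[abs_def]
      by (intro continuous_intros continuous_sing \<delta>2) auto
    then show "continuous_on ?S (\<lambda>x. complex_of_real (h (sq i x)))" by (intro continuous_intros radial_continuous)
    show z: "complex_of_real (h (sq i x)) = 0" if "x \<notin> shell i ?d (2 * ?d)" for x
    proof (cases "x = a i")
      case True
      then show ?thesis by (simp add: h_def lap_def sing_simps[OF \<delta>2])
    next
      case False
      then have p: "0 < sq i x" by simp
      have "sq i x \<le> ?d \<or> sq i x \<ge> 2 * ?d" using that by (auto simp: shell_def)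
      then show ?thesis
      proof
        assume "sq i x \<le> ?d"
        then show ?thesis unfolding h_def using p by (subst lap_indicial[OF e(1)]) auto
      next
        assume 2: "sq i x \<ge> 2 * ?d"
        show ?thesis using sing_simps(1,2,3)[OF \<delta>2 2] by (simp add: h_def lap_def)
      qed
    qed
    then show "complex_of_real (h (sq i x)) = 0" if "x \<notin> shell i ?d (2 * ?d)" for x using that .
  qed
  have rL: "(\<lambda>x. complex_of_real (V x - \<kappa> / sq i x) * ?v x) \<in> L2"
  proof (rule L2_dominated[OF vL])
    show "AE x in lebesgue. norm (complex_of_real (V x - \<kappa> / sq i x) * ?v x) \<le> B * norm (?v x)"
      using Vi
    proof eventually_elim
      case (elim x)
      show ?case
      proof (cases "sq i x < 2 * ?d")
        case True
        then show ?thesis using elim by (simp only: norm_mult norm_of_real) (intro mult_right_mono; simp)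
      next
        case False
        then show ?thesis using sing_simps(1)[OF \<delta>2] by simp
      qed
    qed
    have "(\<lambda>x. \<kappa> / sq i x) \<in> borel_measurable borel" by measurable
    then have [measurable]: "(\<lambda>x. \<kappa> / sq i x) \<in> borel_measurable lebesgue" by (intro measurable_completion) simp
    show "(\<lambda>x. complex_of_real (V x - \<kappa> / sq i x) * ?v x) \<in> borel_measurable lebesgue" by measurable
  qed
  have w_eq: "?w = (\<lambda>x. (-1) * complex_of_real (h (sq i x))) - (\<lambda>x. complex_of_real (V x - \<kappa> / sq i x) * ?v x)"
    by (auto simp: fun_eq_iff h_def algebra_simps)
  have wL: "?w \<in> L2" unfolding w_eq by (intro L2_diff L2_scale hL rL)
  have C2: "C2_on \<Omega> ?v (\<lambda>j x. complex_of_real (2 * sing' ?d e (sq i x) * (x - a i) $ j))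
     (\<lambda>j x. complex_of_real (4 * sing'' ?d e (sq i x) * ((x - a i) $ j)\<^sup>2 + 2 * sing' ?d e (sq i x)))"
    by (rule C2_on_linear[OF bounded_linear_of_real], rule C2_on_radial)
      (use sq_pos[OF _ i] in \<open>auto intro!: DERIV_sing \<delta>2 continuous_on_subset[OF continuous_sing(3)[OF \<delta>2]]\<close>)
  have "L2_inner (schroed V u) ?v = L2_inner u ?w" if "u \<in> Cc_infty \<Omega>" for u
  proof (rule schroed_Green[OF open_\<Omega> V that C2 vL wL])
    fix x
    show "?w x = - (\<Sum>j\<in>UNIV. complex_of_real (4 * sing'' ?d e (sq i x) * ((x - a i) $ j)\<^sup>2 + 2 * sing' ?d e (sq i x))) - complex_of_real (V x) * ?v x"
      unfolding of_real_sum[symmetric] sum_radial_second lap_def by simp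
  qed
  then show ?thesis using vL wL unfolding schroedinger_graph_alt by (auto simp: graph_adjoint_def)
qed

text \<open>The flux of $v_+\nabla v_- - v_-\nabla v_+$ through small spheres around the pole does not vanish,
  so $v_+$ and $v_-$ cannot both lie in the domain of a symmetric operator.\<close>

lemma flux_nonzero:
  fixes i :: nat and e1 e2 \<kappa> :: real
  assumes e: "4 * e1\<^sup>2 + (2 * N - 4) * e1 + \<kappa> = 0" "4 * e2\<^sup>2 + (2 * N - 4) * e2 + \<kappa> = 0" "e1 < e2"
  defines "W \<equiv> \<lambda>x. sing (\<delta>\<^sup>2) e1 (sq i x) * lap e2 (sq i x) - sing (\<delta>\<^sup>2) e2 (sq i x) * lap e1 (sq i x)"
  shows "integrable lborel W" "(LINT x|lborel. W x) < 0"
proof -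
  let ?d = "\<delta>\<^sup>2"
  let ?g1 = "sing ?d e1" and ?g2 = "sing ?d e2"
  let ?S = "UNIV - {a i}"
  have oS: "open ?S" by (simp add: open_Diff)
  \<comment> \<open>The Wronskian of the two profiles with respect to s.\<close>
  define D where "D s = ?g1 s * sing' ?d e2 s - ?g2 s * sing' ?d e1 s" for s
  define D' where "D' s = ?g1 s * sing'' ?d e2 s - ?g2 s * sing'' ?d e1 s" for s
  \<comment> \<open>A cutoff that removes the pole: 0 for s \<le> \<delta>^2/2 and 1 for s \<ge>
    \<delta>^2. It replaces the flux through one small sphere by an average over a shell, so no
    surface integral appears.\<close>
  define \<zeta> where "\<zeta> s = 1 - cutoff (s / (?d / 2))" for s
  define \<zeta>' where "\<zeta>' s = - (cutoff' (s / (?d / 2)) / (?d / 2))" for s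
  have d2: "?d / 2 > 0" using \<delta>2 by simp
  have d\<zeta>: "(\<zeta> has_real_derivative \<zeta>' s) (at s)" for s
    using DERIV_diff[OF DERIV_const[of 1] DERIV_cut_scaled(1)[of "?d / 2" s]] \<delta>2 by (simp add: \<zeta>_def[abs_def] \<zeta>'_def)
  have dD: "(D has_real_derivative D' s) (at s)" if s: "s > 0" for s
  proof -
    have "(D has_real_derivative (sing' ?d e1 s * sing' ?d e2 s + sing'' ?d e2 s * ?g1 s) - (sing' ?d e2 s * sing' ?d e1 s + sing'' ?d e1 s * ?g2 s)) (at s)"
      unfolding D_def[abs_def] by (intro DERIV_diff DERIV_mult DERIV_sing \<delta>2 s)
    then show ?thesis by (simp add: D'_def algebra_simps)
  qed
  have c\<zeta>: "continuous_on A \<zeta>" "continuous_on A \<zeta>'" for A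
    unfolding \<zeta>_def[abs_def] \<zeta>'_def[abs_def] using \<delta>2 by (intro continuous_intros continuous_cut_scaled; simp)+
  have cD: "continuous_on {0<..} D" "continuous_on {0<..} D'"
    unfolding D_def[abs_def] D'_def[abs_def] by (intro continuous_intros continuous_sing \<delta>2)+
  \<comment> \<open>The gradient of a radial function with profile g is 2 g'(s) (x-a); hence G(s)
    (x-a) is \<zeta> times the field v1 grad v2 - v2 grad v1, and its divergence has integral
    0.\<close>
  define G where "G s = 2 * (\<zeta> s * D s)" for s
  define G' where "G' s = 2 * (\<zeta>' s * D s + \<zeta> s * D' s)" for s
  have dG: "(G has_real_derivative G' s) (at s)" if "s > 0" for s
    using DERIV_cmult[OF DERIV_mult[OF d\<zeta> dD[OF that]], of 2] by (simp add: G_def[abs_def] G'_def mult.commute)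
  have cG: "continuous_on {0<..} G" "continuous_on {0<..} G'"
    unfolding G_def[abs_def] G'_def[abs_def] by (intro continuous_intros c\<zeta> cD)+
  have low: "\<zeta> s = 0 \<and> \<zeta>' s = 0" if "s \<le> ?d / 2" for s
  proof -
    have "s / (?d / 2) \<le> 1" using that d2 by (simp add: field_simps)
    then show ?thesis by (simp add: \<zeta>_def \<zeta>'_def cutoff_simps)
  qed
  have high: "D s = 0 \<and> D' s = 0" if "s \<ge> 2 * ?d" for s using sing_simps(1,2,3)[OF \<delta>2 that] by (simp add: D_def D'_def)
  let ?C = "shell i (?d / 2) (2 * ?d)"
  have out: "G (sq i x) = 0 \<and> G' (sq i x) = 0" if "x \<notin> ?C" for x
  proof -
    have "sq i x \<le> ?d / 2 \<or> sq i x \<ge> 2 * ?d" using that by (auto simp: shell_def)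
    then show ?thesis using low high by (auto simp: G_def G'_def)
  qed
  have pd: "has_pd j (\<lambda>x. G (sq i x) * (x - a i) $ j) (\<lambda>x. G (sq i x) * 1 + (G' (sq i x) * (2 * (x - a i) $ j)) * (x - a i) $ j) ?S" for j
  proof -
    have "has_pd j (\<lambda>x. (x - a i) $ j) (\<lambda>x. if j = j then 1 else 0) ?S" by (rule has_pd_component)
    then have "has_pd j (\<lambda>x. (x - a i) $ j) (\<lambda>x. 1) ?S" by simp
    then show ?thesis by (intro has_pd_mult has_pd_chain has_pd_dist_sq dG) auto
  qed
  have cc: "continuous_on ?S (\<lambda>x. G (sq i x) * (x - a i) $ j)"
    "continuous_on ?S (\<lambda>x. G (sq i x) * 1 + (G' (sq i x) * (2 * (x - a i) $ j)) * (x - a i) $ j)" for j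
    by (intro continuous_intros radial_continuous cG)+
  have I: "integrable lborel (\<lambda>x. G (sq i x) * 1 + (G' (sq i x) * (2 * (x - a i) $ j)) * (x - a i) $ j)"
    "(LINT x|lborel. G (sq i x) * 1 + (G' (sq i x) * (2 * (x - a i) $ j)) * (x - a i) $ j) = 0" for j
    by (rule integral_pd_eq_0[OF oS compact_shell[of i "?d / 2" "2 * ?d"] shell_sub[OF d2] cc pd]; use out in simp)+
  \<comment> \<open>Where \<zeta> differs from 1 both solutions are pure powers satisfying the same
    equation, so W vanishes there.\<close>
  have cut_eq: "\<zeta> (sq i x) * W x = W x" for x
  proof (cases "sq i x \<ge> ?d")
    case True
    then have "sq i x / (?d / 2) \<ge> 2" using d2 by (simp add: field_simps)
    then show ?thesis by (simp add: \<zeta>_def cutoff_simps)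
  next
    case False
    show ?thesis
    proof (cases "sq i x = 0")
      case True
      then show ?thesis by (simp add: W_def sing_simps[OF \<delta>2])
    next
      case f: False
      have s: "0 < sq i x" "sq i x \<le> ?d" using f False by auto
      have "lap e1 (sq i x) = - (\<kappa> * ?g1 (sq i x) / sq i x)" "lap e2 (sq i x) = - (\<kappa> * ?g2 (sq i x) / sq i x)"
        using lap_indicial[OF e(1) s] lap_indicial[OF e(2) s] by linarith+
      then show ?thesis by (simp add: W_def)
    qed
  qed
  \<comment> \<open>The part of the divergence in which \<zeta> is differentiated, that is the
    averaged flux. Its integral is the negative of the integral of W.\<close>
  define P where "P x = 4 * sq i x * \<zeta>' (sq i x) * D (sq i x)" for x
  have sumF: "(\<Sum>j\<in>UNIV. G (sq i x) * 1 + (G' (sq i x) * (2 * (x - a i) $ j)) * (x - a i) $ j) = P x + W x" for x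
  proof -
    have "(\<Sum>j\<in>UNIV. G (sq i x) * 1 + (G' (sq i x) * (2 * (x - a i) $ j)) * (x - a i) $ j)
      = N * G (sq i x) + 2 * G' (sq i x) * (\<Sum>j\<in>UNIV. ((x - a i) $ j)\<^sup>2)"
      by (simp add: sum.distrib N_def sum_distrib_left power2_eq_square mult_ac del: vector_minus_component)
    also have "\<dots> = N * G (sq i x) + 2 * G' (sq i x) * sq i x" unfolding sum_component_sq ..
    also have "\<dots> = P x + \<zeta> (sq i x) * W x"
      by (simp add: P_def W_def G_def G'_def D_def D'_def lap_def algebra_simps)
    finally show ?thesis unfolding cut_eq .
  qed
  have Wi: "integrable lborel W"
  proof (rule integrable_extend_zero(2)[OF oS compact_shell[of i ?d "2 * ?d"] shell_sub[OF \<delta>2]])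
    show "continuous_on ?S W" unfolding W_def lap_def
      by (intro continuous_intros radial_continuous continuous_sing \<delta>2)
    show "W x = 0" if "x \<notin> shell i ?d (2 * ?d)" for x
    proof (cases "sq i x \<ge> 2 * ?d")
      case True
      then show ?thesis using sing_simps(1)[OF \<delta>2 True] by (simp add: W_def)
    next
      case f: False
      then have lt: "sq i x < ?d" using that by (auto simp: shell_def)
      show ?thesis
      proof (cases "sq i x = 0")
        case True
        then show ?thesis by (simp add: W_def sing_simps[OF \<delta>2])
      next
        case False
        then have s: "0 < sq i x" "sq i x \<le> ?d" using lt by auto
        have "lap e1 (sq i x) = - (\<kappa> * ?g1 (sq i x) / sq i x)" "lap e2 (sq i x) = - (\<kappa> * ?g2 (sq i x) / sq i x)"
          using lap_indicial[OF e(1) s] lap_indicial[OF e(2) s] by linarith+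
        then show ?thesis by (simp add: W_def)
      qed
    qed
  qed
  have Pc: "continuous_on ?S P" unfolding P_def by (intro continuous_intros radial_continuous c\<zeta> cD)
  have Pi: "integrable lborel P"
    by (rule integrable_extend_zero(2)[OF oS compact_shell[of i "?d / 2" "2 * ?d"] shell_sub[OF d2] Pc])
      (use low high in \<open>auto simp: P_def shell_def not_le\<close>)
  have D_pos: "D s = (e2 - e1) * s powr (e1 + e2 - 1)" if "0 < s" "s \<le> ?d" for s
    unfolding D_def sing_simps(4,5)[OF \<delta>2 that(2)] using that(1)
    by (simp add: powr_diff powr_add field_simps)
  have P_nonneg: "0 \<le> P x" for x
  proof (cases "0 < sq i x \<and> sq i x \<le> ?d")
    case True
    have "0 \<le> \<zeta>' (sq i x)" unfolding \<zeta>'_def using cutoff_simps(10) d2 by (simp add: divide_nonpos_pos)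
    moreover have "0 \<le> D (sq i x)" using D_pos True e(3) by simp
    ultimately show ?thesis unfolding P_def by simp
  next
    case False
    then have "sq i x = 0 \<or> sq i x / (?d / 2) \<ge> 2" using d2 by (auto simp: field_simps)
    then show ?thesis by (auto simp: P_def \<zeta>'_def cutoff_simps)
  qed
  obtain j0 :: 'n where True by simp
  \<comment> \<open>A point with s = (3/4)\<delta>^2, where the argument s / (\<delta>^2/2) of the
    cutoff is 3/2 and its derivative is strictly negative. The index \<open>j0\<close> serves only
    to name some coordinate direction.\<close>
  define y where "y = a i + sqrt (3 / 4 * ?d) *\<^sub>R axis j0 (1::real)"
  have sy: "sq i y = 3 / 4 * ?d" by (simp add: y_def)
  have "P y \<noteq> 0"
  proof -
    have m: "sq i y / (?d / 2) = 3 / 2" unfolding sy using \<delta>2 by (simp add: field_simps)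
    have "\<zeta>' (sq i y) \<noteq> 0" unfolding \<zeta>'_def m using cutoff'_neg d2 by auto
    moreover have "D (sq i y) \<noteq> 0" unfolding sy using D_pos[of "3 / 4 * ?d"] \<delta>2 e(3) by simp
    ultimately show ?thesis unfolding P_def sy using \<delta>2 by simp
  qed
  moreover have "y \<in> ?S" using sy \<delta>2 by auto
  ultimately have P0: "0 < (LINT x|lborel. P x)"
    using integral_pos_of_continuous[OF Pi P_nonneg oS Pc] by blast
  have "0 = (LINT x|lborel. (\<Sum>j\<in>UNIV. G (sq i x) * 1 + (G' (sq i x) * (2 * (x - a i) $ j)) * (x - a i) $ j))"
    using I by (subst Bochner_Integration.integral_sum) auto
  also have "\<dots> = (LINT x|lborel. P x) + (LINT x|lborel. W x)" unfolding sumF using Pi Wi by simp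
  finally show "(LINT x|lborel. W x) < 0" using P0 by simp
  show "integrable lborel W" by (rule Wi)
qed

text \<open>The boundary pairing of the two singular solutions is the integral of their Wronskian
  expression: the terms with V cancel because V is real, and \<open>flux_nonzero\<close> says that
  the rest is not 0.\<close>

lemma not_essentially_self_adjoint:
  assumes i: "i < k" and V: "loc_bounded_on \<Omega> V"
    and Vi: "AE x in lebesgue. sq i x < 2 * \<delta>\<^sup>2 \<longrightarrow> \<bar>V x - \<kappa> / sq i x\<bar> \<le> B"
    and \<kappa>: "(N - 2)\<^sup>2 / 4 - 1 < \<kappa>" "\<kappa> < (N - 2)\<^sup>2 / 4"
  shows "\<not> essentially_self_adjoint (schroedinger_graph V (Cc_infty \<Omega>))"
proof
  assume esa: "essentially_self_adjoint (schroedinger_graph V (Cc_infty \<Omega>))"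
  define \<mu> where "\<mu> = sqrt ((N - 2)\<^sup>2 / 4 - \<kappa>)"
  have \<mu>2: "\<mu>\<^sup>2 = (N - 2)\<^sup>2 / 4 - \<kappa>" using \<kappa> by (simp add: \<mu>_def)
  have \<mu>: "0 < \<mu>" "\<mu> < 1" unfolding \<mu>_def using \<kappa> by simp_all
  \<comment> \<open>The exponents are -\<gamma>/2 for the larger and the smaller \<gamma>. The lower
    bound on \<kappa> gives \<mu> < 1 and hence -4 e1 = N - 2 + 2\<mu> < N; the upper bound gives
    \<mu> > 0, so the exponents differ.\<close>
  define e1 where "e1 = - ((N - 2) / 2 + \<mu>) / 2"
  define e2 where "e2 = - ((N - 2) / 2 - \<mu>) / 2"
  have "4 * e1\<^sup>2 + (2 * N - 4) * e1 + \<kappa> = \<mu>\<^sup>2 - (N - 2)\<^sup>2 / 4 + \<kappa>"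
    by (simp add: e1_def power2_eq_square field_simps)
  then have q1: "4 * e1\<^sup>2 + (2 * N - 4) * e1 + \<kappa> = 0" using \<mu>2 by simp
  have "4 * e2\<^sup>2 + (2 * N - 4) * e2 + \<kappa> = \<mu>\<^sup>2 - (N - 2)\<^sup>2 / 4 + \<kappa>"
    by (simp add: e2_def power2_eq_square field_simps)
  then have q2: "4 * e2\<^sup>2 + (2 * N - 4) * e2 + \<kappa> = 0" using \<mu>2 by simp
  have n: "- 4 * e1 < N" "- 4 * e2 < N" "e1 < e2" using \<mu> by (auto simp: e1_def e2_def field_simps)
  let ?v = "\<lambda>e x. sing (\<delta>\<^sup>2) e (sq i x)" and ?w = "\<lambda>e x. - lap e (sq i x) - V x * sing (\<delta>\<^sup>2) e (sq i x)"
  note a1 = singular_in_adjoint[OF i V Vi q1 n(1)] and a2 = singular_in_adjoint[OF i V Vi q2 n(2)]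
  have G: "schroedinger_graph V (Cc_infty \<Omega>) \<subseteq> L2 \<times> L2"
    unfolding schroedinger_graph_alt using Cc_infty_L2(1) schroed_L2(2)[OF V] by auto
  have eq: "L2_inner (\<lambda>x. complex_of_real (?w e1 x)) (\<lambda>x. complex_of_real (?v e2 x))
    = L2_inner (\<lambda>x. complex_of_real (?v e1 x)) (\<lambda>x. complex_of_real (?w e2 x))"
    by (rule essentially_self_adjoint_symmetric[OF G esa a1 a2])
  have L: "(\<lambda>x. complex_of_real (?v e1 x)) \<in> L2" "(\<lambda>x. complex_of_real (?v e2 x)) \<in> L2"
    "(\<lambda>x. complex_of_real (?w e1 x)) \<in> L2" "(\<lambda>x. complex_of_real (?w e2 x)) \<in> L2"
    using a1 a2 by (auto simp: graph_adjoint_def)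
  let ?W = "\<lambda>x. ?v e1 x * lap e2 (sq i x) - ?v e2 x * lap e1 (sq i x)"
  have "0 = (LINT x|lebesgue. cnj (complex_of_real (?w e1 x)) * complex_of_real (?v e2 x) - cnj (complex_of_real (?v e1 x)) * complex_of_real (?w e2 x))"
    using eq unfolding L2_inner_def
    by (subst Bochner_Integration.integral_diff) (intro L2_mult_integrable L, intro L2_mult_integrable L, simp)
  also have "\<dots> = (LINT x|lebesgue. complex_of_real (?W x))"
    by (intro Bochner_Integration.integral_cong refl) (simp add: algebra_simps)
  also have "\<dots> = complex_of_real (LINT x|lebesgue. ?W x)" by (rule integral_complex_of_real)
  also have "(LINT x|lebesgue. ?W x) = (LINT x|lborel. ?W x)"
    by (rule lebesgue_integral_lborel(2)[OF flux_nonzero(1)[OF q1 q2 n(3)]])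
  finally have "(LINT x|lborel. ?W x) = 0" by simp
  then show False using flux_nonzero(2)[OF q1 q2 n(3), of i] by simp
qed

end

section \<open>Reduction of the potential to its inverse-square part\<close>

lemma separated_points:
  fixes a :: "nat \<Rightarrow> 'a::real_normed_vector"
  assumes "inj_on a {..<k}"
  shows "\<exists>\<delta>>0. \<forall>i<k. \<forall>i'<k. i \<noteq> i' \<longrightarrow> 4 * \<delta> \<le> norm (a i - a i')"
proof -
  define P where "P = {(i, i'). i < k \<and> i' < k \<and> i \<noteq> i'}"
  \<comment> \<open>The element 1 provides a minimum when there are no two distinct indices.\<close>
  define S where "S = insert 1 ((\<lambda>(i, i'). norm (a i - a i') / 4) ` P)"
  have "finite P" by (rule finite_subset[of _ "{..<k} \<times> {..<k}"]) (auto simp: P_def)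
  then have fin: "finite S" by (simp add: S_def)
  have pos: "\<forall>s\<in>S. s > 0" using assms by (auto simp: S_def P_def inj_on_def)
  have "Min S > 0" using fin pos by (subst Min_gr_iff) (auto simp: S_def)
  moreover have "4 * Min S \<le> norm (a i - a i')" if "i < k" "i' < k" "i \<noteq> i'" for i i'
  proof -
    have "norm (a i - a i') / 4 \<in> S" unfolding S_def using that by (intro insertI2 image_eqI[of _ _ "(i, i')"]) (auto simp: P_def)
    then have "Min S \<le> norm (a i - a i') / 4" using fin by (intro Min_le)
    then show ?thesis by simp
  qed
  ultimately show ?thesis by blast
qed

text \<open>Outside its ball an inverse-square term is at most |\<open>lam i\<close>| /
  \<open>r i\<close>^2, and the term at infinity is at most |\<open>lam_inf\<close>| / R^2. Removing
  the indicators, the tail and W is therefore a bounded change, which leaves the couplings at the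
  poles.\<close>

lemma potential_bounded_part:
  fixes a :: "nat \<Rightarrow> real^'n::finite"
  assumes r: "\<forall>i<k. r i > 0" and R: "R > 0" and W: "AE x in lebesgue. \<bar>W x\<bar> \<le> C"
  shows "\<exists>B. AE x in lebesgue. \<bar>potential k a r lam lam_inf R W x - (\<Sum>i<k. lam i / (norm (x - a i))\<^sup>2)\<bar> \<le> B"
proof -
  have "AE x in lebesgue. \<bar>potential k a r lam lam_inf R W x - (\<Sum>i<k. lam i / (norm (x - a i))\<^sup>2)\<bar>
    \<le> (\<Sum>i<k. \<bar>lam i\<bar> / (r i)\<^sup>2) + \<bar>lam_inf\<bar> / R\<^sup>2 + C"
    using W
  proof eventually_elim
    case (elim x)
    have 1: "\<bar>lam i * indicator (ball (a i) (r i)) x / (norm (x - a i))\<^sup>2 - lam i / (norm (x - a i))\<^sup>2\<bar> \<le> \<bar>lam i\<bar> / (r i)\<^sup>2" if i: "i < k" for i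
    proof (cases "x \<in> ball (a i) (r i)")
      case False
      then have "r i \<le> norm (x - a i)" by (simp add: dist_norm norm_minus_commute)
      then have "(r i)\<^sup>2 \<le> (norm (x - a i))\<^sup>2" using r i by (intro power_mono) (auto simp: less_imp_le)
      then have "\<bar>lam i\<bar> / (norm (x - a i))\<^sup>2 \<le> \<bar>lam i\<bar> / (r i)\<^sup>2" using r i by (intro frac_le) auto
      then show ?thesis using False by (simp add: abs_divide)
    qed simp
    have 2: "\<bar>lam_inf * indicator (UNIV - ball 0 R) x / (norm x)\<^sup>2\<bar> \<le> \<bar>lam_inf\<bar> / R\<^sup>2"
    proof (cases "x \<in> ball 0 R")
      case False
      then have "R\<^sup>2 \<le> (norm x)\<^sup>2" using R by (intro power_mono) auto
      then have "\<bar>lam_inf\<bar> / (norm x)\<^sup>2 \<le> \<bar>lam_inf\<bar> / R\<^sup>2" using R by (intro frac_le) auto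
      then show ?thesis using False by (simp add: abs_divide abs_mult)
    qed simp
    have "\<bar>\<Sum>i<k. lam i * indicator (ball (a i) (r i)) x / (norm (x - a i))\<^sup>2 - lam i / (norm (x - a i))\<^sup>2\<bar> \<le> (\<Sum>i<k. \<bar>lam i\<bar> / (r i)\<^sup>2)"
      by (rule order_trans[OF sum_abs]) (intro sum_mono, use 1 in auto)
    then show ?case using 2 elim unfolding potential_def sum_subtractf by linarith
  qed
  then show ?thesis by blast
qed

lemma potential_measurable:
  fixes W :: "real^'n::finite \<Rightarrow> real"
  assumes [measurable]: "W \<in> borel_measurable lebesgue"
  shows "potential k a r lam lam_inf R W \<in> borel_measurable lebesgue"
proof -
  have [measurable]: "ball c t \<in> sets borel" for c :: "real^'n" and t by (simp add: borel_open)
  have "(\<lambda>x. (\<Sum>i<k. lam i * indicator (ball (a i) (r i)) x / (norm (x - a i))\<^sup>2)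
     + lam_inf * indicator (UNIV - ball 0 R) x / (norm x)\<^sup>2) \<in> borel_measurable borel"
    by measurable
  then have [measurable]: "(\<lambda>x. (\<Sum>i<k. lam i * indicator (ball (a i) (r i)) x / (norm (x - a i))\<^sup>2)
     + lam_inf * indicator (UNIV - ball 0 R) x / (norm x)\<^sup>2) \<in> borel_measurable lebesgue"
    by (intro measurable_completion) simp
  show ?thesis unfolding potential_def[abs_def] by measurable
qed

theorem theorem1p8:
  fixes k :: nat and a :: "nat \<Rightarrow> real^'n::finite" and r lam :: "nat \<Rightarrow> real"
    and lam_inf R :: real and W :: "real^'n \<Rightarrow> real"
  assumes N3: "CARD('n) \<ge> 3"
    and k1: "k \<ge> 1"
    and r_pos: "\<forall>i<k. r i > 0" and R_pos: "R > 0"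
    and a_dist: "inj_on a {..<k}"
    and lam_bd: "\<forall>i<k. lam i < (real CARD('n) - 2)\<^sup>2 / 4"
    and lam_inf_bd: "lam_inf < (real CARD('n) - 2)\<^sup>2 / 4"
    and W_meas: "W \<in> borel_measurable lebesgue"
    and W_LN2: "integrable lebesgue (\<lambda>x. \<bar>W x\<bar> powr (real CARD('n) / 2))"
    and W_Linf: "\<exists>C. AE x in lebesgue. \<bar>W x\<bar> \<le> C"
  shows "essentially_self_adjoint
           (schroedinger_graph (potential k a r lam lam_inf R W) (Cc_infty (UNIV - a ` {..<k})))
         \<longleftrightarrow> (\<forall>i<k. lam i \<le> (real CARD('n) - 2)\<^sup>2 / 4 - 1)"
proof -
  obtain \<delta> where \<delta>: "\<delta> > 0" "\<forall>i<k. \<forall>i'<k. i \<noteq> i' \<longrightarrow> 4 * \<delta> \<le> norm (a i - a i')"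
    using separated_points[OF a_dist] by blast
  \<comment> \<open>A crude radius: the sum of the norms of all poles dominates each of
    them.\<close>
  define \<rho> where "\<rho> = (\<Sum>i<k. norm (a i)) + 2 * \<delta>"
  interpret poles k a \<delta> \<rho>
  proof
    show "\<rho> > 0" unfolding \<rho>_def using \<delta>(1) by (intro add_nonneg_pos sum_nonneg) auto
    fix i assume "i < k"
    then have "norm (a i) \<le> (\<Sum>i<k. norm (a i))" by (intro member_le_sum) auto
    then show "norm (a i) + 2 * \<delta> \<le> \<rho>" by (simp add: \<rho>_def)
  qed (use \<delta> in auto)
  define V where "V = potential k a r lam lam_inf R W"
  have Vm: "V \<in> borel_measurable lebesgue" unfolding V_def by (rule potential_measurable[OF W_meas])
  obtain C where "AE x in lebesgue. \<bar>W x\<bar> \<le> C" using W_Linf by blast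
  then obtain B where B: "AE x in lebesgue. \<bar>V x - (\<Sum>i<k. lam i / sq i x)\<bar> \<le> B"
    unfolding V_def using potential_bounded_part[OF r_pos R_pos] by blast
  have Vb: "\<exists>B. AE x in lebesgue. (\<forall>i<k. c \<le> sq i x) \<longrightarrow> \<bar>V x\<bar> \<le> B" if c: "c > 0" for c
  proof -
    have "AE x in lebesgue. (\<forall>i<k. c \<le> sq i x) \<longrightarrow> \<bar>V x\<bar> \<le> B + (\<Sum>i<k. \<bar>lam i\<bar> / c)"
      using B
    proof eventually_elim
      case (elim x)
      have "\<bar>\<Sum>i<k. lam i / sq i x\<bar> \<le> (\<Sum>i<k. \<bar>lam i\<bar> / c)" if "\<forall>i<k. c \<le> sq i x"
        by (rule order_trans[OF sum_abs], intro sum_mono)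
          (use that c in \<open>auto simp: abs_divide intro!: divide_left_mono mult_pos_pos intro: less_le_trans\<close>)
      then show ?case using elim by force
    qed
    then show ?thesis by blast
  qed
  have \<theta>: "\<theta> = (N - 2)\<^sup>2 / 4 - 1"
    by (simp add: \<theta>_def \<alpha>_def power2_eq_square field_simps)
  have "essentially_self_adjoint (schroedinger_graph V (Cc_infty \<Omega>)) \<longleftrightarrow> (\<forall>i<k. lam i \<le> \<theta>)"
  proof
    assume le: "\<forall>i<k. lam i \<le> \<theta>"
    obtain C where C: "\<forall>x\<in>\<Omega>. Q x \<le> - (\<Sum>i<k. \<theta> / sq i x) + C" using Q_bound by blast
    \<comment> \<open>Term by term \<open>lam i / sq i x\<close> is at most
      \<open>\<theta> / sq i x\<close>, which the upper bound for Q cancels. The two bounded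
      remainders add up to B + C, and this fixes the shift.\<close>
    have VQ: "AE x in lebesgue. x \<in> \<Omega> \<longrightarrow> Q x + V x \<le> (B + C + 1) - 1"
      using B
    proof eventually_elim
      case (elim x)
      have "(\<Sum>i<k. lam i / sq i x) \<le> (\<Sum>i<k. \<theta> / sq i x)"
        using le by (intro sum_mono divide_right_mono) auto
      then show ?case using elim C by force
    qed
    show "essentially_self_adjoint (schroedinger_graph V (Cc_infty \<Omega>))"
      by (rule essentially_self_adjoint_of_weight[OF Vm Vb VQ])
  next
    assume esa: "essentially_self_adjoint (schroedinger_graph V (Cc_infty \<Omega>))"
    show "\<forall>i<k. lam i \<le> \<theta>"
    proof (rule ccontr)
      assume "\<not> ?thesis"
      then obtain i where i: "i < k" "\<theta> < lam i" by (auto simp: not_le)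
      \<comment> \<open>Near \<open>a i\<close> every other pole is at squared distance at least
        2\<delta>^2, so its term joins the bounded remainder.\<close>
      have "AE x in lebesgue. sq i x < 2 * \<delta>\<^sup>2 \<longrightarrow> \<bar>V x - lam i / sq i x\<bar> \<le> B + (\<Sum>j\<in>{..<k} - {i}. \<bar>lam j\<bar> / (2 * \<delta>\<^sup>2))"
        using B
      proof eventually_elim
        case (elim x)
        show ?case
        proof
          assume near: "sq i x < 2 * \<delta>\<^sup>2"
          have "(\<Sum>j<k. lam j / sq j x) = lam i / sq i x + (\<Sum>j\<in>{..<k} - {i}. lam j / sq j x)"
            using i by (intro sum.remove) auto
          moreover have "\<bar>\<Sum>j\<in>{..<k} - {i}. lam j / sq j x\<bar> \<le> (\<Sum>j\<in>{..<k} - {i}. \<bar>lam j\<bar> / (2 * \<delta>\<^sup>2))"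
          proof (rule order_trans[OF sum_abs], rule sum_mono)
            fix j assume "j \<in> {..<k} - {i}"
            then have "2 * \<delta>\<^sup>2 \<le> sq j x" using sq_other[OF near i(1)] by auto
            then show "\<bar>lam j / sq j x\<bar> \<le> \<bar>lam j\<bar> / (2 * \<delta>\<^sup>2)"
              unfolding abs_divide using \<delta>2 by (intro frac_le) auto
          qed
          ultimately show "\<bar>V x - lam i / sq i x\<bar> \<le> B + (\<Sum>j\<in>{..<k} - {i}. \<bar>lam j\<bar> / (2 * \<delta>\<^sup>2))"
            using elim by linarith
        qed
      qed
      \<comment> \<open>The assumed bound on the couplings enters here as the upper bound on
        \<kappa>, which keeps the two exponents distinct.\<close>
      from not_essentially_self_adjoint[OF i(1) loc_bounded_on_\<Omega>[OF Vm Vb] this]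
      show False using esa i lam_bd unfolding \<theta> by (auto simp: N_def)
    qed
  qed
  then show ?thesis unfolding V_def \<Omega>_def \<theta> N_def .
qed

end
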